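(* Let $\Gamma$ be a connected network with vertex set $\mathbf{V}=\mathbf{V}_i\cup\mathbf{V}_b$ and edge set $\mathbf{E}$. Assume that $\lambda>0$, that $\{H_E\}_{E\in\mathbf{E}}$ and $\{\nu_{EF}\}_{E,F\in\mathbf{E}}$ satisfy the assumptions listed in the context, and that $\{h_{\mathbf{v}}\}_{\mathbf{v}\in\mathbf{V}_b}$, $\{B_{\mathbf{v}}\}_{\mathbf{v}\in\mathbf{V}_i}\subset\mathbb{R}$ are given. Then there exists a unique viscosity solution $u\in C(\Gamma)$ of the Kirchhoff--Dirichlet problem $$\lambda u-\mathcal{I}_Eu(x)+H_E(x,u_x)=0\ \ (x\in E,\ E\in\mathbf{E}),\qquad \sum_{E\in\mathrm{Inc}(\mathbf{v})}-\partial_Eu(\mathbf{v})=B_{\mathbf{v}}\ \ (\mathbf{v}\in\mathbf{V}_i),\qquad u(\mathbf{v})=h_{\mathbf{v}}\ \ (\mathbf{v}\in\mathbf{V}_b).$$ This solution is Lipschitz continuous in $\Gamma\setminus\bigcup_{\mathbf{v}\in\mathbf{V}_b}B_\delta(\mathbf{v})$ for every $\delta>0$.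
   Context: **Network.** $\mathbf{V}\subset\mathbb{R}^d$ is a finite nonempty set (vertices), $\mathbf{V}=\mathbf{V}_i\cup\mathbf{V}_b$ with $\mathbf{V}_i\cap\mathbf{V}_b=\emptyset$ (interior and boundary vertices). $\mathbf{E}$ is a finite set of edges: each $E\in\mathbf{E}$ is an open straight segment whose closure $\bar E$ meets $\mathbf{V}$ in exactly its two endpoints; distinct edges are disjoint. $\Gamma=\bigcup_{E\in\mathbf{E}}\bar E$ is assumed connected (any two vertices are joined by a path of edges). Label the vertices $\mathbf{v}_1,\dots,\mathbf{v}_{\mathrm{card}(\mathbf{V})}$; if $E$ joins $\mathbf{v}_i,\mathbf{v}_j$ with $i<j$, let $a_E=|\mathbf{v}_j-\mathbf{v}_i|$, $J_E=(0,a_E)$, $\gamma_E:[0,a_E]\to\bar E$, $\gamma_E(t)=\mathbf{v}_i+t(\mathbf{v}_j-\mathbf{v}_i)/a_E$. $\rho$ is the geodesic distance on $\Gamma$ (infimum of lengths of paths in $\Gamma$), $B_\delta(x)$ the open $\rho$-ball, $B_\delta^c(x)=\Gamma\setminus B_\delta(x)$. $\mathrm{Inc}(\mathbf{v})$ is the set of edges having $\mathbf{v}$ as an endpoint. **Function spaces.** For $u:\Gamma\to\mathbb{R}$, $u_E=u\circ\gamma_E$, and $x_E=\gamma_E^{-1}(x)$ for $x\in\bar E$. $USC(\Gamma)$ (resp. $LSC(\Gamma)$): all $u_E$ upper (resp. lower) semicontinuous on $[0,a_E]$; $C(\Gamma)=USC(\Gamma)\cap LSC(\Gamma)$; $C^m(\Gamma)=\{u\in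 C(\Gamma):u_E\in C^m([0,a_E])\ \forall E\}$. For $u\in C^1(\Gamma)$: $u_x(x)=u_E'(x_E)$ for $x\in E$; for $E\in\mathrm{Inc}(\mathbf{v})$, $u_{x_E}(\mathbf{v})=\lim_{x\to\mathbf{v},x\in E}u_x(x)$ and the inward derivative is $\partial_Eu(\mathbf{v})=\lim_{x\to\mathbf{v},x\in E}\frac{u(x)-u(\mathbf{v})}{\rho(x,\mathbf{v})}$. **Assumptions on the data.** $H_E\in C(\bar E\times\mathbb{R})$ and there is $C_H>1$ such that for all $E$, $x,y\in\bar E$, $p,q\in\mathbb{R}$: $C_H^{-1}|p|-C_H\le H_E(x,p)\le C_H(1+|p|)$ and $|H_E(x,p)-H_E(y,q)|\le C_H\big((1+\min\{|p|,|q|\})|x-y|+|p-q|\big)$. The kernels $\nu_{EF}:\bar E\times(0,\infty)\to[0,\infty)$ are measurable and there are $\Lambda>0$, $\sigma\in(0,1)$ with $0\le\nu_{EF}(x,t)\le\Lambda t^{-(1+\sigma)}$, $|\nu_{EF}(x,t)-\nu_{EF}(y,t)|\le\Lambda|x-y|t^{-(1+\sigma)}$ for all $E,F\in\mathbf{E}$, $x,y\in\bar E$, $t>0$. **Nonlocal operators.** For measurable $A\subseteq\Gamma$, $x\in\bar E$: $\mathcal{I}_E[A]\varphi(x)=\sum_{F\in\mathbf{E}}\int_{\{z\in J_F:\gamma_F(z)\in A\}}[\varphi_F(z)-\varphi(x)]\,\nu_{EF}(x,\rho(x,\gamma_F(z)))\,dz$, and $\mathcal{I}_E=\mathcal{I}_E[\Gamma]$.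 **Viscosity solutions.** $G_E^\delta(u,\varphi,p,x)=\lambda u(x)-\mathcal{I}_E[B_\delta^c(x)]u(x)-\mathcal{I}_E[B_\delta(x)]\varphi(x)+H_E(x,p)$. $u\in USC(\Gamma)$ is a viscosity subsolution if for every $x\in\Gamma$, $\delta>0$, $\varphi\in C^1(\Gamma)$ such that $x$ is a maximum point of $u-\varphi$ in $B_\delta(x)$: - $G_E^\delta(u,\varphi,\varphi_x(x),x)\le0$ if $x\in E$; - $\min\{\min_{E\in\mathrm{Inc}(x)}G_E^\delta(u,\varphi,\varphi_{x_E}(x),x),\ \sum_{E\in\mathrm{Inc}(x)}-\partial_E\varphi(x)-B_x\}\le0$ if $x\in\mathbf{V}_i$; - $\min\{\min_{E\in\mathrm{Inc}(x)}G_E^\delta(u,\varphi,\varphi_{x_E}(x),x),\ u(x)-h_x\}\le0$ if $x\in\mathbf{V}_b$. $u\in LSC(\Gamma)$ is a viscosity supersolution if the analogous conditions hold with "minimum point", every $\min$ replaced by $\max$, and $\le0$ replaced by $\ge0$. A viscosity solution is a function in $C(\Gamma)$ that is both. *)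

theory Defs
  imports "HOL-Analysis.Analysis"
begin

text \<open>The labelling \<open>label\<close> is used at the indices \<open>1, \<dots>, card V\<close> only; its sole purpose is to
  orient the edges. An edge is the open segment itself, as a set of points.\<close>

record 'a network =
  inner_verts :: "'a set"
  bdry_verts :: "'a set"
  edges :: "'a set set"
  label :: "nat \<Rightarrow> 'a"

definition verts :: "'a network \<Rightarrow> 'a set" where
  "verts N = inner_verts N \<union> bdry_verts N"

definition edge_src :: "'a::euclidean_space network \<Rightarrow> 'a set \<Rightarrow> 'a" where
  "edge_src N E = label N (Min {i \<in> {1..card (verts N)}. label N i \<in> closure E})"

definition edge_tgt :: "'a::euclidean_space network \<Rightarrow> 'a set \<Rightarrow> 'a" where
  "edge_tgt N E = label N (Max {i \<in> {1..card (verts N)}. label N i \<in> closure E})"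

definition Inc :: "'a::euclidean_space network \<Rightarrow> 'a \<Rightarrow> 'a set set" where
  "Inc N v = {E \<in> edges N. v = edge_src N E \<or> v = edge_tgt N E}"

definition adjacent :: "'a::euclidean_space network \<Rightarrow> ('a \<times> 'a) set" where
  "adjacent N = {(v, w). \<exists>E \<in> edges N. {v, w} = {edge_src N E, edge_tgt N E}}"

definition connected_network :: "'a::euclidean_space network \<Rightarrow> bool" where
  "connected_network N \<longleftrightarrow>
     finite (verts N) \<and> verts N \<noteq> {} \<and> inner_verts N \<inter> bdry_verts N = {} \<and>
     bij_betw (label N) {1..card (verts N)} (verts N) \<and>
     finite (edges N) \<and>
     (\<forall>E \<in> edges N. \<exists>a b. a \<noteq> b \<and> E = open_segment a b \<and> closure E \<inter> verts N = {a, b}) \<and>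
     (\<forall>E \<in> edges N. \<forall>F \<in> edges N. E \<noteq> F \<longrightarrow> E \<inter> F = {}) \<and>
     (\<forall>v \<in> verts N. \<forall>w \<in> verts N. (v, w) \<in> (adjacent N)\<^sup>*)"

definition Gam :: "'a::euclidean_space network \<Rightarrow> 'a set" where
  "Gam N = (\<Union>E \<in> edges N. closure E)"

definition edge_len :: "'a::euclidean_space network \<Rightarrow> 'a set \<Rightarrow> real" where
  "edge_len N E = norm (edge_tgt N E - edge_src N E)"

definition edge_param :: "'a::euclidean_space network \<Rightarrow> 'a set \<Rightarrow> real \<Rightarrow> 'a" where
  "edge_param N E t = edge_src N E + (t / edge_len N E) *\<^sub>R (edge_tgt N E - edge_src N E)"

definition edge_coord :: "'a::euclidean_space network \<Rightarrow> 'a set \<Rightarrow> 'a \<Rightarrow> real" where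
  "edge_coord N E x = inv_into {0..edge_len N E} (edge_param N E) x"

definition curve_length :: "(real \<Rightarrow> 'a::metric_space) \<Rightarrow> ennreal" where
  "curve_length g = (SUP ts \<in> {ts. sorted ts \<and> set ts \<subseteq> {0..1}}.
     ennreal (\<Sum>i < length ts - 1. dist (g (ts ! i)) (g (ts ! Suc i))))"

definition geo_dist :: "'a::euclidean_space network \<Rightarrow> 'a \<Rightarrow> 'a \<Rightarrow> real" where
  "geo_dist N x y = enn2real (INF g \<in> {g. path g \<and> path_image g \<subseteq> Gam N \<and>
     pathstart g = x \<and> pathfinish g = y}. curve_length g)"

definition geo_ball :: "'a::euclidean_space network \<Rightarrow> 'a \<Rightarrow> real \<Rightarrow> 'a set" where
  "geo_ball N x \<delta> = {y \<in> Gam N. geo_dist N x y < \<delta>}"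

text \<open>A function on \<open>\<Gamma>\<close> is represented by a function on the whole space; none of the notions below
  depends on its values outside \<open>\<Gamma>\<close>.\<close>

definition usc_on :: "real set \<Rightarrow> (real \<Rightarrow> real) \<Rightarrow> bool" where
  "usc_on S f \<longleftrightarrow> (\<forall>t \<in> S. \<forall>e > 0. eventually (\<lambda>s. f s < f t + e) (at t within S))"

definition lsc_on :: "real set \<Rightarrow> (real \<Rightarrow> real) \<Rightarrow> bool" where
  "lsc_on S f \<longleftrightarrow> (\<forall>t \<in> S. \<forall>e > 0. eventually (\<lambda>s. f s > f t - e) (at t within S))"

definition USC :: "'a::euclidean_space network \<Rightarrow> ('a \<Rightarrow> real) set" where
  "USC N = {u. \<forall>E \<in> edges N. usc_on {0..edge_len N E} (u \<circ> edge_param N E)}"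

definition LSC :: "'a::euclidean_space network \<Rightarrow> ('a \<Rightarrow> real) set" where
  "LSC N = {u. \<forall>E \<in> edges N. lsc_on {0..edge_len N E} (u \<circ> edge_param N E)}"

definition C0 :: "'a::euclidean_space network \<Rightarrow> ('a \<Rightarrow> real) set" where
  "C0 N = USC N \<inter> LSC N"

definition C1 :: "'a::euclidean_space network \<Rightarrow> ('a \<Rightarrow> real) set" where
  "C1 N = {u \<in> C0 N. \<forall>E \<in> edges N. \<exists>D. continuous_on {0..edge_len N E} D \<and>
     (\<forall>t \<in> {0..edge_len N E}.
        ((u \<circ> edge_param N E) has_real_derivative D t) (at t within {0..edge_len N E}))}"

text \<open>The derivatives \<open>edge_deriv\<close> (meaningful on the open edge) and \<open>vertex_deriv\<close> depend on the
  orientation of the edge, \<open>inward_deriv\<close> does not.\<close>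

definition edge_deriv :: "'a::euclidean_space network \<Rightarrow> 'a set \<Rightarrow> ('a \<Rightarrow> real) \<Rightarrow> 'a \<Rightarrow> real" where
  "edge_deriv N E u x = deriv (u \<circ> edge_param N E) (edge_coord N E x)"

definition vertex_deriv :: "'a::euclidean_space network \<Rightarrow> 'a set \<Rightarrow> ('a \<Rightarrow> real) \<Rightarrow> 'a \<Rightarrow> real" where
  "vertex_deriv N E u v = Lim (at v within E) (edge_deriv N E u)"

definition inward_deriv :: "'a::euclidean_space network \<Rightarrow> 'a set \<Rightarrow> ('a \<Rightarrow> real) \<Rightarrow> 'a \<Rightarrow> real" where
  "inward_deriv N E u v = Lim (at v within E) (\<lambda>x. (u x - u v) / geo_dist N x v)"

definition admissible_hamiltonians ::
  "'a::euclidean_space network \<Rightarrow> ('a set \<Rightarrow> 'a \<Rightarrow> real \<Rightarrow> real) \<Rightarrow> bool" where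
  "admissible_hamiltonians N H \<longleftrightarrow>
     (\<forall>E \<in> edges N. continuous_on (closure E \<times> UNIV) (\<lambda>(x, p). H E x p)) \<and>
     (\<exists>C > 1. \<forall>E \<in> edges N. \<forall>x \<in> closure E. \<forall>y \<in> closure E. \<forall>p q.
        \<bar>p\<bar> / C - C \<le> H E x p \<and> H E x p \<le> C * (1 + \<bar>p\<bar>) \<and>
        \<bar>H E x p - H E y q\<bar> \<le> C * ((1 + min \<bar>p\<bar> \<bar>q\<bar>) * norm (x - y) + \<bar>p - q\<bar>))"

text \<open>Measurability on \<open>closure E \<times> (0,\<infinity>)\<close> is Lebesgue measurability in the arc length coordinate
  of the edge and \<open>t\<close>.\<close>

definition admissible_kernels ::
  "'a::euclidean_space network \<Rightarrow> ('a set \<Rightarrow> 'a set \<Rightarrow> 'a \<Rightarrow> real \<Rightarrow> real) \<Rightarrow> bool" where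
  "admissible_kernels N \<nu> \<longleftrightarrow>
     (\<forall>E \<in> edges N. \<forall>F \<in> edges N.
        (\<lambda>(s, t). \<nu> E F (edge_param N E s) t)
          \<in> borel_measurable (lebesgue_on ({0..edge_len N E} \<times> {0<..}))) \<and>
     (\<exists>\<Lambda> > 0. \<exists>\<sigma>. 0 < \<sigma> \<and> \<sigma> < 1 \<and>
        (\<forall>E \<in> edges N. \<forall>F \<in> edges N. \<forall>x \<in> closure E. \<forall>y \<in> closure E. \<forall>t > 0.
           0 \<le> \<nu> E F x t \<and> \<nu> E F x t \<le> \<Lambda> * t powr (-(1 + \<sigma>)) \<and>
           \<bar>\<nu> E F x t - \<nu> E F y t\<bar> \<le> \<Lambda> * norm (x - y) * t powr (-(1 + \<sigma>))))"

definition nonloc ::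
  "'a::euclidean_space network \<Rightarrow> ('a set \<Rightarrow> 'a set \<Rightarrow> 'a \<Rightarrow> real \<Rightarrow> real) \<Rightarrow> 'a set \<Rightarrow> 'a set \<Rightarrow>
     ('a \<Rightarrow> real) \<Rightarrow> 'a \<Rightarrow> real" where
  "nonloc N \<nu> E A \<phi> x =
     (\<Sum>F \<in> edges N. LINT z:{z \<in> {0<..<edge_len N F}. edge_param N F z \<in> A}|lebesgue.
        (\<phi> (edge_param N F z) - \<phi> x) * \<nu> E F x (geo_dist N x (edge_param N F z)))"

definition Gop ::
  "'a::euclidean_space network \<Rightarrow> real \<Rightarrow> ('a set \<Rightarrow> 'a \<Rightarrow> real \<Rightarrow> real) \<Rightarrow>
     ('a set \<Rightarrow> 'a set \<Rightarrow> 'a \<Rightarrow> real \<Rightarrow> real) \<Rightarrow>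
     'a set \<Rightarrow> real \<Rightarrow> ('a \<Rightarrow> real) \<Rightarrow> ('a \<Rightarrow> real) \<Rightarrow> real \<Rightarrow> 'a \<Rightarrow> real" where
  "Gop N lam H \<nu> E \<delta> u \<phi> p x =
     lam * u x - nonloc N \<nu> E (Gam N - geo_ball N x \<delta>) u x
       - nonloc N \<nu> E (geo_ball N x \<delta>) \<phi> x + H E x p"

text \<open>An unbounded semicontinuous \<open>u\<close> may have a divergent integral in \<open>Gop\<close>, to which the Bochner
  integral gives the value \<open>0\<close> instead of an infinite one. This does not affect viscosity solutions:
  these are continuous, hence bounded, and then all the integrals converge.\<close>

definition visc_subsolution ::
  "'a::euclidean_space network \<Rightarrow> real \<Rightarrow> ('a set \<Rightarrow> 'a \<Rightarrow> real \<Rightarrow> real) \<Rightarrow>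
     ('a set \<Rightarrow> 'a set \<Rightarrow> 'a \<Rightarrow> real \<Rightarrow> real) \<Rightarrow> ('a \<Rightarrow> real) \<Rightarrow> ('a \<Rightarrow> real) \<Rightarrow>
     ('a \<Rightarrow> real) \<Rightarrow> bool" where
  "visc_subsolution N lam H \<nu> B h u \<longleftrightarrow> u \<in> USC N \<and>
     (\<forall>x \<in> Gam N. \<forall>\<delta> > 0. \<forall>\<phi> \<in> C1 N.
        (\<forall>y \<in> geo_ball N x \<delta>. u y - \<phi> y \<le> u x - \<phi> x) \<longrightarrow>
        (\<forall>E \<in> edges N. x \<in> E \<longrightarrow> Gop N lam H \<nu> E \<delta> u \<phi> (edge_deriv N E \<phi> x) x \<le> 0) \<and>
        (x \<in> inner_verts N \<longrightarrow>
           min (Min ((\<lambda>E. Gop N lam H \<nu> E \<delta> u \<phi> (vertex_deriv N E \<phi> x) x) ` Inc N x))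
               ((\<Sum>E \<in> Inc N x. - inward_deriv N E \<phi> x) - B x) \<le> 0) \<and>
        (x \<in> bdry_verts N \<longrightarrow>
           min (Min ((\<lambda>E. Gop N lam H \<nu> E \<delta> u \<phi> (vertex_deriv N E \<phi> x) x) ` Inc N x))
               (u x - h x) \<le> 0))"

definition visc_supersolution ::
  "'a::euclidean_space network \<Rightarrow> real \<Rightarrow> ('a set \<Rightarrow> 'a \<Rightarrow> real \<Rightarrow> real) \<Rightarrow>
     ('a set \<Rightarrow> 'a set \<Rightarrow> 'a \<Rightarrow> real \<Rightarrow> real) \<Rightarrow> ('a \<Rightarrow> real) \<Rightarrow> ('a \<Rightarrow> real) \<Rightarrow>
     ('a \<Rightarrow> real) \<Rightarrow> bool" where
  "visc_supersolution N lam H \<nu> B h u \<longleftrightarrow> u \<in> LSC N \<and>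
     (\<forall>x \<in> Gam N. \<forall>\<delta> > 0. \<forall>\<phi> \<in> C1 N.
        (\<forall>y \<in> geo_ball N x \<delta>. u y - \<phi> y \<ge> u x - \<phi> x) \<longrightarrow>
        (\<forall>E \<in> edges N. x \<in> E \<longrightarrow> Gop N lam H \<nu> E \<delta> u \<phi> (edge_deriv N E \<phi> x) x \<ge> 0) \<and>
        (x \<in> inner_verts N \<longrightarrow>
           max (Max ((\<lambda>E. Gop N lam H \<nu> E \<delta> u \<phi> (vertex_deriv N E \<phi> x) x) ` Inc N x))
               ((\<Sum>E \<in> Inc N x. - inward_deriv N E \<phi> x) - B x) \<ge> 0) \<and>
        (x \<in> bdry_verts N \<longrightarrow>
           max (Max ((\<lambda>E. Gop N lam H \<nu> E \<delta> u \<phi> (vertex_deriv N E \<phi> x) x) ` Inc N x))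
               (u x - h x) \<ge> 0))"

definition visc_solution ::
  "'a::euclidean_space network \<Rightarrow> real \<Rightarrow> ('a set \<Rightarrow> 'a \<Rightarrow> real \<Rightarrow> real) \<Rightarrow>
     ('a set \<Rightarrow> 'a set \<Rightarrow> 'a \<Rightarrow> real \<Rightarrow> real) \<Rightarrow> ('a \<Rightarrow> real) \<Rightarrow> ('a \<Rightarrow> real) \<Rightarrow>
     ('a \<Rightarrow> real) \<Rightarrow> bool" where
  "visc_solution N lam H \<nu> B h u \<longleftrightarrow> u \<in> C0 N \<and>
     visc_subsolution N lam H \<nu> B h u \<and> visc_supersolution N lam H \<nu> B h u"

end

theory Submission
  imports Defs
begin

text \<open>Coercivity of the Hamiltonians makes a bounded subsolution Lipschitz with a constant that only depends
  on its bound: at a point of contact with a steep test function the nonlocal term is at most of lower order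
  than the slope, first for increments from vertices and then along the edges. For a Lipschitz function the
  nonlocal term, rewritten in geodesic distance from the base point, depends continuously on that point by
  dominated convergence. The problem thus becomes a local Hamilton--Jacobi problem with a continuous right-hand
  side that is monotone in \<open>u\<close>, and Perron's method gives a solution. For comparison no doubling of variables
  is needed: as in the work of Lions and Souganidis on junctions, at a positive maximum of \<open>u - w\<close> every slope
  between the Dini derivatives of \<open>u\<close> or of \<open>w\<close> along an incident edge satisfies the corresponding equation, and
  this contradicts the Kirchhoff condition.\<close>

subsection \<open>Lengths of curves\<close>

text \<open>The kernels are only measurable in their distance variable, so
  \<open>\<nu> E F x (\<rho> x z)\<close> need not converge when \<open>x\<close> moves and
  \<open>z\<close> is fixed, whereas at a fixed distance the dependence on \<open>x\<close> is
  Lipschitz. This is why every edge is cut into branches on which the distance from the base point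
  is the integration variable. The order \<open>\<sigma> < 1\<close> enters twice: the kernels
  integrate increments of Lipschitz functions, and a slope \<open>K\<close> seen up to distance
  \<open>\<tau>\<close> costs a multiple of \<open>K * \<tau> powr (1 - \<sigma>)\<close>, which a
  small \<open>\<tau>\<close> makes half of the coercive gain \<open>K / C\<close>. The obstacle in
  the Lipschitz bound is the far part of the integral: at distance \<open>s\<close> from a vertex an
  oscillation \<open>\<omega>\<close> costs \<open>\<omega> * s powr (- \<sigma>)\<close>, and at
  first \<open>\<omega>\<close> is merely bounded. Upper bounds from a vertex come directly; lower
  ones need an induction over dyadic scales, in which this cost, singular at the vertex but
  integrable along the edge, reproduces the same constant. Contact points inside open edges and
  continuity at the vertices suffice for these estimates, so they hold up to the boundary
  vertices.\<close>

fun polyline_len :: "(real \<Rightarrow> 'a::metric_space) \<Rightarrow> real list \<Rightarrow> real" where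
  "polyline_len g (x # y # zs) = dist (g x) (g y) + polyline_len g (y # zs)"
| "polyline_len g _ = 0"

lemma polyline_len_eq_sum:
  "(\<Sum>i < length ts - 1. dist (g (ts ! i)) (g (ts ! Suc i))) = polyline_len g ts"
proof (induction g ts rule: polyline_len.induct)
  case (1 g x y zs)
  have "(\<Sum>i < Suc (length zs). dist (g ((x # y # zs) ! i)) (g ((x # y # zs) ! Suc i)))
     = dist (g x) (g y) + (\<Sum>i < length zs. dist (g ((y # zs) ! i)) (g ((y # zs) ! Suc i)))"
    by (subst sum.lessThan_Suc_shift) simp
  with 1 show ?case by simp
qed auto

lemma polyline_len_nonneg [simp]: "0 \<le> polyline_len g ts"
  by (induction g ts rule: polyline_len.induct) auto

lemma polyline_len_map: "polyline_len g (map f ts) = polyline_len (g \<circ> f) ts"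
  by (induction "g \<circ> f" ts rule: polyline_len.induct) auto

text \<open>Inserting a division point can only lengthen a polygon, by the triangle inequality;
  partitions can therefore be cut at a prescribed parameter.\<close>

lemma polyline_len_append:
  "polyline_len g (xs @ ys) \<le> polyline_len g (xs @ [m]) + polyline_len g (m # ys)"
proof (induction g xs rule: polyline_len.induct)
  case (1 g x y zs) then show ?case by simp
next
  case ("2_1" g) then show ?case by (cases ys) auto
next
  case ("2_2" g v)
  show ?case
  proof (cases ys)
    case (Cons y zs)
    show ?thesis using dist_triangle[of "g v" "g y" "g m"] Cons by simp
  qed auto
qed

lemma polyline_len_append_ge:
  "xs \<noteq> [] \<Longrightarrow> polyline_len g xs + polyline_len g (m # ys) \<le> polyline_len g (xs @ m # ys)"
proof (induction g xs rule: polyline_len.induct)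
  case ("2_2" g v) then show ?case by simp
qed auto

lemma curve_length_alt:
  "curve_length g = (SUP ts \<in> {ts. sorted ts \<and> set ts \<subseteq> {0..1}}. ennreal (polyline_len g ts))"
  unfolding curve_length_def polyline_len_eq_sum ..

lemma polyline_len_le_curve_length:
  "sorted ts \<Longrightarrow> set ts \<subseteq> {0..1} \<Longrightarrow> ennreal (polyline_len g ts) \<le> curve_length g"
  unfolding curve_length_alt by (rule SUP_upper) auto

lemma curve_length_le_iff:
  "curve_length g \<le> c \<longleftrightarrow> (\<forall>ts. sorted ts \<longrightarrow> set ts \<subseteq> {0..1} \<longrightarrow> ennreal (polyline_len g ts) \<le> c)"
  unfolding curve_length_alt by (auto simp: SUP_le_iff)

lemma polyline_len_cong:
  "(\<And>x. x \<in> set ts \<Longrightarrow> g x = h x) \<Longrightarrow> polyline_len g ts = polyline_len h ts"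
  by (induction g ts rule: polyline_len.induct) auto

lemma polyline_len_rev: "polyline_len g (rev ts) = polyline_len g ts"
proof (induction g ts rule: polyline_len.induct)
  case (1 g x y zs)
  have snoc: "polyline_len g (as @ [b, c]) = polyline_len g (as @ [b]) + dist (g b) (g c)" for as b c
    by (induction g as rule: polyline_len.induct) auto
  show ?case using 1 snoc[of "rev zs" y x] by (simp add: dist_commute)
qed auto

lemma curve_length_reversepath: "curve_length (reversepath g) \<le> curve_length g"
  unfolding curve_length_le_iff
proof (intro allI impI)
  fix ts :: "real list" assume ts: "sorted ts" "set ts \<subseteq> {0..1}"
  have "polyline_len (reversepath g) ts = polyline_len g (map (\<lambda>x. 1 - x) ts)"
    by (simp add: polyline_len_map reversepath_def comp_def)
  also have "\<dots> = polyline_len g (rev (map (\<lambda>x. 1 - x) ts))" by (simp add: polyline_len_rev)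
  finally have eq: "polyline_len (reversepath g) ts = polyline_len g (rev (map (\<lambda>x. 1 - x) ts))" .
  have "sorted (rev (map (\<lambda>x. 1 - x) ts))"
    using ts(1) by (simp add: sorted_wrt_rev sorted_wrt_map)
  then show "ennreal (polyline_len (reversepath g) ts) \<le> curve_length g"
    unfolding eq using ts(2) by (intro polyline_len_le_curve_length) auto
qed

text \<open>A partition of the joined curve is cut at \<open>1/2\<close>, with \<open>1/2\<close>
  inserted, and each half is rescaled to a partition of one of the two curves.\<close>

lemma curve_length_joinpaths:
  assumes "pathfinish g1 = pathstart g2"
  shows "curve_length (g1 +++ g2) \<le> curve_length g1 + curve_length g2"
  unfolding curve_length_le_iff
proof (intro allI impI)
  fix ts :: "real list" assume ts: "sorted ts" "set ts \<subseteq> {0..1}"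
  define as where "as = takeWhile (\<lambda>x. x \<le> 1/2) ts"
  define bs where "bs = dropWhile (\<lambda>x. x \<le> 1/2) ts"
  have tsab: "ts = as @ bs" by (simp add: as_def bs_def)
  have so: "sorted as" "sorted bs" using ts(1) unfolding tsab by (auto simp: sorted_append)
  have as: "x \<in> {0..1/2}" if "x \<in> set as" for x
    using that ts(2) set_takeWhileD[of x "\<lambda>x. x \<le> 1/2" ts] unfolding as_def by auto
  have bs: "x \<in> {1/2..1}" if "x \<in> set bs" for x
  proof -
    have "bs \<noteq> []" using that by auto
    then have "\<not> hd bs \<le> 1/2" unfolding bs_def by (rule hd_dropWhile)
    moreover have "hd bs \<le> x" using so(2) that \<open>bs \<noteq> []\<close> by (cases bs) auto
    moreover have "x \<in> set ts" using that tsab by auto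
    ultimately show ?thesis using ts(2) by auto
  qed
  have h: "(g1 +++ g2) x = g1 (2 * x)" if "x \<le> 1/2" for x using that by (simp add: joinpaths_def)
  have h2: "(g1 +++ g2) x = g2 (2 * x - 1)" if "x \<ge> 1/2" for x
  proof (cases "x = 1/2")
    case True
    show ?thesis unfolding True using assms by (simp add: joinpaths_def pathfinish_def pathstart_def)
  qed (use that in \<open>simp add: joinpaths_def\<close>)
  have "polyline_len (g1 +++ g2) (as @ [1/2]) = polyline_len (g1 \<circ> (\<lambda>x. 2 * x)) (as @ [1/2])"
    by (rule polyline_len_cong) (use as h in auto)
  also have "\<dots> = polyline_len g1 (map (\<lambda>x. 2 * x) (as @ [1/2]))" by (simp only: polyline_len_map)
  finally have 1: "polyline_len (g1 +++ g2) (as @ [1/2]) = polyline_len g1 (map (\<lambda>x. 2 * x) (as @ [1/2]))" .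
  have "polyline_len (g1 +++ g2) (1/2 # bs) = polyline_len (g2 \<circ> (\<lambda>x. 2 * x - 1)) (1/2 # bs)"
    by (rule polyline_len_cong) (use bs h2 in auto)
  also have "\<dots> = polyline_len g2 (map (\<lambda>x. 2 * x - 1) (1/2 # bs))" by (simp only: polyline_len_map)
  finally have 2: "polyline_len (g1 +++ g2) (1/2 # bs) = polyline_len g2 (map (\<lambda>x. 2 * x - 1) (1/2 # bs))" .
  have l1: "ennreal (polyline_len g1 (map (\<lambda>x. 2 * x) (as @ [1/2]))) \<le> curve_length g1"
  proof (rule polyline_len_le_curve_length)
    show "sorted (map (\<lambda>x. 2 * x) (as @ [1/2]))"
      using so as by (fastforce simp: sorted_wrt_map sorted_append)
    show "set (map (\<lambda>x. 2 * x) (as @ [1/2])) \<subseteq> {0..1}" using as by fastforce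
  qed
  have l2: "ennreal (polyline_len g2 (map (\<lambda>x. 2 * x - 1) (1/2 # bs))) \<le> curve_length g2"
  proof (rule polyline_len_le_curve_length)
    show "sorted (map (\<lambda>x. 2 * x - 1) (1/2 # bs))"
      using so bs by (fastforce simp: sorted_wrt_map)
    show "set (map (\<lambda>x. 2 * x - 1) (1/2 # bs)) \<subseteq> {0..1}" using bs by fastforce
  qed
  have "polyline_len (g1 +++ g2) ts \<le> polyline_len g1 (map (\<lambda>x. 2 * x) (as @ [1/2])) +
      polyline_len g2 (map (\<lambda>x. 2 * x - 1) (1/2 # bs))"
    unfolding tsab 1[symmetric] 2[symmetric] by (rule polyline_len_append)
  then have "ennreal (polyline_len (g1 +++ g2) ts) \<le> ennreal (polyline_len g1 (map (\<lambda>x. 2 * x) (as @ [1/2]))) +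
      ennreal (polyline_len g2 (map (\<lambda>x. 2 * x - 1) (1/2 # bs)))"
    by (subst ennreal_plus[symmetric]) (auto simp del: ennreal_plus intro: ennreal_leI)
  also have "\<dots> \<le> curve_length g1 + curve_length g2" using l1 l2 by (rule add_mono)
  finally show "ennreal (polyline_len (g1 +++ g2) ts) \<le> curve_length g1 + curve_length g2" .
qed

lemma curve_length_linepath: "curve_length (linepath x y) \<le> ennreal (dist x y)" for x y :: "'a::euclidean_space"
  unfolding curve_length_le_iff
proof (intro allI impI)
  fix ts :: "real list" assume ts: "sorted ts" "set ts \<subseteq> {0..1}"
  have d: "dist (linepath x y a) (linepath x y b) = \<bar>b - a\<bar> * dist x y" for a b
  proof -
    have "linepath x y a - linepath x y b = (b - a) *\<^sub>R (x - y)"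
      by (simp add: linepath_def algebra_simps)
    then show ?thesis by (simp add: dist_norm)
  qed
  have "ts \<noteq> [] \<Longrightarrow> polyline_len (linepath x y) ts = (last ts - hd ts) * dist x y" using ts(1)
  proof (induction "linepath x y" ts rule: polyline_len.induct)
    case (1 a b zs)
    then show ?case by (auto simp: d algebra_simps)
  qed auto
  moreover have "ts \<noteq> [] \<Longrightarrow> last ts - hd ts \<le> 1"
  proof -
    assume "ts \<noteq> []"
    then have "last ts \<in> {0..1}" "hd ts \<in> {0..1}" using ts(2) last_in_set[of ts] hd_in_set[of ts] by blast+
    then show ?thesis by auto
  qed
  ultimately have "polyline_len (linepath x y) ts \<le> dist x y"
    by (cases "ts = []") (auto simp: mult_left_le_one_le mult_right_mono[of _ 1 "dist x y", simplified])
  then show "ennreal (polyline_len (linepath x y) ts) \<le> ennreal (dist x y)" by (rule ennreal_leI)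
qed

lemma dist_le_curve_length: "ennreal (dist (pathstart g) (pathfinish g)) \<le> curve_length g"
  using polyline_len_le_curve_length[of "[0,1]" g] by (simp add: pathstart_def pathfinish_def)

text \<open>Appending \<open>\<tau>\<close> and \<open>1\<close> to a rescaled partition of the
  initial part gives a partition of the whole curve. This accounts for the length that a curve still
  has to spend after its last entry into an edge.\<close>

lemma curve_length_ge_initial:
  assumes "0 \<le> \<tau>" "\<tau> \<le> 1"
  shows "curve_length (subpath 0 \<tau> g) + ennreal (dist (g \<tau>) (g 1)) \<le> curve_length g"
proof -
  have "ennreal (polyline_len (subpath 0 \<tau> g) ts) + ennreal (dist (g \<tau>) (g 1)) \<le> curve_length g"
    if ts: "sorted ts" "set ts \<subseteq> {0..1}" for ts
  proof -
    define us where "us = map (\<lambda>x. \<tau> * x) ts"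
    have us: "polyline_len (subpath 0 \<tau> g) ts = polyline_len g us"
      by (simp add: us_def polyline_len_map subpath_def comp_def)
    have "sorted us" using ts(1) assms by (auto simp: us_def sorted_wrt_map intro!: mult_left_mono elim!: sorted_wrt_mono_rel[rotated])
    moreover have "x \<in> {0..\<tau>}" if "x \<in> set us" for x
      using that ts(2) assms by (auto simp: us_def intro!: mult_left_le)
    ultimately have "ennreal (polyline_len g (us @ [\<tau>, 1])) \<le> curve_length g"
      using assms by (intro polyline_len_le_curve_length) (fastforce simp: sorted_append)+
    moreover have "polyline_len g us + dist (g \<tau>) (g 1) \<le> polyline_len g (us @ [\<tau>, 1])"
      using polyline_len_append_ge[of us g \<tau> "[1]"] by (cases "us = []") auto
    ultimately show ?thesis unfolding us
      by (subst ennreal_plus[symmetric]) (auto simp del: ennreal_plus intro: order.trans[OF ennreal_leI])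
  qed
  note * = this
  show ?thesis
  \<comment> \<open>For a finite length the distance can be moved to the other side, where the
    supremum over partitions is then taken.\<close>
  proof (cases "curve_length g = top")
    case False
    then obtain c where c: "curve_length g = ennreal c" "c \<ge> 0" by (cases "curve_length g") auto
    have "dist (g \<tau>) (g 1) \<le> c" using *[of "[]"] c by (simp add: ennreal_le_iff)
    have "curve_length (subpath 0 \<tau> g) \<le> ennreal (c - dist (g \<tau>) (g 1))"
      unfolding curve_length_le_iff
    proof (intro allI impI)
      fix ts :: "real list" assume "sorted ts" "set ts \<subseteq> {0..1}"
      from *[OF this] have "ennreal (polyline_len (subpath 0 \<tau> g) ts + dist (g \<tau>) (g 1)) \<le> ennreal c"
        using c by simp
      then have "polyline_len (subpath 0 \<tau> g) ts + dist (g \<tau>) (g 1) \<le> c"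
        using c by (simp add: ennreal_le_iff del: ennreal_plus)
      then show "ennreal (polyline_len (subpath 0 \<tau> g) ts) \<le> ennreal (c - dist (g \<tau>) (g 1))"
        by (intro ennreal_leI) simp
    qed
    then have "curve_length (subpath 0 \<tau> g) + ennreal (dist (g \<tau>) (g 1)) \<le>
       ennreal (c - dist (g \<tau>) (g 1)) + ennreal (dist (g \<tau>) (g 1))" by (rule add_right_mono)
    also have "\<dots> = ennreal c" using \<open>dist (g \<tau>) (g 1) \<le> c\<close> by (simp flip: ennreal_plus)
    finally show ?thesis using c by simp
  qed auto
qed

section \<open>Edges, their arc length coordinate and the separation of vertices\<close>

locale network =
  fixes N :: "'a::euclidean_space network"
  assumes connected: "connected_network N"
begin

abbreviation "src \<equiv> edge_src N"
abbreviation "tgt \<equiv> edge_tgt N"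
abbreviation "len \<equiv> edge_len N"
abbreviation "\<gamma> \<equiv> edge_param N"
abbreviation "\<rho> \<equiv> geo_dist N"
abbreviation "\<Gamma> \<equiv> Gam N"

lemma finite_verts [simp]: "finite (verts N)" and verts_nonempty: "verts N \<noteq> {}"
  and verts_disjoint: "inner_verts N \<inter> bdry_verts N = {}"
  and bij_label: "bij_betw (label N) {1..card (verts N)} (verts N)"
  and finite_edges [simp]: "finite (edges N)"
  and edges_disjoint: "\<lbrakk>E \<in> edges N; F \<in> edges N; E \<noteq> F\<rbrakk> \<Longrightarrow> E \<inter> F = {}"
  and adjacent_connected: "\<lbrakk>v \<in> verts N; w \<in> verts N\<rbrakk> \<Longrightarrow> (v, w) \<in> (adjacent N)\<^sup>*"
  using connected unfolding connected_network_def by auto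

lemma edge_segments:
  "\<forall>E \<in> edges N. \<exists>a b. a \<noteq> b \<and> E = open_segment a b \<and> closure E \<inter> verts N = {a, b}"
  using connected unfolding connected_network_def by (elim conjE)

text \<open>Exactly two indices have their label in the closure of an edge, since the labelling is a
  bijection and the closure meets the vertex set in the two end points. \<open>Min\<close> and
  \<open>Max\<close> therefore pick different ends.\<close>

lemma edge_ends:
  assumes E: "E \<in> edges N"
  shows "src E \<noteq> tgt E" "E = open_segment (src E) (tgt E)" "closure E \<inter> verts N = {src E, tgt E}"
proof -
  obtain a b where ab: "a \<noteq> b" "E = open_segment a b" "closure E \<inter> verts N = {a, b}"
    using bspec[OF edge_segments E] by (elim exE conjE)
  have abV: "a \<in> verts N" "b \<in> verts N" using ab(3) by blast+
  then obtain i j where ij: "i \<in> {1..card (verts N)}" "label N i = a" "j \<in> {1..card (verts N)}" "label N j = b"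
    using bij_label unfolding bij_betw_def by (metis imageE)
  define S where "S = {i \<in> {1..card (verts N)}. label N i \<in> closure E}"
  have inj: "inj_on (label N) {1..card (verts N)}" using bij_label by (simp add: bij_betw_def)
  have img: "label N k \<in> verts N" if "k \<in> {1..card (verts N)}" for k
    using bij_label that by (auto simp: bij_betw_def)
  have "S = {i, j}"
  proof
    show "S \<subseteq> {i, j}"
    proof
      fix k assume k: "k \<in> S"
      then have "label N k \<in> {a, b}" using ab(3) img by (auto simp: S_def)
      then have "label N k = label N i \<or> label N k = label N j" using ij(2,4) by simp
      moreover have "k \<in> {1..card (verts N)}" using k by (simp add: S_def)
      ultimately show "k \<in> {i, j}" using inj_onD[OF inj] ij(1,3) by blast
    qed
    have "a \<in> closure E" "b \<in> closure E" using ab(3) by blast+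
    then show "{i, j} \<subseteq> S" using ij by (simp add: S_def)
  qed
  then have "src E = label N (min i j)" "tgt E = label N (max i j)"
    unfolding edge_src_def edge_tgt_def S_def[symmetric] by auto
  then have "(src E = a \<and> tgt E = b) \<or> (src E = b \<and> tgt E = a)"
    using ij(2,4) by (cases "i \<le> j") (simp_all add: min_def max_def)
  then show "src E \<noteq> tgt E" "E = open_segment (src E) (tgt E)" "closure E \<inter> verts N = {src E, tgt E}"
    using ab open_segment_commute[of a b] by (metis insert_commute)+
qed

lemma closure_edge: "E \<in> edges N \<Longrightarrow> closure E = closed_segment (src E) (tgt E)"
  using edge_ends[of E] closure_open_segment by metis

lemma len_pos: "E \<in> edges N \<Longrightarrow> 0 < len E"
  using edge_ends(1)[of E] by (simp add: edge_len_def)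

lemma len_nonneg [simp]: "0 \<le> len E" by (simp add: edge_len_def)

lemma \<gamma>_0 [simp]: "\<gamma> E 0 = src E" by (simp add: edge_param_def)

lemma \<gamma>_len: "E \<in> edges N \<Longrightarrow> \<gamma> E (len E) = tgt E"
  using len_pos[of E] by (simp add: edge_param_def)

lemma \<gamma>_image: "E \<in> edges N \<Longrightarrow> \<gamma> E ` {0..len E} = closure E"
proof -
  assume E: "E \<in> edges N"
  have "\<gamma> E ` {0..len E} = (\<lambda>u. src E + u *\<^sub>R (tgt E - src E)) ` {0..1}"
  proof -
    have "(\<lambda>t. t / len E) ` {0..len E} = {0..1}"
      using len_pos[OF E] by (auto simp: image_iff divide_simps intro!: bexI[of _ "_ * len E"])
    then have "(\<lambda>u. src E + u *\<^sub>R (tgt E - src E)) ` (\<lambda>t. t / len E) ` {0..len E} =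
       (\<lambda>u. src E + u *\<^sub>R (tgt E - src E)) ` {0..1}" by simp
    then show ?thesis by (simp add: image_image edge_param_def)
  qed
  also have "\<dots> = closed_segment (src E) (tgt E)"
    by (auto simp: closed_segment_image_interval algebra_simps)
  finally show ?thesis using closure_edge[OF E] by simp
qed

lemma \<gamma>_in_closure: "E \<in> edges N \<Longrightarrow> 0 \<le> t \<Longrightarrow> t \<le> len E \<Longrightarrow> \<gamma> E t \<in> closure E"
  using \<gamma>_image[of E] by auto

lemma dist_\<gamma>: "E \<in> edges N \<Longrightarrow> dist (\<gamma> E s) (\<gamma> E t) = \<bar>s - t\<bar>"
proof -
  assume E: "E \<in> edges N"
  have "\<gamma> E s - \<gamma> E t = ((s - t) / len E) *\<^sub>R (tgt E - src E)"
    by (simp add: edge_param_def algebra_simps diff_divide_distrib)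
  then have "dist (\<gamma> E s) (\<gamma> E t) = \<bar>s - t\<bar> / len E * norm (tgt E - src E)"
    by (simp add: dist_norm)
  also have "norm (tgt E - src E) = len E" by (simp add: edge_len_def)
  finally show ?thesis using len_pos[OF E] by simp
qed

lemma \<gamma>_eq_iff: "E \<in> edges N \<Longrightarrow> \<gamma> E s = \<gamma> E t \<longleftrightarrow> s = t"
  using dist_\<gamma>[of E s t] by auto

lemma edge_coord_\<gamma>: "E \<in> edges N \<Longrightarrow> 0 \<le> t \<Longrightarrow> t \<le> len E \<Longrightarrow> edge_coord N E (\<gamma> E t) = t"
  unfolding edge_coord_def by (rule inv_into_f_f) (auto simp: inj_on_def \<gamma>_eq_iff)

lemma ends_in_verts: "E \<in> edges N \<Longrightarrow> src E \<in> verts N" "E \<in> edges N \<Longrightarrow> tgt E \<in> verts N"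
  using edge_ends(3)[of E] by auto

lemma edge_no_verts: "E \<in> edges N \<Longrightarrow> E \<inter> verts N = {}"
  using edge_ends[of E] closure_subset[of E] by (auto simp: open_segment_def)

lemma closure_edge_eq: "E \<in> edges N \<Longrightarrow> closure E = E \<union> {src E, tgt E}"
  using edge_ends[of E] closure_edge[of E] by (auto simp: open_segment_def)

lemma \<gamma>_vertex_iff: "E \<in> edges N \<Longrightarrow> 0 \<le> t \<Longrightarrow> t \<le> len E \<Longrightarrow> \<gamma> E t \<in> verts N \<longleftrightarrow> t = 0 \<or> t = len E"
  using edge_ends(3)[of E] \<gamma>_in_closure[of E t] ends_in_verts[of E] \<gamma>_eq_iff[of E t 0] \<gamma>_eq_iff[of E t "len E"] \<gamma>_len[of E]
  by auto

lemma \<gamma>_interior_iff: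
  assumes E: "E \<in> edges N" and t: "0 \<le> t" "t \<le> len E" shows "\<gamma> E t \<in> E \<longleftrightarrow> 0 < t \<and> t < len E"
proof -
  have "\<gamma> E t \<in> E \<longleftrightarrow> \<gamma> E t \<notin> verts N"
    using closure_edge_eq[OF E] \<gamma>_in_closure[OF E t] edge_no_verts[OF E] ends_in_verts[OF E] by auto
  then show ?thesis using \<gamma>_vertex_iff[OF E t] t by linarith
qed

lemma \<gamma>_interior: "E \<in> edges N \<Longrightarrow> 0 < t \<Longrightarrow> t < len E \<Longrightarrow> \<gamma> E t \<in> E"
  using \<gamma>_interior_iff[of E t] by auto

lemma closure_edge_point:
  assumes "E \<in> edges N" "x \<in> closure E" shows "\<exists>t. 0 \<le> t \<and> t \<le> len E \<and> x = \<gamma> E t"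
  using assms(2) unfolding \<gamma>_image[OF assms(1), symmetric] by auto

lemma edge_point:
  assumes "E \<in> edges N" "x \<in> E" shows "\<exists>t. 0 < t \<and> t < len E \<and> x = \<gamma> E t"
proof -
  have "x \<in> closure E" using assms(2) closure_subset by blast
  then obtain t where t: "0 \<le> t" "t \<le> len E" "x = \<gamma> E t" using closure_edge_point[OF assms(1)] by blast
  then show ?thesis using assms \<gamma>_interior_iff[OF assms(1) t(1,2)] by blast
qed

lemma \<gamma>_in_edge_eq:
  assumes EF: "E \<in> edges N" "F \<in> edges N" and t: "0 \<le> t" "t \<le> len F" and m: "\<gamma> F t \<in> E"
  shows "F = E"
proof (rule ccontr)
  assume "F \<noteq> E"
  then have "\<gamma> F t \<notin> F" using edges_disjoint[OF EF(2,1)] m by blast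
  then have "\<gamma> F t \<in> verts N" using \<gamma>_interior_iff[OF EF(2) t] \<gamma>_vertex_iff[OF EF(2) t] t by linarith
  then show False using edge_no_verts[OF EF(1)] m by blast
qed

lemma \<Gamma>_point: "x \<in> \<Gamma> \<Longrightarrow> \<exists>E t. E \<in> edges N \<and> 0 \<le> t \<and> t \<le> len E \<and> x = \<gamma> E t"
  unfolding Gam_def using closure_edge_point by (metis UN_E)

lemma \<gamma>_in_\<Gamma>: "E \<in> edges N \<Longrightarrow> 0 \<le> t \<Longrightarrow> t \<le> len E \<Longrightarrow> \<gamma> E t \<in> \<Gamma>"
  unfolding Gam_def using \<gamma>_in_closure by blast

lemma ends_in_\<Gamma>: "E \<in> edges N \<Longrightarrow> src E \<in> \<Gamma>" "E \<in> edges N \<Longrightarrow> tgt E \<in> \<Gamma>"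
  using \<gamma>_in_\<Gamma>[of E 0] \<gamma>_in_\<Gamma>[of E "len E"] \<gamma>_len[of E] by auto

lemma \<Gamma>_cases:
  assumes "x \<in> \<Gamma>"
  obtains (vertex) "x \<in> verts N" | (interior) E t where "E \<in> edges N" "0 < t" "t < len E" "x = \<gamma> E t" "x \<notin> verts N"
proof -
  obtain E t where E: "E \<in> edges N" "0 \<le> t" "t \<le> len E" "x = \<gamma> E t" using \<Gamma>_point[OF assms] by blast
  then show thesis using \<gamma>_vertex_iff[of E t] that(1) that(2)[of E t] by force
qed

text \<open>The inserted \<open>1\<close> keeps the set nonempty when there is only one vertex.
  Balls of this radius around a vertex are stars of incident edges.\<close>

definition vsep :: real where
  "vsep = Min (insert 1 ((\<lambda>(v, w). dist v w) ` {(v, w) \<in> verts N \<times> verts N. v \<noteq> w}))"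

lemma vsep_pos: "0 < vsep" and vsep_le: "v \<in> verts N \<Longrightarrow> w \<in> verts N \<Longrightarrow> v \<noteq> w \<Longrightarrow> vsep \<le> dist v w"
proof -
  have "finite {(v, w) \<in> verts N \<times> verts N. v \<noteq> w}"
    by (rule finite_subset[of _ "verts N \<times> verts N"]) auto
  then have fin: "finite (insert 1 ((\<lambda>(v, w). dist v w) ` {(v, w) \<in> verts N \<times> verts N. v \<noteq> w}))" by simp
  show "0 < vsep" unfolding vsep_def using fin by (subst Min_gr_iff) auto
  show "v \<in> verts N \<Longrightarrow> w \<in> verts N \<Longrightarrow> v \<noteq> w \<Longrightarrow> vsep \<le> dist v w"
    unfolding vsep_def using fin by (intro Min_le) auto
qed

lemma vsep_le_len: "E \<in> edges N \<Longrightarrow> vsep \<le> len E"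
  using vsep_le[of "tgt E" "src E"] ends_in_verts[of E] edge_ends(1)[of E] by (simp add: edge_len_def dist_norm)

subsection \<open>The geodesic distance\<close>

definition curves :: "'a \<Rightarrow> 'a \<Rightarrow> (real \<Rightarrow> 'a) set" where
  "curves x y = {g. path g \<and> path_image g \<subseteq> \<Gamma> \<and> pathstart g = x \<and> pathfinish g = y}"

text \<open>The infimum before \<open>enn2real\<close>, which sends an infinite value to
  \<open>0\<close>. At this level symmetry and the triangle inequality hold before any rectifiable
  curve is known to exist.\<close>

definition \<rho>e :: "'a \<Rightarrow> 'a \<Rightarrow> ennreal" where
  "\<rho>e x y = (INF g \<in> curves x y. curve_length g)"

lemma \<rho>_eq: "\<rho> x y = enn2real (\<rho>e x y)"
  by (simp add: geo_dist_def \<rho>e_def curves_def)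

lemma \<rho>e_le: "g \<in> curves x y \<Longrightarrow> \<rho>e x y \<le> curve_length g"
  unfolding \<rho>e_def by (rule INF_lower)

lemma \<rho>e_approx:
  assumes "\<rho>e x y < c" obtains g where "g \<in> curves x y" "curve_length g < c"
  using assms unfolding \<rho>e_def by (auto simp: INF_less_iff)

lemma \<rho>e_commute_le: "\<rho>e x y \<le> \<rho>e y x"
  unfolding \<rho>e_def
proof (rule INF_greatest)
  fix g assume "g \<in> curves y x"
  then have "reversepath g \<in> curves x y" by (auto simp: curves_def)
  then have "\<rho>e x y \<le> curve_length (reversepath g)" by (rule \<rho>e_le)
  then show "(INF g\<in>curves x y. curve_length g) \<le> curve_length g"
    using curve_length_reversepath[of g] unfolding \<rho>e_def by (rule order.trans)
qed

lemma \<rho>e_commute: "\<rho>e x y = \<rho>e y x"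
  using \<rho>e_commute_le by (rule antisym) (rule \<rho>e_commute_le)

lemma \<rho>e_triangle: "\<rho>e x z \<le> \<rho>e x y + \<rho>e y z"
proof (rule ennreal_le_epsilon)
  fix e :: real assume fin: "\<rho>e x y + \<rho>e y z < top" and e: "0 < e"
  have "\<rho>e x y < \<rho>e x y + ennreal (e/2)" "\<rho>e y z < \<rho>e y z + ennreal (e/2)"
    using fin e by (cases "\<rho>e x y"; cases "\<rho>e y z"; simp add: ennreal_less_iff flip: ennreal_plus)+
  then obtain g h where g: "g \<in> curves x y" "curve_length g < \<rho>e x y + ennreal (e/2)"
    and h: "h \<in> curves y z" "curve_length h < \<rho>e y z + ennreal (e/2)"
    by (metis \<rho>e_approx)
  have "g +++ h \<in> curves x z" using g(1) h(1) by (auto simp: curves_def path_image_join)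
  then have "\<rho>e x z \<le> curve_length (g +++ h)" by (rule \<rho>e_le)
  also have "\<dots> \<le> curve_length g + curve_length h"
    using g(1) h(1) by (intro curve_length_joinpaths) (auto simp: curves_def)
  also have "\<dots> \<le> (\<rho>e x y + ennreal (e/2)) + (\<rho>e y z + ennreal (e/2))"
    using g(2) h(2) by (intro add_mono) auto
  also have "\<dots> = \<rho>e x y + \<rho>e y z + (ennreal (e/2) + ennreal (e/2))" by (simp add: ac_simps)
  also have "ennreal (e/2) + ennreal (e/2) = ennreal e" using e by (simp flip: ennreal_plus)
  finally show "\<rho>e x z \<le> \<rho>e x y + \<rho>e y z + ennreal e" .
qed

lemma dist_le_\<rho>e: "ennreal (dist x y) \<le> \<rho>e x y"
  unfolding \<rho>e_def
proof (rule INF_greatest)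
  fix g assume "g \<in> curves x y"
  then show "ennreal (dist x y) \<le> curve_length g"
    using dist_le_curve_length[of g] by (auto simp: curves_def)
qed

text \<open>Edges are straight: the segment itself is a curve in \<Gamma>, and the Euclidean
  distance bounds every curve from below.\<close>

lemma \<rho>e_edge:
  assumes "E \<in> edges N" "0 \<le> s" "s \<le> len E" "0 \<le> t" "t \<le> len E"
  shows "\<rho>e (\<gamma> E s) (\<gamma> E t) = ennreal \<bar>s - t\<bar>"
proof (rule antisym)
  have "closed_segment (\<gamma> E s) (\<gamma> E t) \<subseteq> closure E"
    using assms closure_edge[of E] \<gamma>_in_closure[of E]
    by (metis closed_segment_subset convex_closed_segment)
  then have "linepath (\<gamma> E s) (\<gamma> E t) \<in> curves (\<gamma> E s) (\<gamma> E t)"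
    using assms(1) by (auto simp: curves_def Gam_def)
  then have "\<rho>e (\<gamma> E s) (\<gamma> E t) \<le> curve_length (linepath (\<gamma> E s) (\<gamma> E t))" by (rule \<rho>e_le)
  also have "\<dots> \<le> ennreal (dist (\<gamma> E s) (\<gamma> E t))" by (rule curve_length_linepath)
  finally show "\<rho>e (\<gamma> E s) (\<gamma> E t) \<le> ennreal \<bar>s - t\<bar>" using assms(1) by (simp add: dist_\<gamma>)
  show "ennreal \<bar>s - t\<bar> \<le> \<rho>e (\<gamma> E s) (\<gamma> E t)"
    using dist_le_\<rho>e[of "\<gamma> E s" "\<gamma> E t"] assms(1) by (simp add: dist_\<gamma>)
qed

text \<open>Connectedness of the network enters here, through a chain of edges of finite length
  between the two edges.\<close>

lemma \<rho>e_finite: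
  assumes "x \<in> \<Gamma>" "y \<in> \<Gamma>" shows "\<rho>e x y < top"
proof -
  have tr: "\<rho>e a c < top" if "\<rho>e a b < top" "\<rho>e b c < top" for a b c
    using \<rho>e_triangle[of a c b] that by (auto simp: ennreal_add_eq_top intro: le_less_trans)
  obtain E s where E: "E \<in> edges N" "0 \<le> s" "s \<le> len E" "x = \<gamma> E s" using \<Gamma>_point[OF assms(1)] by blast
  obtain F t where F: "F \<in> edges N" "0 \<le> t" "t \<le> len F" "y = \<gamma> F t" using \<Gamma>_point[OF assms(2)] by blast
  have 1: "\<rho>e x (src E) < top" using \<rho>e_edge[of E s 0] E by simp
  have 2: "\<rho>e (src F) y < top" using \<rho>e_edge[of F 0 t] F by simp
  have "(src E, src F) \<in> (adjacent N)\<^sup>*" using adjacent_connected ends_in_verts E F by blast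
  then have "\<rho>e (src E) (src F) < top"
  proof (induction rule: rtrancl_induct)
    case base
    show ?case using \<rho>e_edge[of E 0 0] E(1) by simp
  next
    case (step v w)
    from step(2) obtain G where G: "G \<in> edges N" "{v, w} = {src G, tgt G}" by (auto simp: adjacent_def)
    have "\<rho>e (src G) (tgt G) < top" using \<rho>e_edge[of G 0 "len G"] G(1) \<gamma>_len[OF G(1)] by simp
    then have "\<rho>e v w < top" using G(2) \<rho>e_commute[of "src G"] by (auto simp: doubleton_eq_iff)
    then show ?case using step(3) tr by blast
  qed
  then show ?thesis using 1 2 tr by blast
qed

lemma \<rho>e_\<rho>: "x \<in> \<Gamma> \<Longrightarrow> y \<in> \<Gamma> \<Longrightarrow> \<rho>e x y = ennreal (\<rho> x y)"
  using \<rho>e_finite[of x y] by (simp add: \<rho>_eq less_top[symmetric])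

lemma \<rho>_nonneg [simp]: "0 \<le> \<rho> x y" by (simp add: \<rho>_eq)

lemma \<rho>_commute: "\<rho> x y = \<rho> y x" by (simp add: \<rho>_eq \<rho>e_commute)

lemma \<rho>_triangle: "x \<in> \<Gamma> \<Longrightarrow> y \<in> \<Gamma> \<Longrightarrow> z \<in> \<Gamma> \<Longrightarrow> \<rho> x z \<le> \<rho> x y + \<rho> y z"
  using \<rho>e_triangle[of x z y] by (simp add: \<rho>e_\<rho> ennreal_le_iff flip: ennreal_plus)

lemma dist_le_\<rho>: "x \<in> \<Gamma> \<Longrightarrow> y \<in> \<Gamma> \<Longrightarrow> dist x y \<le> \<rho> x y"
  using dist_le_\<rho>e[of x y] by (simp add: \<rho>e_\<rho> ennreal_le_iff)

lemma \<rho>_edge: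
  assumes "E \<in> edges N" "0 \<le> s" "s \<le> len E" "0 \<le> t" "t \<le> len E"
  shows "\<rho> (\<gamma> E s) (\<gamma> E t) = \<bar>s - t\<bar>"
  using \<rho>e_edge[OF assms] by (simp add: \<rho>_eq)

lemma \<rho>_refl [simp]: "x \<in> \<Gamma> \<Longrightarrow> \<rho> x x = 0"
  using \<Gamma>_point[of x] \<rho>_edge by fastforce

lemma \<rho>_eq_0_iff: "x \<in> \<Gamma> \<Longrightarrow> y \<in> \<Gamma> \<Longrightarrow> \<rho> x y = 0 \<longleftrightarrow> x = y"
  using dist_le_\<rho>[of x y] by auto

lemma vsep_le_\<rho>: "v \<in> verts N \<Longrightarrow> w \<in> verts N \<Longrightarrow> v \<in> \<Gamma> \<Longrightarrow> w \<in> \<Gamma> \<Longrightarrow> v \<noteq> w \<Longrightarrow> vsep \<le> \<rho> v w"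
  using vsep_le[of v w] dist_le_\<rho>[of v w] by linarith

text \<open>The last parameter at which the curve is off the open edge gives a point of its closure
  outside it, that is, one of its ends.\<close>

lemma curve_last_entry:
  assumes g: "g \<in> curves x y" and F: "F \<in> edges N" and x: "x \<notin> F" and y: "y \<in> F"
  obtains \<tau> where "0 \<le> \<tau>" "\<tau> \<le> 1" "g \<tau> = src F \<or> g \<tau> = tgt F"
proof -
  have pg: "continuous_on {0..1} g" "\<And>t. t \<in> {0..1} \<Longrightarrow> g t \<in> \<Gamma>" "g 0 = x" "g 1 = y"
    using g by (auto simp: curves_def path_def path_image_def pathstart_def pathfinish_def)
  \<comment> \<open>A closed set whose trace on \<Gamma> is the complement of \<open>F\<close>; it
    is closed because there are finitely many edges.\<close>
  define C where "C = (\<Union>E \<in> edges N - {F}. closure E) \<union> {src F, tgt F}"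
  have "closed C" unfolding C_def by (intro closed_Un closed_UN) auto
  have CF: "z \<in> C \<longleftrightarrow> z \<notin> F" if "z \<in> \<Gamma>" for z
  proof
    assume "z \<in> C"
    then show "z \<notin> F"
      unfolding C_def using closure_edge_eq edges_disjoint[OF F] edge_no_verts[OF F] ends_in_verts F by fastforce
  next
    assume "z \<notin> F"
    then show "z \<in> C" using that closure_edge_eq[OF F] by (auto simp: C_def Gam_def)
  qed
  define T where "T = {0..1} \<inter> g -` C"
  have "closed T" unfolding T_def by (rule continuous_closed_preimage[OF pg(1)]) (auto simp: \<open>closed C\<close>)
  moreover have "bounded T" by (rule bounded_subset[of "{0..1}"]) (auto simp: T_def)
  ultimately have "compact T" by (simp add: compact_eq_bounded_closed)
  have "0 \<in> T" using CF[of x] x pg by (auto simp: T_def)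
  then obtain \<tau> where \<tau>: "\<tau> \<in> T" "\<And>t. t \<in> T \<Longrightarrow> t \<le> \<tau>"
    using \<open>compact T\<close> compact_attains_sup[of T] by blast
  have \<tau>01: "\<tau> \<in> {0..1}" "g \<tau> \<notin> F" using \<tau>(1) CF pg(2) by (auto simp: T_def)
  then have "\<tau> < 1" using pg(4) y by (cases "\<tau> = 1") auto
  have after: "g t \<in> F" if "t \<in> {\<tau><..<1}" for t
    using \<tau>(2)[of t] that \<tau>01 CF[of "g t"] pg(2)[of t] by (fastforce simp: T_def)
  have "g \<tau> \<in> closure F"
  proof (rule Lim_in_closed_set[of "closure F" g "at \<tau> within {\<tau><..<1}"])
    have "(g \<longlongrightarrow> g \<tau>) (at \<tau> within {0..1})" using pg(1) \<tau>01 by (simp add: continuous_on_def)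
    then show "(g \<longlongrightarrow> g \<tau>) (at \<tau> within {\<tau><..<1})" by (rule tendsto_within_subset) (use \<tau>01 in auto)
    show "\<forall>\<^sub>F t in at \<tau> within {\<tau><..<1}. g t \<in> closure F"
      using after closure_subset[of F] by (auto simp: eventually_at_filter intro!: always_eventually)
    show "at \<tau> within {\<tau><..<1} \<noteq> bot"
      using \<open>\<tau> < 1\<close> by (simp add: trivial_limit_within islimpt_greaterThanLessThan1)
  qed auto
  then have "g \<tau> = src F \<or> g \<tau> = tgt F" using \<tau>01 closure_edge_eq[OF F] by auto
  then show thesis using that \<tau>01 by auto
qed

text \<open>A curve that comes from outside passes an end of \<open>F\<close>, and from there on it
  is at least as long as the straight distance to its final point. On such an edge the distance is
  piecewise linear with slopes \<open>1\<close> and \<open>-1\<close>, which is the source of the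
  two branches used for the nonlocal term.\<close>

lemma \<rho>_through_end:
  assumes F: "F \<in> edges N" and x: "x \<in> \<Gamma>" "x \<notin> F" and z: "0 \<le> z" "z \<le> len F"
  shows "\<rho> x (\<gamma> F z) = min (\<rho> x (src F) + z) (\<rho> x (tgt F) + len F - z)"
proof (rule antisym)
  note G = ends_in_\<Gamma>[OF F] \<gamma>_in_\<Gamma>[OF F z]
  have 1: "\<rho> (src F) (\<gamma> F z) = z" "\<rho> (tgt F) (\<gamma> F z) = len F - z"
    using \<rho>_edge[OF F, of 0 z] \<rho>_edge[OF F, of "len F" z] z \<gamma>_len[OF F] by auto
  show "\<rho> x (\<gamma> F z) \<le> min (\<rho> x (src F) + z) (\<rho> x (tgt F) + len F - z)"
    using \<rho>_triangle[of x "src F" "\<gamma> F z"] \<rho>_triangle[of x "tgt F" "\<gamma> F z"] G x 1 by auto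
  show "min (\<rho> x (src F) + z) (\<rho> x (tgt F) + len F - z) \<le> \<rho> x (\<gamma> F z)"
  proof (cases "z = 0 \<or> z = len F")
    case True
    then show ?thesis using \<gamma>_len[OF F] by auto
  next
    case False
    then have zF: "\<gamma> F z \<in> F" using \<gamma>_interior[OF F, of z] z by auto
    have "ennreal (min (\<rho> x (src F) + z) (\<rho> x (tgt F) + len F - z)) \<le> \<rho>e x (\<gamma> F z)"
      unfolding \<rho>e_def
    proof (rule INF_greatest)
      fix g assume g: "g \<in> curves x (\<gamma> F z)"
      then obtain \<tau> where \<tau>: "0 \<le> \<tau>" "\<tau> \<le> 1" "g \<tau> = src F \<or> g \<tau> = tgt F"
        using curve_last_entry[OF g F x(2) zF] by blast
      have g': "path g" "path_image g \<subseteq> \<Gamma>" "g 0 = x" "g 1 = \<gamma> F z"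
        using g by (auto simp: curves_def pathstart_def pathfinish_def)
      have "subpath 0 \<tau> g \<in> curves x (g \<tau>)"
        using g' \<tau>(1,2) path_image_subpath_subset[of 0 \<tau> g] path_subpath[of g 0 \<tau>]
        by (auto simp: curves_def pathstart_def pathfinish_def) (auto simp: subpath_def)
      then have "\<rho>e x (g \<tau>) + ennreal (dist (g \<tau>) (g 1)) \<le> curve_length g"
        using curve_length_ge_initial[OF \<tau>(1,2), of g] \<rho>e_le by (meson add_right_mono order.trans)
      moreover have "\<rho>e x (g \<tau>) + ennreal (dist (g \<tau>) (g 1)) = ennreal (\<rho> x (g \<tau>) + dist (g \<tau>) (g 1))"
        using \<tau>(3) G x by (auto simp: \<rho>e_\<rho>)
      moreover have "min (\<rho> x (src F) + z) (\<rho> x (tgt F) + len F - z) \<le> \<rho> x (g \<tau>) + dist (g \<tau>) (g 1)"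
        using \<tau>(3) dist_\<gamma>[OF F, of 0 z] dist_\<gamma>[OF F, of "len F" z] z \<gamma>_len[OF F] g'(4) by auto
      ultimately show "ennreal (min (\<rho> x (src F) + z) (\<rho> x (tgt F) + len F - z)) \<le> curve_length g"
        by (metis ennreal_leI order.trans)
    qed
    then show ?thesis using G x by (simp add: \<rho>e_\<rho> ennreal_le_iff)
  qed
qed

lemma sum_pm: "(\<Sum>\<epsilon> \<in> {1, -1::real}. f \<epsilon>) = f 1 + f (-1)" for f :: "real \<Rightarrow> real"
  by simp

lemma \<rho>_bounded: "\<exists>D > 0. \<forall>x \<in> \<Gamma>. \<forall>y \<in> \<Gamma>. \<rho> x y \<le> D"
proof -
  define D where "D = 1 + 2 * (\<Sum>E \<in> edges N. len E) + (\<Sum>p \<in> verts N \<times> verts N. \<rho> (fst p) (snd p))"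
  have s: "\<rho> v w \<le> (\<Sum>p \<in> verts N \<times> verts N. \<rho> (fst p) (snd p))" if "v \<in> verts N" "w \<in> verts N" for v w
    using that member_le_sum[of "(v, w)" "verts N \<times> verts N" "\<lambda>p. \<rho> (fst p) (snd p)"] by simp
  have l: "len E \<le> (\<Sum>E \<in> edges N. len E)" if "E \<in> edges N" for E
    using that by (intro member_le_sum) auto
  have "\<rho> x y \<le> D" if xy: "x \<in> \<Gamma>" "y \<in> \<Gamma>" for x y
  proof -
    obtain E t where E: "E \<in> edges N" "0 \<le> t" "t \<le> len E" "x = \<gamma> E t" using \<Gamma>_point[OF xy(1)] by blast
    obtain F r where F: "F \<in> edges N" "0 \<le> r" "r \<le> len F" "y = \<gamma> F r" using \<Gamma>_point[OF xy(2)] by blast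
    note G = ends_in_\<Gamma>(1)[OF E(1)] ends_in_\<Gamma>(1)[OF F(1)]
    have "\<rho> x y \<le> \<rho> x (src E) + \<rho> (src E) (src F) + \<rho> (src F) y"
      using \<rho>_triangle[OF xy(1) G(1) xy(2)] \<rho>_triangle[OF G xy(2)] by linarith
    moreover have "\<rho> x (src E) = t" using \<rho>_edge[of E t 0] E by simp
    moreover have "\<rho> (src F) y = r" using \<rho>_edge[of F 0 r] F by simp
    ultimately show ?thesis
      using s[OF ends_in_verts(1)[OF E(1)] ends_in_verts(1)[OF F(1)]] E(3) F(3) l[OF E(1)] l[OF F(1)] unfolding D_def by linarith
  qed
  moreover have "D > 0" unfolding D_def
    by (intro add_pos_nonneg mult_nonneg_nonneg sum_nonneg) auto
  ultimately show ?thesis by blast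
qed

text \<open>Some positive bound for all distances, chosen once; it need not be the exact diameter,
  and it is positive even if \<Gamma> is empty.\<close>

definition diam :: real where "diam = (SOME D. D > 0 \<and> (\<forall>x \<in> \<Gamma>. \<forall>y \<in> \<Gamma>. \<rho> x y \<le> D))"

lemma diam_pos: "0 < diam" and \<rho>_le_diam: "x \<in> \<Gamma> \<Longrightarrow> y \<in> \<Gamma> \<Longrightarrow> \<rho> x y \<le> diam"
  using someI_ex[OF \<rho>_bounded] unfolding diam_def by auto

lemma \<rho>_outside_edge:
  assumes E: "E \<in> edges N" and s: "0 \<le> s" "s \<le> len E" and y: "y \<in> \<Gamma>" "y \<notin> E"
  shows "min s (len E - s) \<le> \<rho> (\<gamma> E s) y"
  unfolding \<rho>_commute[of "\<gamma> E s" y] \<rho>_through_end[OF E y s]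
  using \<rho>_nonneg[of y "src E"] \<rho>_nonneg[of y "tgt E"] by linarith

lemma edge_ball:
  assumes E: "E \<in> edges N" and s: "0 \<le> s" "s \<le> len E" and y: "y \<in> \<Gamma>" "\<rho> (\<gamma> E s) y < \<delta>" "\<delta> \<le> min s (len E - s)"
  obtains t where "0 < t" "t < len E" "y = \<gamma> E t" "\<bar>t - s\<bar> < \<delta>" "\<rho> (\<gamma> E s) y = \<bar>t - s\<bar>"
proof -
  have "y \<in> E" using \<rho>_outside_edge[OF E s y(1)] y by linarith
  then obtain t where t: "0 < t" "t < len E" "y = \<gamma> E t" using edge_point[OF E] by blast
  then have "\<rho> (\<gamma> E s) y = \<bar>t - s\<bar>" using \<rho>_edge[OF E s, of t] by (simp add: abs_minus_commute)
  then show thesis using that[of t] t y by auto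
qed

text \<open>Together with \<open>end_sign\<close>: \<open>end_coord E v + end_sign E v * t\<close>
  is the coordinate of the point of \<open>E\<close> at distance \<open>t\<close> from its end
  \<open>v\<close>, whatever the orientation. If \<open>v\<close> is not an end, the values are
  those of the target.\<close>

definition end_coord :: "'a set \<Rightarrow> 'a \<Rightarrow> real" where "end_coord E v = (if v = src E then 0 else len E)"
definition end_sign :: "'a set \<Rightarrow> 'a \<Rightarrow> real" where "end_sign E v = (if v = src E then 1 else -1)"

lemma Inc_edges: "E \<in> Inc N v \<Longrightarrow> E \<in> edges N" by (simp add: Inc_def)
lemma finite_Inc [simp]: "finite (Inc N v)" by (simp add: Inc_def)

lemma end_coord_bounds: "0 \<le> end_coord E v" "end_coord E v \<le> len E" by (auto simp: end_coord_def)

lemma \<gamma>_end_coord: "E \<in> Inc N v \<Longrightarrow> \<gamma> E (end_coord E v) = v"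
  by (auto simp: Inc_def end_coord_def \<gamma>_len)

lemma end_sign_sq [simp]: "end_sign E v * end_sign E v = 1" "end_sign E v * (end_sign E v * c) = c"
  by (auto simp: end_sign_def)
lemma abs_end_sign [simp]: "\<bar>end_sign E v\<bar> = 1" by (auto simp: end_sign_def)

lemma end_shift_bounds:
  "0 \<le> t \<Longrightarrow> t \<le> len E \<Longrightarrow> 0 \<le> end_coord E v + end_sign E v * t \<and> end_coord E v + end_sign E v * t \<le> len E"
  "0 < t \<Longrightarrow> t < len E \<Longrightarrow> 0 < end_coord E v + end_sign E v * t \<and> end_coord E v + end_sign E v * t < len E"
  by (auto simp: end_coord_def end_sign_def)

lemma Inc_vertex: "E \<in> Inc N v \<Longrightarrow> v \<in> verts N" "E \<in> Inc N v \<Longrightarrow> v \<in> \<Gamma>"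
  using ends_in_verts ends_in_\<Gamma> by (auto simp: Inc_def)

text \<open>A single vertex without edges is a connected network with empty \<Gamma>. This is why
  membership in \<Gamma> accompanies membership in \<open>verts N\<close> here and below.\<close>

lemma vertex_Inc: "v \<in> verts N \<Longrightarrow> v \<in> \<Gamma> \<Longrightarrow> Inc N v \<noteq> {}"
proof -
  assume v: "v \<in> verts N" "v \<in> \<Gamma>"
  obtain E t where E: "E \<in> edges N" "0 \<le> t" "t \<le> len E" "v = \<gamma> E t" using \<Gamma>_point[OF v(2)] by blast
  then have "t = 0 \<or> t = len E" using v \<gamma>_vertex_iff by blast
  then have "E \<in> Inc N v" using E \<gamma>_len by (auto simp: Inc_def)
  then show ?thesis by blast
qed

lemma \<rho>_vertex_edge: "E \<in> Inc N v \<Longrightarrow> 0 \<le> t \<Longrightarrow> t \<le> len E \<Longrightarrow> \<rho> v (\<gamma> E (end_coord E v + end_sign E v * t)) = t"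
  using \<rho>_edge[of E "end_coord E v" "end_coord E v + end_sign E v * t"] end_coord_bounds[of E v] end_shift_bounds(1)[of t E v]
    \<gamma>_end_coord[of E v] Inc_edges[of E v] by (auto simp: abs_mult)

text \<open>An edge that does not end at \<open>v\<close> has both ends at distance at least
  \<open>vsep\<close> from \<open>v\<close>, so by \<open>\<rho>_through_end\<close> it lies outside
  the ball.\<close>

lemma vertex_ball:
  assumes v: "v \<in> verts N" "v \<in> \<Gamma>" and y: "y \<in> \<Gamma>" "\<rho> v y < \<delta>" "\<delta> \<le> vsep"
  obtains E t where "E \<in> Inc N v" "0 \<le> t" "t < len E" "t = \<rho> v y" "y = \<gamma> E (end_coord E v + end_sign E v * t)"
proof -
  obtain E s where E: "E \<in> edges N" "0 \<le> s" "s \<le> len E" "y = \<gamma> E s" using \<Gamma>_point[OF y(1)] by blast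
  have "v \<notin> E" using v edge_no_verts[OF E(1)] by blast
  from \<rho>_through_end[OF E(1) v(2) this E(2,3)]
  have r: "\<rho> v y = min (\<rho> v (src E) + s) (\<rho> v (tgt E) + len E - s)" using E by simp
  have "v = src E \<or> v = tgt E"
  proof (rule ccontr)
    assume "\<not> ?thesis"
    then have "v \<noteq> src E" "v \<noteq> tgt E" by auto
    then have "vsep \<le> \<rho> v (src E)" "vsep \<le> \<rho> v (tgt E)"
      using vsep_le_\<rho>[OF v(1) _ v(2)] ends_in_verts[OF E(1)] ends_in_\<Gamma>[OF E(1)] by simp_all
    then show False using r y(2,3) E(2,3) by linarith
  qed
  then have I: "E \<in> Inc N v" using E by (auto simp: Inc_def)
  define t where "t = end_sign E v * (s - end_coord E v)"
  have t: "0 \<le> t" "t \<le> len E" using E by (auto simp: t_def end_sign_def end_coord_def)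
  have yt: "y = \<gamma> E (end_coord E v + end_sign E v * t)" using E by (simp add: t_def)
  then have vy: "\<rho> v y = t" using \<rho>_vertex_edge[OF I t] by simp
  have "t < len E" using vy y vsep_le_len[OF E(1)] by linarith
  then show thesis by (rule that[OF I t(1) _ vy[symmetric] yt])
qed

subsection \<open>Arc length coordinates around a point\<close>

text \<open>Every point of an edge \<open>F\<close> at distance \<open>t\<close> from \<open>\<gamma> E s\<close> is \<open>\<gamma> F (br_off + \<epsilon> * t)\<close>, with
  \<open>\<epsilon> = 1\<close> if moving away means moving towards \<open>tgt F\<close> and \<open>\<epsilon> = -1\<close> otherwise;
  \<open>t\<close> ranges over \<open>{br_lo<..<br_hi}\<close>.\<close>

definition br_off :: "'a set \<Rightarrow> real \<Rightarrow> 'a set \<Rightarrow> real \<Rightarrow> real" where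
  "br_off E s F \<epsilon> = (if F = E then s else if \<epsilon> = 1 then - \<rho> (\<gamma> E s) (src F) else \<rho> (\<gamma> E s) (tgt F) + len F)"
definition br_lo :: "'a set \<Rightarrow> real \<Rightarrow> 'a set \<Rightarrow> real \<Rightarrow> real" where
  "br_lo E s F \<epsilon> = (if F = E then 0 else if \<epsilon> = 1 then \<rho> (\<gamma> E s) (src F) else \<rho> (\<gamma> E s) (tgt F))"
definition br_hi :: "'a set \<Rightarrow> real \<Rightarrow> 'a set \<Rightarrow> real \<Rightarrow> real" where
  "br_hi E s F \<epsilon> = (if F = E then if \<epsilon> = 1 then len E - s else s
     else (\<rho> (\<gamma> E s) (src F) + \<rho> (\<gamma> E s) (tgt F) + len F) / 2)"
text \<open>The point of \<open>F\<close> at which its two branches meet: the base point itself if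
  \<open>F = E\<close>, otherwise the point reached equally fast through both ends.\<close>

definition br_mid :: "'a set \<Rightarrow> real \<Rightarrow> 'a set \<Rightarrow> real" where
  "br_mid E s F = (if F = E then s else (\<rho> (\<gamma> E s) (tgt F) + len F - \<rho> (\<gamma> E s) (src F)) / 2)"

context
  fixes E F s
  assumes E: "E \<in> edges N" and F: "F \<in> edges N" and s: "0 \<le> s" "s \<le> len E"
begin

lemma ends_triangle:
  "\<rho> (\<gamma> E s) (src F) \<le> \<rho> (\<gamma> E s) (tgt F) + len F" "\<rho> (\<gamma> E s) (tgt F) \<le> \<rho> (\<gamma> E s) (src F) + len F"
proof -
  have 1: "\<rho> (src F) (tgt F) = len F" using \<rho>_edge[OF F, of 0 "len F"] \<gamma>_len[OF F] by simp
  have 2: "\<rho> (tgt F) (src F) = len F" unfolding \<rho>_commute[of "tgt F"] by (rule 1)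
  note G = \<gamma>_in_\<Gamma>[OF E s] ends_in_\<Gamma>[OF F]
  show "\<rho> (\<gamma> E s) (src F) \<le> \<rho> (\<gamma> E s) (tgt F) + len F"
    using \<rho>_triangle[OF G(1,3,2)] 2 by linarith
  show "\<rho> (\<gamma> E s) (tgt F) \<le> \<rho> (\<gamma> E s) (src F) + len F"
    using \<rho>_triangle[OF G] 1 by linarith
qed

lemma \<rho>_other_edge:
  assumes "F \<noteq> E" "0 \<le> z" "z \<le> len F"
  shows "\<rho> (\<gamma> E s) (\<gamma> F z) = min (\<rho> (\<gamma> E s) (src F) + z) (\<rho> (\<gamma> E s) (tgt F) + len F - z)"
  using \<rho>_through_end[OF F \<gamma>_in_\<Gamma>[OF E s] _ assms(2,3)] \<gamma>_in_edge_eq[OF F E s] assms(1) by blast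

lemma br_lo_nonneg: "0 \<le> br_lo E s F \<epsilon>"
  by (auto simp: br_lo_def)

lemma br_point:
  assumes "\<epsilon> \<in> {1, -1}" "br_lo E s F \<epsilon> < t" "t < br_hi E s F \<epsilon>"
  shows "0 < br_off E s F \<epsilon> + \<epsilon> * t" "br_off E s F \<epsilon> + \<epsilon> * t < len F"
    "\<rho> (\<gamma> E s) (\<gamma> F (br_off E s F \<epsilon> + \<epsilon> * t)) = t"
proof -
  show 1: "0 < br_off E s F \<epsilon> + \<epsilon> * t" and 2: "br_off E s F \<epsilon> + \<epsilon> * t < len F"
    using assms s ends_triangle \<rho>_nonneg[of "\<gamma> E s" "src F"] \<rho>_nonneg[of "\<gamma> E s" "tgt F"]
    by (auto simp: br_off_def br_lo_def br_hi_def split: if_splits)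
  show "\<rho> (\<gamma> E s) (\<gamma> F (br_off E s F \<epsilon> + \<epsilon> * t)) = t"
  proof (cases "F = E")
    case True
    then show ?thesis using \<rho>_edge[OF E s, of "br_off E s F \<epsilon> + \<epsilon> * t"] 1 2 assms
      by (auto simp: br_off_def br_lo_def)
  next
    case False
    then show ?thesis using \<rho>_other_edge[OF False, of "br_off E s F \<epsilon> + \<epsilon> * t"] 1 2 assms
      by (auto simp: br_off_def br_lo_def br_hi_def min_def)
  qed
qed

text \<open>Off the meeting point each point of the open edge lies on exactly one branch. A branch
  may be empty, namely when one end is reached just as fast through the other end.\<close>

lemma br_partition:
  assumes "z \<noteq> br_mid E s F"
  shows "indicator {0<..<len F} z =
    (\<Sum>\<epsilon> \<in> {1, -1}. indicator {br_lo E s F \<epsilon><..<br_hi E s F \<epsilon>} (\<epsilon> * (z - br_off E s F \<epsilon>)) :: real)"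
proof (cases "F = E")
  case True
  then show ?thesis using assms s unfolding sum_pm by (auto simp: indicator_def br_off_def br_lo_def br_hi_def br_mid_def)
next
  case False
  then show ?thesis using assms ends_triangle unfolding sum_pm
    by (auto simp: indicator_def br_off_def br_lo_def br_hi_def br_mid_def field_simps)
qed

lemma br_hi_le_diam: "\<epsilon> \<in> {1, -1} \<Longrightarrow> br_lo E s F \<epsilon> < t \<Longrightarrow> t < br_hi E s F \<epsilon> \<Longrightarrow> t \<le> diam"
  using br_point[of \<epsilon> t] \<rho>_le_diam[OF \<gamma>_in_\<Gamma>[OF E s] \<gamma>_in_\<Gamma>[OF F]] by (metis less_imp_le)

end

lemma abs_\<rho>_diff_le: "x \<in> \<Gamma> \<Longrightarrow> y \<in> \<Gamma> \<Longrightarrow> z \<in> \<Gamma> \<Longrightarrow> \<bar>\<rho> x z - \<rho> y z\<bar> \<le> \<rho> x y"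
  using \<rho>_triangle[of x y z] \<rho>_triangle[of y x z] \<rho>_commute[of x y] by linarith

lemma continuous_\<rho>_\<gamma>: "E \<in> edges N \<Longrightarrow> z \<in> \<Gamma> \<Longrightarrow> continuous_on {0..len E} (\<lambda>s. \<rho> (\<gamma> E s) z)"
proof -
  assume E: "E \<in> edges N" and z: "z \<in> \<Gamma>"
  have "dist (\<rho> (\<gamma> E s) z) (\<rho> (\<gamma> E t) z) \<le> 1 * dist s t" if "s \<in> {0..len E}" "t \<in> {0..len E}" for s t
    using abs_\<rho>_diff_le[OF \<gamma>_in_\<Gamma>[OF E, of s] \<gamma>_in_\<Gamma>[OF E, of t] z] \<rho>_edge[OF E, of s t] that
    by (auto simp: dist_real_def)
  then have "1-lipschitz_on {0..len E} (\<lambda>s. \<rho> (\<gamma> E s) z)" by (intro lipschitz_onI) auto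
  then show ?thesis by (rule lipschitz_on_continuous_on)
qed

text \<open>In the branch coordinate the geometry depends on the base point only through these three
  continuous quantities, and the singularity of the kernel stays at \<open>t = 0\<close>.\<close>

lemma continuous_br:
  assumes "E \<in> edges N" "F \<in> edges N"
  shows "continuous_on {0..len E} (\<lambda>s. br_off E s F \<epsilon>)" "continuous_on {0..len E} (\<lambda>s. br_lo E s F \<epsilon>)"
    "continuous_on {0..len E} (\<lambda>s. br_hi E s F \<epsilon>)"
proof -
  note c = continuous_\<rho>_\<gamma>[OF assms(1) ends_in_\<Gamma>(1)[OF assms(2)]] continuous_\<rho>_\<gamma>[OF assms(1) ends_in_\<Gamma>(2)[OF assms(2)]]
  show "continuous_on {0..len E} (\<lambda>s. br_off E s F \<epsilon>)" unfolding br_off_def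
    by (cases "F = E"; cases "\<epsilon> = 1"; simp; intro continuous_intros c)
  show "continuous_on {0..len E} (\<lambda>s. br_lo E s F \<epsilon>)" unfolding br_lo_def
    by (cases "F = E"; cases "\<epsilon> = 1"; simp; intro continuous_intros c)
  show "continuous_on {0..len E} (\<lambda>s. br_hi E s F \<epsilon>)" unfolding br_hi_def
    by (cases "F = E"; cases "\<epsilon> = 1"; simp; intro continuous_intros c; simp)
qed

end

section \<open>Measurability of kernel sections and integrals of powers\<close>

lemma AE_lborel_interval:
  assumes "AE x in lborel. P x" "c < d" shows "\<exists>x \<in> {c<..<d::real}. P x"
proof (rule ccontr)
  assume "\<not> ?thesis"
  then have sub: "{c<..<d} \<subseteq> {x \<in> space lborel. \<not> P x}" by auto
  obtain M where M: "{x \<in> space lborel. \<not> P x} \<subseteq> M" "emeasure lborel M = 0" "M \<in> sets lborel"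
    using assms(1) by (rule AE_E)
  have "emeasure lborel {c<..<d} \<le> emeasure lborel M"
    using sub M by (intro emeasure_mono) auto
  then show False using M assms(2) by simp
qed

lemma borel_measurable_lebesgue_AE:
  fixes f g :: "real \<Rightarrow> real"
  assumes f: "f \<in> borel_measurable lebesgue" and ae: "AE x in lebesgue. f x = g x"
  shows "g \<in> borel_measurable lebesgue"
proof (rule measurableI)
  fix A :: "real set" assume A: "A \<in> sets borel"
  show "g -` A \<inter> space lebesgue \<in> sets lebesgue"
  proof (rule completion.in_sets_AE)
    show "AE x in lebesgue. x \<in> f -` A \<inter> space lebesgue \<longleftrightarrow> x \<in> g -` A \<inter> space lebesgue"
      using ae by eventually_elim auto
    show "f -` A \<inter> space lebesgue \<in> sets lebesgue" using f A by (rule measurable_sets)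
  qed auto
qed simp

text \<open>Fubini gives measurability of almost every section; continuity in the parameter gives the rest.\<close>

lemma section_measurable:
  fixes f :: "real \<Rightarrow> real \<Rightarrow> real"
  assumes m: "(\<lambda>(s, t). f s t) \<in> borel_measurable (lebesgue_on ({0..a} \<times> {0<..}))"
    and lip: "\<And>s s' t. \<lbrakk>s \<in> {0..a}; s' \<in> {0..a}; t > 0\<rbrakk> \<Longrightarrow> \<bar>f s t - f s' t\<bar> \<le> K t * \<bar>s - s'\<bar>"
    and s: "s \<in> {0..a}" and a: "a > 0"
  shows "f s \<in> borel_measurable (lebesgue_on {0<..})"
proof -
  define g where "g = (\<lambda>p::real \<times> real. if p \<in> {0..a} \<times> {0<..} then (\<lambda>(s, t). f s t) p else 0)"
  have S: "{0..a} \<times> {0<..} \<in> sets (lebesgue :: (real \<times> real) measure)"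
    by (intro borel_measurableI sets_completionI_sets) (auto intro!: borel_Times)
  have "g \<in> borel_measurable lebesgue"
    unfolding g_def using m S by (simp add: borel_measurable_if)
  \<comment> \<open>A section of a Lebesgue measurable function can be nonmeasurable, but every
    section of a Borel function is Borel; on almost every section the two agree almost
    everywhere.\<close>
  then obtain g' where g': "g' \<in> borel_measurable lborel" "AE p in lborel. g p = g' p"
    using completion_ex_borel_measurable_real[of g lborel] by blast
  have "AE p in lborel \<Otimes>\<^sub>M lborel. g p = g' p" unfolding lborel_prod by (rule g'(2))
  then have AE: "AE x in lborel. AE y in lborel. g (x, y) = g' (x, y)"
    by (rule lborel_pair.AE_pair)
  have sec: "(\<lambda>t. g (x, t)) \<in> borel_measurable lebesgue" if "AE y in lborel. g (x, y) = g' (x, y)" for x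
  proof -
    have "(\<lambda>t. g' (x, t)) \<in> borel_measurable borel"
      using g'(1) by (auto simp: borel_prod[symmetric])
    then have 1: "(\<lambda>t. g' (x, t)) \<in> borel_measurable lebesgue" by (simp add: measurable_completion)
    have "AE y in lebesgue. g' (x, y) = g (x, y)" using AE_completion[OF that] by auto
    then show ?thesis by (rule borel_measurable_lebesgue_AE[OF 1])
  qed
  \<comment> \<open>Parameters with a measurable section are dense, as their complement is null; the
    section at \<open>s\<close> is then a pointwise limit.\<close>
  have "\<exists>x. x \<in> {0..a} \<and> \<bar>x - s\<bar> \<le> 1 / Suc n \<and> (\<lambda>t. g (x, t)) \<in> borel_measurable lebesgue" for n
  proof -
    define d where "d = 1 / real (Suc n)"
    have "d > 0" by (simp add: d_def)
    then have "max 0 (s - d) < min a (s + d)" using s a by auto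
    from AE_lborel_interval[OF AE this] obtain x where
      x: "x \<in> {max 0 (s - d)<..<min a (s + d)}" "AE y in lborel. g (x, y) = g' (x, y)" by blast
    then have "x \<in> {0..a}" "\<bar>x - s\<bar> \<le> d" by auto
    then show ?thesis using sec[OF x(2)] unfolding d_def by blast
  qed
  then obtain x where x: "x n \<in> {0..a}" "\<bar>x n - s\<bar> \<le> 1 / Suc n" "(\<lambda>t. g (x n, t)) \<in> borel_measurable lebesgue" for n
    by metis
  have xs: "(\<lambda>n. \<bar>x n - s\<bar>) \<longlonglongrightarrow> 0"
    by (rule tendsto_sandwich[OF _ _ tendsto_const LIMSEQ_inverse_real_of_nat]) (use x(2) in \<open>auto simp: inverse_eq_divide\<close>)
  have "(\<lambda>n. g (x n, t)) \<longlonglongrightarrow> g (s, t)" for t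
  proof (cases "t > 0")
    case True
    have "(\<lambda>n. K t * \<bar>x n - s\<bar>) \<longlonglongrightarrow> 0" using tendsto_mult_left[OF xs, of "K t"] by simp
    then have "(\<lambda>n. g (x n, t) - g (s, t)) \<longlonglongrightarrow> 0"
      by (rule Lim_null_comparison[rotated]) (use x(1) s lip True in \<open>auto simp: g_def\<close>)
    then show ?thesis by (simp add: LIM_zero_iff)
  qed (simp add: g_def)
  then have gs: "(\<lambda>t. g (s, t)) \<in> borel_measurable lebesgue"
    by (rule borel_measurable_LIMSEQ_real) (use x in auto)
  have "(\<lambda>t. if t \<in> {0<..} then f s t else 0) \<in> borel_measurable lebesgue"
    by (rule measurable_cong[THEN iffD1, OF _ gs]) (use s in \<open>auto simp: g_def\<close>)
  then show ?thesis by (subst (asm) borel_measurable_if) auto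
qed

lemma integrable_powr_0:
  assumes "-1 < a" "0 \<le> c"
  shows "integrable lebesgue (\<lambda>t::real. indicator {0<..c} t * t powr a)"
    "(LINT t|lebesgue. indicator {0<..c} t * t powr a) = c powr (a + 1) / (a + 1)"
proof -
  have h: "((\<lambda>t::real. t powr a) has_integral (c powr (a + 1) / (a + 1))) {0<..c}"
    by (rule has_integral_spike_set_eq[THEN iffD1, OF _ _ has_integral_powr_from_0[OF assms]])
       (auto intro: negligible_subset[of "{0}"])
  then have "(\<lambda>t. t powr a) absolutely_integrable_on {0<..c}"
    by (intro nonnegative_absolutely_integrable_1) (auto simp: integrable_on_def)
  then show 1: "integrable lebesgue (\<lambda>t::real. indicator {0<..c} t * t powr a)"
    by (simp add: set_integrable_def)
  have "set_lebesgue_integral lebesgue {0<..c} (\<lambda>t. t powr a) = integral {0<..c} (\<lambda>t. t powr a)"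
    using 1 by (intro set_lebesgue_integral_eq_integral) (simp add: set_integrable_def)
  then show "(LINT t|lebesgue. indicator {0<..c} t * t powr a) = c powr (a + 1) / (a + 1)"
    using integral_unique[OF h] by (simp add: set_lebesgue_integral_def)
qed

lemma integrable_powr_inf:
  assumes "a < -1" "0 < c"
  shows "integrable lebesgue (\<lambda>t::real. indicator {c..} t * t powr a)"
    "(LINT t|lebesgue. indicator {c..} t * t powr a) = - (c powr (a + 1)) / (a + 1)"
proof -
  have h: "((\<lambda>t::real. t powr a) has_integral (- (c powr (a + 1)) / (a + 1))) {c..}"
    by (rule has_integral_powr_to_inf[OF assms])
  then have "(\<lambda>t. t powr a) absolutely_integrable_on {c..}"
    by (intro nonnegative_absolutely_integrable_1) (auto simp: integrable_on_def)
  then show 1: "integrable lebesgue (\<lambda>t::real. indicator {c..} t * t powr a)"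
    by (simp add: set_integrable_def)
  have "set_lebesgue_integral lebesgue {c..} (\<lambda>t. t powr a) = integral {c..} (\<lambda>t. t powr a)"
    using 1 by (intro set_lebesgue_integral_eq_integral) (simp add: set_integrable_def)
  then show "(LINT t|lebesgue. indicator {c..} t * t powr a) = - (c powr (a + 1)) / (a + 1)"
    using integral_unique[OF h] by (simp add: set_lebesgue_integral_def)
qed

subsection \<open>The nonlocal term as a function of the point\<close>

locale network_kernels = network N for N :: "'a::euclidean_space network" +
  fixes \<nu> :: "'a set \<Rightarrow> 'a set \<Rightarrow> 'a \<Rightarrow> real \<Rightarrow> real" and \<Lambda> \<sigma> :: real
  assumes \<Lambda>_pos: "0 < \<Lambda>" and \<sigma>: "0 < \<sigma>" "\<sigma> < 1"
    and \<nu>_measurable: "\<lbrakk>E \<in> edges N; F \<in> edges N\<rbrakk> \<Longrightarrow> (\<lambda>(s, t). \<nu> E F (edge_param N E s) t)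
          \<in> borel_measurable (lebesgue_on ({0..edge_len N E} \<times> {0<..}))"
    and \<nu>_nonneg: "\<lbrakk>E \<in> edges N; F \<in> edges N; x \<in> closure E; t > 0\<rbrakk> \<Longrightarrow> 0 \<le> \<nu> E F x t"
    and \<nu>_le: "\<lbrakk>E \<in> edges N; F \<in> edges N; x \<in> closure E; t > 0\<rbrakk> \<Longrightarrow> \<nu> E F x t \<le> \<Lambda> * t powr (-(1 + \<sigma>))"
    and \<nu>_lipschitz: "\<lbrakk>E \<in> edges N; F \<in> edges N; x \<in> closure E; y \<in> closure E; t > 0\<rbrakk> \<Longrightarrow>
          \<bar>\<nu> E F x t - \<nu> E F y t\<bar> \<le> \<Lambda> * norm (x - y) * t powr (-(1 + \<sigma>))"
begin

lemma \<nu>_section: 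
  assumes E: "E \<in> edges N" "F \<in> edges N" and s: "0 \<le> s" "s \<le> len E"
  shows "\<nu> E F (\<gamma> E s) \<in> borel_measurable (lebesgue_on {0<..})"
proof (rule section_measurable[OF \<nu>_measurable[OF E], where K = "\<lambda>t. \<Lambda> * t powr (-(1 + \<sigma>))"])
  fix s s' t :: real assume "s \<in> {0..len E}" "s' \<in> {0..len E}" "0 < t"
  then show "\<bar>\<nu> E F (\<gamma> E s) t - \<nu> E F (\<gamma> E s') t\<bar> \<le> \<Lambda> * t powr (-(1 + \<sigma>)) * \<bar>s - s'\<bar>"
    using \<nu>_lipschitz[OF E \<gamma>_in_closure[OF E(1), of s] \<gamma>_in_closure[OF E(1), of s'], of t] dist_\<gamma>[OF E(1), of s s']
    by (simp add: dist_norm mult_ac)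
qed (use s len_pos[OF E(1)] in auto)

definition edgewise_measurable :: "('a \<Rightarrow> real) \<Rightarrow> bool" where
  "edgewise_measurable f \<longleftrightarrow> (\<forall>F \<in> edges N. (\<lambda>z. f (\<gamma> F z)) \<in> borel_measurable (lebesgue_on {0<..<len F}))"

text \<open>\<open>Lipschitz_at L x f\<close> is what makes the singular integral at \<open>x\<close> absolutely convergent.\<close>

definition Lipschitz_at :: "real \<Rightarrow> 'a \<Rightarrow> ('a \<Rightarrow> real) \<Rightarrow> bool" where
  "Lipschitz_at L x f \<longleftrightarrow> edgewise_measurable f \<and> (\<forall>z \<in> \<Gamma>. \<bar>f z - f x\<bar> \<le> L * \<rho> x z)"

definition br_fun :: "'a set \<Rightarrow> real \<Rightarrow> 'a set \<Rightarrow> real \<Rightarrow> ('a \<Rightarrow> real) \<Rightarrow> real \<Rightarrow> real" where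
  "br_fun E s F \<epsilon> f t = indicator {br_lo E s F \<epsilon><..<br_hi E s F \<epsilon>} t *
     ((f (\<gamma> F (br_off E s F \<epsilon> + \<epsilon> * t)) - f (\<gamma> E s)) * \<nu> E F (\<gamma> E s) t)"

definition edge_fun :: "'a set \<Rightarrow> real \<Rightarrow> 'a set \<Rightarrow> ('a \<Rightarrow> real) \<Rightarrow> real \<Rightarrow> real" where
  "edge_fun E s F f z = indicator {0<..<len F} z *
     ((f (\<gamma> F z) - f (\<gamma> E s)) * \<nu> E F (\<gamma> E s) (\<rho> (\<gamma> E s) (\<gamma> F z)))"

context
  fixes E F s
  assumes E: "E \<in> edges N" and F: "F \<in> edges N" and s: "0 \<le> s" "s \<le> len E"
begin

lemma br_fun_measurable:
  assumes f: "edgewise_measurable f" and \<epsilon>: "\<epsilon> \<in> {1, -1}"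
  shows "br_fun E s F \<epsilon> f \<in> borel_measurable lebesgue"
proof -
  define q where "q = (\<lambda>z. if z \<in> {0<..<len F} then f (\<gamma> F z) else 0)"
  have q: "q \<in> borel_measurable lebesgue"
    unfolding q_def using f F by (subst borel_measurable_if) (auto simp: edgewise_measurable_def)
  have aff: "(\<lambda>t. br_off E s F \<epsilon> + \<epsilon> * t) \<in> lebesgue \<rightarrow>\<^sub>M lebesgue"
    using lebesgue_affine_measurable[where c = "\<lambda>_::real. \<epsilon>" and t = "br_off E s F \<epsilon>"] \<epsilon> by auto
  have q2: "(\<lambda>t. q (br_off E s F \<epsilon> + \<epsilon> * t)) \<in> borel_measurable lebesgue"
    using measurable_comp[OF aff q] by (simp add: comp_def)
  define k where "k = (\<lambda>t. if t \<in> {0<..} then \<nu> E F (\<gamma> E s) t else 0)"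
  have k: "k \<in> borel_measurable lebesgue"
    unfolding k_def using \<nu>_section[OF E F s] by (subst borel_measurable_if) auto
  have i: "(\<lambda>t. indicator {br_lo E s F \<epsilon><..<br_hi E s F \<epsilon>} t :: real) \<in> borel_measurable lebesgue"
    by (intro borel_measurable_indicator) auto
  have "(\<lambda>t. indicator {br_lo E s F \<epsilon><..<br_hi E s F \<epsilon>} t * ((q (br_off E s F \<epsilon> + \<epsilon> * t) - f (\<gamma> E s)) * k t))
      \<in> borel_measurable lebesgue"
    by (intro borel_measurable_times i k borel_measurable_diff q2 borel_measurable_const)
  moreover have "indicator {br_lo E s F \<epsilon><..<br_hi E s F \<epsilon>} t * ((q (br_off E s F \<epsilon> + \<epsilon> * t) - f (\<gamma> E s)) * k t)
      = br_fun E s F \<epsilon> f t" for t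
    using br_point(1,2)[OF E F s \<epsilon>, of t] br_lo_nonneg[OF E F s, of \<epsilon>]
    by (auto simp: br_fun_def q_def k_def indicator_def)
  ultimately show ?thesis by simp
qed

lemma \<nu>_bounds: "0 < t \<Longrightarrow> 0 \<le> \<nu> E F (\<gamma> E s) t" "0 < t \<Longrightarrow> \<nu> E F (\<gamma> E s) t \<le> \<Lambda> * t powr (-(1 + \<sigma>))"
  using \<nu>_nonneg[OF E F \<gamma>_in_closure[OF E s]] \<nu>_le[OF E F \<gamma>_in_closure[OF E s]] by auto

text \<open>\<open>L * t\<close> against \<open>\<Lambda> * t powr (-(1 + \<sigma>))\<close> leaves
  \<open>t powr (- \<sigma>)\<close>, integrable at \<open>0\<close>. The majorant is the same for
  all base points, edges and branches, so it also dominates along sequences.\<close>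

lemma br_fun_bound:
  assumes \<epsilon>: "\<epsilon> \<in> {1, -1}" and f: "\<And>z. z \<in> \<Gamma> \<Longrightarrow> \<bar>f z - f (\<gamma> E s)\<bar> \<le> L * \<rho> (\<gamma> E s) z"
  shows "\<bar>br_fun E s F \<epsilon> f t\<bar> \<le> L * \<Lambda> * (indicator {0<..diam} t * t powr (-\<sigma>))"
proof (cases "t \<in> {br_lo E s F \<epsilon><..<br_hi E s F \<epsilon>}")
  case True
  then have t: "0 < t" "t \<le> diam"
    using br_hi_le_diam[OF E F s \<epsilon>, of t] br_lo_nonneg[OF E F s, of \<epsilon>] by auto
  note p = br_point[OF E F s \<epsilon>, of t]
  have "\<bar>br_fun E s F \<epsilon> f t\<bar> = \<bar>f (\<gamma> F (br_off E s F \<epsilon> + \<epsilon> * t)) - f (\<gamma> E s)\<bar> * \<nu> E F (\<gamma> E s) t"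
    using True \<nu>_bounds(1)[OF t(1)] by (simp add: br_fun_def abs_mult)
  also have "\<dots> \<le> (L * t) * (\<Lambda> * t powr (-(1 + \<sigma>)))"
  proof (rule mult_mono)
    show f': "\<bar>f (\<gamma> F (br_off E s F \<epsilon> + \<epsilon> * t)) - f (\<gamma> E s)\<bar> \<le> L * t"
      using f[OF \<gamma>_in_\<Gamma>[OF F, of "br_off E s F \<epsilon> + \<epsilon> * t"]] p True by auto
    show "0 \<le> L * t" using f' by linarith
  qed (use \<nu>_bounds t in auto)
  also have "\<dots> = L * \<Lambda> * (t * t powr (-1 + -\<sigma>))" by simp
  also have "t * t powr (-1 + -\<sigma>) = t powr (-\<sigma>)" using t by (subst powr_add) (simp add: powr_minus_divide)
  finally show ?thesis using t by simp
next
  case False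
  \<comment> \<open>Off the branch only \<open>0 \<le> L\<close> is at stake; it follows from the
    hypothesis at any point different from the base point.\<close>
  obtain z where "z \<in> \<Gamma>" "0 < \<rho> (\<gamma> E s) z"
  proof (cases "s = 0")
    case True
    then show ?thesis using that[of "tgt E"] ends_in_\<Gamma>[OF E] \<rho>_edge[OF E, of 0 "len E"] len_pos[OF E] \<gamma>_len[OF E] by simp
  next
    case False
    then show ?thesis using that[of "src E"] ends_in_\<Gamma>[OF E] \<rho>_edge[OF E, of s 0] s by simp
  qed
  then have "0 \<le> L" using f[of z] by (meson abs_ge_zero order.trans zero_le_mult_iff not_less)
  then show ?thesis using False \<Lambda>_pos by (simp add: br_fun_def)
qed

lemma integrable_bound_fun: "integrable lebesgue (\<lambda>t. c * (indicator {0<..diam} t * t powr (-\<sigma>)))"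
  using integrable_powr_0(1)[of "-\<sigma>" diam] \<sigma> diam_pos by simp

lemma br_fun_integrable:
  assumes f: "Lipschitz_at L (\<gamma> E s) f" and \<epsilon>: "\<epsilon> \<in> {1, -1}"
  shows "integrable lebesgue (br_fun E s F \<epsilon> f)"
proof (rule Bochner_Integration.integrable_bound[OF integrable_bound_fun])
  show "br_fun E s F \<epsilon> f \<in> borel_measurable lebesgue"
    using f \<epsilon> by (intro br_fun_measurable) (auto simp: Lipschitz_at_def)
  show "AE t in lebesgue. norm (br_fun E s F \<epsilon> f t) \<le> norm (L * \<Lambda> * (indicator {0<..diam} t * t powr (-\<sigma>)))"
    using br_fun_bound[OF \<epsilon>, of f L] f unfolding Lipschitz_at_def
    by (intro AE_I2) (smt (verit) real_norm_def)
qed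

text \<open>A correction supported at the single point \<open>br_mid E s F\<close> makes the
  identity hold everywhere, so that integrability and integrals transfer by plain addition.\<close>

lemma edge_fun_eq:
  "edge_fun E s F f z = br_fun E s F 1 f (- br_off E s F 1 + 1 * z) + br_fun E s F (-1) f (br_off E s F (-1) + (-1) * z)
     + indicator {br_mid E s F} z * (edge_fun E s F f (br_mid E s F) - br_fun E s F 1 f (- br_off E s F 1 + 1 * br_mid E s F)
      - br_fun E s F (-1) f (br_off E s F (-1) + (-1) * br_mid E s F))"
proof (cases "z = br_mid E s F")
  case False
  have part: "indicator {0<..<len F} z = indicator {br_lo E s F 1<..<br_hi E s F 1} (z - br_off E s F 1) +
     (indicator {br_lo E s F (-1)<..<br_hi E s F (-1)} (br_off E s F (-1) - z) :: real)"
    using br_partition[OF E F s False] unfolding sum_pm by simp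
  have 1: "br_fun E s F 1 f (z - br_off E s F 1) = indicator {br_lo E s F 1<..<br_hi E s F 1} (z - br_off E s F 1) *
     ((f (\<gamma> F z) - f (\<gamma> E s)) * \<nu> E F (\<gamma> E s) (\<rho> (\<gamma> E s) (\<gamma> F z)))"
    using br_point(3)[OF E F s, of 1 "z - br_off E s F 1"] by (auto simp: br_fun_def indicator_def)
  have 2: "br_fun E s F (-1) f (br_off E s F (-1) - z) = indicator {br_lo E s F (-1)<..<br_hi E s F (-1)} (br_off E s F (-1) - z) *
     ((f (\<gamma> F z) - f (\<gamma> E s)) * \<nu> E F (\<gamma> E s) (\<rho> (\<gamma> E s) (\<gamma> F z)))"
    using br_point(3)[OF E F s, of "-1" "br_off E s F (-1) - z"] by (auto simp: br_fun_def indicator_def)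
  show ?thesis using False 1 2 part by (simp add: edge_fun_def distrib_right)
qed simp

lemma edge_fun_integrable:
  assumes f: "Lipschitz_at L (\<gamma> E s) f"
  shows "integrable lebesgue (edge_fun E s F f)"
    "(LINT z|lebesgue. edge_fun E s F f z) = (\<Sum>\<epsilon> \<in> {1, -1}. LINT t|lebesgue. br_fun E s F \<epsilon> f t)"
proof -
  have i: "integrable lebesgue (\<lambda>z. br_fun E s F 1 f (- br_off E s F 1 + 1 * z))"
    "integrable lebesgue (\<lambda>z. br_fun E s F (-1) f (br_off E s F (-1) + (-1) * z))"
    by (intro lebesgue_integrable_real_affine br_fun_integrable[OF f]; simp)+
  have mid: "integrable lebesgue (\<lambda>z. indicator {br_mid E s F} z * c :: real)"
     "(LINT z|lebesgue. indicator {br_mid E s F} z * c :: real) = 0" for c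
    by (auto simp: integrable_mult_left_iff)
  define c where "c = edge_fun E s F f (br_mid E s F) - br_fun E s F 1 f (- br_off E s F 1 + 1 * br_mid E s F)
      - br_fun E s F (-1) f (br_off E s F (-1) + (-1) * br_mid E s F)"
  have eq: "edge_fun E s F f = (\<lambda>z. br_fun E s F 1 f (- br_off E s F 1 + 1 * z) +
     br_fun E s F (-1) f (br_off E s F (-1) + (-1) * z) + indicator {br_mid E s F} z * c)"
    unfolding c_def by (rule ext) (rule edge_fun_eq)
  show "integrable lebesgue (edge_fun E s F f)"
    unfolding eq by (intro Bochner_Integration.integrable_add i mid)
  have "(LINT z|lebesgue. edge_fun E s F f z) = (LINT z|lebesgue. br_fun E s F 1 f (- br_off E s F 1 + 1 * z)) +
     (LINT z|lebesgue. br_fun E s F (-1) f (br_off E s F (-1) + (-1) * z))"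
    unfolding eq by (subst Bochner_Integration.integral_add)
      (use i mid in \<open>auto simp: Bochner_Integration.integral_add\<close>)
  also have "(LINT z|lebesgue. br_fun E s F 1 f (- br_off E s F 1 + 1 * z)) = (LINT t|lebesgue. br_fun E s F 1 f t)"
    using lebesgue_integral_real_affine[of 1 "br_fun E s F 1 f" "- br_off E s F 1"] by simp
  also have "(LINT z|lebesgue. br_fun E s F (-1) f (br_off E s F (-1) + (-1) * z)) = (LINT t|lebesgue. br_fun E s F (-1) f t)"
    using lebesgue_integral_real_affine[of "-1" "br_fun E s F (-1) f" "br_off E s F (-1)"] by simp
  finally show "(LINT z|lebesgue. edge_fun E s F f z) = (\<Sum>\<epsilon> \<in> {1, -1}. LINT t|lebesgue. br_fun E s F \<epsilon> f t)"
    unfolding sum_pm .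
qed

end

lemma nonloc_edge_fun: "nonloc N \<nu> E \<Gamma> f (\<gamma> E s) = (\<Sum>F \<in> edges N. LINT z|lebesgue. edge_fun E s F f z)"
proof -
  have "{z \<in> {0<..<len F}. \<gamma> F z \<in> \<Gamma>} = {0<..<len F}" if "F \<in> edges N" for F
    using \<gamma>_in_\<Gamma>[OF that] by auto
  then show ?thesis
    unfolding nonloc_def set_lebesgue_integral_def edge_fun_def by (intro sum.cong) auto
qed

lemma nonloc_eq:
  assumes "E \<in> edges N" "0 \<le> s" "s \<le> len E" "Lipschitz_at L (\<gamma> E s) f"
  shows "nonloc N \<nu> E \<Gamma> f (\<gamma> E s) = (\<Sum>F \<in> edges N. \<Sum>\<epsilon> \<in> {1, -1}. LINT t|lebesgue. br_fun E s F \<epsilon> f t)"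
  unfolding nonloc_edge_fun using edge_fun_integrable(2)[OF assms(1) _ assms(2-4)] by (intro sum.cong) auto

lemma nonloc_mono:
  assumes E: "E \<in> edges N" and s: "0 \<le> s" "s \<le> len E"
    and f: "Lipschitz_at L (\<gamma> E s) f" and g: "Lipschitz_at M (\<gamma> E s) g"
    and le: "\<And>z. z \<in> \<Gamma> \<Longrightarrow> f z - f (\<gamma> E s) \<le> g z - g (\<gamma> E s)"
  shows "nonloc N \<nu> E \<Gamma> f (\<gamma> E s) \<le> nonloc N \<nu> E \<Gamma> g (\<gamma> E s)"
  unfolding nonloc_eq[OF E s f] nonloc_eq[OF E s g]
proof (intro sum_mono integral_mono br_fun_integrable[OF E _ s f] br_fun_integrable[OF E _ s g])
  fix F \<epsilon> and t :: real assume F: "F \<in> edges N" and \<epsilon>: "\<epsilon> \<in> {1, - 1::real}"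
  show "br_fun E s F \<epsilon> f t \<le> br_fun E s F \<epsilon> g t"
  proof (cases "t \<in> {br_lo E s F \<epsilon><..<br_hi E s F \<epsilon>}")
    case True
    then have "0 < t" using br_lo_nonneg[OF E F s, of \<epsilon>] by auto
    then show ?thesis using True br_point(1,2)[OF E F s \<epsilon>, of t] \<nu>_bounds(1)[OF E F s, of t]
      unfolding br_fun_def by (auto intro!: mult_right_mono le \<gamma>_in_\<Gamma> F)
  qed (simp add: br_fun_def)
qed auto

text \<open>Integrability of both pieces is inherited from the combined function \<open>f\<close>,
  which is Lipschitz at the base point; \<open>u\<close> and \<open>\<phi>\<close> each contribute
  on one part of \<Gamma>.\<close>

lemma nonloc_split:
  assumes E: "E \<in> edges N" and s: "0 \<le> s" "s \<le> len E"
    and A: "\<And>F. F \<in> edges N \<Longrightarrow> {z \<in> {0<..<len F}. \<gamma> F z \<in> A} \<in> sets lebesgue"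
    and f: "Lipschitz_at L (\<gamma> E s) f"
    and fA: "\<And>z. z \<in> \<Gamma> \<Longrightarrow> z \<in> A \<Longrightarrow> f z - f (\<gamma> E s) = \<phi> z - \<phi> (\<gamma> E s)"
    and fu: "\<And>z. z \<in> \<Gamma> \<Longrightarrow> z \<notin> A \<Longrightarrow> f z - f (\<gamma> E s) = u z - u (\<gamma> E s)"
  shows "nonloc N \<nu> E (\<Gamma> - A) u (\<gamma> E s) + nonloc N \<nu> E A \<phi> (\<gamma> E s) = nonloc N \<nu> E \<Gamma> f (\<gamma> E s)"
proof -
  define T where "T = (\<lambda>F. {z \<in> {0<..<len F}. \<gamma> F z \<in> A})"
  have 1: "(LINT z:{z \<in> {0<..<len F}. \<gamma> F z \<in> \<Gamma> - A}|lebesgue.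
        (u (\<gamma> F z) - u (\<gamma> E s)) * \<nu> E F (\<gamma> E s) (\<rho> (\<gamma> E s) (\<gamma> F z))) =
     (LINT z|lebesgue. edge_fun E s F f z) - (LINT z|lebesgue. indicator (T F) z *\<^sub>R edge_fun E s F f z)"
    and 2: "(LINT z:{z \<in> {0<..<len F}. \<gamma> F z \<in> A}|lebesgue.
        (\<phi> (\<gamma> F z) - \<phi> (\<gamma> E s)) * \<nu> E F (\<gamma> E s) (\<rho> (\<gamma> E s) (\<gamma> F z))) =
     (LINT z|lebesgue. indicator (T F) z *\<^sub>R edge_fun E s F f z)" if F: "F \<in> edges N" for F
  proof -
    have G: "\<gamma> F z \<in> \<Gamma>" if "0 < z" "z < len F" for z using \<gamma>_in_\<Gamma>[OF F, of z] that by simp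
    note int = edge_fun_integrable(1)[OF E F s f]
    have iT: "integrable lebesgue (\<lambda>z. indicator (T F) z *\<^sub>R edge_fun E s F f z)"
      using A[OF F] int unfolding T_def by (intro integrable_mult_indicator)
    have "(LINT z|lebesgue. edge_fun E s F f z) - (LINT z|lebesgue. indicator (T F) z *\<^sub>R edge_fun E s F f z) =
       (LINT z|lebesgue. edge_fun E s F f z - indicator (T F) z *\<^sub>R edge_fun E s F f z)"
      by (rule Bochner_Integration.integral_diff[symmetric, OF int iT])
    also have "\<dots> = (LINT z:{z \<in> {0<..<len F}. \<gamma> F z \<in> \<Gamma> - A}|lebesgue.
        (u (\<gamma> F z) - u (\<gamma> E s)) * \<nu> E F (\<gamma> E s) (\<rho> (\<gamma> E s) (\<gamma> F z)))"
      unfolding set_lebesgue_integral_def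
      by (intro Bochner_Integration.integral_cong refl) (use G in \<open>auto simp: edge_fun_def T_def indicator_def fu\<close>)
    finally show "(LINT z:{z \<in> {0<..<len F}. \<gamma> F z \<in> \<Gamma> - A}|lebesgue.
        (u (\<gamma> F z) - u (\<gamma> E s)) * \<nu> E F (\<gamma> E s) (\<rho> (\<gamma> E s) (\<gamma> F z))) =
     (LINT z|lebesgue. edge_fun E s F f z) - (LINT z|lebesgue. indicator (T F) z *\<^sub>R edge_fun E s F f z)" ..
    show "(LINT z:{z \<in> {0<..<len F}. \<gamma> F z \<in> A}|lebesgue.
        (\<phi> (\<gamma> F z) - \<phi> (\<gamma> E s)) * \<nu> E F (\<gamma> E s) (\<rho> (\<gamma> E s) (\<gamma> F z))) =
     (LINT z|lebesgue. indicator (T F) z *\<^sub>R edge_fun E s F f z)"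
      unfolding set_lebesgue_integral_def
      by (intro Bochner_Integration.integral_cong refl) (use G in \<open>auto simp: edge_fun_def T_def indicator_def fA\<close>)
  qed
  show ?thesis
    unfolding nonloc_edge_fun unfolding nonloc_def using 1 2 by (simp add: sum.distrib[symmetric])
qed

text \<open>Two branches per edge, times a bracket that dominates the integrals of
  \<open>t powr (- \<sigma>)\<close> over \<open>{0<..\<tau>}\<close> and \<open>{0<..diam}\<close>
  and of \<open>t powr (-(1 + \<sigma>))\<close> over \<open>{\<tau>..}\<close>, once the powers of
  \<open>\<tau>\<close> are taken out. The summand \<open>1\<close> next to the number of edges
  keeps the constant positive.\<close>

definition nonloc_const :: real where
  "nonloc_const = 2 * (1 + card (edges N)) * \<Lambda> * ((1 + diam powr (1 - \<sigma>)) / (1 - \<sigma>) + 1 / \<sigma>)"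

lemma nonloc_const_pos: "0 < nonloc_const"
  unfolding nonloc_const_def using \<Lambda>_pos \<sigma> by (intro mult_pos_pos add_pos_pos divide_pos_pos add_pos_nonneg) auto

text \<open>What matters is the factor \<open>\<tau> powr (1 - \<sigma>)\<close> at the near slope
  \<open>K\<close>: a small \<open>\<tau>\<close> lets coercivity win over it, while the far part
  only sees a slope \<open>L\<close> and a jump \<open>\<omega>\<close> known beforehand.\<close>

lemma nonloc_bound:
  assumes E: "E \<in> edges N" and s: "0 \<le> s" "s \<le> len E" and f: "Lipschitz_at M (\<gamma> E s) f"
    and pos: "0 \<le> K" "0 \<le> L" "0 \<le> \<omega>" "0 < \<tau>"
    and near: "\<And>z. z \<in> \<Gamma> \<Longrightarrow> \<rho> (\<gamma> E s) z < \<tau> \<Longrightarrow> f z - f (\<gamma> E s) \<le> K * \<rho> (\<gamma> E s) z"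
    and far: "\<And>z. z \<in> \<Gamma> \<Longrightarrow> \<tau> \<le> \<rho> (\<gamma> E s) z \<Longrightarrow> f z - f (\<gamma> E s) \<le> L * \<rho> (\<gamma> E s) z + \<omega>"
  shows "nonloc N \<nu> E \<Gamma> f (\<gamma> E s) \<le> nonloc_const * (K * \<tau> powr (1 - \<sigma>) + L + \<omega> * \<tau> powr (- \<sigma>))"
proof -
  define b where "b = (\<lambda>t. (\<Lambda> * K) * (indicator {0<..\<tau>} t * t powr (-\<sigma>)) + (\<Lambda> * L) * (indicator {0<..diam} t * t powr (-\<sigma>))
     + (\<Lambda> * \<omega>) * (indicator {\<tau>..} t * t powr (-(1 + \<sigma>))))"
  have i: "integrable lebesgue (\<lambda>t. c * (indicator {0<..\<tau>} t * t powr (-\<sigma>)))"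
     "integrable lebesgue (\<lambda>t. c * (indicator {0<..diam} t * t powr (-\<sigma>)))"
     "integrable lebesgue (\<lambda>t. c * (indicator {\<tau>..} t * t powr (-(1 + \<sigma>))))" for c
    using integrable_powr_0(1)[of "-\<sigma>" \<tau>] integrable_powr_0(1)[of "-\<sigma>" diam] integrable_powr_inf(1)[of "-(1 + \<sigma>)" \<tau>]
      pos \<sigma> diam_pos by auto
  have bi: "integrable lebesgue b" unfolding b_def by (intro Bochner_Integration.integrable_add i)
  have "(LINT t|lebesgue. b t) = \<Lambda> * K * (\<tau> powr (1 - \<sigma>) / (1 - \<sigma>)) + \<Lambda> * L * (diam powr (1 - \<sigma>) / (1 - \<sigma>))
     + \<Lambda> * \<omega> * (\<tau> powr (-\<sigma>) / \<sigma>)"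
    unfolding b_def using i integrable_powr_0(2)[of "-\<sigma>" \<tau>] integrable_powr_0(2)[of "-\<sigma>" diam] integrable_powr_inf(2)[of "-(1 + \<sigma>)" \<tau>]
      pos \<sigma> diam_pos by simp
  also have "\<dots> \<le> \<Lambda> * ((1 + diam powr (1 - \<sigma>)) / (1 - \<sigma>) + 1 / \<sigma>) * (K * \<tau> powr (1 - \<sigma>) + L + \<omega> * \<tau> powr (- \<sigma>))"
  proof -
    define Q where "Q = (1 + diam powr (1 - \<sigma>)) / (1 - \<sigma>) + 1 / \<sigma>"
    have "1 / (1 - \<sigma>) \<le> Q" "diam powr (1 - \<sigma>) / (1 - \<sigma>) \<le> Q" "1 / \<sigma> \<le> Q"
      using \<sigma> by (auto simp: Q_def add_divide_distrib)
    then have "K * \<tau> powr (1 - \<sigma>) * (1 / (1 - \<sigma>)) + L * (diam powr (1 - \<sigma>) / (1 - \<sigma>)) + \<omega> * \<tau> powr (-\<sigma>) * (1 / \<sigma>)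
       \<le> K * \<tau> powr (1 - \<sigma>) * Q + L * Q + \<omega> * \<tau> powr (-\<sigma>) * Q"
      using pos by (intro add_mono mult_left_mono) auto
    then have "\<Lambda> * (K * \<tau> powr (1 - \<sigma>) * (1 / (1 - \<sigma>)) + L * (diam powr (1 - \<sigma>) / (1 - \<sigma>)) + \<omega> * \<tau> powr (-\<sigma>) * (1 / \<sigma>))
       \<le> \<Lambda> * (K * \<tau> powr (1 - \<sigma>) * Q + L * Q + \<omega> * \<tau> powr (-\<sigma>) * Q)"
      using \<Lambda>_pos by (intro mult_left_mono) auto
    then show ?thesis unfolding Q_def[symmetric] by (simp add: algebra_simps)
  qed
  finally have bI: "(LINT t|lebesgue. b t) \<le> \<Lambda> * ((1 + diam powr (1 - \<sigma>)) / (1 - \<sigma>) + 1 / \<sigma>) * (K * \<tau> powr (1 - \<sigma>) + L + \<omega> * \<tau> powr (- \<sigma>))" .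
  define R where "R = \<Lambda> * ((1 + diam powr (1 - \<sigma>)) / (1 - \<sigma>) + 1 / \<sigma>) * (K * \<tau> powr (1 - \<sigma>) + L + \<omega> * \<tau> powr (- \<sigma>))"
  have bnn: "0 \<le> b t" for t unfolding b_def using pos \<Lambda>_pos by (intro add_nonneg_nonneg mult_nonneg_nonneg) auto
  have le: "br_fun E s F \<epsilon> f t \<le> b t" if F: "F \<in> edges N" and \<epsilon>: "\<epsilon> \<in> {1, -1}" for F \<epsilon> t
  proof (cases "t \<in> {br_lo E s F \<epsilon><..<br_hi E s F \<epsilon>}")
    case True
    then have t: "0 < t" "t \<le> diam"
      using br_hi_le_diam[OF E F s \<epsilon>, of t] br_lo_nonneg[OF E F s, of \<epsilon>] by auto
    define z where "z = \<gamma> F (br_off E s F \<epsilon> + \<epsilon> * t)"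
    have z: "z \<in> \<Gamma>" "\<rho> (\<gamma> E s) z = t" unfolding z_def using br_point[OF E F s \<epsilon>, of t] True \<gamma>_in_\<Gamma>[OF F] by auto
    have pw: "t * t powr (-(1 + \<sigma>)) = t powr (-\<sigma>)"
      using powr_mult_base[of t "-(1 + \<sigma>)"] t by simp
    have br: "br_fun E s F \<epsilon> f t = (f z - f (\<gamma> E s)) * \<nu> E F (\<gamma> E s) t" using True by (simp add: br_fun_def z_def)
    define h where "h = (if t < \<tau> then K * t else L * t + \<omega>)"
    have "h \<ge> 0" using pos t by (simp add: h_def)
    have "f z - f (\<gamma> E s) \<le> h" using near[OF z(1)] far[OF z(1)] z(2) by (simp add: h_def)
    then have "br_fun E s F \<epsilon> f t \<le> h * \<nu> E F (\<gamma> E s) t"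
      unfolding br using \<nu>_bounds(1)[OF E F s t(1)] by (rule mult_right_mono)
    also have "\<dots> \<le> h * (\<Lambda> * t powr (-(1 + \<sigma>)))"
      using \<nu>_bounds(2)[OF E F s t(1)] \<open>h \<ge> 0\<close> by (rule mult_left_mono)
    also have "\<dots> \<le> b t"
    proof (cases "t < \<tau>")
      case True
      have "h * (\<Lambda> * t powr (-(1 + \<sigma>))) = \<Lambda> * K * (t * t powr (-(1 + \<sigma>)))" using True by (simp add: h_def)
      also have "\<dots> = \<Lambda> * K * t powr (-\<sigma>)" unfolding pw ..
      also have "\<dots> \<le> b t" unfolding b_def using True t pos \<Lambda>_pos by simp
      finally show ?thesis .
    next
      case False
      have "h * (\<Lambda> * t powr (-(1 + \<sigma>))) = \<Lambda> * L * (t * t powr (-(1 + \<sigma>))) + \<Lambda> * \<omega> * t powr (-(1 + \<sigma>))"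
        using False by (simp add: h_def algebra_simps)
      also have "\<dots> = \<Lambda> * L * t powr (-\<sigma>) + \<Lambda> * \<omega> * t powr (-(1 + \<sigma>))" unfolding pw ..
      also have "\<dots> \<le> b t" unfolding b_def using False t pos \<Lambda>_pos by simp
      finally show ?thesis .
    qed
    finally show ?thesis .
  qed (use bnn in \<open>simp add: br_fun_def\<close>)
  have "nonloc N \<nu> E \<Gamma> f (\<gamma> E s) \<le> (\<Sum>F \<in> edges N. \<Sum>\<epsilon> \<in> {1, -1::real}. R)"
    unfolding nonloc_eq[OF E s f]
  proof (intro sum_mono)
    fix F \<epsilon> assume F: "F \<in> edges N" and \<epsilon>: "\<epsilon> \<in> {1, - 1::real}"
    have "(LINT t|lebesgue. br_fun E s F \<epsilon> f t) \<le> (LINT t|lebesgue. b t)"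
      by (intro integral_mono br_fun_integrable[OF E F s f \<epsilon>] bi le F \<epsilon>)
    then show "(LINT t|lebesgue. br_fun E s F \<epsilon> f t) \<le> R" using bI unfolding R_def by linarith
  qed
  also have "\<dots> = 2 * card (edges N) * R" by simp
  also have "\<dots> \<le> 2 * (1 + card (edges N)) * R"
  proof -
    have "0 \<le> R" unfolding R_def using \<Lambda>_pos \<sigma> pos
      by (intro mult_nonneg_nonneg add_nonneg_nonneg divide_nonneg_nonneg) auto
    then show ?thesis by (simp add: mult_right_mono)
  qed
  also have "\<dots> = nonloc_const * (K * \<tau> powr (1 - \<sigma>) + L + \<omega> * \<tau> powr (- \<sigma>))"
    by (simp add: R_def nonloc_const_def)
  finally show ?thesis .
qed

text \<open>Dominated convergence on each branch. The hypothesis \<open>ptz\<close> asks for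
  convergence along moving points because the point at distance \<open>t\<close> moves with the base
  point.\<close>

lemma nonloc_tendsto:
  assumes E: "E \<in> edges N" and sn: "\<And>n. 0 \<le> sn n \<and> sn n \<le> len E" and s: "0 \<le> s" "s \<le> len E" and lim: "sn \<longlonglongrightarrow> s"
    and fn: "\<And>n. Lipschitz_at L (\<gamma> E (sn n)) (fn n)" and f: "Lipschitz_at L (\<gamma> E s) f"
    and ptx: "(\<lambda>n. fn n (\<gamma> E (sn n))) \<longlonglongrightarrow> f (\<gamma> E s)"
    and ptz: "\<And>F z y. \<lbrakk>F \<in> edges N; 0 < z; z < len F; \<gamma> F z \<noteq> \<gamma> E s; y \<longlonglongrightarrow> z; \<forall>n. 0 \<le> y n \<and> y n \<le> len F\<rbrakk> \<Longrightarrow>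
       (\<lambda>n. fn n (\<gamma> F (y n))) \<longlonglongrightarrow> f (\<gamma> F z)"
  shows "(\<lambda>n. nonloc N \<nu> E \<Gamma> (fn n) (\<gamma> E (sn n))) \<longlonglongrightarrow> nonloc N \<nu> E \<Gamma> f (\<gamma> E s)"
proof -
  note eqn = nonloc_eq[OF E conjunct1[OF sn] conjunct2[OF sn] fn]
  have br: "(\<lambda>n. LINT t|lebesgue. br_fun E (sn n) F \<epsilon> (fn n) t) \<longlonglongrightarrow> (LINT t|lebesgue. br_fun E s F \<epsilon> f t)"
    if F: "F \<in> edges N" and \<epsilon>: "\<epsilon> \<in> {1, -1}" for F \<epsilon>
  proof (rule integral_dominated_convergence[OF _ _ integrable_bound_fun[OF E F s, of "L * \<Lambda>"]])
    show "br_fun E s F \<epsilon> f \<in> borel_measurable lebesgue"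
      using br_fun_integrable[OF E F s f \<epsilon>] by (rule borel_measurable_integrable)
    show "br_fun E (sn n) F \<epsilon> (fn n) \<in> borel_measurable lebesgue" for n
      using br_fun_integrable[OF E F _ _ fn \<epsilon>, of n] sn[of n] by (intro borel_measurable_integrable) auto
    show "AE t in lebesgue. norm (br_fun E (sn n) F \<epsilon> (fn n) t) \<le> L * \<Lambda> * (indicator {0<..diam} t * t powr (-\<sigma>))" for n
      using br_fun_bound[OF E F _ _ \<epsilon>, of "sn n" "fn n" L] sn[of n] fn[of n] unfolding Lipschitz_at_def
      by (intro AE_I2) auto
    have cl: "(\<lambda>n. br_off E (sn n) F \<epsilon>) \<longlonglongrightarrow> br_off E s F \<epsilon>" "(\<lambda>n. br_lo E (sn n) F \<epsilon>) \<longlonglongrightarrow> br_lo E s F \<epsilon>"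
      "(\<lambda>n. br_hi E (sn n) F \<epsilon>) \<longlonglongrightarrow> br_hi E s F \<epsilon>"
      using sn s by (auto intro: continuous_on_tendsto_compose[OF continuous_br(1)[OF E F] lim]
        continuous_on_tendsto_compose[OF continuous_br(2)[OF E F] lim] continuous_on_tendsto_compose[OF continuous_br(3)[OF E F] lim])
    \<comment> \<open>At the two ends of the limiting branch the indicators may fail to
      converge.\<close>
    have "AE t in lborel. t \<noteq> br_lo E s F \<epsilon> \<and> t \<noteq> br_hi E s F \<epsilon>"
      using AE_lborel_singleton[of "br_lo E s F \<epsilon>"] AE_lborel_singleton[of "br_hi E s F \<epsilon>"] by auto
    then have "AE t in lebesgue. t \<noteq> br_lo E s F \<epsilon> \<and> t \<noteq> br_hi E s F \<epsilon>" by (rule AE_completion)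
    then show "AE t in lebesgue. (\<lambda>n. br_fun E (sn n) F \<epsilon> (fn n) t) \<longlonglongrightarrow> br_fun E s F \<epsilon> f t"
    proof (rule AE_mp, intro AE_I2 impI)
      fix t assume ne: "t \<noteq> br_lo E s F \<epsilon> \<and> t \<noteq> br_hi E s F \<epsilon>"
      show "(\<lambda>n. br_fun E (sn n) F \<epsilon> (fn n) t) \<longlonglongrightarrow> br_fun E s F \<epsilon> f t"
      proof (cases "br_lo E s F \<epsilon> < t \<and> t < br_hi E s F \<epsilon>")
        case True
        have t: "0 < t" using True br_lo_nonneg[OF E F s, of \<epsilon>] by auto
        define z where "z = br_off E s F \<epsilon> + \<epsilon> * t"
        \<comment> \<open>Clamped so that \<open>ptz\<close> applies to the whole sequence;
          eventually the clamping changes nothing.\<close>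
        define y where "y = (\<lambda>n. max 0 (min (len F) (br_off E (sn n) F \<epsilon> + \<epsilon> * t)))"
        note p = br_point[OF E F s \<epsilon>, of t, folded z_def]
        have z: "0 < z" "z < len F" using p True by auto
        have zz: "max 0 (min (len F) z) = z" using z by auto
        have "y \<longlonglongrightarrow> max 0 (min (len F) z)" unfolding y_def z_def
          by (intro tendsto_intros cl)
        then have y: "y \<longlonglongrightarrow> z" unfolding zz .
        have ne: "\<gamma> F z \<noteq> \<gamma> E s" using p(3) True t \<gamma>_in_\<Gamma>[OF E s] by auto
        have 1: "(\<lambda>n. fn n (\<gamma> F (y n))) \<longlonglongrightarrow> f (\<gamma> F z)"
          by (rule ptz[OF F z ne y]) (auto simp: y_def)
        have 2: "(\<lambda>n. \<nu> E F (\<gamma> E (sn n)) t) \<longlonglongrightarrow> \<nu> E F (\<gamma> E s) t"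
        proof (rule LIM_zero_cancel, rule Lim_null_comparison)
          show "\<forall>\<^sub>F n in sequentially. norm (\<nu> E F (\<gamma> E (sn n)) t - \<nu> E F (\<gamma> E s) t) \<le> (\<Lambda> * t powr (-(1 + \<sigma>))) * \<bar>sn n - s\<bar>"
          proof (intro always_eventually allI)
            fix n
            show "norm (\<nu> E F (\<gamma> E (sn n)) t - \<nu> E F (\<gamma> E s) t) \<le> (\<Lambda> * t powr (-(1 + \<sigma>))) * \<bar>sn n - s\<bar>"
              using \<nu>_lipschitz[OF E F \<gamma>_in_closure[OF E, of "sn n"] \<gamma>_in_closure[OF E s] t] sn[of n] dist_\<gamma>[OF E, of "sn n" s]
              by (simp add: dist_norm mult_ac)
          qed
          have "(\<lambda>n. \<bar>sn n - s\<bar>) \<longlonglongrightarrow> 0" using lim by (simp add: LIM_zero_iff tendsto_rabs_zero_iff)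
          then show "(\<lambda>n. (\<Lambda> * t powr (-(1 + \<sigma>))) * \<bar>sn n - s\<bar>) \<longlonglongrightarrow> 0" by (rule tendsto_mult_right_zero)
        qed
        have "(\<lambda>n. (fn n (\<gamma> F (y n)) - fn n (\<gamma> E (sn n))) * \<nu> E F (\<gamma> E (sn n)) t) \<longlonglongrightarrow> (f (\<gamma> F z) - f (\<gamma> E s)) * \<nu> E F (\<gamma> E s) t"
          by (intro tendsto_intros 1 2 ptx)
        moreover have "\<forall>\<^sub>F n in sequentially. br_lo E (sn n) F \<epsilon> < t" "\<forall>\<^sub>F n in sequentially. t < br_hi E (sn n) F \<epsilon>"
          using order_tendstoD[OF cl(2)] order_tendstoD[OF cl(3)] True by auto
        then have "\<forall>\<^sub>F n in sequentially. (fn n (\<gamma> F (y n)) - fn n (\<gamma> E (sn n))) * \<nu> E F (\<gamma> E (sn n)) t = br_fun E (sn n) F \<epsilon> (fn n) t"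
        proof eventually_elim
          case (elim n)
          then have "y n = br_off E (sn n) F \<epsilon> + \<epsilon> * t"
            using br_point(1,2)[OF E F conjunct1[OF sn] conjunct2[OF sn] \<epsilon> elim] unfolding y_def by linarith
          then show ?case using elim by (simp add: br_fun_def)
        qed
        ultimately have "(\<lambda>n. br_fun E (sn n) F \<epsilon> (fn n) t) \<longlonglongrightarrow> (f (\<gamma> F z) - f (\<gamma> E s)) * \<nu> E F (\<gamma> E s) t"
          by (rule Lim_transform_eventually)
        then show ?thesis using True by (simp add: br_fun_def z_def)
      next
        case False
        then have "t < br_lo E s F \<epsilon> \<or> br_hi E s F \<epsilon> < t" using ne by auto
        then have "\<forall>\<^sub>F n in sequentially. t < br_lo E (sn n) F \<epsilon> \<or> br_hi E (sn n) F \<epsilon> < t"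
        proof
          assume "t < br_lo E s F \<epsilon>"
          from order_tendstoD(1)[OF cl(2) this] show ?thesis by eventually_elim simp
        next
          assume "br_hi E s F \<epsilon> < t"
          from order_tendstoD(2)[OF cl(3) this] show ?thesis by eventually_elim simp
        qed
        then have "\<forall>\<^sub>F n in sequentially. 0 = br_fun E (sn n) F \<epsilon> (fn n) t"
          by eventually_elim (auto simp: br_fun_def)
        then have "(\<lambda>n. br_fun E (sn n) F \<epsilon> (fn n) t) \<longlonglongrightarrow> 0"
          by (rule Lim_transform_eventually[OF tendsto_const])
        moreover have "br_fun E s F \<epsilon> f t = 0" using False by (auto simp: br_fun_def)
        ultimately show ?thesis by simp
      qed
    qed
  qed
  show ?thesis unfolding nonloc_eq[OF E s f] eqn by (intro tendsto_sum br)
qed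

end

section \<open>Continuous and Lipschitz functions on the network\<close>

lemma usc_lsc_on_iff: "usc_on S f \<and> lsc_on S f \<longleftrightarrow> continuous_on S f"
proof -
  have "usc_on S f \<and> lsc_on S f \<longleftrightarrow>
    (\<forall>t \<in> S. \<forall>e > 0. eventually (\<lambda>s. f s < f t + e \<and> f s > f t - e) (at t within S))"
    unfolding usc_on_def lsc_on_def eventually_conj_iff by blast
  also have "\<dots> \<longleftrightarrow> continuous_on S f"
    unfolding continuous_on_def tendsto_iff dist_real_def
    by (intro ball_cong refl all_cong arg_cong2[of _ _ _ _ eventually] ext) (auto simp: abs_less_iff algebra_simps)
  finally show ?thesis .
qed

context network
begin

lemma C0_iff: "u \<in> C0 N \<longleftrightarrow> (\<forall>E \<in> edges N. continuous_on {0..len E} (\<lambda>t. u (\<gamma> E t)))"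
  unfolding C0_def USC_def LSC_def by (auto simp: usc_lsc_on_iff[symmetric] comp_def)

lemma C0_D: "u \<in> C0 N \<Longrightarrow> E \<in> edges N \<Longrightarrow> continuous_on {0..len E} (\<lambda>t. u (\<gamma> E t))"
  by (simp add: C0_iff)

lemma compact_\<Gamma>: "compact \<Gamma>"
  unfolding Gam_def by (intro compact_UN) (auto simp: closure_edge)

lemma C0_continuous_on:
  assumes "u \<in> C0 N" shows "continuous_on \<Gamma> u"
  unfolding Gam_def
proof (rule continuous_on_closed_Union)
  fix E assume E: "E \<in> edges N"
  have "continuous_on (\<gamma> E ` {0..len E}) u"
    unfolding continuous_on_iff
  proof (intro ballI allI impI)
    fix x e assume "x \<in> \<gamma> E ` {0..len E}" and e: "0 < (e::real)"
    then obtain s where s: "s \<in> {0..len E}" "x = \<gamma> E s" by blast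
    then obtain d where d: "d > 0" "\<And>t. t \<in> {0..len E} \<Longrightarrow> dist t s < d \<Longrightarrow> dist (u (\<gamma> E t)) (u (\<gamma> E s)) < e"
      using C0_D[OF assms E] e unfolding continuous_on_iff by metis
    show "\<exists>d>0. \<forall>x'\<in>\<gamma> E ` {0..len E}. dist x' x < d \<longrightarrow> dist (u x') (u x) < e"
      using d s dist_\<gamma>[OF E] by (intro exI[of _ d]) (auto simp: dist_real_def)
  qed
  then show "continuous_on (closure E) u" by (simp add: \<gamma>_image[OF E])
qed auto

lemma C0_bounded: "u \<in> C0 N \<Longrightarrow> \<exists>M > 0. \<forall>x \<in> \<Gamma>. \<bar>u x\<bar> \<le> M"
  using compact_imp_bounded[OF compact_continuous_image[OF C0_continuous_on compact_\<Gamma>]]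
  unfolding bounded_pos by auto

lemma C0_attains_sup: "u \<in> C0 N \<Longrightarrow> \<Gamma> \<noteq> {} \<Longrightarrow> \<exists>x \<in> \<Gamma>. \<forall>y \<in> \<Gamma>. u y \<le> u x"
  using continuous_attains_sup[OF compact_\<Gamma> _ C0_continuous_on] by blast

lemma C0_tendsto:
  assumes "u \<in> C0 N" "F \<in> edges N" "y \<longlonglongrightarrow> z" "0 \<le> z" "z \<le> len F" "\<And>n. 0 \<le> y n \<and> y n \<le> len F"
  shows "(\<lambda>n. u (\<gamma> F (y n))) \<longlonglongrightarrow> u (\<gamma> F z)"
  using assms by (intro continuous_on_tendsto_compose[OF C0_D[OF assms(1,2)] assms(3)]) auto

lemma C0_add: "u \<in> C0 N \<Longrightarrow> v \<in> C0 N \<Longrightarrow> (\<lambda>x. u x + v x) \<in> C0 N"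
  and C0_diff: "u \<in> C0 N \<Longrightarrow> v \<in> C0 N \<Longrightarrow> (\<lambda>x. u x - v x) \<in> C0 N"
  and C0_max: "u \<in> C0 N \<Longrightarrow> v \<in> C0 N \<Longrightarrow> (\<lambda>x. max (u x) (v x)) \<in> C0 N"
  and C0_cmult: "u \<in> C0 N \<Longrightarrow> (\<lambda>x. c * u x) \<in> C0 N"
  and C0_const: "(\<lambda>x. c) \<in> C0 N"
  by (auto simp: C0_iff intro!: continuous_intros)

lemma C0_\<rho>: "x \<in> \<Gamma> \<Longrightarrow> (\<lambda>y. \<rho> x y) \<in> C0 N"
  using continuous_\<rho>_\<gamma> by (simp add: C0_iff \<rho>_commute[of x])

definition \<rho>_lipschitz :: "real \<Rightarrow> ('a \<Rightarrow> real) \<Rightarrow> bool" where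
  "\<rho>_lipschitz L f \<longleftrightarrow> 0 \<le> L \<and> (\<forall>x \<in> \<Gamma>. \<forall>y \<in> \<Gamma>. \<bar>f x - f y\<bar> \<le> L * \<rho> x y)"

lemma \<rho>_lipschitz_C0: 
  assumes "\<rho>_lipschitz L f" shows "f \<in> C0 N"
  unfolding C0_iff
proof
  fix E assume E: "E \<in> edges N"
  have "L-lipschitz_on {0..len E} (\<lambda>t. f (\<gamma> E t))"
  proof (rule lipschitz_onI)
    fix s t assume "s \<in> {0..len E}" "t \<in> {0..len E}"
    then show "dist (f (\<gamma> E s)) (f (\<gamma> E t)) \<le> L * dist s t"
      using assms \<rho>_edge[OF E, of s t] \<gamma>_in_\<Gamma>[OF E, of s] \<gamma>_in_\<Gamma>[OF E, of t]
      unfolding \<rho>_lipschitz_def dist_real_def by fastforce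
  qed (use assms in \<open>simp add: \<rho>_lipschitz_def\<close>)
  then show "continuous_on {0..len E} (\<lambda>t. f (\<gamma> E t))" by (rule lipschitz_on_continuous_on)
qed

text \<open>Distinct vertices are at least \<open>vsep\<close> apart, so boundedness gives a
  Lipschitz bound between vertices. \<open>\<rho>_through_end\<close> then extends it, first to a
  vertex and a point, then to two points.\<close>

lemma \<rho>_lipschitzI:
  assumes edge: "\<And>E s t. \<lbrakk>E \<in> edges N; 0 \<le> s; s \<le> len E; 0 \<le> t; t \<le> len E\<rbrakk> \<Longrightarrow> \<bar>f (\<gamma> E s) - f (\<gamma> E t)\<bar> \<le> L * \<bar>s - t\<bar>"
    and M: "\<And>x. x \<in> \<Gamma> \<Longrightarrow> \<bar>f x\<bar> \<le> M" "0 \<le> M" and L: "0 \<le> L"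
  shows "\<rho>_lipschitz (max L (2 * M / vsep)) f"
proof -
  define K where "K = max L (2 * M / vsep)"
  have K: "0 \<le> K" "L \<le> K" using L by (auto simp: K_def)
  have vv: "\<bar>f v - f w\<bar> \<le> K * \<rho> v w" if "v \<in> verts N" "w \<in> verts N" "v \<in> \<Gamma>" "w \<in> \<Gamma>" for v w
  proof (cases "v = w")
    case True then show ?thesis using that by simp
  next
    case False
    have "\<bar>f v - f w\<bar> \<le> 2 * M" using M(1)[OF that(3)] M(1)[OF that(4)] by linarith
    also have "2 * M = (2 * M / vsep) * vsep" using vsep_pos by simp
    also have "\<dots> \<le> K * \<rho> v w"
      using vsep_le_\<rho>[OF that False] vsep_pos M(2) K(1) by (intro mult_mono) (auto simp: K_def)
    finally show ?thesis .
  qed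
  have edgeK: "\<bar>f (\<gamma> E s) - f (\<gamma> E t)\<bar> \<le> K * \<bar>s - t\<bar>" if "E \<in> edges N" "0 \<le> s" "s \<le> len E" "0 \<le> t" "t \<le> len E" for E s t
    using edge[OF that] K(2) mult_right_mono[of L K "\<bar>s - t\<bar>"] by linarith
  have through: "\<bar>f x - f (\<gamma> F t)\<bar> \<le> K * \<rho> x (\<gamma> F t)"
    if F: "F \<in> edges N" "0 \<le> t" "t \<le> len F" and x: "x \<in> \<Gamma>" "x \<notin> F"
      and e: "\<bar>f x - f (src F)\<bar> \<le> K * \<rho> x (src F)" "\<bar>f x - f (tgt F)\<bar> \<le> K * \<rho> x (tgt F)" for x F t
  proof -
    have 1: "\<bar>f (src F) - f (\<gamma> F t)\<bar> \<le> K * t" using edgeK[OF F(1), of 0 t] F by simp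
    have 2: "\<bar>f (tgt F) - f (\<gamma> F t)\<bar> \<le> K * (len F - t)" using edgeK[OF F(1), of "len F" t] F by (simp add: \<gamma>_len)
    have "\<bar>f x - f (\<gamma> F t)\<bar> \<le> K * (\<rho> x (src F) + t)" using 1 e(1) by (simp add: algebra_simps)
    moreover have "\<bar>f x - f (\<gamma> F t)\<bar> \<le> K * (\<rho> x (tgt F) + len F - t)" using 2 e(2) by (simp add: algebra_simps)
    ultimately show ?thesis unfolding \<rho>_through_end[OF F(1) x F(2,3)] by (auto simp: min_def)
  qed
  have vx: "\<bar>f v - f x\<bar> \<le> K * \<rho> v x" if v: "v \<in> verts N" "v \<in> \<Gamma>" and x: "x \<in> \<Gamma>" for v x
  proof -
    obtain F t where F: "F \<in> edges N" "0 \<le> t" "t \<le> len F" "x = \<gamma> F t" using \<Gamma>_point[OF x] by blast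
    have "v \<notin> F" using v edge_no_verts[OF F(1)] by blast
    then show ?thesis unfolding F(4)
      using through[OF F(1-3) v(2)] vv v ends_in_verts[OF F(1)] ends_in_\<Gamma>[OF F(1)] by blast
  qed
  have "\<bar>f x - f y\<bar> \<le> K * \<rho> x y" if x: "x \<in> \<Gamma>" and y: "y \<in> \<Gamma>" for x y
  proof -
    obtain F t where F: "F \<in> edges N" "0 \<le> t" "t \<le> len F" "y = \<gamma> F t" using \<Gamma>_point[OF y] by blast
    show ?thesis
    proof (cases "x \<in> F")
      case True
      then obtain s where s: "0 < s" "s < len F" "x = \<gamma> F s" using edge_point[OF F(1)] by blast
      then show ?thesis using edgeK[OF F(1), of s t] \<rho>_edge[OF F(1), of s t] F by simp
    next
      case False
      have "\<bar>f x - f v\<bar> \<le> K * \<rho> x v" if "v \<in> verts N" "v \<in> \<Gamma>" for v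
        using vx[OF that x] by (simp add: \<rho>_commute[of x v] abs_minus_commute)
      then show ?thesis unfolding F(4)
        using through[OF F(1-3) x False] ends_in_verts[OF F(1)] ends_in_\<Gamma>[OF F(1)] by blast
    qed
  qed
  then show ?thesis using K unfolding \<rho>_lipschitz_def K_def by blast
qed

subsection \<open>Continuously differentiable functions\<close>

text \<open>The derivative within the closed interval is one-sided at the ends, so a single function
  covers \<open>edge_deriv\<close> on the open edge and \<open>vertex_deriv\<close> at the
  vertices.\<close>

definition slope :: "'a set \<Rightarrow> ('a \<Rightarrow> real) \<Rightarrow> real \<Rightarrow> real" where
  "slope E \<phi> t = vector_derivative (\<lambda>t. \<phi> (\<gamma> E t)) (at t within {0..len E})"

lemma slope_unique:
  assumes "E \<in> edges N" "t \<in> {0..len E}" "((\<lambda>t. \<phi> (\<gamma> E t)) has_real_derivative d) (at t within {0..len E})"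
  shows "slope E \<phi> t = d"
  unfolding slope_def using assms len_pos[of E]
  by (intro vector_derivative_within_closed_interval) (auto simp: has_real_derivative_iff_has_vector_derivative)

lemma C1_C0: "\<phi> \<in> C1 N \<Longrightarrow> \<phi> \<in> C0 N" by (simp add: C1_def)

lemma C1_slope:
  assumes \<phi>: "\<phi> \<in> C1 N" and E: "E \<in> edges N"
  shows "t \<in> {0..len E} \<Longrightarrow> ((\<lambda>t. \<phi> (\<gamma> E t)) has_real_derivative slope E \<phi> t) (at t within {0..len E})"
    and "continuous_on {0..len E} (slope E \<phi>)"
proof -
  obtain D where D: "continuous_on {0..len E} D"
    "\<And>t. t \<in> {0..len E} \<Longrightarrow> ((\<lambda>t. \<phi> (\<gamma> E t)) has_real_derivative D t) (at t within {0..len E})"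
    using \<phi> E unfolding C1_def comp_def by blast
  have eq: "slope E \<phi> t = D t" if "t \<in> {0..len E}" for t
    by (rule slope_unique[OF E that D(2)[OF that]])
  show "t \<in> {0..len E} \<Longrightarrow> ((\<lambda>t. \<phi> (\<gamma> E t)) has_real_derivative slope E \<phi> t) (at t within {0..len E})"
    using D(2) eq by simp
  show "continuous_on {0..len E} (slope E \<phi>)" by (rule continuous_on_eq[OF D(1)]) (simp add: eq)
qed

lemma C1_I:
  assumes "\<And>E. E \<in> edges N \<Longrightarrow> continuous_on {0..len E} (D E)"
    "\<And>E t. E \<in> edges N \<Longrightarrow> t \<in> {0..len E} \<Longrightarrow> ((\<lambda>t. \<phi> (\<gamma> E t)) has_real_derivative D E t) (at t within {0..len E})"
  shows "\<phi> \<in> C1 N"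
proof -
  have "continuous_on {0..len E} (\<lambda>t. \<phi> (\<gamma> E t))" if "E \<in> edges N" for E
    using assms(2)[OF that] by (intro DERIV_continuous_on) auto
  then show ?thesis using assms unfolding C1_def C0_iff comp_def by blast
qed

lemma C1_add: "\<phi> \<in> C1 N \<Longrightarrow> \<psi> \<in> C1 N \<Longrightarrow> (\<lambda>x. \<phi> x + \<psi> x) \<in> C1 N"
  by (rule C1_I[where D = "\<lambda>E t. slope E \<phi> t + slope E \<psi> t"]) (auto intro!: continuous_intros derivative_intros C1_slope)

lemma slope_add:
  assumes "\<phi> \<in> C1 N" "\<psi> \<in> C1 N" "E \<in> edges N" "t \<in> {0..len E}"
  shows "slope E (\<lambda>x. \<phi> x + \<psi> x) t = slope E \<phi> t + slope E \<psi> t"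
  using assms by (intro slope_unique) (auto intro!: derivative_intros C1_slope)

lemma C1_\<rho>_lipschitz: "\<phi> \<in> C1 N \<Longrightarrow> \<exists>L. \<rho>_lipschitz L \<phi>"
proof -
  assume \<phi>: "\<phi> \<in> C1 N"
  have "\<exists>L \<ge> 0. \<forall>t \<in> {0..len E}. \<bar>slope E \<phi> t\<bar> \<le> L" if E: "E \<in> edges N" for E
  proof -
    obtain b where "b > 0" "\<forall>x \<in> slope E \<phi> ` {0..len E}. norm x \<le> b"
      using compact_imp_bounded[OF compact_continuous_image[OF C1_slope(2)[OF \<phi> E] compact_Icc]]
      unfolding bounded_pos by blast
    then show ?thesis by (intro exI[of _ b]) auto
  qed
  then obtain L where L: "\<And>E. E \<in> edges N \<Longrightarrow> 0 \<le> L E"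
     "\<And>E t. E \<in> edges N \<Longrightarrow> t \<in> {0..len E} \<Longrightarrow> \<bar>slope E \<phi> t\<bar> \<le> L E" by metis
  define K where "K = (\<Sum>E \<in> edges N. L E)"
  have K: "L E \<le> K" if "E \<in> edges N" for E
    unfolding K_def using that L(1) by (intro member_le_sum) auto
  obtain M where M: "0 < M" "\<And>x. x \<in> \<Gamma> \<Longrightarrow> \<bar>\<phi> x\<bar> \<le> M" using C0_bounded[OF C1_C0[OF \<phi>]] by blast
  have "\<rho>_lipschitz (max K (2 * M / vsep)) \<phi>"
  proof (rule \<rho>_lipschitzI)
    fix E s t assume E: "E \<in> edges N" and st: "0 \<le> s" "s \<le> len E" "0 \<le> t" "t \<le> len E"
    have "norm (\<phi> (\<gamma> E s) - \<phi> (\<gamma> E t)) \<le> K * norm (s - t)"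
      by (rule field_differentiable_bound[of "{0..len E}" "\<lambda>t. \<phi> (\<gamma> E t)" "slope E \<phi>"])
         (use C1_slope(1)[OF \<phi> E] L(2)[OF E] K[OF E] st in \<open>auto intro: order.trans\<close>)
    then show "\<bar>\<phi> (\<gamma> E s) - \<phi> (\<gamma> E t)\<bar> \<le> K * \<bar>s - t\<bar>" by simp
  next
    show "0 \<le> K" unfolding K_def using L(1) by (rule sum_nonneg)
  qed (use M in auto)
  then show ?thesis by blast
qed

text \<open>Edgewise functions glue as soon as they agree at the vertices; any other point of
  \<Gamma> lies on exactly one open edge, which selects the piece.\<close>

lemma C1_exists:
  assumes ends: "\<And>E. E \<in> edges N \<Longrightarrow> g E 0 = val (src E)" "\<And>E. E \<in> edges N \<Longrightarrow> g E (len E) = val (tgt E)"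
    and cont: "\<And>E. E \<in> edges N \<Longrightarrow> continuous_on {0..len E} (g' E)"
    and der: "\<And>E t. E \<in> edges N \<Longrightarrow> t \<in> {0..len E} \<Longrightarrow> (g E has_real_derivative g' E t) (at t within {0..len E})"
  obtains \<phi> where "\<phi> \<in> C1 N" "\<And>E t. E \<in> edges N \<Longrightarrow> 0 \<le> t \<Longrightarrow> t \<le> len E \<Longrightarrow> \<phi> (\<gamma> E t) = g E t"
    "\<And>E t. E \<in> edges N \<Longrightarrow> 0 \<le> t \<Longrightarrow> t \<le> len E \<Longrightarrow> slope E \<phi> t = g' E t"
proof -
  define \<phi> where "\<phi> = (\<lambda>x. if x \<in> verts N then val x else
    (let E = (THE E. E \<in> edges N \<and> x \<in> E) in g E (edge_coord N E x)))"
  have val: "\<phi> (\<gamma> E t) = g E t" if E: "E \<in> edges N" and t: "0 \<le> t" "t \<le> len E" for E t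
  proof (cases "\<gamma> E t \<in> verts N")
    case True
    then consider "t = 0" | "t = len E" using \<gamma>_vertex_iff[OF E t] by blast
    then show ?thesis
    proof cases
      case 1
      then show ?thesis using True ends(1)[OF E] by (simp add: \<phi>_def)
    next
      case 2
      then show ?thesis using True ends(2)[OF E] \<gamma>_len[OF E] by (simp add: \<phi>_def)
    qed
  next
    case False
    then have m: "\<gamma> E t \<in> E" using \<gamma>_vertex_iff[OF E t] \<gamma>_interior_iff[OF E t] t by force
    then have "(THE F. F \<in> edges N \<and> \<gamma> E t \<in> F) = E"
      using E \<gamma>_in_edge_eq[OF _ E t] by (intro the_equality) auto
    then show ?thesis using False edge_coord_\<gamma>[OF E t] by (simp add: \<phi>_def Let_def)
  qed
  have d: "((\<lambda>t. \<phi> (\<gamma> E t)) has_real_derivative g' E t) (at t within {0..len E})"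
    if E: "E \<in> edges N" and t: "t \<in> {0..len E}" for E t
    by (rule has_field_derivative_transform_within[OF der[OF E t] zero_less_one t]) (use val[OF E] in auto)
  have "\<phi> \<in> C1 N" by (rule C1_I[OF cont d])
  then show thesis using that[OF _ val] slope_unique[OF _ _ d] by auto
qed

lemma edge_deriv_eq:
  assumes \<phi>: "\<phi> \<in> C1 N" and E: "E \<in> edges N" and t: "0 < t" "t < len E"
  shows "edge_deriv N E \<phi> (\<gamma> E t) = slope E \<phi> t"
proof -
  have "((\<lambda>t. \<phi> (\<gamma> E t)) has_real_derivative slope E \<phi> t) (at t within {0..len E})"
    using C1_slope(1)[OF \<phi> E] t by auto
  then have "((\<lambda>t. \<phi> (\<gamma> E t)) has_real_derivative slope E \<phi> t) (at t)"
    using t at_within_Icc_at[of 0 t "len E"] by simp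
  then show ?thesis unfolding edge_deriv_def edge_coord_\<gamma>[OF E less_imp_le[OF t(1)] less_imp_le[OF t(2)]]
    by (simp add: DERIV_imp_deriv comp_def)
qed

text \<open>Both derivatives at a vertex are limits within the open edge. Distances on an edge are
  differences of coordinates, which turns these limits into one-sided limits on the line.\<close>

lemma end_limit:
  fixes f :: "real \<Rightarrow> real" and g :: "'a \<Rightarrow> real"
  assumes E: "E \<in> Inc N v" and lim: "(f \<longlongrightarrow> l) (at (end_coord E v) within {0..len E})"
    and eq: "\<And>t. 0 < t \<Longrightarrow> t < len E \<Longrightarrow> g (\<gamma> E t) = f t"
  shows "Lim (at v within E) g = l"
proof (rule tendsto_Lim)
  note E' = Inc_edges[OF E]
  have "v \<in> closure E" using E' E \<gamma>_in_closure[OF E', of "end_coord E v"] end_coord_bounds[of E v] \<gamma>_end_coord[OF E] by simp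
  moreover have "v \<notin> E" using edge_no_verts[OF E'] Inc_vertex(1)[OF E] by blast
  ultimately have "v islimpt E" by (simp add: closure_def)
  then show "at v within E \<noteq> bot" by (simp add: trivial_limit_within)
  show "(g \<longlongrightarrow> l) (at v within E)"
    unfolding Lim_within
  proof (intro allI impI)
    fix e :: real assume "0 < e"
    then obtain d where d: "0 < d" "\<And>t. t \<in> {0..len E} \<Longrightarrow> 0 < dist t (end_coord E v) \<Longrightarrow> dist t (end_coord E v) < d \<Longrightarrow> dist (f t) l < e"
      using lim unfolding Lim_within by blast
    show "\<exists>d>0. \<forall>x\<in>E. 0 < dist x v \<and> dist x v < d \<longrightarrow> dist (g x) l < e"
    proof (intro exI[of _ d] conjI ballI impI d(1))
      fix x assume "x \<in> E" and x: "0 < dist x v \<and> dist x v < d"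
      then obtain t where t: "0 < t" "t < len E" "x = \<gamma> E t" using edge_point[OF E'] by blast
      have "dist x v = \<bar>t - end_coord E v\<bar>" using dist_\<gamma>[OF E', of t "end_coord E v"] t \<gamma>_end_coord[OF E] by simp
      then show "dist (g x) l < e" using d(2)[of t] t x eq by (simp add: dist_real_def)
    qed
  qed
qed

lemma vertex_deriv_eq:
  assumes \<phi>: "\<phi> \<in> C1 N" and E: "E \<in> Inc N v"
  shows "vertex_deriv N E \<phi> v = slope E \<phi> (end_coord E v)"
  unfolding vertex_deriv_def
proof (rule end_limit[OF E, where f = "slope E \<phi>"])
  show "(slope E \<phi> \<longlongrightarrow> slope E \<phi> (end_coord E v)) (at (end_coord E v) within {0..len E})"
    using C1_slope(2)[OF \<phi> Inc_edges[OF E]] end_coord_bounds[of E v] by (simp add: continuous_on_def)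
qed (rule edge_deriv_eq[OF \<phi> Inc_edges[OF E]])

lemma inward_deriv_eq:
  assumes \<phi>: "\<phi> \<in> C1 N" and E: "E \<in> Inc N v"
  shows "inward_deriv N E \<phi> v = end_sign E v * slope E \<phi> (end_coord E v)"
  unfolding inward_deriv_def
proof (rule end_limit[OF E, where f = "\<lambda>t. end_sign E v * ((\<phi> (\<gamma> E t) - \<phi> (\<gamma> E (end_coord E v))) / (t - end_coord E v))"])
  note E' = Inc_edges[OF E]
  have "((\<lambda>t. \<phi> (\<gamma> E t)) has_real_derivative slope E \<phi> (end_coord E v)) (at (end_coord E v) within {0..len E})"
    using C1_slope(1)[OF \<phi> E'] end_coord_bounds[of E v] by simp
  then show "((\<lambda>t. end_sign E v * ((\<phi> (\<gamma> E t) - \<phi> (\<gamma> E (end_coord E v))) / (t - end_coord E v))) \<longlongrightarrow>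
     end_sign E v * slope E \<phi> (end_coord E v)) (at (end_coord E v) within {0..len E})"
    by (intro tendsto_mult tendsto_const) (simp add: has_field_derivative_iff)
  fix t assume t: "0 < t" "t < len E"
  have "\<rho> (\<gamma> E t) v = \<bar>t - end_coord E v\<bar>"
    using \<rho>_edge[OF E', of t "end_coord E v"] t end_coord_bounds[of E v] \<gamma>_end_coord[OF E] by simp
  also have "\<dots> = end_sign E v * (t - end_coord E v)" using t by (auto simp: end_sign_def end_coord_def)
  finally have r: "\<rho> (\<gamma> E t) v = end_sign E v * (t - end_coord E v)" .
  have "(a - b) / (- (t - end_coord E v)) = - ((a - b) / (t - end_coord E v))" for a b by (rule divide_minus_right)
  with r show "(\<phi> (\<gamma> E t) - \<phi> v) / \<rho> (\<gamma> E t) v =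
     end_sign E v * ((\<phi> (\<gamma> E t) - \<phi> (\<gamma> E (end_coord E v))) / (t - end_coord E v))"
    using \<gamma>_end_coord[OF E] by (simp add: end_sign_def split: if_splits del: minus_diff_eq)
qed

end

lemma ball_gt_0_cong:
  assumes "\<And>x \<phi> d. x \<in> S \<Longrightarrow> \<phi> \<in> K \<Longrightarrow> A x d \<phi> \<longleftrightarrow> A' x d \<phi>" "\<And>\<phi> x d. T' x d \<phi> \<longleftrightarrow> 0 < d \<and> T x d \<phi>"
  shows "(\<forall>x \<in> S. \<forall>d > 0::real. \<forall>\<phi> \<in> K. T x d \<phi> \<longrightarrow> A x d \<phi>) \<longleftrightarrow> (\<forall>x \<in> S. \<forall>d. \<forall>\<phi> \<in> K. T' x d \<phi> \<longrightarrow> A' x d \<phi>)"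
  using assms by blast

section \<open>Nonlocal operators with a test function inside the ball\<close>

context network_kernels
begin

lemma C0_measurable: "u \<in> C0 N \<Longrightarrow> edgewise_measurable u"
  unfolding edgewise_measurable_def
  by (auto intro!: continuous_imp_measurable_on_sets_lebesgue continuous_on_subset[OF C0_D])

lemma \<rho>_lipschitz_at: "\<rho>_lipschitz L u \<Longrightarrow> x \<in> \<Gamma> \<Longrightarrow> Lipschitz_at L x u"
  using C0_measurable[OF \<rho>_lipschitz_C0] unfolding Lipschitz_at_def \<rho>_lipschitz_def
  by (auto simp: abs_minus_commute)

lemma ball_section: 
  assumes "x \<in> \<Gamma>" "F \<in> edges N" shows "{z \<in> {0<..<len F}. \<gamma> F z \<in> geo_ball N x \<delta>} \<in> sets lebesgue"
proof -
  have c: "continuous_on {0<..<len F} (\<lambda>z. \<rho> x (\<gamma> F z))"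
    by (rule continuous_on_subset[OF C0_D[OF C0_\<rho>[OF assms(1)] assms(2)]]) auto
  have "open ({0<..<len F} \<inter> (\<lambda>z. \<rho> x (\<gamma> F z)) -` {..<\<delta>})"
    by (rule continuous_open_preimage[OF c]) auto
  also have "{0<..<len F} \<inter> (\<lambda>z. \<rho> x (\<gamma> F z)) -` {..<\<delta>} = {z \<in> {0<..<len F}. \<gamma> F z \<in> geo_ball N x \<delta>}"
    using \<gamma>_in_\<Gamma>[OF assms(2)] by (auto simp: geo_ball_def)
  finally show ?thesis by simp
qed

text \<open>The operator in \<open>Gop\<close> is the full nonlocal operator applied to \<open>u\<close> modified inside the ball.\<close>

definition patch :: "real \<Rightarrow> ('a \<Rightarrow> real) \<Rightarrow> ('a \<Rightarrow> real) \<Rightarrow> 'a \<Rightarrow> 'a \<Rightarrow> real" where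
  "patch \<delta> u \<phi> x z = (if z \<in> geo_ball N x \<delta> then \<phi> z - \<phi> x + u x else u z)"

lemma patch_self [simp]: "patch \<delta> u \<phi> x x = u x" by (simp add: patch_def)

lemma patch_measurable:
  assumes "u \<in> C0 N" "\<phi> \<in> C0 N" "x \<in> \<Gamma>" shows "edgewise_measurable (patch \<delta> u \<phi> x)"
  unfolding edgewise_measurable_def
proof
  fix F assume F: "F \<in> edges N"
  define S where "S = {z \<in> {0<..<len F}. \<gamma> F z \<in> geo_ball N x \<delta>}"
  have S: "S \<in> sets (lebesgue_on {0<..<len F})"
    using ball_section[OF assms(3) F, of \<delta>] unfolding S_def by (auto simp: sets_restrict_space_iff)
  have "(\<lambda>z. if z \<in> S then \<phi> (\<gamma> F z) - \<phi> x + u x else u (\<gamma> F z)) \<in> borel_measurable (lebesgue_on {0<..<len F})"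
    using C0_measurable[OF assms(1)] C0_measurable[OF assms(2)] F S unfolding edgewise_measurable_def
    by (intro measurable_If_set) auto
  then show "(\<lambda>z. patch \<delta> u \<phi> x (\<gamma> F z)) \<in> borel_measurable (lebesgue_on {0<..<len F})"
    by (rule measurable_cong[THEN iffD1, rotated]) (auto simp: S_def patch_def)
qed

text \<open>Outside the ball the distance is at least \<open>\<delta>\<close>, so a jump of size
  \<open>2 * M\<close> is at most \<open>2 * M / \<delta>\<close> times the distance. The singular
  integral thus converges for \<open>u\<close> merely continuous.\<close>

lemma patch_Lipschitz_at:
  assumes u: "u \<in> C0 N" and \<phi>: "\<rho>_lipschitz L \<phi>" and x: "x \<in> \<Gamma>" and \<delta>: "\<delta> > 0"
  shows "\<exists>K. Lipschitz_at K x (patch \<delta> u \<phi> x)"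
proof -
  obtain M where M: "M > 0" "\<And>y. y \<in> \<Gamma> \<Longrightarrow> \<bar>u y\<bar> \<le> M" using C0_bounded[OF u] by blast
  have "\<bar>patch \<delta> u \<phi> x z - u x\<bar> \<le> max L (2 * M / \<delta>) * \<rho> x z" if z: "z \<in> \<Gamma>" for z
  proof (cases "z \<in> geo_ball N x \<delta>")
    case True
    then have "\<bar>patch \<delta> u \<phi> x z - u x\<bar> \<le> L * \<rho> x z"
      using \<phi> x z by (auto simp: patch_def \<rho>_lipschitz_def abs_minus_commute)
    also have "\<dots> \<le> max L (2 * M / \<delta>) * \<rho> x z" by (intro mult_right_mono) auto
    finally show ?thesis .
  next
    case False
    then have \<rho>: "\<delta> \<le> \<rho> x z" using z by (simp add: geo_ball_def)
    have "\<bar>patch \<delta> u \<phi> x z - u x\<bar> \<le> 2 * M"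
      using M(2)[OF x] M(2)[OF z] False by (simp add: patch_def)
    also have "\<dots> = (2 * M / \<delta>) * \<delta>" using \<delta> by simp
    also have "\<dots> \<le> max L (2 * M / \<delta>) * \<rho> x z"
      using \<rho> \<delta> \<phi> unfolding \<rho>_lipschitz_def by (intro mult_mono) auto
    finally show ?thesis .
  qed
  then show ?thesis
    using patch_measurable[OF u \<rho>_lipschitz_C0[OF \<phi>] x, of \<delta>] unfolding Lipschitz_at_def by auto
qed

lemma nonloc_patch:
  assumes E: "E \<in> edges N" "0 \<le> s" "s \<le> len E" and f: "Lipschitz_at K (\<gamma> E s) (patch \<delta> u \<phi> (\<gamma> E s))"
  shows "nonloc N \<nu> E (\<Gamma> - geo_ball N (\<gamma> E s) \<delta>) u (\<gamma> E s) + nonloc N \<nu> E (geo_ball N (\<gamma> E s) \<delta>) \<phi> (\<gamma> E s)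
    = nonloc N \<nu> E \<Gamma> (patch \<delta> u \<phi> (\<gamma> E s)) (\<gamma> E s)"
  by (rule nonloc_split[OF E ball_section[OF \<gamma>_in_\<Gamma>[OF E]] f]) (auto simp: patch_def)

end

subsection \<open>Viscosity conditions for Lipschitz functions\<close>

locale hj_network = network_kernels N \<nu> \<Lambda> \<sigma> for N :: "'a::euclidean_space network" and \<nu> \<Lambda> \<sigma> +
  fixes lam :: real and H :: "'a set \<Rightarrow> 'a \<Rightarrow> real \<Rightarrow> real" and C :: real and B h :: "'a \<Rightarrow> real"
  assumes lam_pos: "0 < lam" and C_gt_1: "1 < C"
    and H_lower: "\<lbrakk>E \<in> edges N; x \<in> closure E\<rbrakk> \<Longrightarrow> \<bar>p\<bar> / C - C \<le> H E x p"
    and H_upper: "\<lbrakk>E \<in> edges N; x \<in> closure E\<rbrakk> \<Longrightarrow> H E x p \<le> C * (1 + \<bar>p\<bar>)"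
    and H_lipschitz: "\<lbrakk>E \<in> edges N; x \<in> closure E; y \<in> closure E\<rbrakk> \<Longrightarrow>
      \<bar>H E x p - H E y q\<bar> \<le> C * ((1 + min \<bar>p\<bar> \<bar>q\<bar>) * norm (x - y) + \<bar>p - q\<bar>)"
begin

lemma H_tendsto:
  assumes E: "E \<in> edges N" and sn: "\<And>n. 0 \<le> sn n \<and> sn n \<le> len E" and s: "0 \<le> s" "s \<le> len E"
    and lim: "sn \<longlonglongrightarrow> s" "pn \<longlonglongrightarrow> p"
  shows "(\<lambda>n. H E (\<gamma> E (sn n)) (pn n)) \<longlonglongrightarrow> H E (\<gamma> E s) p"
proof (rule LIM_zero_cancel, rule Lim_null_comparison)
  show "\<forall>\<^sub>F n in sequentially. norm (H E (\<gamma> E (sn n)) (pn n) - H E (\<gamma> E s) p) \<le> C * ((1 + \<bar>p\<bar>) * \<bar>sn n - s\<bar> + \<bar>pn n - p\<bar>)"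
  proof (intro always_eventually allI)
    fix n
    have "\<bar>H E (\<gamma> E (sn n)) (pn n) - H E (\<gamma> E s) p\<bar> \<le> C * ((1 + min \<bar>pn n\<bar> \<bar>p\<bar>) * \<bar>sn n - s\<bar> + \<bar>pn n - p\<bar>)"
      using H_lipschitz[OF E \<gamma>_in_closure[OF E, of "sn n"] \<gamma>_in_closure[OF E s]] sn[of n] dist_\<gamma>[OF E, of "sn n" s]
      by (simp add: dist_norm)
    also have "\<dots> \<le> C * ((1 + \<bar>p\<bar>) * \<bar>sn n - s\<bar> + \<bar>pn n - p\<bar>)"
      using C_gt_1 by (intro mult_left_mono add_mono mult_right_mono) auto
    finally show "norm (H E (\<gamma> E (sn n)) (pn n) - H E (\<gamma> E s) p) \<le> C * ((1 + \<bar>p\<bar>) * \<bar>sn n - s\<bar> + \<bar>pn n - p\<bar>)" by simp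
  qed
  have "(\<lambda>n. \<bar>sn n - s\<bar>) \<longlonglongrightarrow> 0" "(\<lambda>n. \<bar>pn n - p\<bar>) \<longlonglongrightarrow> 0"
    using lim by (simp_all add: LIM_zero_iff tendsto_rabs_zero_iff)
  then have "(\<lambda>n. C * ((1 + \<bar>p\<bar>) * \<bar>sn n - s\<bar> + \<bar>pn n - p\<bar>)) \<longlonglongrightarrow> C * ((1 + \<bar>p\<bar>) * 0 + 0)"
    by (intro tendsto_intros)
  then show "(\<lambda>n. C * ((1 + \<bar>p\<bar>) * \<bar>sn n - s\<bar> + \<bar>pn n - p\<bar>)) \<longlonglongrightarrow> 0" by simp
qed

lemma H_lipschitz_p: "E \<in> edges N \<Longrightarrow> x \<in> closure E \<Longrightarrow> \<bar>H E x p - H E x q\<bar> \<le> C * \<bar>p - q\<bar>"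
  using H_lipschitz[of E x x p q] by simp

text \<open>\<open>c = 1\<close> gives the subsolution conditions, \<open>c = -1\<close> the supersolution conditions.\<close>

definition visc_cond :: "real \<Rightarrow> ('a set \<Rightarrow> real \<Rightarrow> real) \<Rightarrow> ('a \<Rightarrow> real) \<Rightarrow> 'a \<Rightarrow> ('a \<Rightarrow> real) \<Rightarrow> bool" where
  "visc_cond c G u x \<phi> \<longleftrightarrow>
    (\<forall>E \<in> edges N. \<forall>t. 0 < t \<and> t < len E \<and> x = \<gamma> E t \<longrightarrow> c * G E (slope E \<phi> t) \<le> 0) \<and>
    (x \<in> inner_verts N \<longrightarrow> (\<exists>E \<in> Inc N x. c * G E (slope E \<phi> (end_coord E x)) \<le> 0) \<or>
       c * ((\<Sum>E \<in> Inc N x. - (end_sign E x * slope E \<phi> (end_coord E x))) - B x) \<le> 0) \<and>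
    (x \<in> bdry_verts N \<longrightarrow> (\<exists>E \<in> Inc N x. c * G E (slope E \<phi> (end_coord E x)) \<le> 0) \<or> c * (u x - h x) \<le> 0)"

definition touches :: "real \<Rightarrow> ('a \<Rightarrow> real) \<Rightarrow> ('a \<Rightarrow> real) \<Rightarrow> 'a \<Rightarrow> real \<Rightarrow> bool" where
  "touches c u \<phi> x \<delta> \<longleftrightarrow> 0 < \<delta> \<and> (\<forall>y \<in> geo_ball N x \<delta>. c * (u y - \<phi> y) \<le> c * (u x - \<phi> x))"

definition visc_gen :: "real \<Rightarrow> ('a \<Rightarrow> real) \<Rightarrow> bool" where
  "visc_gen c u \<longleftrightarrow> (\<forall>x \<in> \<Gamma>. \<forall>\<delta>. \<forall>\<phi> \<in> C1 N. touches c u \<phi> x \<delta> \<longrightarrow>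
     visc_cond c (\<lambda>E p. Gop N lam H \<nu> E \<delta> u \<phi> p x) u x \<phi>)"

text \<open>The operator with \<open>u\<close> itself in the singular integral, meaningful for
  Lipschitz \<open>u\<close>: the limit of \<open>Gop\<close> for vanishing radius, in which the
  test function only survives through its slope \<open>p\<close>.\<close>

definition LG :: "('a \<Rightarrow> real) \<Rightarrow> 'a \<Rightarrow> 'a set \<Rightarrow> real \<Rightarrow> real" where
  "LG u x E p = lam * u x - nonloc N \<nu> E \<Gamma> u x + H E x p"

definition visc_lip :: "real \<Rightarrow> ('a \<Rightarrow> real) \<Rightarrow> bool" where
  "visc_lip c u \<longleftrightarrow> (\<forall>x \<in> \<Gamma>. \<forall>\<delta>. \<forall>\<phi> \<in> C1 N. touches c u \<phi> x \<delta> \<longrightarrow> visc_cond c (LG u x) u x \<phi>)"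

lemma edge_cond_iff:
  assumes "\<phi> \<in> C1 N"
  shows "(\<forall>E \<in> edges N. x \<in> E \<longrightarrow> P E (edge_deriv N E \<phi> x)) \<longleftrightarrow>
    (\<forall>E \<in> edges N. \<forall>t. 0 < t \<and> t < len E \<and> x = \<gamma> E t \<longrightarrow> P E (slope E \<phi> t))"
proof (intro ball_cong refl iffI allI impI)
  fix E t assume E: "E \<in> edges N" and P: "x \<in> E \<longrightarrow> P E (edge_deriv N E \<phi> x)" and t: "0 < t \<and> t < len E \<and> x = \<gamma> E t"
  then show "P E (slope E \<phi> t)" using edge_deriv_eq[OF assms E, of t] \<gamma>_interior[OF E, of t] by auto
next
  fix E assume E: "E \<in> edges N" and P: "\<forall>t. 0 < t \<and> t < len E \<and> x = \<gamma> E t \<longrightarrow> P E (slope E \<phi> t)" and x: "x \<in> E"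
  obtain t where "0 < t" "t < len E" "x = \<gamma> E t" using edge_point[OF E x] by blast
  then show "P E (edge_deriv N E \<phi> x)" using edge_deriv_eq[OF assms E, of t] P by auto
qed

lemma Min_Inc_le_iff:
  assumes \<phi>: "\<phi> \<in> C1 N" and x: "x \<in> \<Gamma>" "x \<in> verts N"
  shows "min (Min ((\<lambda>E. G E (vertex_deriv N E \<phi> x)) ` Inc N x)) r \<le> (0::real) \<longleftrightarrow>
      (\<exists>E \<in> Inc N x. G E (slope E \<phi> (end_coord E x)) \<le> 0) \<or> r \<le> 0"
    and "max (Max ((\<lambda>E. G E (vertex_deriv N E \<phi> x)) ` Inc N x)) r \<ge> 0 \<longleftrightarrow>
      (\<exists>E \<in> Inc N x. G E (slope E \<phi> (end_coord E x)) \<ge> 0) \<or> r \<ge> 0"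
proof -
  have e: "(\<lambda>E. G E (vertex_deriv N E \<phi> x)) ` Inc N x = (\<lambda>E. G E (slope E \<phi> (end_coord E x))) ` Inc N x"
    using vertex_deriv_eq[OF \<phi>] by (intro image_cong) auto
  have ne: "(\<lambda>E. G E (slope E \<phi> (end_coord E x))) ` Inc N x \<noteq> {}" using vertex_Inc[OF x(2,1)] by simp
  show "min (Min ((\<lambda>E. G E (vertex_deriv N E \<phi> x)) ` Inc N x)) r \<le> (0::real) \<longleftrightarrow>
      (\<exists>E \<in> Inc N x. G E (slope E \<phi> (end_coord E x)) \<le> 0) \<or> r \<le> 0"
    unfolding e min_le_iff_disj using ne by (subst Min_le_iff) auto
  show "max (Max ((\<lambda>E. G E (vertex_deriv N E \<phi> x)) ` Inc N x)) r \<ge> 0 \<longleftrightarrow>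
      (\<exists>E \<in> Inc N x. G E (slope E \<phi> (end_coord E x)) \<ge> 0) \<or> r \<ge> 0"
    unfolding e le_max_iff_disj using ne by (subst Max_ge_iff) auto
qed

lemma inward_sum_eq: "\<phi> \<in> C1 N \<Longrightarrow> (\<Sum>E \<in> Inc N x. - inward_deriv N E \<phi> x) =
    (\<Sum>E \<in> Inc N x. - (end_sign E x * slope E \<phi> (end_coord E x)))"
  by (intro sum.cong) (auto simp: inward_deriv_eq)

lemma visc_subsolution_iff: "visc_subsolution N lam H \<nu> B h u \<longleftrightarrow> u \<in> USC N \<and> visc_gen 1 u"
proof -
  have "(\<forall>E \<in> edges N. x \<in> E \<longrightarrow> Gop N lam H \<nu> E \<delta> u \<phi> (edge_deriv N E \<phi> x) x \<le> 0) \<and>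
        (x \<in> inner_verts N \<longrightarrow>
           min (Min ((\<lambda>E. Gop N lam H \<nu> E \<delta> u \<phi> (vertex_deriv N E \<phi> x) x) ` Inc N x))
               ((\<Sum>E \<in> Inc N x. - inward_deriv N E \<phi> x) - B x) \<le> 0) \<and>
        (x \<in> bdry_verts N \<longrightarrow>
           min (Min ((\<lambda>E. Gop N lam H \<nu> E \<delta> u \<phi> (vertex_deriv N E \<phi> x) x) ` Inc N x))
               (u x - h x) \<le> 0) \<longleftrightarrow> visc_cond 1 (\<lambda>E p. Gop N lam H \<nu> E \<delta> u \<phi> p x) u x \<phi>"
    if "x \<in> \<Gamma>" "\<phi> \<in> C1 N" for x \<delta> \<phi>
    using edge_cond_iff[OF that(2), of x "\<lambda>E p. Gop N lam H \<nu> E \<delta> u \<phi> p x \<le> 0"]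
      Min_Inc_le_iff(1)[OF that(2,1), of "\<lambda>E p. Gop N lam H \<nu> E \<delta> u \<phi> p x"]
    unfolding visc_cond_def inward_sum_eq[OF that(2)] by (auto simp: verts_def)
  moreover have "touches 1 u \<phi> x \<delta> \<longleftrightarrow> \<delta> > 0 \<and> (\<forall>y \<in> geo_ball N x \<delta>. u y - \<phi> y \<le> u x - \<phi> x)" for \<phi> x \<delta>
    unfolding touches_def by auto
  ultimately show ?thesis unfolding visc_subsolution_def visc_gen_def
    by (intro arg_cong2[where f = conj] refl ball_gt_0_cong)
qed

lemma visc_supersolution_iff: "visc_supersolution N lam H \<nu> B h u \<longleftrightarrow> u \<in> LSC N \<and> visc_gen (-1) u"
proof -
  have "(\<forall>E \<in> edges N. x \<in> E \<longrightarrow> Gop N lam H \<nu> E \<delta> u \<phi> (edge_deriv N E \<phi> x) x \<ge> 0) \<and>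
        (x \<in> inner_verts N \<longrightarrow>
           max (Max ((\<lambda>E. Gop N lam H \<nu> E \<delta> u \<phi> (vertex_deriv N E \<phi> x) x) ` Inc N x))
               ((\<Sum>E \<in> Inc N x. - inward_deriv N E \<phi> x) - B x) \<ge> 0) \<and>
        (x \<in> bdry_verts N \<longrightarrow>
           max (Max ((\<lambda>E. Gop N lam H \<nu> E \<delta> u \<phi> (vertex_deriv N E \<phi> x) x) ` Inc N x))
               (u x - h x) \<ge> 0) \<longleftrightarrow> visc_cond (-1) (\<lambda>E p. Gop N lam H \<nu> E \<delta> u \<phi> p x) u x \<phi>"
    (is "?A x \<delta> \<phi> \<longleftrightarrow> ?B x \<delta> \<phi>") if "x \<in> \<Gamma>" "\<phi> \<in> C1 N" for x \<delta> \<phi>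
    using edge_cond_iff[OF that(2), of x "\<lambda>E p. Gop N lam H \<nu> E \<delta> u \<phi> p x \<ge> 0"]
      Min_Inc_le_iff(2)[OF that(2,1), of "\<lambda>E p. Gop N lam H \<nu> E \<delta> u \<phi> p x"]
    unfolding visc_cond_def inward_sum_eq[OF that(2)] by (auto simp: verts_def)
  moreover have "touches (-1) u \<phi> x \<delta> \<longleftrightarrow> \<delta> > 0 \<and> (\<forall>y \<in> geo_ball N x \<delta>. u y - \<phi> y \<ge> u x - \<phi> x)" for \<phi> x \<delta>
    unfolding touches_def by auto
  ultimately show ?thesis unfolding visc_supersolution_def visc_gen_def
    by (intro arg_cong2[where f = conj] refl ball_gt_0_cong)
qed

lemma visc_solution_iff: "visc_solution N lam H \<nu> B h u \<longleftrightarrow> u \<in> C0 N \<and> visc_gen 1 u \<and> visc_gen (-1) u"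
  unfolding visc_solution_def visc_subsolution_iff visc_supersolution_iff by (auto simp: C0_def)

lemma Gop_patch:
  assumes E: "E \<in> edges N" "0 \<le> s" "s \<le> len E" and u: "u \<in> C0 N" and \<phi>: "\<phi> \<in> C1 N" and \<delta>: "0 < \<delta>"
  shows "Gop N lam H \<nu> E \<delta> u \<phi> p (\<gamma> E s) =
    lam * u (\<gamma> E s) - nonloc N \<nu> E \<Gamma> (patch \<delta> u \<phi> (\<gamma> E s)) (\<gamma> E s) + H E (\<gamma> E s) p"
proof -
  obtain L where "\<rho>_lipschitz L \<phi>" using C1_\<rho>_lipschitz[OF \<phi>] by blast
  then obtain K where "Lipschitz_at K (\<gamma> E s) (patch \<delta> u \<phi> (\<gamma> E s))"
    using patch_Lipschitz_at[OF u _ \<gamma>_in_\<Gamma>[OF E] \<delta>] by blast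
  from nonloc_patch[OF E this] show ?thesis unfolding Gop_def by simp
qed

lemma visc_cond_mono:
  assumes "visc_cond c G u x \<phi>" "x \<in> \<Gamma>"
    and "\<And>E t p. E \<in> edges N \<Longrightarrow> 0 \<le> t \<Longrightarrow> t \<le> len E \<Longrightarrow> x = \<gamma> E t \<Longrightarrow> c * G' E p \<le> c * G E p"
  shows "visc_cond c G' u x \<phi>"
proof -
  have "c * G' E p \<le> c * G E p" if "E \<in> Inc N x" for E p
    by (rule assms(3)[OF Inc_edges[OF that] end_coord_bounds \<gamma>_end_coord[OF that, symmetric]])
  then show ?thesis using assms(1) assms(3)[OF _ less_imp_le less_imp_le] unfolding visc_cond_def
    by (meson order.trans)
qed

lemma patch_Lipschitz_at_both:
  assumes u: "\<rho>_lipschitz L u" and \<phi>: "\<rho>_lipschitz K \<phi>" and x: "x \<in> \<Gamma>"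
  shows "Lipschitz_at (max L K) x (patch \<delta> u \<phi> x)"
proof -
  have "\<bar>patch \<delta> u \<phi> x z - u x\<bar> \<le> max L K * \<rho> x z" if z: "z \<in> \<Gamma>" for z
  proof -
    have "\<bar>u z - u x\<bar> \<le> L * \<rho> x z" "\<bar>\<phi> z - \<phi> x\<bar> \<le> K * \<rho> x z"
      using u \<phi> x z unfolding \<rho>_lipschitz_def by (metis \<rho>_commute)+
    moreover have "L * \<rho> x z \<le> max L K * \<rho> x z" "K * \<rho> x z \<le> max L K * \<rho> x z"
      by (intro mult_right_mono; simp)+
    ultimately show ?thesis unfolding patch_def by auto
  qed
  then show ?thesis
    using patch_measurable[OF \<rho>_lipschitz_C0[OF u] \<rho>_lipschitz_C0[OF \<phi>] x, of \<delta>] unfolding Lipschitz_at_def by auto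
qed

text \<open>Near every point other than the base point the patched function eventually coincides
  with \<open>u\<close>, and one Lipschitz constant serves all radii.\<close>

lemma Gop_tendsto:
  assumes E: "E \<in> edges N" "0 \<le> s" "s \<le> len E" and u: "\<rho>_lipschitz L u" and \<phi>: "\<phi> \<in> C1 N"
  shows "(\<lambda>n. Gop N lam H \<nu> E (1 / real (Suc n)) u \<phi> p (\<gamma> E s)) \<longlonglongrightarrow> LG u (\<gamma> E s) E p"
proof -
  obtain K where K: "\<rho>_lipschitz K \<phi>" using C1_\<rho>_lipschitz[OF \<phi>] by blast
  note x = \<gamma>_in_\<Gamma>[OF E]
  have "(\<lambda>n. nonloc N \<nu> E \<Gamma> (patch (1 / real (Suc n)) u \<phi> (\<gamma> E s)) (\<gamma> E s)) \<longlonglongrightarrow> nonloc N \<nu> E \<Gamma> u (\<gamma> E s)"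
  proof (rule nonloc_tendsto[OF E(1) _ E(2,3) tendsto_const])
    show "Lipschitz_at (max L K) (\<gamma> E s) (patch (1 / real (Suc n)) u \<phi> (\<gamma> E s))" for n
      by (rule patch_Lipschitz_at_both[OF u K x])
    show "Lipschitz_at (max L K) (\<gamma> E s) u"
    proof -
      have "\<rho>_lipschitz (max L K) u"
        using u unfolding \<rho>_lipschitz_def by (auto intro: order.trans[OF _ mult_right_mono[of L "max L K"]])
      then show ?thesis using x by (rule \<rho>_lipschitz_at)
    qed
    fix F z y assume F: "F \<in> edges N" and z: "0 < z" "z < len F" "\<gamma> F z \<noteq> \<gamma> E s"
      and y: "y \<longlonglongrightarrow> z" "\<forall>n. 0 \<le> y n \<and> y n \<le> len F"
    have lim: "(\<lambda>n. u (\<gamma> F (y n))) \<longlonglongrightarrow> u (\<gamma> F z)" "(\<lambda>n. \<rho> (\<gamma> E s) (\<gamma> F (y n))) \<longlonglongrightarrow> \<rho> (\<gamma> E s) (\<gamma> F z)"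
      using C0_tendsto[OF \<rho>_lipschitz_C0[OF u] F y(1)] C0_tendsto[OF C0_\<rho>[OF x] F y(1)] y(2) z by auto
    define r where "r = \<rho> (\<gamma> E s) (\<gamma> F z) / 2"
    have r: "0 < r" "r < \<rho> (\<gamma> E s) (\<gamma> F z)"
      using z \<rho>_eq_0_iff[OF x \<gamma>_in_\<Gamma>[OF F, of z]] \<rho>_nonneg[of "\<gamma> E s" "\<gamma> F z"] unfolding r_def by (auto simp: less_le)
    have "\<forall>\<^sub>F n in sequentially. 1 / real (Suc n) < r"
      using order_tendstoD(2)[OF LIMSEQ_inverse_real_of_nat r(1)] by (simp add: inverse_eq_divide)
    moreover have "\<forall>\<^sub>F n in sequentially. r < \<rho> (\<gamma> E s) (\<gamma> F (y n))"
      by (rule order_tendstoD(1)[OF lim(2) r(2)])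
    ultimately have "\<forall>\<^sub>F n in sequentially. u (\<gamma> F (y n)) = patch (1 / real (Suc n)) u \<phi> (\<gamma> E s) (\<gamma> F (y n))"
      by eventually_elim (auto simp: patch_def geo_ball_def)
    with lim(1) show "(\<lambda>n. patch (1 / real (Suc n)) u \<phi> (\<gamma> E s) (\<gamma> F (y n))) \<longlonglongrightarrow> u (\<gamma> F z)"
      by (rule Lim_transform_eventually)
  qed (use E in auto)
  then have "(\<lambda>n. lam * u (\<gamma> E s) - nonloc N \<nu> E \<Gamma> (patch (1 / real (Suc n)) u \<phi> (\<gamma> E s)) (\<gamma> E s) + H E (\<gamma> E s) p)
     \<longlonglongrightarrow> LG u (\<gamma> E s) E p" unfolding LG_def by (intro tendsto_intros)
  then show ?thesis using Gop_patch[OF E \<rho>_lipschitz_C0[OF u] \<phi>] by simp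
qed

text \<open>From \<open>LG\<close> to \<open>Gop\<close>: contact orders the increments of
  \<open>u\<close> and of the patched function, hence the nonlocal terms. Conversely, contact
  persists on smaller balls and the radius tends to \<open>0\<close>; at a vertex the strict failure
  on finitely many edges is stable under this limit.\<close>

lemma visc_gen_iff_lip:
  assumes u: "\<rho>_lipschitz L u" and c: "c \<in> {1, -1}"
  shows "visc_gen c u \<longleftrightarrow> visc_lip c u"
proof
  assume vl: "visc_lip c u"
  show "visc_gen c u" unfolding visc_gen_def
  proof (intro ballI allI impI)
    fix x \<delta> \<phi> assume x: "x \<in> \<Gamma>" and \<phi>: "\<phi> \<in> C1 N" and t: "touches c u \<phi> x \<delta>"
    then have \<delta>: "0 < \<delta>" by (simp add: touches_def)
    obtain K where K: "\<rho>_lipschitz K \<phi>" using C1_\<rho>_lipschitz[OF \<phi>] by blast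
    show "visc_cond c (\<lambda>E p. Gop N lam H \<nu> E \<delta> u \<phi> p x) u x \<phi>"
    proof (rule visc_cond_mono[OF _ x])
      show "visc_cond c (LG u x) u x \<phi>" using vl x \<phi> t unfolding visc_lip_def by blast
      fix E s p assume E: "E \<in> edges N" "0 \<le> s" "s \<le> len E" and xs: "x = \<gamma> E s"
      note la = patch_Lipschitz_at_both[OF u K x, of \<delta>, unfolded xs]
      have tt: "c * (patch \<delta> u \<phi> x z - patch \<delta> u \<phi> x x) \<ge> c * (u z - u x)" if "z \<in> \<Gamma>" for z
        using t that unfolding touches_def by (auto simp: patch_def algebra_simps)
      have "c * nonloc N \<nu> E \<Gamma> (patch \<delta> u \<phi> x) x \<ge> c * nonloc N \<nu> E \<Gamma> u x"
        using nonloc_mono[OF E \<rho>_lipschitz_at[OF u \<gamma>_in_\<Gamma>[OF E]] la] nonloc_mono[OF E la \<rho>_lipschitz_at[OF u \<gamma>_in_\<Gamma>[OF E]]]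
          tt c unfolding xs by auto
      then show "c * Gop N lam H \<nu> E \<delta> u \<phi> p x \<le> c * LG u x E p"
        unfolding xs Gop_patch[OF E \<rho>_lipschitz_C0[OF u] \<phi> \<delta>] LG_def by (simp add: algebra_simps)
    qed
  qed
next
  assume vg: "visc_gen c u"
  show "visc_lip c u" unfolding visc_lip_def
  proof (intro ballI allI impI)
    fix x \<delta> \<phi> assume x: "x \<in> \<Gamma>" and \<phi>: "\<phi> \<in> C1 N" and t: "touches c u \<phi> x \<delta>"
    then have \<delta>: "0 < \<delta>" by (simp add: touches_def)
    define G where "G = (\<lambda>n E p. Gop N lam H \<nu> E (1 / real (Suc n)) u \<phi> p x)"
    have lim: "(\<lambda>n. c * G n E p) \<longlonglongrightarrow> c * LG u x E p" if "E \<in> edges N" "0 \<le> s" "s \<le> len E" "x = \<gamma> E s" for E s p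
      unfolding G_def that(4) by (intro tendsto_mult_left Gop_tendsto[OF that(1-3) u \<phi>])
    have limI: "(\<lambda>n. c * G n E p) \<longlonglongrightarrow> c * LG u x E p" if "E \<in> Inc N x" for E p
      by (rule lim[OF Inc_edges[OF that] end_coord_bounds \<gamma>_end_coord[OF that, symmetric]])
    have ev: "\<forall>\<^sub>F n in sequentially. visc_cond c (G n) u x \<phi>"
    proof -
      have "\<forall>\<^sub>F n in sequentially. 1 / real (Suc n) < \<delta>"
        using order_tendstoD(2)[OF LIMSEQ_inverse_real_of_nat \<delta>] by (simp add: inverse_eq_divide)
      then show ?thesis
      proof eventually_elim
        case (elim n)
        then have "touches c u \<phi> x (1 / real (Suc n))" using t unfolding touches_def geo_ball_def by auto
        then show ?case using vg x \<phi> unfolding visc_gen_def G_def by blast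
      qed
    qed
    have bad: False if "\<forall>E \<in> Inc N x. 0 < c * LG u x E (slope E \<phi> (end_coord E x))"
      "\<forall>\<^sub>F n in sequentially. \<exists>E \<in> Inc N x. c * G n E (slope E \<phi> (end_coord E x)) \<le> 0"
    proof -
      have "\<forall>\<^sub>F n in sequentially. \<forall>E \<in> Inc N x. 0 < c * G n E (slope E \<phi> (end_coord E x))"
        using that(1) order_tendstoD(1)[OF limI] by (intro eventually_ball_finite) auto
      with that(2) have "\<forall>\<^sub>F n in sequentially. False" by eventually_elim force
      then show False by simp
    qed
    show "visc_cond c (LG u x) u x \<phi>"
      unfolding visc_cond_def
    proof (intro conjI ballI allI impI)
      fix E s assume E: "E \<in> edges N" and s: "0 < s \<and> s < len E \<and> x = \<gamma> E s"
      have "\<forall>\<^sub>F n in sequentially. c * G n E (slope E \<phi> s) \<le> 0"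
        using ev by eventually_elim (use E s in \<open>auto simp: visc_cond_def\<close>)
      then show "c * LG u x E (slope E \<phi> s) \<le> 0"
        using tendsto_upperbound[OF lim[OF E]] s by auto
    next
      assume i: "x \<in> inner_verts N"
      show "(\<exists>E\<in>Inc N x. c * LG u x E (slope E \<phi> (end_coord E x)) \<le> 0) \<or>
        c * ((\<Sum>E\<in>Inc N x. - (end_sign E x * slope E \<phi> (end_coord E x))) - B x) \<le> 0"
      proof (rule ccontr)
        assume n: "\<not> ?thesis"
        have "\<forall>\<^sub>F n in sequentially. \<exists>E \<in> Inc N x. c * G n E (slope E \<phi> (end_coord E x)) \<le> 0"
          using ev by eventually_elim (use n i in \<open>auto simp: visc_cond_def\<close>)
        then show False using bad n by (auto simp: not_le)
      qed
    next
      assume i: "x \<in> bdry_verts N"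
      show "(\<exists>E\<in>Inc N x. c * LG u x E (slope E \<phi> (end_coord E x)) \<le> 0) \<or> c * (u x - h x) \<le> 0"
      proof (rule ccontr)
        assume n: "\<not> ?thesis"
        have "\<forall>\<^sub>F n in sequentially. \<exists>E \<in> Inc N x. c * G n E (slope E \<phi> (end_coord E x)) \<le> 0"
          using ev by eventually_elim (use n i in \<open>auto simp: visc_cond_def\<close>)
        then show False using bad n by (auto simp: not_le)
      qed
    qed
  qed
qed

end

subsection \<open>Lipschitz bounds for subsolutions\<close>

text \<open>Choose a level \<open>m\<close> strictly between \<open>W b\<close> and
  \<open>W a\<close>. The first point with \<open>W\<close> at most \<open>m\<close> would have an
  earlier such point, by the hypothesis or, at \<open>b\<close>, by continuity.\<close>

lemma left_mono_le:
  fixes W :: "real \<Rightarrow> real"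
  assumes ab: "a < b" and cont: "continuous_on {a..b} W"
    and left: "\<And>x. a < x \<Longrightarrow> x < b \<Longrightarrow> \<exists>d>0. \<forall>y \<in> {a..b}. x - d < y \<and> y < x \<longrightarrow> W y \<le> W x"
  shows "W a \<le> W b"
proof (rule ccontr)
  assume "\<not> W a \<le> W b"
  define m where "m = (W a + W b) / 2"
  have m: "W b < m" "m < W a" using \<open>\<not> W a \<le> W b\<close> by (auto simp: m_def)
  define S where "S = {a..b} \<inter> W -` {..m}"
  have "closed S" unfolding S_def by (rule continuous_closed_preimage[OF cont]) auto
  moreover have "bounded S" by (rule bounded_subset[of "{a..b}"]) (auto simp: S_def)
  ultimately have "compact S" by (simp add: compact_eq_bounded_closed)
  moreover have "b \<in> S" using ab m by (auto simp: S_def)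
  ultimately obtain x where x: "x \<in> S" "\<And>y. y \<in> S \<Longrightarrow> x \<le> y" using compact_attains_inf[of S] by blast
  have xab: "a < x" "x \<le> b" using x(1) m by (auto simp: S_def less_le)
  show False
  proof (cases "x = b")
    case False
    then obtain d where d: "d > 0" "\<And>y. y \<in> {a..b} \<Longrightarrow> x - d < y \<Longrightarrow> y < x \<Longrightarrow> W y \<le> W x"
      using left[of x] xab by force
    define y where "y = max a (x - d / 2)"
    have y: "y \<in> {a..b}" "x - d < y" "y < x" using d(1) xab by (auto simp: y_def)
    then have "y \<in> S" using d(2)[OF y] x(1) by (auto simp: S_def)
    then show False using x(2)[of y] y by auto
  next
    case True
    obtain d where d: "d > 0" "\<And>y. y \<in> {a..b} \<Longrightarrow> dist y b < d \<Longrightarrow> dist (W y) (W b) < m - W b"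
      using cont m ab unfolding continuous_on_iff by (metis atLeastAtMost_iff diff_gt_0_iff_gt less_imp_le order_refl)
    define y where "y = max a (b - d / 2)"
    have y: "y \<in> {a..b}" "dist y b < d" "y < b" using d(1) ab by (auto simp: y_def dist_real_def)
    then have "y \<in> S" using d(2)[OF y(1,2)] by (auto simp: S_def dist_real_def)
    then show False using x(2)[of y] y True by auto
  qed
qed

text \<open>\<open>loc\<close> bounds from above how fast \<open>V\<close> decreases, as seen from
  the right end of a short interval. Monotonicity is applied to \<open>V + G\<close> with a small
  linear term added.\<close>

lemma left_slope_integrate:
  fixes V G k :: "real \<Rightarrow> real"
  assumes ab: "a < b" and V: "continuous_on {a..b} V" and G: "continuous_on {a..b} G"
    and der: "\<And>x. a < x \<Longrightarrow> x < b \<Longrightarrow> (G has_real_derivative k x) (at x)"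
    and loc: "\<And>x e. a < x \<Longrightarrow> x < b \<Longrightarrow> 0 < e \<Longrightarrow> \<exists>d>0. \<forall>y \<in> {a..b}. x - d < y \<and> y < x \<longrightarrow> V y - V x \<le> (k x + e) * (x - y)"
  shows "V a - V b \<le> G b - G a"
proof (rule field_le_epsilon)
  fix \<epsilon> :: real assume "0 < \<epsilon>"
  define w where "w = b - a"
  \<comment> \<open>One \<open>e\<close> pays for the slack in \<open>loc\<close>, another for the
    error in differentiating \<open>G\<close>; over the whole interval they add up to
    \<open>\<epsilon>\<close>.\<close>
  define e where "e = \<epsilon> / (2 * w)"
  have "0 < w" using ab by (simp add: w_def)
  then have e: "0 < e" "2 * e * (b - a) = \<epsilon>" using \<open>0 < \<epsilon>\<close> unfolding w_def[symmetric] by (simp_all add: e_def)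
  have "V a + G a + 2 * e * a \<le> V b + G b + 2 * e * b"
  proof (rule left_mono_le[OF ab, of "\<lambda>x. V x + G x + 2 * e * x"])
    show "continuous_on {a..b} (\<lambda>x. V x + G x + 2 * e * x)" by (intro continuous_intros V G)
    fix x assume x: "a < x" "x < b"
    obtain d1 where d1: "d1 > 0" "\<And>y. y \<in> {a..b} \<Longrightarrow> x - d1 < y \<Longrightarrow> y < x \<Longrightarrow> V y - V x \<le> (k x + e) * (x - y)"
      using loc[OF x e(1)] by blast
    obtain d2 where d2: "d2 > 0" "\<And>y. norm (y - x) < d2 \<Longrightarrow> norm (G y - G x - k x * (y - x)) \<le> e * norm (y - x)"
      using der[OF x] e(1) unfolding has_field_derivative_def has_derivative_at_alt by blast
    show "\<exists>d>0. \<forall>y \<in> {a..b}. x - d < y \<and> y < x \<longrightarrow> V y + G y + 2 * e * y \<le> V x + G x + 2 * e * x"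
    proof (intro exI[of _ "min d1 d2"] conjI ballI impI)
      fix y assume y: "y \<in> {a..b}" "x - min d1 d2 < y \<and> y < x"
      have 1: "V y - V x \<le> (k x + e) * (x - y)" using d1(2)[OF y(1)] y(2) by auto
      have "norm (y - x) < d2" using y by auto
      from d2(2)[OF this] have "G y - G x - k x * (y - x) \<le> e * (x - y)" using y by auto
      then have "V y + G y - (V x + G x) \<le> (k x + e) * (x - y) + k x * (y - x) + e * (x - y)" using 1 by linarith
      also have "\<dots> = 2 * e * x - 2 * e * y" by (simp add: algebra_simps)
      finally show "V y + G y + 2 * e * y \<le> V x + G x + 2 * e * x" by linarith
    qed (use d1 d2 in auto)
  qed
  then show "V a - V b \<le> G b - G a + \<epsilon>" using e(2) by (simp add: algebra_simps)
qed

text \<open>Local bounds on upper increments alone are enough: \<open>left_slope_integrate\<close>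
  for \<open>V\<close> bounds its decrease over the interval, and for the reflected function its
  increase.\<close>

lemma lipschitz_from_local:
  fixes V :: "real \<Rightarrow> real"
  assumes V: "continuous_on {a..b} V" and ab: "a \<le> b"
    and loc: "\<And>x e. a < x \<Longrightarrow> x < b \<Longrightarrow> 0 < e \<Longrightarrow> \<exists>d>0. \<forall>y \<in> {a..b}. \<bar>y - x\<bar> < d \<longrightarrow> V y - V x \<le> (k + e) * \<bar>y - x\<bar>"
  shows "\<bar>V a - V b\<bar> \<le> k * (b - a)"
proof (cases "a = b")
  case False
  then have ab: "a < b" using ab by simp
  have 1: "V a - V b \<le> k * b - k * a"
  proof (rule left_slope_integrate[OF ab V, of "\<lambda>x. k * x" "\<lambda>_. k"])
    fix x e :: real assume x: "a < x" "x < b" "0 < e"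
    then obtain d where d: "d > 0" "\<And>y. y \<in> {a..b} \<Longrightarrow> \<bar>y - x\<bar> < d \<Longrightarrow> V y - V x \<le> (k + e) * \<bar>y - x\<bar>"
      using loc by blast
    show "\<exists>d>0. \<forall>y\<in>{a..b}. x - d < y \<and> y < x \<longrightarrow> V y - V x \<le> (k + e) * (x - y)"
    proof (intro exI[of _ d] conjI ballI impI d(1))
      fix y assume "y \<in> {a..b}" "x - d < y \<and> y < x"
      then show "V y - V x \<le> (k + e) * (x - y)" using d(2)[of y] by auto
    qed
  qed (auto intro!: continuous_intros derivative_eq_intros)
  have 2: "V (- (- b)) - V (- (- a)) \<le> k * (- a) - k * (- b)"
  proof (rule left_slope_integrate[of "-b" "-a" "\<lambda>x. V (- x)" "\<lambda>x. k * x" "\<lambda>_. k"])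
    show "continuous_on {- b..- a} (\<lambda>x. V (- x))"
      by (rule continuous_on_compose2[OF V]) (auto intro: continuous_intros)
    fix x e :: real assume x: "- b < x" "x < - a" "0 < e"
    then obtain d where d: "d > 0" "\<And>y. y \<in> {a..b} \<Longrightarrow> \<bar>y - (- x)\<bar> < d \<Longrightarrow> V y - V (- x) \<le> (k + e) * \<bar>y - (- x)\<bar>"
      using loc[of "- x" e] by auto
    show "\<exists>d>0. \<forall>y\<in>{- b..- a}. x - d < y \<and> y < x \<longrightarrow> V (- y) - V (- x) \<le> (k + e) * (x - y)"
    proof (intro exI[of _ d] conjI ballI impI d(1))
      fix y assume "y \<in> {- b..- a}" "x - d < y \<and> y < x"
      then show "V (- y) - V (- x) \<le> (k + e) * (x - y)" using d(2)[of "- y"] by auto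
    qed
  qed (use ab in \<open>auto intro!: continuous_intros derivative_eq_intros\<close>)
  show ?thesis using 1 2 by (simp add: algebra_simps abs_le_iff)
qed simp

lemma quadratic_bound_local:
  fixes k q e :: real
  assumes "0 \<le> q" "0 < e" "0 < r"
  shows "\<exists>d>0. d \<le> r \<and> (\<forall>h. \<bar>h\<bar> < d \<longrightarrow> k * \<bar>h\<bar> + q * h\<^sup>2 \<le> (k + e) * \<bar>h\<bar>)"
proof (intro exI[of _ "min r (e / (q + 1))"] conjI allI impI)
  fix h :: real assume h: "\<bar>h\<bar> < min r (e / (q + 1))"
  have "q * \<bar>h\<bar> \<le> (q + 1) * (e / (q + 1))" using h assms by (intro mult_mono) auto
  also have "\<dots> = e" using assms by simp
  finally have "q * \<bar>h\<bar> * \<bar>h\<bar> \<le> e * \<bar>h\<bar>" by (rule mult_right_mono) simp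
  then show "k * \<bar>h\<bar> + q * h\<^sup>2 \<le> (k + e) * \<bar>h\<bar>" by (simp add: power2_eq_square algebra_simps)
qed (use assms in auto)

section \<open>A priori estimates from contact points inside edges\<close>

context hj_network
begin

text \<open>The other edges are filled in by affine interpolation of the vertex values, so a test
  function can be prescribed freely on a single edge.\<close>

lemma edge_test:
  assumes E: "E \<in> edges N" and f: "\<And>t. (f has_real_derivative f' t) (at t)" "continuous_on UNIV f'"
  obtains \<phi> where "\<phi> \<in> C1 N" "\<And>t. 0 \<le> t \<Longrightarrow> t \<le> len E \<Longrightarrow> \<phi> (\<gamma> E t) = f t"
    "\<And>t. 0 \<le> t \<Longrightarrow> t \<le> len E \<Longrightarrow> slope E \<phi> t = f' t"
proof -
  define val where "val = (\<lambda>v. if v = src E then f 0 else if v = tgt E then f (len E) else 0)"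
  define g where "g = (\<lambda>F t. if F = E then f t else val (src F) + (t / len F) * (val (tgt F) - val (src F)))"
  define g' where "g' = (\<lambda>F t. if F = E then f' t else (val (tgt F) - val (src F)) / len F)"
  obtain \<phi> where \<phi>: "\<phi> \<in> C1 N" "\<And>F t. F \<in> edges N \<Longrightarrow> 0 \<le> t \<Longrightarrow> t \<le> len F \<Longrightarrow> \<phi> (\<gamma> F t) = g F t"
    "\<And>F t. F \<in> edges N \<Longrightarrow> 0 \<le> t \<Longrightarrow> t \<le> len F \<Longrightarrow> slope F \<phi> t = g' F t"
  proof (rule C1_exists[of g val g'])
    fix F assume F: "F \<in> edges N"
    show "g F 0 = val (src F)" using edge_ends(1)[OF E] by (auto simp: g_def val_def)
    show "g F (len F) = val (tgt F)" using edge_ends(1)[OF E] len_pos[OF F] by (auto simp: g_def val_def)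
    show "continuous_on {0..len F} (g' F)"
      by (cases "F = E") (auto simp: g'_def intro: continuous_on_subset[OF f(2)])
    fix t
    have "(g F has_real_derivative g' F t) (at t)"
    proof (cases "F = E")
      case True
      then show ?thesis using f(1) by (simp add: g_def g'_def)
    next
      case False
      have "((\<lambda>t. val (src F) + (t / len F) * (val (tgt F) - val (src F))) has_real_derivative (val (tgt F) - val (src F)) / len F) (at t)"
        using len_pos[OF F] by (auto intro!: derivative_eq_intros)
      then show ?thesis using False by (simp add: g_def g'_def)
    qed
    then show "(g F has_real_derivative g' F t) (at t within {0..len F})" by (rule has_field_derivative_at_within)
  qed blast
  then show thesis using that[of \<phi>] E by (simp add: g_def g'_def)
qed

lemma visc_gen_D: "visc_gen c u \<Longrightarrow> x \<in> \<Gamma> \<Longrightarrow> \<phi> \<in> C1 N \<Longrightarrow> touches c u \<phi> x \<delta> \<Longrightarrow>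
    visc_cond c (\<lambda>E p. Gop N lam H \<nu> E \<delta> u \<phi> p x) u x \<phi>"
  by (simp add: visc_gen_def)

text \<open>The Lipschitz bound will depend on \<open>u\<close> only through \<open>M\<close>; this
  uniformity makes the Perron family equi-Lipschitz.\<close>

definition csub :: "real \<Rightarrow> ('a \<Rightarrow> real) \<Rightarrow> bool" where
  "csub M u \<longleftrightarrow> u \<in> C0 N \<and> visc_gen 1 u \<and> (\<forall>x \<in> \<Gamma>. \<bar>u x\<bar> \<le> M)"

text \<open>The subsolution inequality at the contact point, with \<open>H_lower\<close> on one side
  and \<open>nonloc_bound\<close> on the other. Inside the small ball the test function takes the
  place of \<open>u\<close>, and there its growth obeys the same slope \<open>K\<close>.\<close>

lemma contact_slope_bound:
  assumes u: "csub M u" and E: "E \<in> edges N" and s: "0 < s" "s < len E"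
    and f: "\<And>t. (f has_real_derivative f' t) (at t)" "continuous_on UNIV f'"
    and d: "0 < d" "\<And>t. 0 \<le> t \<Longrightarrow> t \<le> len E \<Longrightarrow> \<bar>t - s\<bar> < d \<Longrightarrow> u (\<gamma> E t) - u (\<gamma> E s) \<le> f t - f s \<and> f t - f s \<le> K * \<bar>t - s\<bar>"
    and pos: "0 \<le> K" "0 \<le> L" "0 \<le> \<omega>" "0 < \<tau>"
    and near: "\<And>z. z \<in> \<Gamma> \<Longrightarrow> \<rho> (\<gamma> E s) z < \<tau> \<Longrightarrow> u z - u (\<gamma> E s) \<le> K * \<rho> (\<gamma> E s) z"
    and far: "\<And>z. z \<in> \<Gamma> \<Longrightarrow> \<tau> \<le> \<rho> (\<gamma> E s) z \<Longrightarrow> u z - u (\<gamma> E s) \<le> L * \<rho> (\<gamma> E s) z + \<omega>"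
  shows "\<bar>f' s\<bar> / C - C - lam * M \<le> nonloc_const * (K * \<tau> powr (1 - \<sigma>) + L + \<omega> * \<tau> powr (- \<sigma>))"
proof -
  note s' = less_imp_le[OF s(1)] less_imp_le[OF s(2)]
  note x = \<gamma>_in_\<Gamma>[OF E s']
  have u': "u \<in> C0 N" "visc_gen 1 u" "\<bar>u (\<gamma> E s)\<bar> \<le> M" using u x by (auto simp: csub_def)
  obtain \<phi> where \<phi>: "\<phi> \<in> C1 N" "\<And>t. 0 \<le> t \<Longrightarrow> t \<le> len E \<Longrightarrow> \<phi> (\<gamma> E t) = f t"
    "\<And>t. 0 \<le> t \<Longrightarrow> t \<le> len E \<Longrightarrow> slope E \<phi> t = f' t" using edge_test[OF E f] by blast
  \<comment> \<open>Small enough for the contact hypothesis, for the near region, and for the ball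
    to be an interval inside \<open>E\<close>.\<close>
  define \<delta> where "\<delta> = min (min d \<tau>) (min s (len E - s))"
  have \<delta>: "0 < \<delta>" "\<delta> \<le> d" "\<delta> \<le> \<tau>" "\<delta> \<le> min s (len E - s)" using d(1) pos s by (auto simp: \<delta>_def)
  have ball: "u y - u (\<gamma> E s) \<le> \<phi> y - \<phi> (\<gamma> E s) \<and> \<phi> y - \<phi> (\<gamma> E s) \<le> K * \<rho> (\<gamma> E s) y" if y: "y \<in> geo_ball N (\<gamma> E s) \<delta>" for y
  proof -
    have y': "y \<in> \<Gamma>" "\<rho> (\<gamma> E s) y < \<delta>" using y by (auto simp: geo_ball_def)
    obtain t where t: "0 < t" "t < len E" "y = \<gamma> E t" "\<bar>t - s\<bar> < \<delta>" "\<rho> (\<gamma> E s) y = \<bar>t - s\<bar>"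
      using edge_ball[OF E s' y' \<delta>(4)] by blast
    then show ?thesis using d(2)[of t] \<phi>(2)[of t] \<phi>(2)[OF s'] \<delta>(2) by auto
  qed
  have "touches 1 u \<phi> (\<gamma> E s) \<delta>" unfolding touches_def using \<delta>(1) ball by force
  then have "visc_cond 1 (\<lambda>F p. Gop N lam H \<nu> F \<delta> u \<phi> p (\<gamma> E s)) u (\<gamma> E s) \<phi>"
    by (rule visc_gen_D[OF u'(2) x \<phi>(1)])
  then have "Gop N lam H \<nu> E \<delta> u \<phi> (slope E \<phi> s) (\<gamma> E s) \<le> 0"
    using E s unfolding visc_cond_def by auto
  then have G: "lam * u (\<gamma> E s) - nonloc N \<nu> E \<Gamma> (patch \<delta> u \<phi> (\<gamma> E s)) (\<gamma> E s) + H E (\<gamma> E s) (f' s) \<le> 0"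
    unfolding Gop_patch[OF E s' u'(1) \<phi>(1) \<delta>(1)] \<phi>(3)[OF s'] .
  obtain L\<phi> where L\<phi>: "\<rho>_lipschitz L\<phi> \<phi>" using C1_\<rho>_lipschitz[OF \<phi>(1)] by blast
  obtain K' where K': "Lipschitz_at K' (\<gamma> E s) (patch \<delta> u \<phi> (\<gamma> E s))"
    using patch_Lipschitz_at[OF u'(1) L\<phi> x \<delta>(1)] by blast
  have "nonloc N \<nu> E \<Gamma> (patch \<delta> u \<phi> (\<gamma> E s)) (\<gamma> E s) \<le> nonloc_const * (K * \<tau> powr (1 - \<sigma>) + L + \<omega> * \<tau> powr (- \<sigma>))"
  proof (rule nonloc_bound[OF E s' K' pos])
    fix z assume z: "z \<in> \<Gamma>" "\<rho> (\<gamma> E s) z < \<tau>"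
    show "patch \<delta> u \<phi> (\<gamma> E s) z - patch \<delta> u \<phi> (\<gamma> E s) (\<gamma> E s) \<le> K * \<rho> (\<gamma> E s) z"
      using near[OF z] ball[of z] by (auto simp: patch_def)
  next
    fix z assume z: "z \<in> \<Gamma>" "\<tau> \<le> \<rho> (\<gamma> E s) z"
    then have "z \<notin> geo_ball N (\<gamma> E s) \<delta>" using \<delta>(3) by (auto simp: geo_ball_def)
    then show "patch \<delta> u \<phi> (\<gamma> E s) z - patch \<delta> u \<phi> (\<gamma> E s) (\<gamma> E s) \<le> L * \<rho> (\<gamma> E s) z + \<omega>"
      using far[OF z] by (simp add: patch_def)
  qed
  moreover have "\<bar>f' s\<bar> / C - C \<le> H E (\<gamma> E s) (f' s)" by (rule H_lower[OF E \<gamma>_in_closure[OF E s']])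
  moreover have "lam * u (\<gamma> E s) \<ge> - (lam * M)"
  proof -
    have "lam * (- M) \<le> lam * u (\<gamma> E s)" using u'(3) lam_pos by (intro mult_left_mono) auto
    then show ?thesis by simp
  qed
  ultimately show ?thesis using G by linarith
qed

text \<open>With \<open>c = nonloc_const\<close>, a slope \<open>K\<close> seen up to distance
  \<open>r\<close> contributes at most \<open>K / (2 * C)\<close> to the nonlocal term, half of what
  coercivity yields.\<close>

lemma small_scale:
  assumes "0 < c" shows "\<exists>r. 0 < r \<and> r \<le> 1 \<and> r \<le> vsep \<and> c * r powr (1 - \<sigma>) \<le> 1 / (2 * C)"
proof -
  define r where "r = min (min 1 vsep) ((1 / (2 * C * c)) powr (1 / (1 - \<sigma>)))"
  have r: "0 < r" "r \<le> 1" "r \<le> vsep" using vsep_pos C_gt_1 assms by (auto simp: r_def)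
  have "r powr (1 - \<sigma>) \<le> ((1 / (2 * C * c)) powr (1 / (1 - \<sigma>))) powr (1 - \<sigma>)"
    using r \<sigma> by (intro powr_mono2) (auto simp: r_def)
  also have "\<dots> = 1 / (2 * C * c)" using \<sigma> C_gt_1 assms by (simp add: powr_powr)
  finally have "c * r powr (1 - \<sigma>) \<le> c * (1 / (2 * C * c))" using assms by (intro mult_left_mono) auto
  also have "\<dots> = 1 / (2 * C)" using assms by simp
  finally show ?thesis using r by blast
qed

lemma csub_diff_le: "csub M u \<Longrightarrow> x \<in> \<Gamma> \<Longrightarrow> y \<in> \<Gamma> \<Longrightarrow> u x - u y \<le> 2 * M"
proof -
  assume u: "csub M u" and xy: "x \<in> \<Gamma>" "y \<in> \<Gamma>"
  then have "\<bar>u x\<bar> \<le> M" "\<bar>u y\<bar> \<le> M" by (auto simp: csub_def)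
  then show ?thesis by linarith
qed

text \<open>If \<open>u\<close> exceeds a steep cone at \<open>v\<close>, the maximum of
  \<open>u - K * \<rho> v\<close> is attained away from \<open>v\<close> but close to it, hence
  inside an incident edge, where the cone is linear of slope \<open>K\<close>. Coercivity excludes
  such a contact.\<close>

lemma vertex_upper_bound:
  assumes M: "0 \<le> M"
  shows "\<exists>L \<ge> 0. \<forall>u. csub M u \<longrightarrow> (\<forall>v \<in> verts N \<inter> \<Gamma>. \<forall>z \<in> \<Gamma>. u z - u v \<le> L * \<rho> v z)"
proof -
  obtain r0 where r0: "0 < r0" "r0 \<le> 1" "r0 \<le> vsep" "nonloc_const * r0 powr (1 - \<sigma>) \<le> 1 / (2 * C)"
    using small_scale[OF nonloc_const_pos] by blast
  define Q where "Q = C + lam * M + nonloc_const * (2 * M * r0 powr (- \<sigma>))"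
  \<comment> \<open>The first summand makes \<open>K / (2 * C)\<close> exceed \<open>Q\<close>; the
    second keeps the maximum point within \<open>r0\<close> of \<open>v\<close>, since
    \<open>u\<close> oscillates by at most \<open>2 * M\<close>.\<close>
  define K where "K = 2 * C * (Q + 1) + 2 * M / r0"
  have Q: "0 \<le> Q" unfolding Q_def using C_gt_1 lam_pos M nonloc_const_pos by auto
  have K: "0 < K" unfolding K_def using Q C_gt_1 M r0 by (intro add_pos_nonneg) auto
  have "u z - u v \<le> K * \<rho> v z" if u: "csub M u" and v: "v \<in> verts N" "v \<in> \<Gamma>" and z: "z \<in> \<Gamma>" for u v z
  proof (rule ccontr)
    assume neg: "\<not> u z - u v \<le> K * \<rho> v z"
    have "(\<lambda>y. u y - K * \<rho> v y) \<in> C0 N"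
      using u C0_\<rho>[OF v(2)] by (intro C0_diff C0_cmult) (auto simp: csub_def)
    then obtain x where x: "x \<in> \<Gamma>" "\<And>y. y \<in> \<Gamma> \<Longrightarrow> u y - K * \<rho> v y \<le> u x - K * \<rho> v x"
      using C0_attains_sup z by blast
    have gt: "K * \<rho> v x < u x - u v" using x(2)[OF z] neg by linarith
    have xv: "x \<noteq> v" using gt v by auto
    have "K * \<rho> v x < 2 * M" using gt csub_diff_le[OF u x(1) v(2)] by linarith
    also have "2 * M = (2 * M / r0) * r0" using r0 by simp
    also have "\<dots> \<le> K * r0" using r0 C_gt_1 Q by (intro mult_right_mono) (auto simp: K_def)
    finally have xr: "\<rho> v x < r0" using K by simp
    obtain E t where E: "E \<in> Inc N v" "0 \<le> t" "t < len E" "t = \<rho> v x" "x = \<gamma> E (end_coord E v + end_sign E v * t)"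
      using vertex_ball[OF v x(1) xr r0(3)] by blast
    note E' = Inc_edges[OF E(1)]
    have t: "0 < t" using \<rho>_eq_0_iff[OF v(2) x(1)] xv E(2,4) by (auto simp: less_le)
    define s where "s = end_coord E v + end_sign E v * t"
    have s: "0 < s" "s < len E" using end_shift_bounds(2)[OF t E(3), of v] by (auto simp: s_def)
    have xs: "x = \<gamma> E s" using E(5) by (simp add: s_def)
    define f where "f = (\<lambda>t. K * end_sign E v * (t - end_coord E v))"
    have fr: "f t' = K * \<rho> v (\<gamma> E t')" if "0 \<le> t'" "t' \<le> len E" for t'
    proof -
      have "\<rho> v (\<gamma> E t') = \<bar>end_coord E v - t'\<bar>"
        using \<rho>_edge[OF E' end_coord_bounds that, of v] \<gamma>_end_coord[OF E(1)] by simp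
      also have "\<dots> = end_sign E v * (t' - end_coord E v)" using that by (auto simp: end_coord_def end_sign_def)
      finally show ?thesis by (simp add: f_def)
    qed
    \<comment> \<open>The triangle inequality turns maximality at \<open>x\<close> into a bound by
      the cone of slope \<open>K\<close> with vertex \<open>x\<close>.\<close>
    have near: "u y - u (\<gamma> E s) \<le> K * \<rho> (\<gamma> E s) y" if "y \<in> \<Gamma>" for y
    proof -
      have "\<rho> v y \<le> \<rho> v x + \<rho> x y" using \<rho>_triangle[OF v(2) x(1) that] .
      then have "K * \<rho> v y \<le> K * \<rho> v x + K * \<rho> x y" using K by (simp flip: distrib_left)
      then show ?thesis using x(2)[OF that] unfolding xs[symmetric] by linarith
    qed
    have "\<bar>K * end_sign E v\<bar> / C - C - lam * M \<le> nonloc_const * (K * r0 powr (1 - \<sigma>) + 0 + 2 * M * r0 powr (- \<sigma>))"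
    proof (rule contact_slope_bound[OF u E' s, of f "\<lambda>_. K * end_sign E v" 1 K 0 "2 * M" r0])
      show "(f has_real_derivative K * end_sign E v) (at t)" for t
        unfolding f_def by (auto intro!: derivative_eq_intros)
      fix t' assume t': "0 \<le> t'" "t' \<le> len E"
      have "u (\<gamma> E t') - u (\<gamma> E s) \<le> f t' - f s"
        using x(2)[OF \<gamma>_in_\<Gamma>[OF E' t']] fr[OF t'] fr[of s] s unfolding xs by auto
      moreover have "f t' - f s \<le> K * \<bar>t' - s\<bar>"
      proof -
        have "f t' - f s = K * (end_sign E v * (t' - s))" by (simp add: f_def algebra_simps)
        also have "\<dots> \<le> K * \<bar>t' - s\<bar>" using K by (intro mult_left_mono) (auto simp: end_sign_def)
        finally show ?thesis .
      qed
      ultimately show "u (\<gamma> E t') - u (\<gamma> E s) \<le> f t' - f s \<and> f t' - f s \<le> K * \<bar>t' - s\<bar>" ..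
    next
      fix y assume "y \<in> \<Gamma>"
      then show "u y - u (\<gamma> E s) \<le> 0 * \<rho> (\<gamma> E s) y + 2 * M"
        using csub_diff_le[OF u _ x(1)] xs by simp
    qed (use K M r0 near in auto)
    moreover have "\<bar>K * end_sign E v\<bar> = K" using K by (simp add: abs_mult)
    moreover have "nonloc_const * (K * r0 powr (1 - \<sigma>)) \<le> K / (2 * C)"
      using mult_left_mono[OF r0(4), of K] K by (simp add: mult_ac)
    ultimately have "K / C - C - lam * M \<le> K / (2 * C) + nonloc_const * (2 * M * r0 powr (- \<sigma>))"
      by (simp add: distrib_left)
    then have "K / (2 * C) \<le> Q" unfolding Q_def by (simp add: field_simps)
    moreover have "Q + 1 \<le> K / (2 * C)" using C_gt_1 M r0 unfolding K_def by (simp add: field_simps)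
    ultimately show False by linarith
  qed
  then show ?thesis using K by (intro exI[of _ K]) auto
qed

text \<open>If \<open>u\<close> rises from points near \<open>y\<close> by at most a slope
  \<open>L\<close> and a jump \<open>\<omega>\<close>, its upper increments at \<open>y\<close> have
  slope at most \<open>A * (1 + \<omega> * s powr (- \<sigma>))\<close>, where the scale
  \<open>s\<close> fits between \<open>y\<close> and the ends. The quadratic term stems from
  localization and disappears when only infinitesimal increments matter.\<close>

definition local_estimate :: "real \<Rightarrow> real \<Rightarrow> real \<Rightarrow> real \<Rightarrow> bool" where
  "local_estimate L M A s0 \<longleftrightarrow> (\<forall>u E y s \<omega>. csub M u \<longrightarrow> E \<in> edges N \<longrightarrow> 0 < s \<longrightarrow> s \<le> s0 \<longrightarrow>
     s \<le> y \<longrightarrow> y \<le> len E - s \<longrightarrow> 0 \<le> \<omega> \<longrightarrow>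
     (\<forall>x. \<bar>x - y\<bar> \<le> s / 8 \<longrightarrow> (\<forall>z \<in> \<Gamma>. u z - u (\<gamma> E x) \<le> L * \<rho> (\<gamma> E x) z + \<omega>)) \<longrightarrow>
     (\<forall>x. \<bar>x - y\<bar> \<le> s / 8 \<longrightarrow> u (\<gamma> E x) - u (\<gamma> E y) \<le>
        A * (1 + \<omega> * s powr (- \<sigma>)) * \<bar>x - y\<bar> + 1024 * (\<omega> + L * s) / s\<^sup>2 * (x - y)\<^sup>2))"

lemma local_estimateD:
  assumes "local_estimate L M A s0" "csub M u" "E \<in> edges N" "0 < s" "s \<le> s0" "s \<le> y" "y \<le> len E - s" "0 \<le> \<omega>"
    "\<And>x z. \<bar>x - y\<bar> \<le> s / 8 \<Longrightarrow> z \<in> \<Gamma> \<Longrightarrow> u z - u (\<gamma> E x) \<le> L * \<rho> (\<gamma> E x) z + \<omega>" "\<bar>x - y\<bar> \<le> s / 8"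
  shows "u (\<gamma> E x) - u (\<gamma> E y) \<le> A * (1 + \<omega> * s powr (- \<sigma>)) * \<bar>x - y\<bar> + 1024 * (\<omega> + L * s) / s\<^sup>2 * (x - y)\<^sup>2"
  using assms unfolding local_estimate_def by blast

text \<open>The barrier has slope \<open>K\<close> at \<open>y\<close> and a quadratic part strong
  enough to force the contact point well inside the interval of radius \<open>s / 8\<close>; there
  \<open>contact_slope_bound\<close> at scale \<open>s / 16\<close> contradicts the size of
  \<open>K\<close>.\<close>

lemma interior_estimate:
  assumes M: "0 \<le> M" and L: "0 \<le> L"
  shows "\<exists>A s0. 0 < A \<and> 0 < s0 \<and> s0 \<le> 1 \<and> s0 \<le> vsep \<and> local_estimate L M A s0"
proof -
  obtain s0 where s0: "0 < s0" "s0 \<le> 1" "s0 \<le> vsep" "nonloc_const * s0 powr (1 - \<sigma>) \<le> 1 / (2 * C)"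
    using small_scale[OF nonloc_const_pos] by blast
  \<comment> \<open>The numbers \<open>257 = 256 + 1\<close> here and \<open>272 = 256 + 16\<close>
    in \<open>A\<close>: on the interval the quadratic part has slope at most
    \<open>q * (s / 4) = 256 * W / s\<close>, the far slope \<open>L\<close> adds one unit, and
    replacing \<open>s / 16\<close> by \<open>s\<close> in a power with exponent
    \<open>- \<sigma>\<close> costs at most a factor \<open>16\<close>.\<close>
  define Q where "Q = C + lam * M + 257 * nonloc_const * L"
  define A where "A = 2 * C * (Q + 272 * nonloc_const + 1)"
  have Q: "0 \<le> Q" unfolding Q_def using C_gt_1 lam_pos M L nonloc_const_pos by auto
  have A: "0 < A" unfolding A_def using Q C_gt_1 nonloc_const_pos by (intro mult_pos_pos) auto
  have main: "u (\<gamma> E x0) - u (\<gamma> E y) \<le> A * (1 + \<omega> * s powr (- \<sigma>)) * \<bar>x0 - y\<bar> + 1024 * (\<omega> + L * s) / s\<^sup>2 * (x0 - y)\<^sup>2"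
    if u: "csub M u" and E: "E \<in> edges N" and s: "0 < s" "s \<le> s0" and y: "s \<le> y" "y \<le> len E - s" and \<omega>: "0 \<le> \<omega>"
      and osc: "\<And>x z. \<bar>x - y\<bar> \<le> s / 8 \<Longrightarrow> z \<in> \<Gamma> \<Longrightarrow> u z - u (\<gamma> E x) \<le> L * \<rho> (\<gamma> E x) z + \<omega>"
      and x0: "\<bar>x0 - y\<bar> \<le> s / 8"
    for u E y s \<omega> x0
  proof (rule ccontr)
    assume neg: "\<not> ?thesis"
    define K where "K = A * (1 + \<omega> * s powr (- \<sigma>))"
    define W where "W = \<omega> + L * s"
    \<comment> \<open>At distance \<open>s / 16\<close> the quadratic term equals
      \<open>4 * W\<close>, whereas \<open>u\<close> rises by at most \<open>W\<close> on the
      interval; so contact takes place closer to \<open>y\<close>.\<close>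
    define q where "q = 1024 * W / s\<^sup>2"
    have K: "0 < K" unfolding K_def using A \<omega> by (intro mult_pos_pos add_pos_nonneg) auto
    have W: "0 \<le> W" "0 \<le> q" using \<omega> L s by (auto simp: W_def q_def)
    have neg': "u (\<gamma> E x0) - u (\<gamma> E y) > K * \<bar>x0 - y\<bar> + q * (x0 - y)\<^sup>2"
      using neg by (simp add: K_def W_def q_def)
    have iv: "t \<in> {y - s / 8..y + s / 8} \<longleftrightarrow> \<bar>t - y\<bar> \<le> s / 8" for t
      unfolding atLeastAtMost_iff by arith
    define g where "g = (\<lambda>x. u (\<gamma> E x) - (K * \<bar>x - y\<bar> + q * (x - y)\<^sup>2))"
    have uC: "u \<in> C0 N" using u by (simp add: csub_def)
    have sub: "{y - s / 8..y + s / 8} \<subseteq> {0..len E}" using s y by auto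
    have "continuous_on {y - s / 8..y + s / 8} g"
      unfolding g_def by (intro continuous_intros continuous_on_subset[OF C0_D[OF uC E] sub])
    then obtain x where x: "x \<in> {y - s / 8..y + s / 8}" "\<And>t. t \<in> {y - s / 8..y + s / 8} \<Longrightarrow> g t \<le> g x"
      using continuous_attains_sup[of "{y - s / 8..y + s / 8}" g] s by auto
    have xy8: "\<bar>x - y\<bar> \<le> s / 8" using x(1) unfolding iv .
    have G: "\<gamma> E t \<in> \<Gamma>" if "\<bar>t - y\<bar> \<le> s / 8" for t
      using \<gamma>_in_\<Gamma>[OF E, of t] subsetD[OF sub, of t] that unfolding iv by simp
    have gy: "g y < g x"
    proof -
      have "g x0 \<le> g x" using x(2)[of x0] x0 unfolding iv by blast
      then show ?thesis using neg' by (simp add: g_def)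
    qed
    then have xney: "x \<noteq> y" by auto
    have ux: "u (\<gamma> E x) - u (\<gamma> E y) > K * \<bar>x - y\<bar> + q * (x - y)\<^sup>2" using gy by (simp add: g_def)
    have uW: "u (\<gamma> E x) - u (\<gamma> E y) \<le> W"
    proof -
      have "\<rho> (\<gamma> E y) (\<gamma> E x) = \<bar>y - x\<bar>" using \<rho>_edge[OF E, of y x] sub x(1) s y by auto
      then have "u (\<gamma> E x) - u (\<gamma> E y) \<le> L * \<bar>y - x\<bar> + \<omega>" using osc[of y "\<gamma> E x"] G[OF xy8] s by auto
      also have "L * \<bar>y - x\<bar> \<le> L * s" using L xy8 s(1) by (intro mult_left_mono) linarith+
      finally show ?thesis by (simp add: W_def)
    qed
    have x16: "\<bar>x - y\<bar> < s / 16"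
    proof (rule ccontr)
      assume "\<not> ?thesis"
      then have "(s / 16)\<^sup>2 \<le> (x - y)\<^sup>2" using s abs_le_square_iff[of "s / 16" "x - y"] by auto
      then have "q * (s / 16)\<^sup>2 \<le> q * (x - y)\<^sup>2" using W by (intro mult_left_mono) auto
      moreover have "q * (s / 16)\<^sup>2 = 4 * W" using s by (simp add: q_def power2_eq_square)
      moreover have "0 < K * \<bar>x - y\<bar>" using K xney by simp
      ultimately show False using ux uW W by linarith
    qed
    define sg where "sg = sgn (x - y)"
    have sg: "sg * sg = 1" "\<bar>sg\<bar> = 1" "sg * (x - y) = \<bar>x - y\<bar>" using xney by (auto simp: sg_def sgn_real_def)
    \<comment> \<open>Within \<open>\<bar>x - y\<bar>\<close> of \<open>x\<close> the sign of
      \<open>t - y\<close> does not change, and the barrier coincides with this smooth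
      function.\<close>
    define f where "f = (\<lambda>t. K * sg * (t - y) + q * (t - y)\<^sup>2)"
    define f' where "f' = (\<lambda>t. K * sg + 2 * q * (t - y))"
    define K' where "K' = K + q * (s / 4)"
    have K': "0 \<le> K'" using K W s by (simp add: K'_def)
    have xin: "0 < x" "x < len E" using x16 s y by linarith+
    have incr: "K * \<bar>t - y\<bar> + q * (t - y)\<^sup>2 - (K * \<bar>x - y\<bar> + q * (x - y)\<^sup>2) \<le> K' * \<bar>t - x\<bar>"
      if t: "\<bar>t - y\<bar> \<le> s / 8" for t
    proof -
      have "(t - y)\<^sup>2 - (x - y)\<^sup>2 = (t - x) * ((t - y) + (x - y))" by (simp add: power2_eq_square algebra_simps)
      also have "\<dots> \<le> \<bar>t - x\<bar> * \<bar>(t - y) + (x - y)\<bar>" by (metis abs_ge_self abs_mult)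
      also have "\<dots> \<le> \<bar>t - x\<bar> * (s / 4)" using t xy8 by (intro mult_left_mono) linarith+
      finally have "q * ((t - y)\<^sup>2 - (x - y)\<^sup>2) \<le> q * (\<bar>t - x\<bar> * (s / 4))" using W by (intro mult_left_mono) auto
      moreover have "K * (\<bar>t - y\<bar> - \<bar>x - y\<bar>) \<le> K * \<bar>t - x\<bar>" using K by (intro mult_left_mono) linarith+
      ultimately show ?thesis by (simp add: K'_def algebra_simps)
    qed
    have gx: "u (\<gamma> E t) - u (\<gamma> E x) \<le> K * \<bar>t - y\<bar> + q * (t - y)\<^sup>2 - (K * \<bar>x - y\<bar> + q * (x - y)\<^sup>2)" if "\<bar>t - y\<bar> \<le> s / 8" for t
      using x(2)[of t] that unfolding iv g_def by linarith
    have "\<bar>f' x\<bar> / C - C - lam * M \<le> nonloc_const * (K' * (s / 16) powr (1 - \<sigma>) + L + \<omega> * (s / 16) powr (- \<sigma>))"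
    proof (rule contact_slope_bound[OF u E xin, of f f' "\<bar>x - y\<bar>"])
      show "(f has_real_derivative f' t) (at t)" for t
        unfolding f_def f'_def by (auto intro!: derivative_eq_intros)
      show "continuous_on UNIV f'" unfolding f'_def by (intro continuous_intros)
      show "0 < \<bar>x - y\<bar>" using xney by simp
      fix t assume t: "\<bar>t - x\<bar> < \<bar>x - y\<bar>"
      then have t8: "\<bar>t - y\<bar> \<le> s / 8" using x16 by linarith
      have "sg * (t - y) = \<bar>t - y\<bar>" using t xney by (auto simp: sg_def sgn_real_def)
      then have "f t = K * \<bar>t - y\<bar> + q * (t - y)\<^sup>2" by (simp add: f_def mult.assoc)
      moreover have "f x = K * \<bar>x - y\<bar> + q * (x - y)\<^sup>2" using sg by (simp add: f_def mult.assoc)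
      ultimately show "u (\<gamma> E t) - u (\<gamma> E x) \<le> f t - f x \<and> f t - f x \<le> K' * \<bar>t - x\<bar>"
        using incr[OF t8] gx[OF t8] by simp
    next
      fix z assume z: "z \<in> \<Gamma>" "\<rho> (\<gamma> E x) z < s / 16"
      have "s / 16 \<le> min x (len E - x)" using x16 s y by linarith
      then obtain t where t: "z = \<gamma> E t" "\<bar>t - x\<bar> < s / 16" "\<rho> (\<gamma> E x) z = \<bar>t - x\<bar>"
        using edge_ball[OF E less_imp_le[OF xin(1)] less_imp_le[OF xin(2)] z] by metis
      then have "\<bar>t - y\<bar> \<le> s / 8" using x16 by linarith
      then show "u z - u (\<gamma> E x) \<le> K' * \<rho> (\<gamma> E x) z" using incr[of t] gx[of t] t by simp
    next
      show "\<And>z. z \<in> \<Gamma> \<Longrightarrow> u z - u (\<gamma> E x) \<le> L * \<rho> (\<gamma> E x) z + \<omega>" using osc[OF xy8] .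
    qed (use K' L \<omega> s in auto)
    moreover have "K \<le> \<bar>f' x\<bar>"
    proof -
      have "sg * f' x = K + 2 * q * \<bar>x - y\<bar>" 
      proof -
        have "sg * f' x = K * (sg * sg) + 2 * q * (sg * (x - y))" unfolding f'_def by (simp add: algebra_simps)
        then show ?thesis unfolding sg by simp
      qed
      then have "K \<le> sg * f' x" using W by simp
      also have "\<dots> \<le> \<bar>f' x\<bar>" using sg(2) abs_ge_self[of "sg * f' x"] by (simp add: abs_mult)
      finally show ?thesis .
    qed
    moreover have "nonloc_const * (K' * (s / 16) powr (1 - \<sigma>) + L + \<omega> * (s / 16) powr (- \<sigma>)) \<le>
       K / (2 * C) + nonloc_const * (272 * (\<omega> * s powr (- \<sigma>)) + 257 * L)"
    proof -
      have p1: "(s / 16) powr (1 - \<sigma>) \<le> s powr (1 - \<sigma>)" using s \<sigma> by (intro powr_mono2) auto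
      have p2: "(s / 16) powr (- \<sigma>) \<le> 16 * s powr (- \<sigma>)"
      proof -
        have "(s / 16) powr (- \<sigma>) = s powr (- \<sigma>) * 16 powr \<sigma>" using s by (simp add: powr_divide powr_minus_divide)
        also have "\<dots> \<le> s powr (- \<sigma>) * 16 powr 1" using \<sigma> by (intro mult_left_mono powr_mono) auto
        finally show ?thesis by (simp add: mult.commute)
      qed
      have p3: "s powr (1 - \<sigma>) \<le> 1" using s s0 \<sigma> powr_mono2[of "1 - \<sigma>" s 1] by simp
      have p4: "nonloc_const * s powr (1 - \<sigma>) \<le> 1 / (2 * C)"
        using s0(4) s \<sigma> nonloc_const_pos powr_mono2[of "1 - \<sigma>" s s0] by (smt (verit) mult_left_mono)
      have p5: "s powr (1 - \<sigma>) = s * s powr (- \<sigma>)" using powr_mult_base[of s "- \<sigma>"] s by simp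
      have "K' * (s / 16) powr (1 - \<sigma>) \<le> K' * s powr (1 - \<sigma>)" using p1 K' by (rule mult_left_mono)
      also have "\<dots> = K * s powr (1 - \<sigma>) + 256 * (\<omega> * s powr (- \<sigma>)) + 256 * L * s powr (1 - \<sigma>)"
      proof -
        have "q * (s / 4) * s powr (1 - \<sigma>) = 256 * W * s powr (- \<sigma>)"
          unfolding p5 q_def using s by (simp add: power2_eq_square)
        also have "\<dots> = 256 * (\<omega> * s powr (- \<sigma>)) + 256 * L * s powr (1 - \<sigma>)" unfolding W_def p5 by (simp add: algebra_simps)
        finally show ?thesis by (simp add: K'_def distrib_right)
      qed
      also have "256 * L * s powr (1 - \<sigma>) \<le> 256 * L" using p3 L mult_left_mono[of "s powr (1 - \<sigma>)" 1 "256 * L"] by simp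
      finally have a: "K' * (s / 16) powr (1 - \<sigma>) \<le> K * s powr (1 - \<sigma>) + 256 * (\<omega> * s powr (- \<sigma>)) + 256 * L" by simp
      have b: "\<omega> * (s / 16) powr (- \<sigma>) \<le> 16 * (\<omega> * s powr (- \<sigma>))" using mult_left_mono[OF p2 \<omega>] by simp
      have "nonloc_const * (K' * (s / 16) powr (1 - \<sigma>) + L + \<omega> * (s / 16) powr (- \<sigma>)) \<le>
         nonloc_const * (K * s powr (1 - \<sigma>) + (272 * (\<omega> * s powr (- \<sigma>)) + 257 * L))"
        using a b nonloc_const_pos by (intro mult_left_mono) auto
      also have "\<dots> = K * (nonloc_const * s powr (1 - \<sigma>)) + nonloc_const * (272 * (\<omega> * s powr (- \<sigma>)) + 257 * L)"
        by (simp add: algebra_simps)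
      also have "K * (nonloc_const * s powr (1 - \<sigma>)) \<le> K * (1 / (2 * C))" using p4 K by (intro mult_left_mono) auto
      finally show ?thesis by simp
    qed
    moreover have "K / C \<le> \<bar>f' x\<bar> / C" using \<open>K \<le> \<bar>f' x\<bar>\<close> C_gt_1 by (simp add: divide_right_mono)
    ultimately have "K / C - C - lam * M \<le> K / (2 * C) + nonloc_const * (272 * (\<omega> * s powr (- \<sigma>)) + 257 * L)" by linarith
    then have "K / (2 * C) \<le> Q + 272 * nonloc_const * (\<omega> * s powr (- \<sigma>))" unfolding Q_def by (simp add: field_simps)
    also have "\<dots> < (Q + 272 * nonloc_const + 1) * (1 + \<omega> * s powr (- \<sigma>))"
    proof -
      have nn: "0 \<le> (Q + 1) * (\<omega> * s powr (- \<sigma>))" using Q \<omega> by auto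
      have "(Q + 272 * nonloc_const + 1) * (1 + \<omega> * s powr (- \<sigma>)) =
        Q + 272 * nonloc_const * (\<omega> * s powr (- \<sigma>)) + ((Q + 1) * (\<omega> * s powr (- \<sigma>)) + (1 + 272 * nonloc_const))"
        by (simp add: algebra_simps)
      then show ?thesis using nn nonloc_const_pos by linarith
    qed
    also have "\<dots> = K / (2 * C)" unfolding K_def A_def using C_gt_1 by simp
    finally show False by simp
  qed
  show ?thesis unfolding local_estimate_def using A s0 main by (intro exI[of _ A] exI[of _ s0]) auto
qed

text \<open>Induction over the scales \<open>r1 * (1 / 2) ^ n\<close>: a drop of at most
  \<open>D\<close> times one scale bounds the oscillation at the next, \<open>local_estimate\<close>
  turns this into a slope along the edge, and integrating the slope from the vertex gives the drop
  at the next scale with the same \<open>D\<close>.\<close>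

lemma vertex_lower_bound:
  assumes M: "0 \<le> M"
  shows "\<exists>L \<ge> 0. \<forall>u. csub M u \<longrightarrow> (\<forall>v \<in> verts N \<inter> \<Gamma>. \<forall>z \<in> \<Gamma>. u v - u z \<le> L * \<rho> v z)"
proof -
  obtain L where L: "0 \<le> L" and up: "\<And>u v z. csub M u \<Longrightarrow> v \<in> verts N \<inter> \<Gamma> \<Longrightarrow> z \<in> \<Gamma> \<Longrightarrow> u z - u v \<le> L * \<rho> v z"
    using vertex_upper_bound[OF M] by blast
  obtain A s0 where A: "0 < A" and s0: "0 < s0" "s0 \<le> 1" "s0 \<le> vsep" and le: "local_estimate L M A s0"
    using interior_estimate[OF M L] by blast
  note est = local_estimateD[OF le]
  define c where "c = A / (1 - \<sigma>)"
  have c: "0 < c" using A \<sigma> by (simp add: c_def)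
  \<comment> \<open>At this scale the singular part of the slope integrates to at most a quarter of
    \<open>\<omega>\<close>.\<close>
  obtain r1 where r1: "0 < r1" "r1 \<le> s0 / 4" "c * r1 powr (1 - \<sigma>) \<le> 1 / 4"
  proof
    define r where "r = min (s0 / 4) ((1 / (4 * c)) powr (1 / (1 - \<sigma>)))"
    show "0 < r" "r \<le> s0 / 4" using s0 c by (auto simp: r_def)
    have "r powr (1 - \<sigma>) \<le> ((1 / (4 * c)) powr (1 / (1 - \<sigma>))) powr (1 - \<sigma>)"
      using \<open>0 < r\<close> \<sigma> by (intro powr_mono2) (auto simp: r_def)
    also have "\<dots> = 1 / (4 * c)" using \<sigma> c by (simp add: powr_powr)
    finally have "c * r powr (1 - \<sigma>) \<le> c * (1 / (4 * c))" using c by (intro mult_left_mono) auto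
    then show "c * r powr (1 - \<sigma>) \<le> 1 / 4" using c by simp
  qed
  \<comment> \<open>\<open>2 * M / r1\<close> starts the induction and \<open>2 * (A + L)\<close>
    closes it.\<close>
  define D where "D = 2 * (A + L) + 2 * M / r1"
  have D: "0 < D" "2 * (A + L) \<le> D" "2 * M / r1 \<le> D" using A L M r1 by (auto simp: D_def add_pos_nonneg)
  have edge: "u v - u (\<gamma> E (end_coord E v + end_sign E v * y)) \<le> D * (r1 * (1 / 2) ^ n)"
    if u: "csub M u" and E: "E \<in> Inc N v" and y: "0 \<le> y" "y \<le> r1 * (1 / 2) ^ n" for u v E y n
  proof -
    note E' = Inc_edges[OF E]
    have v: "v \<in> verts N \<inter> \<Gamma>" using Inc_vertex[OF E] by blast
    have uC: "u \<in> C0 N" using u by (simp add: csub_def)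
    define \<eta> where "\<eta> = (\<lambda>t. end_coord E v + end_sign E v * t)"
    define V where "V = (\<lambda>t. u (\<gamma> E (\<eta> t)))"
    have V0: "V 0 = u v" using \<gamma>_end_coord[OF E] by (simp add: V_def \<eta>_def)
    have len: "4 * r1 \<le> len E" using r1 s0 vsep_le_len[OF E'] by linarith
    have G: "\<gamma> E (\<eta> t) \<in> \<Gamma>" if "0 \<le> t" "t \<le> len E" for t
      using \<gamma>_in_\<Gamma>[OF E'] end_shift_bounds(1)[OF that, of v] by (simp add: \<eta>_def)
    have contV: "continuous_on {0..S} V" if "S \<le> len E" for S
      unfolding V_def
      by (rule continuous_on_compose2[OF C0_D[OF uC E'], of _ \<eta>])
         (use end_shift_bounds(1)[of _ E v] that in \<open>auto simp: \<eta>_def intro!: continuous_intros\<close>)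
    show ?thesis using y
    proof (induction n arbitrary: y)
      case 0
      have "u v - u (\<gamma> E (\<eta> y)) \<le> 2 * M" using csub_diff_le[OF u _ G] v 0 len r1 by auto
      also have "\<dots> = (2 * M / r1) * r1" using r1 by simp
      also have "\<dots> \<le> D * r1" using D r1 by (intro mult_right_mono) auto
      finally show ?case by (simp add: \<eta>_def)
    next
      case (Suc n)
      define S where "S = r1 * (1 / 2) ^ Suc n"
      have "S \<le> r1 * 1" unfolding S_def using r1 by (intro mult_left_mono power_le_one) auto
      then have S: "0 < S" "S \<le> r1" "2 * S = r1 * (1 / 2) ^ n"
        using r1 by (auto simp: S_def)
      \<comment> \<open>Up to distance \<open>2 * S\<close> the induction hypothesis bounds the drop
        from \<open>v\<close>, and \<open>up\<close> bounds the rise from \<open>v\<close> to any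
        point; the sum is the admissible jump seen from points near coordinate
        \<open>t\<close>.\<close>
      define \<omega> where "\<omega> = D * (2 * S) + 2 * L * S"
      have \<omega>: "0 \<le> \<omega>" using D L S by (simp add: \<omega>_def)
      have osc: "V 0 - V t \<le> D * (2 * S)" if "0 \<le> t" "t \<le> 2 * S" for t
        using Suc.IH[of t] that S V0 unfolding V_def \<eta>_def by simp
      \<comment> \<open>\<open>local_estimate\<close> is applied at distance \<open>t\<close> with
        scale \<open>s = t\<close>. The resulting slope is singular at the vertex, but it has the
        continuous primitive \<open>P\<close>.\<close>
      define k where "k = (\<lambda>t. A * (1 + \<omega> * t powr (- \<sigma>)))"
      define P where "P = (\<lambda>t. A * (t + \<omega> * (t powr (1 - \<sigma>) / (1 - \<sigma>))))"
      show ?case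
      proof (cases "y = 0")
        case True
        then show ?thesis using D S \<gamma>_end_coord[OF E] unfolding S_def by simp
      next
        case False
        then have y: "0 < y" "y \<le> S" using Suc.prems by (auto simp: S_def)
        have "V 0 - V y \<le> P y - P 0"
        proof (rule left_slope_integrate[OF y(1) contV, of P k])
          show "y \<le> len E" using y S len r1 by linarith
          show "continuous_on {0..y} P" unfolding P_def
            by (intro continuous_on_mult continuous_on_add continuous_on_divide continuous_on_const continuous_on_id continuous_on_powr')
               (use \<sigma> in auto)
          fix t e :: real assume t: "0 < t" "t < y"
          show "(P has_real_derivative k t) (at t)"
          proof -
            have "((\<lambda>t. t powr (1 - \<sigma>) / (1 - \<sigma>)) has_real_derivative t powr (- \<sigma>)) (at t)"
              using DERIV_cdivide[OF has_real_derivative_powr[OF t(1), of "1 - \<sigma>"], of "1 - \<sigma>"] \<sigma> by simp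
            then show ?thesis unfolding P_def k_def by (intro DERIV_cmult DERIV_add DERIV_ident)
          qed
          assume e: "0 < e"
          have tS: "t \<le> S" using t y by linarith
          have bnd: "t \<le> \<eta> t" "\<eta> t \<le> len E - t" using t tS S len r1 by (auto simp: \<eta>_def end_coord_def end_sign_def)
          have loc: "V x - V t \<le> k t * \<bar>x - t\<bar> + 1024 * (\<omega> + L * t) / t\<^sup>2 * (x - t)\<^sup>2" if x: "\<bar>x - t\<bar> \<le> t / 8" for x
          proof -
            have d: "\<eta> x' - \<eta> t = end_sign E v * (x' - t)" for x' by (simp add: \<eta>_def algebra_simps)
            have "u (\<gamma> E (\<eta> x)) - u (\<gamma> E (\<eta> t)) \<le> A * (1 + \<omega> * t powr (- \<sigma>)) * \<bar>\<eta> x - \<eta> t\<bar> + 1024 * (\<omega> + L * t) / t\<^sup>2 * (\<eta> x - \<eta> t)\<^sup>2"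
            proof (rule est[OF u E' t(1) _ bnd \<omega>])
              show "t \<le> s0" using tS S r1 s0 by linarith
              show "\<bar>\<eta> x - \<eta> t\<bar> \<le> t / 8" using x unfolding d by (simp add: abs_mult)
              fix \<xi> z assume \<xi>: "\<bar>\<xi> - \<eta> t\<bar> \<le> t / 8" and z: "z \<in> \<Gamma>"
                define x' where "x' = t + end_sign E v * (\<xi> - \<eta> t)"
                have \<xi>': "\<xi> = \<eta> x'" unfolding x'_def by (simp add: \<eta>_def distrib_left)
                have "\<bar>x' - t\<bar> \<le> t / 8" using \<xi> by (simp add: x'_def abs_mult)
                then have x': "0 \<le> x'" "x' \<le> 2 * S" using tS t by linarith+
                then have x'l: "x' \<le> len E" using S len r1 by linarith
                have \<rho>vx: "\<rho> v (\<gamma> E \<xi>) = x'" using \<rho>_vertex_edge[OF E x'(1) x'l] by (simp add: \<xi>' \<eta>_def)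
                have "u z - u v \<le> L * \<rho> v z" by (rule up[OF u v z])
                also have "\<dots> \<le> L * (2 * S + \<rho> (\<gamma> E \<xi>) z)"
                  using \<rho>_triangle[of v "\<gamma> E \<xi>" z] G[OF x'(1) x'l] z v \<rho>vx x'(2) L \<xi>' by (intro mult_left_mono) auto
                finally have "u z - u v \<le> L * \<rho> (\<gamma> E \<xi>) z + 2 * L * S" by (simp add: algebra_simps)
                moreover have "u v - u (\<gamma> E \<xi>) \<le> D * (2 * S)" using osc[OF x'] V0 by (simp add: V_def \<xi>')
                ultimately show "u z - u (\<gamma> E \<xi>) \<le> L * \<rho> (\<gamma> E \<xi>) z + \<omega>" by (simp add: \<omega>_def)
            qed
            moreover have "\<bar>\<eta> x - \<eta> t\<bar> = \<bar>x - t\<bar>" "(\<eta> x - \<eta> t)\<^sup>2 = (x - t)\<^sup>2"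
              unfolding d by (auto simp: abs_mult power_mult_distrib end_sign_def)
            ultimately show ?thesis by (simp add: V_def k_def)
          qed
          have q: "0 \<le> 1024 * (\<omega> + L * t) / t\<^sup>2" using \<omega> L t by auto
          obtain d where d: "0 < d" "d \<le> t / 8"
            "\<And>h. \<bar>h\<bar> < d \<Longrightarrow> k t * \<bar>h\<bar> + 1024 * (\<omega> + L * t) / t\<^sup>2 * h\<^sup>2 \<le> (k t + e) * \<bar>h\<bar>"
            using quadratic_bound_local[OF q e, of "t / 8" "k t"] t by auto
          show "\<exists>d>0. \<forall>x\<in>{0..y}. t - d < x \<and> x < t \<longrightarrow> V x - V t \<le> (k t + e) * (t - x)"
          proof (intro exI[of _ d] conjI ballI impI d(1))
            fix x assume x: "x \<in> {0..y}" "t - d < x \<and> x < t"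
            then have h: "\<bar>x - t\<bar> < d" "\<bar>x - t\<bar> = t - x" by auto
            then show "V x - V t \<le> (k t + e) * (t - x)" using loc[of x] d(2) d(3)[OF h(1)] by auto
          qed
        qed
        also have "\<dots> = A * y + c * y powr (1 - \<sigma>) * \<omega>" using \<sigma> by (simp add: P_def c_def algebra_simps)
        also have "\<dots> \<le> A * S + 1 / 4 * \<omega>"
        proof (intro add_mono mult_left_mono mult_right_mono)
          have "y powr (1 - \<sigma>) \<le> r1 powr (1 - \<sigma>)" using y S \<sigma> by (intro powr_mono2) auto
          then show "c * y powr (1 - \<sigma>) \<le> 1 / 4" using r1(3) c by (smt (verit) mult_left_mono)
        qed (use A y \<omega> in auto)
        also have "\<dots> \<le> (A + L) * S + D * S / 2" 
        proof -
          have "0 \<le> L * S" using L S(1) by simp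
          then show ?thesis unfolding \<omega>_def by (simp add: algebra_simps)
        qed
        also have "\<dots> \<le> D * S" 
        proof -
          have "2 * (A + L) * S \<le> D * S" using D(2) S(1) by (intro mult_right_mono) auto
          then show ?thesis by (simp add: algebra_simps)
        qed
        finally show ?thesis unfolding V0 by (simp add: V_def \<eta>_def S_def)
      qed
    qed
  qed
  have "u v - u z \<le> 2 * D * \<rho> v z" if u: "csub M u" and v: "v \<in> verts N" "v \<in> \<Gamma>" and z: "z \<in> \<Gamma>" for u v z
  proof (cases "z = v")
    case True
    then show ?thesis using v by simp
  next
    case False
    then have pos: "0 < \<rho> v z" using \<rho>_eq_0_iff[OF v(2) z] by (auto simp: less_le)
    show ?thesis
    proof (cases "\<rho> v z < r1")
      case False
      have "u v - u z \<le> 2 * M" using csub_diff_le[OF u v(2) z] .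
      also have "\<dots> = (2 * M / r1) * r1" using r1 by simp
      also have "\<dots> \<le> D * \<rho> v z" using D r1 False by (intro mult_mono) auto
      also have "\<dots> \<le> 2 * D * \<rho> v z" using D pos by simp
      finally show ?thesis .
    next
      case True
      have rv: "r1 \<le> vsep" using r1(1,2) s0(1,3) by linarith
      obtain E t where E: "E \<in> Inc N v" "0 \<le> t" "t < len E" "t = \<rho> v z" "z = \<gamma> E (end_coord E v + end_sign E v * t)"
        using vertex_ball[OF v z True rv] by blast
      have "(\<lambda>n. r1 * (1 / 2) ^ Suc n) \<longlonglongrightarrow> r1 * 0"
        by (intro tendsto_mult_left LIMSEQ_Suc LIMSEQ_power_zero) simp
      then have "\<forall>\<^sub>F n in sequentially. r1 * (1 / 2) ^ Suc n < \<rho> v z"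
        by (rule order_tendstoD(2)) (use pos in simp)
      then have ex: "\<exists>n. r1 * (1 / 2) ^ Suc n < \<rho> v z"
        unfolding eventually_sequentially by blast
      \<comment> \<open>The dyadic scale that is at least \<open>\<rho> v z\<close> and less than
        twice as large, which explains the constant \<open>2 * D\<close>.\<close>
      define n where "n = (LEAST n. r1 * (1 / 2) ^ Suc n < \<rho> v z)"
      have n: "r1 * (1 / 2) ^ Suc n < \<rho> v z" unfolding n_def using ex by (rule LeastI_ex)
      have "\<rho> v z \<le> r1 * (1 / 2) ^ n"
      proof (cases n)
        case (Suc m)
        then have "\<not> r1 * (1 / 2) ^ Suc m < \<rho> v z" using not_less_Least[of m "\<lambda>n. r1 * (1 / 2) ^ Suc n < \<rho> v z"] n_def by auto
        then show ?thesis using Suc by simp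
      qed (use True in simp)
      then have "t \<le> r1 * (1 / 2) ^ n" unfolding E(4) .
      from edge[OF u E(1,2) this] have "u v - u z \<le> D * (r1 * (1 / 2) ^ n)" unfolding E(5)[symmetric] .
      also have "\<dots> \<le> D * (2 * \<rho> v z)" using n D by (intro mult_left_mono) auto
      finally show ?thesis by simp
    qed
  qed
  then show ?thesis using D by (intro exI[of _ "2 * D"]) auto
qed

text \<open>Near an end the scale is the distance \<open>m\<close> to it, and the vertex bounds give
  the jump \<open>\<omega> = 2 * (L + L') * m\<close>, so that
  \<open>\<omega> * m powr (- \<sigma>)\<close> stays bounded. Far from the ends the scale
  \<open>s0\<close> and the jump \<open>2 * M\<close> do. The slope \<open>k\<close> covers both
  cases.\<close>

lemma csub_lipschitz:
  assumes M: "0 \<le> M"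
  shows "\<exists>L. \<forall>u. csub M u \<longrightarrow> \<rho>_lipschitz L u"
proof -
  obtain L where L: "0 \<le> L" and up: "\<And>u v z. csub M u \<Longrightarrow> v \<in> verts N \<inter> \<Gamma> \<Longrightarrow> z \<in> \<Gamma> \<Longrightarrow> u z - u v \<le> L * \<rho> v z"
    using vertex_upper_bound[OF M] by blast
  obtain L' where L': "0 \<le> L'" and lo: "\<And>u v z. csub M u \<Longrightarrow> v \<in> verts N \<inter> \<Gamma> \<Longrightarrow> z \<in> \<Gamma> \<Longrightarrow> u v - u z \<le> L' * \<rho> v z"
    using vertex_lower_bound[OF M] by blast
  obtain A s0 where A: "0 < A" and s0: "0 < s0" "s0 \<le> 1" "s0 \<le> vsep" and le: "local_estimate L M A s0"
    using interior_estimate[OF M L] by blast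
  note est = local_estimateD[OF le]
  define k where "k = A * (1 + 2 * (L + L') + 2 * M * s0 powr (- \<sigma>))"
  have k: "0 \<le> k" using A L L' M by (simp add: k_def)
  have loc: "\<exists>s > 0. \<exists>q \<ge> 0. \<forall>x. \<bar>x - y\<bar> \<le> s / 8 \<longrightarrow> u (\<gamma> E x) - u (\<gamma> E y) \<le> k * \<bar>x - y\<bar> + q * (x - y)\<^sup>2"
    if u: "csub M u" and E: "E \<in> edges N" and y: "0 < y" "y < len E" for u E y
  proof -
    define m where "m = min y (len E - y)"
    have m: "0 < m" "m \<le> y" "y \<le> len E - m" using y by (auto simp: m_def)
    have "\<exists>s \<omega>. 0 < s \<and> s \<le> s0 \<and> s \<le> m \<and> 0 \<le> \<omega> \<and> A * (1 + \<omega> * s powr (- \<sigma>)) \<le> k \<and>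
      (\<forall>x. \<bar>x - y\<bar> \<le> s / 8 \<longrightarrow> (\<forall>z \<in> \<Gamma>. u z - u (\<gamma> E x) \<le> L * \<rho> (\<gamma> E x) z + \<omega>))"
    proof (cases "m \<le> s0")
      case True
      obtain v where v: "E \<in> Inc N v" "\<bar>y - end_coord E v\<bar> = m"
      proof (cases "y \<le> len E - y")
        case True
        then show ?thesis using that[of "src E"] E y by (auto simp: Inc_def end_coord_def m_def)
      next
        case False
        then show ?thesis using that[of "tgt E"] E y edge_ends(1)[OF E] by (auto simp: Inc_def end_coord_def m_def)
      qed
      have vV: "v \<in> verts N \<inter> \<Gamma>" using Inc_vertex[OF v(1)] by blast
      define \<omega> where "\<omega> = 2 * (L + L') * m"
      have "A * (1 + \<omega> * m powr (- \<sigma>)) \<le> k" unfolding k_def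
      proof (rule mult_left_mono)
        have "m * m powr (- \<sigma>) = m powr (1 - \<sigma>)" using powr_mult_base[of m "- \<sigma>"] m by simp
        also have "\<dots> \<le> 1" using powr_mono2[of "1 - \<sigma>" m 1] m True s0 \<sigma> by simp
        finally have "2 * (L + L') * (m * m powr (- \<sigma>)) \<le> 2 * (L + L') * 1" using L L' by (intro mult_left_mono) auto
        moreover have "0 \<le> 2 * M * s0 powr (- \<sigma>)" using M by simp
        ultimately show "1 + \<omega> * m powr (- \<sigma>) \<le> 1 + 2 * (L + L') + 2 * M * s0 powr (- \<sigma>)" by (simp add: \<omega>_def mult.assoc)
      qed (use A in auto)
      moreover have "u z - u (\<gamma> E x) \<le> L * \<rho> (\<gamma> E x) z + \<omega>" if x: "\<bar>x - y\<bar> \<le> m / 8" and z: "z \<in> \<Gamma>" for x z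
      proof -
        have xl: "0 \<le> x" "x \<le> len E" using x m by linarith+
        have vx: "\<rho> v (\<gamma> E x) \<le> 2 * m"
        proof -
          have "\<rho> v (\<gamma> E x) = \<bar>end_coord E v - x\<bar>"
            using \<rho>_edge[OF E end_coord_bounds xl, of v] \<gamma>_end_coord[OF v(1)] by simp
          then show ?thesis using v(2) x m(1) by linarith
        qed
        have "u z - u v \<le> L * (\<rho> v (\<gamma> E x) + \<rho> (\<gamma> E x) z)"
          using up[OF u vV z] mult_left_mono[OF \<rho>_triangle[of v "\<gamma> E x" z] L] vV z \<gamma>_in_\<Gamma>[OF E xl] by auto
        also have "\<dots> \<le> L * (2 * m + \<rho> (\<gamma> E x) z)" using vx L by (intro mult_left_mono) auto
        finally have "u z - u v \<le> L * \<rho> (\<gamma> E x) z + 2 * L * m" by (simp add: algebra_simps)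
        moreover have "u v - u (\<gamma> E x) \<le> L' * (2 * m)"
          using lo[OF u vV \<gamma>_in_\<Gamma>[OF E xl]] mult_left_mono[OF vx L'] by linarith
        ultimately show ?thesis by (simp add: \<omega>_def algebra_simps)
      qed
      ultimately show ?thesis using m True L L' by (intro exI[of _ m] exI[of _ \<omega>]) (auto simp: \<omega>_def)
    next
      case False
      have "A * (1 + 2 * M * s0 powr (- \<sigma>)) \<le> k" unfolding k_def using A L L' by (intro mult_left_mono) auto
      moreover have "u z - u (\<gamma> E x) \<le> L * \<rho> (\<gamma> E x) z + 2 * M" if x: "\<bar>x - y\<bar> \<le> s0 / 8" and z: "z \<in> \<Gamma>" for x z
      proof -
        have "0 \<le> x" "x \<le> len E" using x m False s0 by linarith+
        then show ?thesis using csub_diff_le[OF u z \<gamma>_in_\<Gamma>[OF E]] L by (intro order.trans[OF _ add_increasing[OF _ order_refl]]) auto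
      qed
      ultimately show ?thesis using s0 False M by (intro exI[of _ s0] exI[of _ "2 * M"]) auto
    qed
    then obtain s \<omega> where s: "0 < s" "s \<le> s0" "s \<le> m" "0 \<le> \<omega>" "A * (1 + \<omega> * s powr (- \<sigma>)) \<le> k"
      "\<forall>x. \<bar>x - y\<bar> \<le> s / 8 \<longrightarrow> (\<forall>z \<in> \<Gamma>. u z - u (\<gamma> E x) \<le> L * \<rho> (\<gamma> E x) z + \<omega>)" by blast
    have "u (\<gamma> E x) - u (\<gamma> E y) \<le> k * \<bar>x - y\<bar> + 1024 * (\<omega> + L * s) / s\<^sup>2 * (x - y)\<^sup>2" if "\<bar>x - y\<bar> \<le> s / 8" for x
    proof -
      have "s \<le> y" "y \<le> len E - s" using s(3) m by auto
      from est[OF u E s(1,2) this s(4) s(6)[rule_format] that] mult_right_mono[OF s(5), of "\<bar>x - y\<bar>"] show ?thesis by simp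
    qed
    moreover have "0 \<le> 1024 * (\<omega> + L * s) / s\<^sup>2" using s L by simp
    ultimately show ?thesis using s(1) by blast
  qed
  have "\<rho>_lipschitz (max k (2 * M / vsep)) u" if u: "csub M u" for u
  proof (rule \<rho>_lipschitzI[OF _ _ M k])
    have mono: "\<bar>u (\<gamma> E a) - u (\<gamma> E b)\<bar> \<le> k * (b - a)" if E: "E \<in> edges N" and ab: "0 \<le> a" "a \<le> b" "b \<le> len E" for E a b
    proof (rule lipschitz_from_local[of a b "\<lambda>t. u (\<gamma> E t)"])
      show "continuous_on {a..b} (\<lambda>t. u (\<gamma> E t))"
        using u ab unfolding csub_def by (intro continuous_on_subset[OF C0_D[OF _ E]]) auto
      fix y e :: real assume y: "a < y" "y < b" and e: "0 < e"
      then obtain s q where s: "0 < s" "0 \<le> q" "\<And>x. \<bar>x - y\<bar> \<le> s / 8 \<Longrightarrow> u (\<gamma> E x) - u (\<gamma> E y) \<le> k * \<bar>x - y\<bar> + q * (x - y)\<^sup>2"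
        using loc[OF u E, of y] ab by auto
      obtain d where d: "0 < d" "d \<le> s / 8" "\<And>h. \<bar>h\<bar> < d \<Longrightarrow> k * \<bar>h\<bar> + q * h\<^sup>2 \<le> (k + e) * \<bar>h\<bar>"
        using quadratic_bound_local[OF s(2) e, of "s / 8" k] s(1) by auto
      show "\<exists>d>0. \<forall>x\<in>{a..b}. \<bar>x - y\<bar> < d \<longrightarrow> u (\<gamma> E x) - u (\<gamma> E y) \<le> (k + e) * \<bar>x - y\<bar>"
      proof (intro exI[of _ d] conjI ballI impI d(1))
        fix x assume "\<bar>x - y\<bar> < d"
        then show "u (\<gamma> E x) - u (\<gamma> E y) \<le> (k + e) * \<bar>x - y\<bar>" using s(3)[of x] d(2) d(3)[of "x - y"] by linarith
      qed
    qed (use ab in auto)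
    fix E a b assume "E \<in> edges N" "0 \<le> a" "a \<le> len E" "0 \<le> b" "b \<le> len E"
    then show "\<bar>u (\<gamma> E a) - u (\<gamma> E b)\<bar> \<le> k * \<bar>a - b\<bar>"
      using mono[of E a b] mono[of E b a] by (cases "a \<le> b") (auto simp: abs_minus_commute)
  qed (use u in \<open>auto simp: csub_def\<close>)
  then show ?thesis by blast
qed

end

subsection \<open>Perron's method\<close>

lemma directional_derivative_nonneg:
  fixes f :: "real \<Rightarrow> real"
  assumes D: "(f has_real_derivative D) (at s within {0..a})" and \<epsilon>: "\<epsilon> \<in> {1, -1}" and d: "0 < d"
    and ge: "\<And>t. 0 < t \<Longrightarrow> t < d \<Longrightarrow> s + \<epsilon> * t \<in> {0..a} \<and> f s \<le> f (s + \<epsilon> * t)"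
  shows "0 \<le> \<epsilon> * D"
proof -
  define t where "t = (\<lambda>n. d / real (Suc (Suc n)))"
  have t: "0 < t n" "t n < d" for n using d by (auto simp: t_def divide_simps)
  have "t \<longlonglongrightarrow> 0" unfolding t_def
    using LIMSEQ_Suc[OF lim_const_over_n[of d]] LIMSEQ_Suc[of "\<lambda>n. d / real (Suc n)"] by simp
  then have lim: "(\<lambda>n. s + \<epsilon> * t n) \<longlonglongrightarrow> s + \<epsilon> * 0" by (intro tendsto_intros)
  have q: "((\<lambda>y. (f y - f s) / (y - s)) \<longlongrightarrow> D) (at s within {0..a})"
    using D by (simp add: has_field_derivative_iff)
  have "filterlim (\<lambda>n. s + \<epsilon> * t n) (at s within {0..a}) sequentially"
    unfolding filterlim_at using lim ge t \<epsilon> by (auto simp: less_imp_neq[symmetric] intro!: always_eventually)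
  then have "(\<lambda>n. (f (s + \<epsilon> * t n) - f s) / (s + \<epsilon> * t n - s)) \<longlonglongrightarrow> D"
    by (rule filterlim_compose[OF q])
  then have "(\<lambda>n. \<epsilon> * ((f (s + \<epsilon> * t n) - f s) / (s + \<epsilon> * t n - s))) \<longlonglongrightarrow> \<epsilon> * D"
    by (rule tendsto_mult_left)
  moreover have "0 \<le> \<epsilon> * ((f (s + \<epsilon> * t n) - f s) / (s + \<epsilon> * t n - s))" for n
    using ge[OF t, of n] t(1)[of n] \<epsilon> by (auto simp: divide_simps)
  ultimately show ?thesis by (intro LIMSEQ_le_const) auto
qed

section \<open>Neighbourhoods of a point and strict test functions\<close>

context network
begin

text \<open>Limit arguments at \<open>x\<close> produce contact points close to \<open>x\<close>;
  these are \<open>x\<close> itself or interior points of edges that reach \<open>x\<close>.\<close>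

lemma near_point:
  assumes x: "x \<in> \<Gamma>"
  shows "\<exists>r>0. \<forall>y \<in> \<Gamma>. \<rho> x y < r \<longrightarrow> (y \<in> verts N \<longrightarrow> y = x) \<and>
    (\<forall>E t. E \<in> edges N \<longrightarrow> 0 \<le> t \<longrightarrow> t \<le> len E \<longrightarrow> y = \<gamma> E t \<longrightarrow> (\<exists>s. 0 \<le> s \<and> s \<le> len E \<and> x = \<gamma> E s))"
proof (cases "x \<in> verts N")
  case True
  have "(y \<in> verts N \<longrightarrow> y = x) \<and>
    (\<forall>E t. E \<in> edges N \<longrightarrow> 0 \<le> t \<longrightarrow> t \<le> len E \<longrightarrow> y = \<gamma> E t \<longrightarrow> (\<exists>s. 0 \<le> s \<and> s \<le> len E \<and> x = \<gamma> E s))"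
    if y: "y \<in> \<Gamma>" "\<rho> x y < vsep" for y
  proof (cases "y = x")
    case False
    obtain E t where E: "E \<in> Inc N x" "0 \<le> t" "t < len E" "t = \<rho> x y" "y = \<gamma> E (end_coord E x + end_sign E x * t)"
      using vertex_ball[OF True x y order_refl] by blast
    note E' = Inc_edges[OF E(1)]
    have t: "0 < t" using \<rho>_eq_0_iff[OF x y(1)] False E(2,4) by (auto simp: less_le)
    define c where "c = end_coord E x + end_sign E x * t"
    have c: "0 < c" "c < len E" using end_shift_bounds(2)[OF t E(3), of x] by (auto simp: c_def)
    have yc: "y = \<gamma> E c" using E(5) unfolding c_def .
    have yE: "y \<in> E" unfolding yc by (rule \<gamma>_interior[OF E' c])
    then have "y \<notin> verts N" using edge_no_verts[OF E'] by blast
    moreover have "F = E" if "F \<in> edges N" "0 \<le> r" "r \<le> len F" "y = \<gamma> F r" for F r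
      using \<gamma>_in_edge_eq[OF E' that(1-3)] yE that(4) by simp
    ultimately show ?thesis using end_coord_bounds[of E x] \<gamma>_end_coord[OF E(1)] by metis
  qed blast
  then show ?thesis using vsep_pos by blast
next
  case False
  then obtain E s where E: "E \<in> edges N" "0 < s" "s < len E" "x = \<gamma> E s" using \<Gamma>_cases[OF x] by metis
  have "(y \<in> verts N \<longrightarrow> y = x) \<and>
    (\<forall>F t. F \<in> edges N \<longrightarrow> 0 \<le> t \<longrightarrow> t \<le> len F \<longrightarrow> y = \<gamma> F t \<longrightarrow> (\<exists>s. 0 \<le> s \<and> s \<le> len F \<and> x = \<gamma> F s))"
    if y: "y \<in> \<Gamma>" "\<rho> x y < min s (len E - s)" for y
  proof -
    obtain t where t: "0 < t" "t < len E" "y = \<gamma> E t"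
      using edge_ball[OF E(1) less_imp_le[OF E(2)] less_imp_le[OF E(3)] y(1) y(2)[unfolded E(4)] order_refl] by blast
    have yE: "y \<in> E" unfolding t(3) by (rule \<gamma>_interior[OF E(1) t(1,2)])
    then have "y \<notin> verts N" using edge_no_verts[OF E(1)] by blast
    moreover have "F = E" if "F \<in> edges N" "0 \<le> r" "r \<le> len F" "y = \<gamma> F r" for F r
      using \<gamma>_in_edge_eq[OF E(1) that(1-3)] yE that(4) by simp
    ultimately show ?thesis using E by (metis less_imp_le)
  qed
  moreover have "0 < min s (len E - s)" using E by simp
  ultimately show ?thesis by blast
qed

text \<open>Subtracting such a \<open>Q\<close> from a test function makes contact points unique.\<close>

lemma strict_minimum:
  assumes x: "x \<in> \<Gamma>"
  obtains Q r where "Q \<in> C1 N" "0 < r" "Q x = 0" "\<And>y. y \<in> \<Gamma> \<Longrightarrow> 0 \<le> Q y"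
    "\<And>y. y \<in> \<Gamma> \<Longrightarrow> y \<noteq> x \<Longrightarrow> \<rho> x y < r \<Longrightarrow> 0 < Q y"
    "\<And>E s. E \<in> edges N \<Longrightarrow> 0 \<le> s \<Longrightarrow> s \<le> len E \<Longrightarrow> x = \<gamma> E s \<Longrightarrow> slope E Q s = 0"
proof (cases "x \<in> verts N")
  case True
  \<comment> \<open>This function has a double zero at every vertex, in particular at
    \<open>x\<close>, and is positive inside the edges.\<close>
  obtain Q where Q: "Q \<in> C1 N" "\<And>E t. E \<in> edges N \<Longrightarrow> 0 \<le> t \<Longrightarrow> t \<le> len E \<Longrightarrow> Q (\<gamma> E t) = (t * (len E - t))\<^sup>2"
    "\<And>E t. E \<in> edges N \<Longrightarrow> 0 \<le> t \<Longrightarrow> t \<le> len E \<Longrightarrow> slope E Q t = 2 * (t * (len E - t)) * (len E - 2 * t)"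
  proof (rule C1_exists[of "\<lambda>E t. (t * (len E - t))\<^sup>2" "\<lambda>_. 0" "\<lambda>E t. 2 * (t * (len E - t)) * (len E - 2 * t)"])
    show "((\<lambda>t. (t * (len E - t))\<^sup>2) has_real_derivative 2 * (t * (len E - t)) * (len E - 2 * t)) (at t within {0..len E})" for E t
      by (auto intro!: derivative_eq_intros simp: algebra_simps power2_eq_square)
  qed (auto intro!: continuous_intros)
  show thesis
  proof (rule that[OF Q(1) vsep_pos])
    show z: "slope E Q s = 0" if "E \<in> edges N" "0 \<le> s" "s \<le> len E" "x = \<gamma> E s" for E s
      using Q(3)[OF that(1-3)] \<gamma>_vertex_iff[OF that(1-3)] True that(4) by auto
    show "Q x = 0"
      using \<Gamma>_point[OF x] Q(2) \<gamma>_vertex_iff True by (metis diff_self mult_zero_left mult_zero_right power_zero_numeral)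
    show "0 \<le> Q y" if "y \<in> \<Gamma>" for y using \<Gamma>_point[OF that] Q(2) by (metis zero_le_power2)
    show "0 < Q y" if y: "y \<in> \<Gamma>" "y \<noteq> x" "\<rho> x y < vsep" for y
    proof -
      obtain E t where E: "E \<in> Inc N x" "0 \<le> t" "t < len E" "t = \<rho> x y" "y = \<gamma> E (end_coord E x + end_sign E x * t)"
        using vertex_ball[OF True x y(1,3) order_refl] by blast
      have t: "0 < t" using \<rho>_eq_0_iff[OF x y(1)] y(2) E(2,4) by (auto simp: less_le)
      define c where "c = end_coord E x + end_sign E x * t"
      have c: "0 < c" "c < len E" using end_shift_bounds(2)[OF t E(3), of x] by (auto simp: c_def)
      have "y = \<gamma> E c" using E(5) unfolding c_def .
      then show ?thesis using Q(2)[OF Inc_edges[OF E(1)], of c] c by simp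
    qed
  qed
next
  case False
  then obtain E s where E: "E \<in> edges N" "0 < s" "s < len E" "x = \<gamma> E s" using \<Gamma>_cases[OF x] by metis
  \<comment> \<open>The factor \<open>t * (len E - t)\<close> lets the function glue with
    \<open>0\<close> on the other edges, and \<open>t - s\<close> puts a double zero at
    \<open>x\<close>.\<close>
  define g where "g = (\<lambda>F t. if F = E then ((t - s) * (t * (len E - t)))\<^sup>2 else 0)"
  define g' where "g' = (\<lambda>F t. if F = E then 2 * ((t - s) * (t * (len E - t))) * (t * (len E - t) + (t - s) * (len E - 2 * t)) else 0)"
  obtain Q where Q: "Q \<in> C1 N" "\<And>F t. F \<in> edges N \<Longrightarrow> 0 \<le> t \<Longrightarrow> t \<le> len F \<Longrightarrow> Q (\<gamma> F t) = g F t"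
    "\<And>F t. F \<in> edges N \<Longrightarrow> 0 \<le> t \<Longrightarrow> t \<le> len F \<Longrightarrow> slope F Q t = g' F t"
  proof (rule C1_exists[of g "\<lambda>_. 0" g'])
    show "(g F has_real_derivative g' F t) (at t within {0..len F})" for F t
    proof (cases "F = E")
      case True
      have "((\<lambda>t. ((t - s) * (t * (len E - t)))\<^sup>2) has_real_derivative
        2 * ((t - s) * (t * (len E - t))) * (t * (len E - t) + (t - s) * (len E - 2 * t))) (at t within {0..len F})"
        by (auto intro!: derivative_eq_intros simp: algebra_simps power2_eq_square)
      then show ?thesis using True by (simp add: g_def g'_def)
    qed (simp add: g_def g'_def)
    show "continuous_on {0..len F} (g' F)" for F
      unfolding g'_def by (cases "F = E") (auto intro!: continuous_intros)
  qed (auto simp: g_def)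
  show thesis
  proof (rule that[OF Q(1)])
    show "0 < min s (len E - s)" using E by simp
    show "Q x = 0" using Q(2)[OF E(1), of s] E by (simp add: g_def)
    show "0 \<le> Q y" if "y \<in> \<Gamma>" for y using \<Gamma>_point[OF that] Q(2) by (auto simp: g_def)
    show "slope F Q t = 0" if "F \<in> edges N" "0 \<le> t" "t \<le> len F" "x = \<gamma> F t" for F t
    proof (cases "F = E")
      case True
      then have "t = s" using that E \<gamma>_eq_iff[OF E(1)] by metis
      then show ?thesis using Q(3)[OF that(1-3)] True by (simp add: g'_def)
    qed (use Q(3)[OF that(1-3)] in \<open>simp add: g'_def\<close>)
    show "0 < Q y" if y: "y \<in> \<Gamma>" "y \<noteq> x" "\<rho> x y < min s (len E - s)" for y
    proof -
      obtain t where t: "0 < t" "t < len E" "y = \<gamma> E t"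
        using edge_ball[OF E(1) less_imp_le[OF E(2)] less_imp_le[OF E(3)] y(1) y(3)[unfolded E(4)] order_refl] by blast
      have "t \<noteq> s" using y(2) t(3) E(4) by auto
      then show ?thesis using Q(2)[OF E(1), of t] t by (simp add: g_def)
    qed
  qed
qed

end

section \<open>Barriers, stability and maximality of subsolutions\<close>

context hj_network
begin

lemma nonloc_const_fun: "nonloc N \<nu> E \<Gamma> (\<lambda>_. c) x = 0"
  unfolding nonloc_def by (simp add: set_lebesgue_integral_def)

lemma \<rho>_lipschitz_const: "\<rho>_lipschitz 0 (\<lambda>_. c)" by (simp add: \<rho>_lipschitz_def)

lemma sum_verts_bound: "v \<in> verts N \<Longrightarrow> \<bar>b v\<bar> \<le> (\<Sum>v \<in> verts N. \<bar>b v\<bar>)" for b :: "'a \<Rightarrow> real"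
  by (rule member_le_sum[of v _ "\<lambda>v. \<bar>b v\<bar>"]) auto

lemma slope_local_min:
  assumes \<phi>: "\<phi> \<in> C1 N" and E: "E \<in> edges N" and s: "0 \<le> s" "s \<le> len E" and \<epsilon>: "\<epsilon> \<in> {1, -1}" and d: "0 < d"
    and g: "(g has_real_derivative D) (at s within {0..len E})"
    and ge: "\<And>t. 0 < t \<Longrightarrow> t < d \<Longrightarrow> s + \<epsilon> * t \<in> {0..len E} \<and> \<phi> (\<gamma> E s) - g s \<le> \<phi> (\<gamma> E (s + \<epsilon> * t)) - g (s + \<epsilon> * t)"
  shows "\<epsilon> * D \<le> \<epsilon> * slope E \<phi> s"
proof -
  have "((\<lambda>t. \<phi> (\<gamma> E t) - g t) has_real_derivative slope E \<phi> s - D) (at s within {0..len E})"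
    using C1_slope(1)[OF \<phi> E, of s] s g by (intro derivative_intros) auto
  from directional_derivative_nonneg[OF this \<epsilon> d ge] show ?thesis by (simp add: algebra_simps)
qed

lemma interior_slope_eq:
  assumes \<phi>: "\<phi> \<in> C1 N" and E: "E \<in> edges N" and s: "0 < s" "s < len E" and d: "0 < d"
    and g: "(g has_real_derivative D) (at s within {0..len E})"
    and ge: "\<And>t. 0 \<le> t \<Longrightarrow> t \<le> len E \<Longrightarrow> \<bar>t - s\<bar> < d \<Longrightarrow> \<phi> (\<gamma> E s) - g s \<le> \<phi> (\<gamma> E t) - g t"
  shows "slope E \<phi> s = D"
proof -
  define d' where "d' = min d (min s (len E - s))"
  have d': "0 < d'" using d s by (simp add: d'_def)
  have "\<epsilon> * D \<le> \<epsilon> * slope E \<phi> s" if "\<epsilon> \<in> {1, -1}" for \<epsilon>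
  proof (rule slope_local_min[OF \<phi> E less_imp_le[OF s(1)] less_imp_le[OF s(2)] that d' g])
    fix t assume t: "0 < t" "t < d'"
    then have "0 \<le> s + \<epsilon> * t" "s + \<epsilon> * t \<le> len E" "\<bar>s + \<epsilon> * t - s\<bar> < d"
      using that s by (auto simp: d'_def abs_mult)
    then show "s + \<epsilon> * t \<in> {0..len E} \<and> \<phi> (\<gamma> E s) - g s \<le> \<phi> (\<gamma> E (s + \<epsilon> * t)) - g (s + \<epsilon> * t)"
      using ge[of "s + \<epsilon> * t"] by auto
  qed
  from this[of 1] this[of "-1"] show ?thesis by simp
qed

lemma inward_slope_ge:
  assumes \<phi>: "\<phi> \<in> C1 N" and E: "E \<in> Inc N v" and d: "0 < d"
    and g: "(g has_real_derivative D) (at (end_coord E v) within {0..len E})"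
    and ge: "\<And>t. 0 \<le> t \<Longrightarrow> t \<le> len E \<Longrightarrow> \<bar>t - end_coord E v\<bar> < d \<Longrightarrow> \<phi> v - g (end_coord E v) \<le> \<phi> (\<gamma> E t) - g t"
  shows "end_sign E v * D \<le> end_sign E v * slope E \<phi> (end_coord E v)"
proof (rule slope_local_min[OF \<phi> Inc_edges[OF E] end_coord_bounds _ _ g])
  show "end_sign E v \<in> {1, -1}" by (simp add: end_sign_def)
  show "0 < min d (len E)" using d len_pos[OF Inc_edges[OF E]] by simp
  fix t assume t: "0 < t" "t < min d (len E)"
  then have "0 \<le> end_coord E v + end_sign E v * t" "end_coord E v + end_sign E v * t \<le> len E"
    using end_shift_bounds(1)[of t E v] by auto
  then show "end_coord E v + end_sign E v * t \<in> {0..len E} \<and>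
     \<phi> (\<gamma> E (end_coord E v)) - g (end_coord E v) \<le> \<phi> (\<gamma> E (end_coord E v + end_sign E v * t)) - g (end_coord E v + end_sign E v * t)"
    using ge[of "end_coord E v + end_sign E v * t"] t \<gamma>_end_coord[OF E] by (auto simp: abs_mult)
qed

text \<open>A test function touching a constant from above has nonnegative inward slopes. At an
  inner vertex either one of them is at most \<open>b\<close>, and the equation holds for large
  \<open>K\<close>, or all exceed \<open>b\<close>, and the Kirchhoff inequality holds. At the
  boundary \<open>- K\<close> lies below the data.\<close>

lemma constant_subsolution: "\<exists>K. visc_gen 1 (\<lambda>_. - K)"
proof -
  define b where "b = (\<Sum>v \<in> verts N. \<bar>B v\<bar>)"
  define K where "K = C * (1 + b) / lam + (\<Sum>v \<in> verts N. \<bar>h v\<bar>)"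
  have b: "0 \<le> b" unfolding b_def by (rule sum_nonneg) auto
  have K: "C * (1 + b) \<le> lam * K"
  proof -
    have "0 \<le> lam * (\<Sum>v \<in> verts N. \<bar>h v\<bar>)" using lam_pos by (intro mult_nonneg_nonneg sum_nonneg) auto
    moreover have "lam * (C * (1 + b) / lam) = C * (1 + b)" using lam_pos by simp
    ultimately show ?thesis unfolding K_def distrib_left by linarith
  qed
  have G: "LG (\<lambda>_. - K) x E p \<le> 0" if "E \<in> edges N" "x \<in> closure E" "\<bar>p\<bar> \<le> b" for x E p
  proof -
    have "H E x p \<le> C * (1 + b)" using H_upper[OF that(1,2), of p] that(3) C_gt_1 by (smt (verit) mult_left_mono)
    then show ?thesis using K by (simp add: LG_def nonloc_const_fun)
  qed
  have "visc_lip 1 (\<lambda>_. - K)"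
    unfolding visc_lip_def
  proof (intro ballI allI impI)
    fix x \<delta> \<phi> assume x: "x \<in> \<Gamma>" and \<phi>: "\<phi> \<in> C1 N" and "touches 1 (\<lambda>_. - K) \<phi> x \<delta>"
    then have \<delta>: "0 < \<delta>" "\<And>y. y \<in> \<Gamma> \<Longrightarrow> \<rho> x y < \<delta> \<Longrightarrow> \<phi> x \<le> \<phi> y" by (auto simp: touches_def geo_ball_def)
    have c: "((\<lambda>_. 0) has_real_derivative 0) F" for F :: "real filter" by simp
    show "visc_cond 1 (LG (\<lambda>_. - K) x) (\<lambda>_. - K) x \<phi>"
      unfolding visc_cond_def
    proof (intro conjI ballI allI impI)
      fix E s assume E: "E \<in> edges N" and s: "0 < s \<and> s < len E \<and> x = \<gamma> E s"
      have "slope E \<phi> s = 0"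
      proof (rule interior_slope_eq[OF \<phi> E _ _ \<delta>(1) c])
        show "0 < s" "s < len E" using s by auto
        fix t assume "0 \<le> t" "t \<le> len E" "\<bar>t - s\<bar> < \<delta>"
        then show "\<phi> (\<gamma> E s) - 0 \<le> \<phi> (\<gamma> E t) - 0"
          using \<delta>(2)[OF \<gamma>_in_\<Gamma>[OF E, of t]] \<rho>_edge[OF E, of s t] s by auto
      qed
      then show "1 * LG (\<lambda>_. - K) x E (slope E \<phi> s) \<le> 0"
        using G[OF E, of x 0] \<gamma>_in_closure[OF E, of s] s b by auto
    next
      assume i: "x \<in> inner_verts N"
      show "(\<exists>E\<in>Inc N x. 1 * LG (\<lambda>_. - K) x E (slope E \<phi> (end_coord E x)) \<le> 0) \<or>
        1 * ((\<Sum>E\<in>Inc N x. - (end_sign E x * slope E \<phi> (end_coord E x))) - B x) \<le> 0"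
      proof (cases "\<exists>E\<in>Inc N x. 1 * LG (\<lambda>_. - K) x E (slope E \<phi> (end_coord E x)) \<le> 0")
        case False
        have xv: "x \<in> verts N" using i by (simp add: verts_def)
        have pb: "b \<le> end_sign E x * slope E \<phi> (end_coord E x)" if E: "E \<in> Inc N x" for E
        proof -
          have "0 \<le> end_sign E x * slope E \<phi> (end_coord E x)"
            using inward_slope_ge[OF \<phi> E \<delta>(1) c]
              \<delta>(2)[OF \<gamma>_in_\<Gamma>[OF Inc_edges[OF E]]] \<rho>_edge[OF Inc_edges[OF E] end_coord_bounds, of _ x] \<gamma>_end_coord[OF E]
            by (simp add: abs_minus_commute)
          moreover have "b < \<bar>slope E \<phi> (end_coord E x)\<bar>"
            using False E G[OF Inc_edges[OF E], of x] \<gamma>_in_closure[OF Inc_edges[OF E] end_coord_bounds, of x] \<gamma>_end_coord[OF E]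
            by (metis mult_1 not_le)
          ultimately show ?thesis by (auto simp: end_sign_def split: if_splits)
        qed
        obtain E0 where E0: "E0 \<in> Inc N x" using vertex_Inc[OF xv x] by blast
        have "b \<le> end_sign E0 x * slope E0 \<phi> (end_coord E0 x)" using pb[OF E0] .
        also have "\<dots> \<le> (\<Sum>E\<in>Inc N x. end_sign E x * slope E \<phi> (end_coord E x))"
          using pb b by (intro member_le_sum[OF E0]) (auto intro: order.trans)
        finally have "- (\<Sum>E\<in>Inc N x. end_sign E x * slope E \<phi> (end_coord E x)) \<le> - b" by simp
        moreover have "\<bar>B x\<bar> \<le> b" unfolding b_def by (rule sum_verts_bound[OF xv])
        ultimately have "(\<Sum>E\<in>Inc N x. - (end_sign E x * slope E \<phi> (end_coord E x))) - B x \<le> 0"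
          unfolding sum_negf by linarith
        then show ?thesis by simp
      qed simp
    next
      assume i: "x \<in> bdry_verts N"
      have "\<bar>h x\<bar> \<le> (\<Sum>v \<in> verts N. \<bar>h v\<bar>)" using i by (intro sum_verts_bound) (simp add: verts_def)
      moreover have "0 \<le> C * (1 + b) / lam" using C_gt_1 b lam_pos by simp
      ultimately have "- K - h x \<le> 0" unfolding K_def by linarith
      then show "(\<exists>E\<in>Inc N x. 1 * LG (\<lambda>_. - K) x E (slope E \<phi> (end_coord E x)) \<le> 0) \<or> 1 * (- K - h x) \<le> 0" by simp
    qed
  qed
  then show ?thesis using visc_gen_iff_lip[OF \<rho>_lipschitz_const, of 1] by blast
qed

text \<open>\<open>\<psi>\<close> has inward derivative \<open>- b\<close> at both ends of each
  edge, with \<open>b\<close> larger than every \<bar>\<open>B v\<close>\<bar>, so at an inner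
  vertex the Kirchhoff alternative fails and the equation holds at a maximum of
  \<open>w - \<psi>\<close>. There the increments of \<open>w\<close> are at most those of
  \<open>\<psi>\<close>, which bounds the nonlocal term independently of \<open>w\<close>.\<close>

lemma subsolution_upper_bound: "\<exists>M. \<forall>w. w \<in> C0 N \<longrightarrow> visc_gen 1 w \<longrightarrow> (\<forall>x \<in> \<Gamma>. w x \<le> M)"
proof -
  define b where "b = 1 + (\<Sum>v \<in> verts N. \<bar>B v\<bar>)"
  have b: "0 < b" unfolding b_def by (intro add_pos_nonneg sum_nonneg) auto
  obtain \<psi> where \<psi>: "\<psi> \<in> C1 N" "\<And>E t. E \<in> edges N \<Longrightarrow> 0 \<le> t \<Longrightarrow> t \<le> len E \<Longrightarrow> \<psi> (\<gamma> E t) = - (b * (t * (len E - t)) / len E)"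
    "\<And>E t. E \<in> edges N \<Longrightarrow> 0 \<le> t \<Longrightarrow> t \<le> len E \<Longrightarrow> slope E \<psi> t = - (b * (len E - 2 * t) / len E)"
  proof (rule C1_exists[of "\<lambda>E t. - (b * (t * (len E - t)) / len E)" "\<lambda>_. 0" "\<lambda>E t. - (b * (len E - 2 * t) / len E)"])
    fix E t assume E: "E \<in> edges N"
    show "((\<lambda>t. - (b * (t * (len E - t)) / len E)) has_real_derivative - (b * (len E - 2 * t) / len E)) (at t within {0..len E})"
      using len_pos[OF E] by (auto intro!: derivative_eq_intros simp: field_simps)
    show "continuous_on {0..len E} (\<lambda>t. - (b * (len E - 2 * t) / len E))"
      using len_pos[OF E] by (auto intro!: continuous_intros)
  qed auto
  obtain L where L: "\<rho>_lipschitz L \<psi>" using C1_\<rho>_lipschitz[OF \<psi>(1)] by blast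
  then have L0: "0 \<le> L" by (simp add: \<rho>_lipschitz_def)
  obtain P where P: "0 < P" "\<And>x. x \<in> \<Gamma> \<Longrightarrow> \<bar>\<psi> x\<bar> \<le> P" using C0_bounded[OF C1_C0[OF \<psi>(1)]] by blast
  define R where "R = (nonloc_const * (L + L) + C) / lam"
  define S where "S = max R (\<Sum>v \<in> verts N. \<bar>h v\<bar>)"
  have "w y \<le> S + 2 * P" if w: "w \<in> C0 N" "visc_gen 1 w" and y: "y \<in> \<Gamma>" for w y
  proof -
    obtain x where x: "x \<in> \<Gamma>" "\<And>z. z \<in> \<Gamma> \<Longrightarrow> w z - \<psi> z \<le> w x - \<psi> x"
      using C0_attains_sup[OF C0_diff[OF w(1) C1_C0[OF \<psi>(1)]]] y by blast
    have t: "touches 1 w \<psi> x 1" unfolding touches_def using x(2) by (simp add: geo_ball_def)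
    note cond = visc_gen_D[OF w(2) x(1) \<psi>(1) t]
    have G: "w x \<le> R" if E: "E \<in> edges N" "0 \<le> s" "s \<le> len E" "x = \<gamma> E s" and le: "1 * Gop N lam H \<nu> E 1 w \<psi> p x \<le> 0" for E s p
    proof -
      obtain K' where K': "Lipschitz_at K' (\<gamma> E s) (patch 1 w \<psi> (\<gamma> E s))"
        using patch_Lipschitz_at[OF w(1) L \<gamma>_in_\<Gamma>[OF E(1-3)] zero_less_one] by blast
      have pl: "patch 1 w \<psi> (\<gamma> E s) z - patch 1 w \<psi> (\<gamma> E s) (\<gamma> E s) \<le> L * \<rho> (\<gamma> E s) z" if z: "z \<in> \<Gamma>" for z
      proof -
        have "patch 1 w \<psi> x z - w x \<le> \<psi> z - \<psi> x" using x(2)[OF z] by (simp add: patch_def)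
        also have "\<dots> \<le> L * \<rho> x z" using L x(1) z unfolding \<rho>_lipschitz_def by (metis abs_ge_self \<rho>_commute order.trans)
        finally show ?thesis using E(4) by simp
      qed
      have "nonloc N \<nu> E \<Gamma> (patch 1 w \<psi> (\<gamma> E s)) (\<gamma> E s) \<le> nonloc_const * (L * 1 powr (1 - \<sigma>) + L + 0 * 1 powr (- \<sigma>))"
        using pl by (intro nonloc_bound[OF E(1-3) K' L0 L0]) auto
      moreover have "- C \<le> H E (\<gamma> E s) p"
        using H_lower[OF E(1) \<gamma>_in_closure[OF E(1-3)], of p] C_gt_1 by (smt (verit) divide_nonneg_pos abs_ge_zero)
      ultimately have "lam * w x \<le> nonloc_const * (L + L) + C"
        using le unfolding E(4) Gop_patch[OF E(1-3) w(1) \<psi>(1) zero_less_one] by simp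
      then show ?thesis unfolding R_def using lam_pos by (simp add: field_simps)
    qed
    have Gv: "w x \<le> R" if "\<exists>E\<in>Inc N x. 1 * Gop N lam H \<nu> E 1 w \<psi> (slope E \<psi> (end_coord E x)) x \<le> 0"
      using that G[OF Inc_edges end_coord_bounds \<gamma>_end_coord[symmetric]] by blast
    have "w x \<le> S"
    proof (cases "x \<in> verts N")
      case False
      then obtain E s where E: "E \<in> edges N" "0 < s" "s < len E" "x = \<gamma> E s" using \<Gamma>_cases[OF x(1)] by metis
      then have "1 * Gop N lam H \<nu> E 1 w \<psi> (slope E \<psi> s) x \<le> 0" using cond unfolding visc_cond_def by blast
      from G[OF E(1) less_imp_le[OF E(2)] less_imp_le[OF E(3)] E(4) this] show ?thesis by (simp add: S_def)
    next
      case True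
      then consider "x \<in> inner_verts N" | "x \<in> bdry_verts N" by (auto simp: verts_def)
      then show ?thesis
      proof cases
        case 1
        have sl: "end_sign E x * slope E \<psi> (end_coord E x) = - b" if "E \<in> Inc N x" for E
          using \<psi>(3)[OF Inc_edges[OF that] end_coord_bounds, of x] len_pos[OF Inc_edges[OF that]]
          by (auto simp: end_sign_def end_coord_def)
        obtain E0 where E0: "E0 \<in> Inc N x" using vertex_Inc[OF True x(1)] by blast
        have "b \<le> (\<Sum>E\<in>Inc N x. - (end_sign E x * slope E \<psi> (end_coord E x)))"
          using member_le_sum[OF E0, of "\<lambda>E. - (end_sign E x * slope E \<psi> (end_coord E x))"] sl b E0 by simp
        moreover have "B x < b" using sum_verts_bound[OF True, of B] by (simp add: b_def)
        ultimately have "\<exists>E\<in>Inc N x. 1 * Gop N lam H \<nu> E 1 w \<psi> (slope E \<psi> (end_coord E x)) x \<le> 0"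
          using cond 1 unfolding visc_cond_def by force
        then show ?thesis using Gv by (auto simp: S_def)
      next
        case 2
        have "\<bar>h x\<bar> \<le> (\<Sum>v \<in> verts N. \<bar>h v\<bar>)" by (rule sum_verts_bound[OF True])
        moreover have "w x \<le> R \<or> w x \<le> h x" using cond 2 Gv unfolding visc_cond_def by fastforce
        ultimately show ?thesis by (auto simp: S_def)
      qed
    qed
    then show ?thesis using x(2)[OF y] P(2)[OF y] P(2)[OF x(1)] by linarith
  qed
  then show ?thesis by blast
qed

text \<open>The cone with vertex \<open>(x, c)\<close> truncated by \<open>u\<close> replaces the equicontinuity argument when a
  sequence below \<open>u\<close> only converges at one point.\<close>

lemma LG_eventually_pos:
  assumes E: "E \<in> edges N" and s: "0 \<le> s" "s \<le> len E" and u: "\<rho>_lipschitz L u"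
    and w: "\<And>n. \<rho>_lipschitz L (w n)" "\<And>n z. z \<in> \<Gamma> \<Longrightarrow> w n z \<le> u z"
    and y: "\<And>n. 0 \<le> y n \<and> y n \<le> len E" "y \<longlonglongrightarrow> s" and wy: "(\<lambda>n. w n (\<gamma> E (y n))) \<longlonglongrightarrow> u (\<gamma> E s)"
    and p: "pn \<longlonglongrightarrow> p" and pos: "0 < LG u (\<gamma> E s) E p"
  shows "\<forall>\<^sub>F n in sequentially. 0 < LG (w n) (\<gamma> E (y n)) E (pn n)"
proof -
  note x = \<gamma>_in_\<Gamma>[OF E s]
  have xn: "\<gamma> E (y n) \<in> \<Gamma>" for n using \<gamma>_in_\<Gamma>[OF E] y by blast
  have L: "0 \<le> L" using u by (simp add: \<rho>_lipschitz_def)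
  define f where "f = (\<lambda>n z. min (u z) (w n (\<gamma> E (y n)) + L * \<rho> (\<gamma> E (y n)) z))"
  have fx: "f n (\<gamma> E (y n)) = w n (\<gamma> E (y n))" for n using w(2)[OF xn, of n n] xn by (simp add: f_def)
  have wf: "w n z \<le> f n z" if z: "z \<in> \<Gamma>" for n z
  proof -
    have "\<bar>w n z - w n (\<gamma> E (y n))\<bar> \<le> L * \<rho> z (\<gamma> E (y n))"
      using w(1)[of n] z xn[of n] unfolding \<rho>_lipschitz_def by blast
    then have "w n z \<le> w n (\<gamma> E (y n)) + L * \<rho> (\<gamma> E (y n)) z"
      by (simp add: \<rho>_commute[of z] abs_le_iff)
    then show ?thesis using w(2)[OF z] by (simp add: f_def)
  qed
  have fC: "f n \<in> C0 N" for n
  proof -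
    have "(\<lambda>z. w n (\<gamma> E (y n)) + L * \<rho> (\<gamma> E (y n)) z) \<in> C0 N"
      by (intro C0_add C0_const C0_cmult C0_\<rho> xn)
    then show ?thesis using \<rho>_lipschitz_C0[OF u] unfolding f_def C0_iff by (intro ballI continuous_on_min; simp)
  qed
  have fL: "Lipschitz_at L (\<gamma> E (y n)) (f n)" for n
    unfolding Lipschitz_at_def
  proof (intro conjI ballI)
    show "edgewise_measurable (f n)" by (rule C0_measurable[OF fC])
    fix z assume z: "z \<in> \<Gamma>"
    have "\<bar>w n z - w n (\<gamma> E (y n))\<bar> \<le> L * \<rho> z (\<gamma> E (y n))"
      using w(1)[of n] z xn[of n] unfolding \<rho>_lipschitz_def by blast
    then have "w n (\<gamma> E (y n)) - L * \<rho> (\<gamma> E (y n)) z \<le> f n z" using wf[OF z, of n] by (simp add: \<rho>_commute[of z] abs_le_iff)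
    moreover have "f n z \<le> w n (\<gamma> E (y n)) + L * \<rho> (\<gamma> E (y n)) z" by (simp add: f_def)
    ultimately show "\<bar>f n z - f n (\<gamma> E (y n))\<bar> \<le> L * \<rho> (\<gamma> E (y n)) z" unfolding fx by (simp add: abs_le_iff)
  qed
  have lim: "(\<lambda>n. nonloc N \<nu> E \<Gamma> (f n) (\<gamma> E (y n))) \<longlonglongrightarrow> nonloc N \<nu> E \<Gamma> u (\<gamma> E s)"
  proof (rule nonloc_tendsto[OF E y(1) s y(2) fL \<rho>_lipschitz_at[OF u x]])
    show "(\<lambda>n. f n (\<gamma> E (y n))) \<longlonglongrightarrow> u (\<gamma> E s)" unfolding fx by (rule wy)
    fix F z t assume F: "F \<in> edges N" and z: "0 < z" "z < len F" and t: "t \<longlonglongrightarrow> z" "\<forall>n. 0 \<le> t n \<and> t n \<le> len F"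
    note zG = \<gamma>_in_\<Gamma>[OF F less_imp_le[OF z(1)] less_imp_le[OF z(2)]]
    have tG: "\<gamma> F (t n) \<in> \<Gamma>" for n using \<gamma>_in_\<Gamma>[OF F] t(2) by blast
    have 1: "(\<lambda>n. u (\<gamma> F (t n))) \<longlonglongrightarrow> u (\<gamma> F z)"
      by (rule C0_tendsto[OF \<rho>_lipschitz_C0[OF u] F t(1)]) (use z t in auto)
    have 2: "(\<lambda>n. \<rho> (\<gamma> E (y n)) (\<gamma> F (t n))) \<longlonglongrightarrow> \<rho> (\<gamma> E s) (\<gamma> F z)"
    proof (rule LIM_zero_cancel, rule Lim_null_comparison)
      show "\<forall>\<^sub>F n in sequentially. norm (\<rho> (\<gamma> E (y n)) (\<gamma> F (t n)) - \<rho> (\<gamma> E s) (\<gamma> F z)) \<le> \<bar>y n - s\<bar> + \<bar>t n - z\<bar>"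
      proof (intro always_eventually allI)
        fix n
        have "\<bar>\<rho> (\<gamma> E (y n)) (\<gamma> F (t n)) - \<rho> (\<gamma> E s) (\<gamma> F (t n))\<bar> \<le> \<bar>y n - s\<bar>"
          using abs_\<rho>_diff_le[OF xn x tG, of n n] \<rho>_edge[OF E, of "y n" s] y(1)[of n] s by simp
        moreover have "\<bar>\<rho> (\<gamma> F (t n)) (\<gamma> E s) - \<rho> (\<gamma> F z) (\<gamma> E s)\<bar> \<le> \<bar>t n - z\<bar>"
          using abs_\<rho>_diff_le[OF tG zG x, of n] \<rho>_edge[OF F, of "t n" z] t(2) z by simp
        ultimately show "norm (\<rho> (\<gamma> E (y n)) (\<gamma> F (t n)) - \<rho> (\<gamma> E s) (\<gamma> F z)) \<le> \<bar>y n - s\<bar> + \<bar>t n - z\<bar>"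
          unfolding \<rho>_commute[of "\<gamma> E s"] real_norm_def by linarith
      qed
      have "(\<lambda>n. \<bar>y n - s\<bar>) \<longlonglongrightarrow> 0" "(\<lambda>n. \<bar>t n - z\<bar>) \<longlonglongrightarrow> 0"
        using y(2) t(1) by (simp_all add: LIM_zero_iff tendsto_rabs_zero_iff)
      then show "(\<lambda>n. \<bar>y n - s\<bar> + \<bar>t n - z\<bar>) \<longlonglongrightarrow> 0" by (rule tendsto_add_zero)
    qed
    have "(\<lambda>n. f n (\<gamma> F (t n))) \<longlonglongrightarrow> min (u (\<gamma> F z)) (u (\<gamma> E s) + L * \<rho> (\<gamma> E s) (\<gamma> F z))"
      unfolding f_def by (intro tendsto_intros 1 2 wy)
    moreover have "u (\<gamma> F z) \<le> u (\<gamma> E s) + L * \<rho> (\<gamma> E s) (\<gamma> F z)"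
    proof -
      have "\<bar>u (\<gamma> F z) - u (\<gamma> E s)\<bar> \<le> L * \<rho> (\<gamma> F z) (\<gamma> E s)"
        using u zG x unfolding \<rho>_lipschitz_def by blast
      then show ?thesis by (simp add: \<rho>_commute[of "\<gamma> F z"] abs_le_iff)
    qed
    ultimately show "(\<lambda>n. f n (\<gamma> F (t n))) \<longlonglongrightarrow> u (\<gamma> F z)" by (simp add: min_absorb1)
  qed
  have "(\<lambda>n. lam * w n (\<gamma> E (y n)) - nonloc N \<nu> E \<Gamma> (f n) (\<gamma> E (y n)) + H E (\<gamma> E (y n)) (pn n)) \<longlonglongrightarrow> LG u (\<gamma> E s) E p"
    unfolding LG_def by (intro tendsto_intros wy lim H_tendsto[OF E y(1) s y(2) p])
  \<comment> \<open>Positivity holds with \<open>f n\<close> in the nonlocal term; since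
    \<open>w n\<close> lies below \<open>f n\<close> and agrees with it at the base point, its own
    nonlocal term is no larger.\<close>
  from order_tendstoD(1)[OF this pos] show ?thesis
  proof eventually_elim
    case (elim n)
    have "nonloc N \<nu> E \<Gamma> (w n) (\<gamma> E (y n)) \<le> nonloc N \<nu> E \<Gamma> (f n) (\<gamma> E (y n))"
      using y(1)[of n] wf[of _ n] fx[of n]
      by (intro nonloc_mono[OF E _ _ \<rho>_lipschitz_at[OF w(1) xn] fL]) auto
    then show ?case using elim unfolding LG_def by linarith
  qed
qed

text \<open>With \<open>subsolution_upper_bound\<close> the lower bound makes the members uniformly
  bounded on \<Gamma>, hence equi-Lipschitz.\<close>

definition perron_family :: "real \<Rightarrow> ('a \<Rightarrow> real) set" where
  "perron_family K = {w. w \<in> C0 N \<and> visc_gen 1 w \<and> (\<forall>x \<in> \<Gamma>. - K \<le> w x)}"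

text \<open>Almost optimal members \<open>w n\<close> are touched by \<open>\<phi> + Q\<close> at
  points \<open>X n\<close> that tend to \<open>x\<close>, because \<open>Q\<close> is strict. If
  the condition failed for \<open>u\<close> at \<open>x\<close>, the strict positivity would pass to
  \<open>w n\<close> at \<open>X n\<close>.\<close>

lemma sup_subsolution:
  assumes u: "\<rho>_lipschitz L u" and S: "\<And>w. w \<in> S \<Longrightarrow> \<rho>_lipschitz L w \<and> visc_lip 1 w \<and> (\<forall>z \<in> \<Gamma>. w z \<le> u z)"
    and approx: "\<And>x e. x \<in> \<Gamma> \<Longrightarrow> 0 < e \<Longrightarrow> \<exists>w \<in> S. u x - e < w x"
  shows "visc_lip 1 u"
  unfolding visc_lip_def
proof (intro ballI allI impI)
  fix x \<delta> \<phi> assume x: "x \<in> \<Gamma>" and \<phi>: "\<phi> \<in> C1 N" and t: "touches 1 u \<phi> x \<delta>"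
  have \<delta>: "0 < \<delta>" and touch: "\<And>y. y \<in> \<Gamma> \<Longrightarrow> \<rho> x y < \<delta> \<Longrightarrow> u y - \<phi> y \<le> u x - \<phi> x"
    using t by (auto simp: touches_def geo_ball_def)
  obtain Q r0 where Q: "Q \<in> C1 N" "0 < r0" "Q x = 0" "\<And>y. y \<in> \<Gamma> \<Longrightarrow> 0 \<le> Q y"
    "\<And>y. y \<in> \<Gamma> \<Longrightarrow> y \<noteq> x \<Longrightarrow> \<rho> x y < r0 \<Longrightarrow> 0 < Q y"
    "\<And>E s. E \<in> edges N \<Longrightarrow> 0 \<le> s \<Longrightarrow> s \<le> len E \<Longrightarrow> x = \<gamma> E s \<Longrightarrow> slope E Q s = 0"
    using strict_minimum[OF x] by metis
  define r where "r = min r0 \<delta> / 2"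
  have r: "0 < r" "r < r0" "r < \<delta>" using Q(2) \<delta> by (auto simp: r_def)
  define \<Phi> where "\<Phi> = (\<lambda>y. \<phi> y + Q y)"
  have \<Phi>: "\<Phi> \<in> C1 N" unfolding \<Phi>_def by (rule C1_add[OF \<phi> Q(1)])
  define e where "e = (\<lambda>n. 1 / real (Suc n))"
  have e0: "0 < e n" for n by (simp add: e_def)
  have elim: "e \<longlonglongrightarrow> 0" unfolding e_def using LIMSEQ_inverse_real_of_nat by (simp add: inverse_eq_divide)
  obtain w where w: "\<And>n. w n \<in> S" "\<And>n. u x - e n < w n x" using approx[OF x e0] by metis
  have wl: "\<rho>_lipschitz L (w n)" "visc_lip 1 (w n)" "\<And>z. z \<in> \<Gamma> \<Longrightarrow> w n z \<le> u z" for n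
    using S[OF w(1)] by auto
  have comp: "compact (\<Gamma> \<inter> {y. \<rho> x y \<in> T})" if "closed T" for T
  proof -
    have "closed (\<Gamma> \<inter> (\<lambda>y. \<rho> x y) -` T)"
      by (rule continuous_closed_preimage[OF C0_continuous_on[OF C0_\<rho>[OF x]] compact_imp_closed[OF compact_\<Gamma>] that])
    then have "compact (\<Gamma> \<inter> (\<Gamma> \<inter> (\<lambda>y. \<rho> x y) -` T))" by (rule compact_Int_closed[OF compact_\<Gamma>])
    moreover have "\<Gamma> \<inter> (\<Gamma> \<inter> (\<lambda>y. \<rho> x y) -` T) = \<Gamma> \<inter> {y. \<rho> x y \<in> T}" by auto
    ultimately show ?thesis by simp
  qed
  have "\<exists>y \<in> \<Gamma> \<inter> {y. \<rho> x y \<in> {..r}}. \<forall>z \<in> \<Gamma> \<inter> {y. \<rho> x y \<in> {..r}}. w n z - \<Phi> z \<le> w n y - \<Phi> y" for n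
  proof (rule continuous_attains_sup[OF comp])
    show "\<Gamma> \<inter> {y. \<rho> x y \<in> {..r}} \<noteq> {}" using x r by auto
    show "continuous_on (\<Gamma> \<inter> {y. \<rho> x y \<in> {..r}}) (\<lambda>z. w n z - \<Phi> z)"
      by (rule continuous_on_subset[OF C0_continuous_on[OF C0_diff[OF \<rho>_lipschitz_C0[OF wl(1)] C1_C0[OF \<Phi>]]]]) auto
  qed auto
  then obtain X where X: "\<And>n. X n \<in> \<Gamma>" "\<And>n. \<rho> x (X n) \<le> r"
    "\<And>n z. z \<in> \<Gamma> \<Longrightarrow> \<rho> x z \<le> r \<Longrightarrow> w n z - \<Phi> z \<le> w n (X n) - \<Phi> (X n)"
    by (simp add: Bex_def Ball_def) metis
  have base: "u x - \<phi> x - e n \<le> w n (X n) - \<phi> (X n) - Q (X n)" for n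
    using X(3)[OF x, of n] w(2)[of n] x r Q(3) by (simp add: \<Phi>_def)
  \<comment> \<open>The defect \<open>e n\<close> of \<open>w n\<close> at \<open>x\<close> bounds
    \<open>Q\<close> at the contact point, which confines \<open>X n\<close> to small neighbourhoods
    of \<open>x\<close>.\<close>
  have QX: "Q (X n) \<le> e n" for n
    using base[of n] touch[OF X(1), of n] X(2)[of n] r wl(3)[OF X(1), of n n] by linarith
  have Xx: "(\<lambda>n. \<rho> x (X n)) \<longlonglongrightarrow> 0"
  proof (rule order_tendstoI)
    fix a :: real assume "0 < a"
    define T where "T = \<Gamma> \<inter> {y. \<rho> x y \<in> {min a r..r}}"
    have "compact T" unfolding T_def by (rule comp) auto
    show "\<forall>\<^sub>F n in sequentially. \<rho> x (X n) < a"
    proof (cases "T = {}")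
      case True
      have "\<rho> x (X n) < a" for n
        using True X(1,2)[of n] unfolding T_def by (auto simp: min_def split: if_splits)
      then show ?thesis by simp
    next
      case False
      obtain q where q: "q \<in> T" "\<And>y. y \<in> T \<Longrightarrow> Q q \<le> Q y"
        using continuous_attains_inf[OF \<open>compact T\<close> False continuous_on_subset[OF C0_continuous_on[OF C1_C0[OF Q(1)]]]]
        unfolding T_def by blast
      have "q \<noteq> x" using q(1) x \<open>0 < a\<close> r by (auto simp: T_def)
      then have "0 < Q q" using Q(5)[of q] q(1) r by (auto simp: T_def)
      from order_tendstoD(2)[OF elim this] show ?thesis
      proof eventually_elim
        case (elim n)
        show ?case
        proof (rule ccontr)
          assume "\<not> ?thesis"
          then have "X n \<in> T" using X(1,2)[of n] by (auto simp: T_def)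
          then show False using q(2) QX[of n] elim by force
        qed
      qed
    qed
  qed (auto intro!: always_eventually less_le_trans[OF _ \<rho>_nonneg])
  obtain L\<phi> where L\<phi>: "\<rho>_lipschitz L\<phi> \<phi>" using C1_\<rho>_lipschitz[OF \<phi>] by blast
  have wX: "(\<lambda>n. w n (X n)) \<longlonglongrightarrow> u x"
  proof (rule tendsto_sandwich)
    show "\<forall>\<^sub>F n in sequentially. u x - L\<phi> * \<rho> x (X n) - e n \<le> w n (X n)"
    proof (intro always_eventually allI)
      fix n
      have "\<bar>\<phi> x - \<phi> (X n)\<bar> \<le> L\<phi> * \<rho> x (X n)" using L\<phi> x X(1) unfolding \<rho>_lipschitz_def by blast
      then show "u x - L\<phi> * \<rho> x (X n) - e n \<le> w n (X n)" using base[of n] Q(4)[OF X(1), of n] by linarith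
    qed
    show "\<forall>\<^sub>F n in sequentially. w n (X n) \<le> u x + L * \<rho> x (X n)"
    proof (intro always_eventually allI)
      fix n
      have "\<bar>u x - u (X n)\<bar> \<le> L * \<rho> x (X n)" using u x X(1) unfolding \<rho>_lipschitz_def by blast
      then show "w n (X n) \<le> u x + L * \<rho> x (X n)" using wl(3)[OF X(1), of n n] by linarith
    qed
    have "(\<lambda>n. u x - L\<phi> * \<rho> x (X n) - e n) \<longlonglongrightarrow> u x - L\<phi> * 0 - 0" by (intro tendsto_intros Xx elim)
    then show "(\<lambda>n. u x - L\<phi> * \<rho> x (X n) - e n) \<longlonglongrightarrow> u x" by simp
    have "(\<lambda>n. u x + L * \<rho> x (X n)) \<longlonglongrightarrow> u x + L * 0" by (intro tendsto_intros Xx)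
    then show "(\<lambda>n. u x + L * \<rho> x (X n)) \<longlonglongrightarrow> u x" by simp
  qed
  have wx: "(\<lambda>n. w n x) \<longlonglongrightarrow> u x"
  proof (rule tendsto_sandwich[of "\<lambda>n. u x - e n" _ _ "\<lambda>_. u x"])
    have "(\<lambda>n. u x - e n) \<longlonglongrightarrow> u x - 0" by (intro tendsto_intros elim)
    then show "(\<lambda>n. u x - e n) \<longlonglongrightarrow> u x" by simp
  qed (use w(2) wl(3)[OF x] in \<open>auto intro!: always_eventually less_imp_le\<close>)
  have star: "\<forall>\<^sub>F n in sequentially. \<forall>t. 0 \<le> t \<and> t \<le> len E \<and> X n = \<gamma> E t \<longrightarrow> 0 < LG (w n) (X n) E (slope E \<Phi> t)"
    if E: "E \<in> edges N" and s: "0 \<le> s" "s \<le> len E" "x = \<gamma> E s" and pos: "0 < LG u x E (slope E \<phi> s)" for E s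
  proof -
    \<comment> \<open>When \<open>X n\<close> is not on \<open>E\<close> the value \<open>s\<close>
      keeps the sequence on the edge and convergent; the conclusion only concerns the remaining
      indices.\<close>
    define y where "y = (\<lambda>n. if X n \<in> closure E then edge_coord N E (X n) else s)"
    have Xc: "\<exists>t. 0 \<le> t \<and> t \<le> len E \<and> X n = \<gamma> E t \<and> y n = t" if "X n \<in> closure E" for n
      using closure_edge_point[OF E that] edge_coord_\<gamma>[OF E] that by (auto simp: y_def)
    have y: "0 \<le> y n \<and> y n \<le> len E" for n
      using Xc[of n] s by (cases "X n \<in> closure E") (auto simp: y_def)
    have ydist: "\<bar>y n - s\<bar> \<le> \<rho> x (X n)" for n
    proof (cases "X n \<in> closure E")
      case True
      then show ?thesis using Xc[OF True] \<rho>_edge[OF E s(1,2), of "y n"] s(3) by (auto simp: abs_minus_commute)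
    qed (simp add: y_def)
    have ys: "y \<longlonglongrightarrow> s"
    proof (rule LIM_zero_cancel, rule Lim_null_comparison[OF _ Xx])
      show "\<forall>\<^sub>F n in sequentially. norm (y n - s) \<le> \<rho> x (X n)" using ydist by simp
    qed
    have wy: "(\<lambda>n. w n (\<gamma> E (y n))) \<longlonglongrightarrow> u (\<gamma> E s)"
    proof (rule LIM_zero_cancel, rule Lim_null_comparison)
      show "\<forall>\<^sub>F n in sequentially. norm (w n (\<gamma> E (y n)) - u (\<gamma> E s)) \<le> \<bar>w n (X n) - u x\<bar> + \<bar>w n x - u x\<bar>"
      proof (intro always_eventually allI)
        fix n
        have "\<gamma> E (y n) = X n \<or> \<gamma> E (y n) = x"
          using Xc[of n] s(3) by (cases "X n \<in> closure E") (auto simp: y_def)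
        then show "norm (w n (\<gamma> E (y n)) - u (\<gamma> E s)) \<le> \<bar>w n (X n) - u x\<bar> + \<bar>w n x - u x\<bar>" using s(3) by auto
      qed
      have "(\<lambda>n. \<bar>w n (X n) - u x\<bar>) \<longlonglongrightarrow> 0" "(\<lambda>n. \<bar>w n x - u x\<bar>) \<longlonglongrightarrow> 0"
        using wX wx by (simp_all add: LIM_zero_iff tendsto_rabs_zero_iff)
      then show "(\<lambda>n. \<bar>w n (X n) - u x\<bar> + \<bar>w n x - u x\<bar>) \<longlonglongrightarrow> 0" by (rule tendsto_add_zero)
    qed
    have p: "(\<lambda>n. slope E \<Phi> (y n)) \<longlonglongrightarrow> slope E \<Phi> s"
      using y s by (intro continuous_on_tendsto_compose[OF C1_slope(2)[OF \<Phi> E] ys]) auto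
    have "slope E \<Phi> s = slope E \<phi> s"
      using slope_add[OF \<phi> Q(1) E, of s] Q(6)[OF E s] s by (simp add: \<Phi>_def)
    then have pos': "0 < LG u (\<gamma> E s) E (slope E \<Phi> s)" using pos s(3) by simp
    have "\<forall>\<^sub>F n in sequentially. 0 < LG (w n) (\<gamma> E (y n)) E (slope E \<Phi> (y n))"
      by (rule LG_eventually_pos[OF E s(1,2) u wl(1) _ y ys wy p pos']) (rule wl(3))
    then show ?thesis
    proof eventually_elim
      case (elim n)
      show ?case
      proof (intro allI impI)
        fix t assume t: "0 \<le> t \<and> t \<le> len E \<and> X n = \<gamma> E t"
        then have "X n \<in> closure E" using \<gamma>_in_closure[OF E] by auto
        then have "y n = t" using t edge_coord_\<gamma>[OF E, of t] by (simp add: y_def)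
        then show "0 < LG (w n) (X n) E (slope E \<Phi> t)" using elim t by simp
      qed
    qed
  qed
  obtain r1 where r1: "0 < r1" and near: "\<And>y. y \<in> \<Gamma> \<Longrightarrow> \<rho> x y < r1 \<Longrightarrow> (y \<in> verts N \<longrightarrow> y = x) \<and>
    (\<forall>E t. E \<in> edges N \<longrightarrow> 0 \<le> t \<longrightarrow> t \<le> len E \<longrightarrow> y = \<gamma> E t \<longrightarrow> (\<exists>s. 0 \<le> s \<and> s \<le> len E \<and> x = \<gamma> E s))"
    using near_point[OF x] by blast
  have cond: "\<forall>\<^sub>F n in sequentially. visc_cond 1 (LG (w n) (X n)) (w n) (X n) \<Phi> \<and> \<rho> x (X n) < r1"
  proof -
    have "\<forall>\<^sub>F n in sequentially. \<rho> x (X n) < min r r1" using order_tendstoD(2)[OF Xx, of "min r r1"] r(1) r1 by simp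
    then show ?thesis
    proof eventually_elim
      case (elim n)
      have "touches 1 (w n) \<Phi> (X n) (r - \<rho> x (X n))"
        unfolding touches_def
      proof (intro conjI ballI)
        fix y assume "y \<in> geo_ball N (X n) (r - \<rho> x (X n))"
        then have y: "y \<in> \<Gamma>" "\<rho> (X n) y < r - \<rho> x (X n)" by (auto simp: geo_ball_def)
        then have "\<rho> x y \<le> r" using \<rho>_triangle[OF x X(1) y(1), of n] by linarith
        then show "1 * (w n y - \<Phi> y) \<le> 1 * (w n (X n) - \<Phi> (X n))" using X(3)[OF y(1)] by simp
      qed (use elim in simp)
      then have "visc_cond 1 (LG (w n) (X n)) (w n) (X n) \<Phi>" using wl(2)[of n] X(1) \<Phi> unfolding visc_lip_def by blast
      then show ?case using elim by simp
    qed
  qed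
  have vertex_case: False if xv: "x \<in> verts N" and pos: "\<forall>E \<in> Inc N x. 0 < LG u x E (slope E \<phi> (end_coord E x))"
    and ev: "\<forall>\<^sub>F n in sequentially. \<not> (visc_cond 1 (LG (w n) x) (w n) x \<Phi> \<and> (\<forall>E \<in> Inc N x. 0 < LG (w n) x E (slope E \<Phi> (end_coord E x))))"
  proof -
    have "\<forall>\<^sub>F n in sequentially. \<forall>E \<in> Inc N x. \<forall>t. 0 \<le> t \<and> t \<le> len E \<and> X n = \<gamma> E t \<longrightarrow> 0 < LG (w n) (X n) E (slope E \<Phi> t)"
      using star[OF Inc_edges end_coord_bounds \<gamma>_end_coord[symmetric]] pos by (intro eventually_ball_finite) auto
    with cond ev have "\<forall>\<^sub>F n in sequentially. False"
    proof eventually_elim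
      case (elim n)
      show ?case
      \<comment> \<open>At \<open>x\<close> the vertex condition of \<open>w n\<close> is
        contradicted, elsewhere the edge equation on an edge that reaches \<open>x\<close>.\<close>
      proof (cases "X n = x")
        case True
        have "0 < LG (w n) x E (slope E \<Phi> (end_coord E x))" if "E \<in> Inc N x" for E
          using elim(3) that end_coord_bounds[of E x] \<gamma>_end_coord[OF that] True by metis
        then show ?thesis using elim(1,2) True by auto
      next
        case False
        then have "X n \<notin> verts N" using near[OF X(1)] elim(1) by blast
        then obtain E t where E: "E \<in> edges N" "0 < t" "t < len E" "X n = \<gamma> E t" using \<Gamma>_cases[OF X(1)[of n]] by metis
        obtain s where s: "0 \<le> s" "s \<le> len E" "x = \<gamma> E s" using near[OF X(1)] elim(1) E by (metis less_imp_le)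
        then have "s = 0 \<or> s = len E" using xv \<gamma>_vertex_iff[OF E(1)] by blast
        then have "E \<in> Inc N x" using s(3) E(1) \<gamma>_len[OF E(1)] by (auto simp: Inc_def)
        then have "0 < LG (w n) (X n) E (slope E \<Phi> t)" using elim(3) E by auto
        moreover have "1 * LG (w n) (X n) E (slope E \<Phi> t) \<le> 0" using elim(1) E unfolding visc_cond_def by blast
        ultimately show ?thesis by simp
      qed
    qed
    then show False by simp
  qed
  have sl: "slope E \<Phi> (end_coord E x) = slope E \<phi> (end_coord E x)" if "E \<in> Inc N x" for E
    using slope_add[OF \<phi> Q(1) Inc_edges[OF that], of "end_coord E x"]
      Q(6)[OF Inc_edges[OF that] end_coord_bounds \<gamma>_end_coord[OF that, symmetric]] end_coord_bounds[of E x] by (simp add: \<Phi>_def)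
  show "visc_cond 1 (LG u x) u x \<phi>"
    unfolding visc_cond_def
  proof (intro conjI ballI allI impI)
    fix E s assume E: "E \<in> edges N" and s: "0 < s \<and> s < len E \<and> x = \<gamma> E s"
    show "1 * LG u x E (slope E \<phi> s) \<le> 0"
    proof (rule ccontr)
      assume "\<not> ?thesis"
      then have pos: "0 < LG u x E (slope E \<phi> s)" by simp
      have sb: "0 \<le> s" "s \<le> len E" "x = \<gamma> E s" using s by auto
      have "\<forall>\<^sub>F n in sequentially. \<rho> x (X n) < min s (len E - s)" using order_tendstoD(2)[OF Xx, of "min s (len E - s)"] s by simp
      with star[OF E sb pos] cond have "\<forall>\<^sub>F n in sequentially. False"
      proof eventually_elim
        case (elim n)
        obtain t where t: "0 < t" "t < len E" "X n = \<gamma> E t"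
          using edge_ball[OF E sb(1,2) X(1) elim(3)[unfolded sb(3)] order_refl] by blast
        then have "1 * LG (w n) (X n) E (slope E \<Phi> t) \<le> 0" using elim(2) E unfolding visc_cond_def by blast
        moreover have "0 < LG (w n) (X n) E (slope E \<Phi> t)"
          using elim(1) less_imp_le[OF t(1)] less_imp_le[OF t(2)] t(3) by blast
        ultimately show ?case by simp
      qed
      then show False by simp
    qed
  next
    assume i: "x \<in> inner_verts N"
    show "(\<exists>E\<in>Inc N x. 1 * LG u x E (slope E \<phi> (end_coord E x)) \<le> 0) \<or>
      1 * ((\<Sum>E\<in>Inc N x. - (end_sign E x * slope E \<phi> (end_coord E x))) - B x) \<le> 0"
    proof (rule ccontr)
      assume n: "\<not> ?thesis"
      show False
      proof (rule vertex_case)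
        show "x \<in> verts N" using i by (simp add: verts_def)
        show "\<forall>E \<in> Inc N x. 0 < LG u x E (slope E \<phi> (end_coord E x))" using n by auto
        have "(\<Sum>E\<in>Inc N x. - (end_sign E x * slope E \<Phi> (end_coord E x))) = (\<Sum>E\<in>Inc N x. - (end_sign E x * slope E \<phi> (end_coord E x)))"
          using sl by (intro sum.cong) auto
        then show "\<forall>\<^sub>F n in sequentially. \<not> (visc_cond 1 (LG (w n) x) (w n) x \<Phi> \<and> (\<forall>E \<in> Inc N x. 0 < LG (w n) x E (slope E \<Phi> (end_coord E x))))"
          using n i unfolding visc_cond_def by (intro always_eventually allI) force
      qed
    qed
  next
    assume i: "x \<in> bdry_verts N"
    show "(\<exists>E\<in>Inc N x. 1 * LG u x E (slope E \<phi> (end_coord E x)) \<le> 0) \<or> 1 * (u x - h x) \<le> 0"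
    proof (rule ccontr)
      assume n: "\<not> ?thesis"
      show False
      proof (rule vertex_case)
        show "x \<in> verts N" using i by (simp add: verts_def)
        show "\<forall>E \<in> Inc N x. 0 < LG u x E (slope E \<phi> (end_coord E x))" using n by auto
        have "h x < u x" using n by simp
        from order_tendstoD(1)[OF wx this]
        show "\<forall>\<^sub>F n in sequentially. \<not> (visc_cond 1 (LG (w n) x) (w n) x \<Phi> \<and> (\<forall>E \<in> Inc N x. 0 < LG (w n) x E (slope E \<Phi> (end_coord E x))))"
        proof eventually_elim
          case (elim m)
          then show ?case using i unfolding visc_cond_def by force
        qed
      qed
    qed
  qed
qed

text \<open>Uniform convergence with a common Lipschitz constant supplies the limits along moving
  points that \<open>nonloc_tendsto\<close> asks for.\<close>

lemma LG_tendsto: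
  assumes E: "E \<in> edges N" and s: "0 \<le> s" "s \<le> len E" and u: "\<rho>_lipschitz L u"
    and w: "\<And>n. \<rho>_lipschitz L (w n)" and wu: "\<And>n z. z \<in> \<Gamma> \<Longrightarrow> \<bar>w n z - u z\<bar> \<le> e n" "e \<longlonglongrightarrow> 0"
    and y: "\<And>n. 0 \<le> y n \<and> y n \<le> len E" "y \<longlonglongrightarrow> s" and p: "pn \<longlonglongrightarrow> p"
  shows "(\<lambda>n. LG (w n) (\<gamma> E (y n)) E (pn n)) \<longlonglongrightarrow> LG u (\<gamma> E s) E p"
proof -
  have xn: "\<gamma> E (y n) \<in> \<Gamma>" for n using \<gamma>_in_\<Gamma>[OF E] y by blast
  have conv: "(\<lambda>n. w n (\<gamma> F (t n))) \<longlonglongrightarrow> u (\<gamma> F z)"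
    if F: "F \<in> edges N" and t: "t \<longlonglongrightarrow> z" "\<And>n. 0 \<le> t n \<and> t n \<le> len F" and z: "0 \<le> z" "z \<le> len F" for F t z
  proof (rule LIM_zero_cancel, rule Lim_null_comparison)
    show "\<forall>\<^sub>F n in sequentially. norm (w n (\<gamma> F (t n)) - u (\<gamma> F z)) \<le> e n + \<bar>u (\<gamma> F (t n)) - u (\<gamma> F z)\<bar>"
    proof (intro always_eventually allI)
      fix n
      have "\<bar>w n (\<gamma> F (t n)) - u (\<gamma> F (t n))\<bar> \<le> e n" using wu(1)[OF \<gamma>_in_\<Gamma>[OF F]] t(2) by blast
      then show "norm (w n (\<gamma> F (t n)) - u (\<gamma> F z)) \<le> e n + \<bar>u (\<gamma> F (t n)) - u (\<gamma> F z)\<bar>"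
        unfolding real_norm_def by linarith
    qed
    have "(\<lambda>n. u (\<gamma> F (t n))) \<longlonglongrightarrow> u (\<gamma> F z)" by (rule C0_tendsto[OF \<rho>_lipschitz_C0[OF u] F t(1) z t(2)])
    then have "(\<lambda>n. \<bar>u (\<gamma> F (t n)) - u (\<gamma> F z)\<bar>) \<longlonglongrightarrow> 0" by (simp add: LIM_zero_iff tendsto_rabs_zero_iff)
    then show "(\<lambda>n. e n + \<bar>u (\<gamma> F (t n)) - u (\<gamma> F z)\<bar>) \<longlonglongrightarrow> 0" by (rule tendsto_add_zero[OF wu(2)])
  qed
  have "(\<lambda>n. nonloc N \<nu> E \<Gamma> (w n) (\<gamma> E (y n))) \<longlonglongrightarrow> nonloc N \<nu> E \<Gamma> u (\<gamma> E s)"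
    by (rule nonloc_tendsto[OF E y(1) s y(2) \<rho>_lipschitz_at[OF w xn] \<rho>_lipschitz_at[OF u \<gamma>_in_\<Gamma>[OF E s]]
      conv[OF E y(2,1) s]]) (use conv in auto)
  then show ?thesis unfolding LG_def
    by (intro tendsto_intros conv[OF E y(2,1) s] H_tendsto[OF E y(1) s y(2) p])
qed

lemma \<rho>_lipschitz_square: "x \<in> \<Gamma> \<Longrightarrow> y \<in> \<Gamma> \<Longrightarrow> z \<in> \<Gamma> \<Longrightarrow> \<bar>(\<rho> x y)\<^sup>2 - (\<rho> x z)\<^sup>2\<bar> \<le> 2 * diam * \<rho> y z"
proof -
  assume G: "x \<in> \<Gamma>" "y \<in> \<Gamma>" "z \<in> \<Gamma>"
  have "(\<rho> x y)\<^sup>2 - (\<rho> x z)\<^sup>2 = (\<rho> x y + \<rho> x z) * (\<rho> x y - \<rho> x z)"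
    by (simp add: power2_eq_square algebra_simps)
  then have "\<bar>(\<rho> x y)\<^sup>2 - (\<rho> x z)\<^sup>2\<bar> = (\<rho> x y + \<rho> x z) * \<bar>\<rho> x y - \<rho> x z\<bar>"
    using abs_of_nonneg[of "\<rho> x y + \<rho> x z"] by (simp add: abs_mult)
  also have "\<dots> \<le> (2 * diam) * \<rho> y z"
    using \<rho>_le_diam[OF G(1,2)] \<rho>_le_diam[OF G(1,3)] abs_\<rho>_diff_le[OF G(2,3,1)] diam_pos
    by (intro mult_mono) (auto simp: \<rho>_commute)
  finally show ?thesis .
qed

text \<open>If the supersolution condition fails at \<open>x\<close>, raising a test function slightly near \<open>x\<close> and taking the
  maximum with \<open>u\<close> gives a larger subsolution.\<close>

lemma maximal_subsolution_is_supersolution: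
  assumes u: "\<rho>_lipschitz L u" and sub: "visc_lip 1 u"
    and maximal: "\<And>w. w \<in> C0 N \<Longrightarrow> visc_gen 1 w \<Longrightarrow> (\<And>z. z \<in> \<Gamma> \<Longrightarrow> u z \<le> w z) \<Longrightarrow> (\<And>z. z \<in> \<Gamma> \<Longrightarrow> w z \<le> u z)"
  shows "visc_lip (-1) u"
  unfolding visc_lip_def
proof (intro ballI allI impI)
  fix x \<delta> \<phi> assume x: "x \<in> \<Gamma>" and \<phi>: "\<phi> \<in> C1 N" and t: "touches (-1) u \<phi> x \<delta>"
  have \<delta>: "0 < \<delta>" and touch: "\<And>y. y \<in> \<Gamma> \<Longrightarrow> \<rho> x y < \<delta> \<Longrightarrow> \<phi> y - \<phi> x + u x \<le> u y"
    using t by (auto simp: touches_def geo_ball_def)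
  show "visc_cond (-1) (LG u x) u x \<phi>"
  proof (rule ccontr)
    assume fail: "\<not> ?thesis"
    have F1: "LG u x E (slope E \<phi> s) < 0" if E: "E \<in> edges N" and s: "0 \<le> s" "s \<le> len E" "x = \<gamma> E s" for E s
    proof (cases "x \<in> verts N")
      case True
      then have se: "s = 0 \<or> s = len E" using \<gamma>_vertex_iff[OF E s(1,2)] s(3) by simp
      then have I: "E \<in> Inc N x" using s(3) E \<gamma>_len[OF E] by (auto simp: Inc_def)
      have "s = end_coord E x"
        using \<gamma>_eq_iff[OF E, of s "end_coord E x"] \<gamma>_end_coord[OF I] s(3) by simp
      moreover have "\<not> (0 < t \<and> t < len F \<and> x = \<gamma> F t)" if "F \<in> edges N" for F t
        using True \<gamma>_interior[OF that, of t] edge_no_verts[OF that] by blast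
      ultimately show ?thesis using fail I unfolding visc_cond_def by force
    next
      case False
      then have iv: "x \<notin> inner_verts N" "x \<notin> bdry_verts N" by (auto simp: verts_def)
      obtain F r where F: "F \<in> edges N" "0 < r" "r < len F" "x = \<gamma> F r" "LG u x F (slope F \<phi> r) < 0"
        using fail iv unfolding visc_cond_def by force
      have "x \<in> F" using \<gamma>_interior[OF F(1-3)] F(4) by simp
      then have "E = F" using \<gamma>_in_edge_eq[OF F(1) E s(1,2)] s(3) by simp
      moreover have "s = r" using \<gamma>_eq_iff[OF E, of s r] F(4) s(3) \<open>E = F\<close> by simp
      ultimately show ?thesis using F(5) by simp
    qed
    have noint: "\<not> (0 < t \<and> t < len F \<and> x = \<gamma> F t)" if "x \<in> verts N" "F \<in> edges N" for F t
      using that(1) \<gamma>_interior[OF that(2), of t] edge_no_verts[OF that(2)] by blast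
    have F2: "(\<Sum>E\<in>Inc N x. - (end_sign E x * slope E \<phi> (end_coord E x))) - B x < 0" if i: "x \<in> inner_verts N"
    proof -
      have "x \<in> verts N" "x \<notin> bdry_verts N" using i verts_disjoint by (auto simp: verts_def)
      then show ?thesis using fail i noint unfolding visc_cond_def by force
    qed
    have F3: "u x < h x" if i: "x \<in> bdry_verts N"
    proof -
      have "x \<in> verts N" "x \<notin> inner_verts N" using i verts_disjoint by (auto simp: verts_def)
      then show ?thesis using fail i noint unfolding visc_cond_def by force
    qed
    obtain L\<phi> where L\<phi>: "\<rho>_lipschitz L\<phi> \<phi>" using C1_\<rho>_lipschitz[OF \<phi>] by blast
    obtain M1 where M1: "0 < M1" "\<And>y. y \<in> \<Gamma> \<Longrightarrow> \<bar>u y\<bar> \<le> M1" using C0_bounded[OF \<rho>_lipschitz_C0[OF u]] by blast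
    obtain M2 where M2: "0 < M2" "\<And>y. y \<in> \<Gamma> \<Longrightarrow> \<bar>\<phi> y\<bar> \<le> M2" using C0_bounded[OF C1_C0[OF \<phi>]] by blast
    \<comment> \<open>Large enough for the raised function to lie below \<open>u\<close> at every
      point at distance at least \<open>\<delta>\<close>, whatever \<open>e n \<le> 1\<close>
      is.\<close>
    define k where "k = (2 * M1 + 2 * M2 + 1) / \<delta>\<^sup>2"
    have k: "0 < k" "k * \<delta>\<^sup>2 = 2 * M1 + 2 * M2 + 1" using \<delta> M1(1) M2(1) by (auto simp: k_def)
    define e where "e = (\<lambda>n. 1 / real (Suc n))"
    have e0: "0 < e n" "e n \<le> 1" for n by (auto simp: e_def)
    have elim: "e \<longlonglongrightarrow> 0" unfolding e_def using LIMSEQ_inverse_real_of_nat by (simp add: inverse_eq_divide)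
    define \<psi> where "\<psi> = (\<lambda>n y. \<phi> y - \<phi> x + u x - k * (\<rho> x y)\<^sup>2 + e n)"
    define W where "W = (\<lambda>n y. max (u y) (\<psi> n y))"
    \<comment> \<open>The set on which \<open>u\<close> is raised shrinks to \<open>x\<close> as
      \<open>e n\<close> tends to \<open>0\<close>.\<close>
    have above: "\<rho> x y < \<delta> \<and> k * (\<rho> x y)\<^sup>2 < e n" if y: "y \<in> \<Gamma>" and gt: "u y < \<psi> n y" for n y
    proof -
      have lt: "\<rho> x y < \<delta>"
      proof (rule ccontr)
        assume "\<not> ?thesis"
        then have "\<delta>\<^sup>2 \<le> (\<rho> x y)\<^sup>2" using \<delta> by (intro power_mono) auto
        then have "k * \<delta>\<^sup>2 \<le> k * (\<rho> x y)\<^sup>2" using k by (intro mult_left_mono) auto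
        then show False using gt M1(2)[OF y] M1(2)[OF x] M2(2)[OF y] M2(2)[OF x] e0(2)[of n] k(2) unfolding \<psi>_def by linarith
      qed
      then show ?thesis using touch[OF y lt] gt unfolding \<psi>_def by linarith
    qed
    have \<psi>le: "\<psi> n y \<le> u y + e n" if y: "y \<in> \<Gamma>" for n y
    proof (cases "u y < \<psi> n y")
      case True
      have "0 \<le> k * (\<rho> x y)\<^sup>2" using k by simp
      then show ?thesis using touch[OF y] above[OF y True] unfolding \<psi>_def by linarith
    qed (use e0(1)[of n] in linarith)
    define K where "K = max L (L\<phi> + k * (2 * diam))"
    have L0: "0 \<le> L" "0 \<le> L\<phi>" using u L\<phi> by (auto simp: \<rho>_lipschitz_def)
    have WL: "\<rho>_lipschitz K (W n)" for n
      unfolding \<rho>_lipschitz_def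
    proof (intro conjI ballI)
      show "0 \<le> K" using L0 by (simp add: K_def)
      fix y z assume yz: "y \<in> \<Gamma>" "z \<in> \<Gamma>"
      have "\<bar>u y - u z\<bar> \<le> L * \<rho> y z" using u yz unfolding \<rho>_lipschitz_def by blast
      also have "\<dots> \<le> K * \<rho> y z" by (intro mult_right_mono) (auto simp: K_def)
      finally have 1: "\<bar>u y - u z\<bar> \<le> K * \<rho> y z" .
      have "\<bar>\<phi> y - \<phi> z\<bar> \<le> L\<phi> * \<rho> y z" using L\<phi> yz unfolding \<rho>_lipschitz_def by blast
      moreover have "k * \<bar>(\<rho> x y)\<^sup>2 - (\<rho> x z)\<^sup>2\<bar> \<le> k * (2 * diam * \<rho> y z)"
        using \<rho>_lipschitz_square[OF x yz] k by (intro mult_left_mono) auto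
      moreover have "\<bar>k * (\<rho> x y)\<^sup>2 - k * (\<rho> x z)\<^sup>2\<bar> = k * \<bar>(\<rho> x y)\<^sup>2 - (\<rho> x z)\<^sup>2\<bar>"
        using k by (simp add: abs_mult flip: right_diff_distrib)
      ultimately have "\<bar>\<psi> n y - \<psi> n z\<bar> \<le> L\<phi> * \<rho> y z + k * (2 * diam * \<rho> y z)" unfolding \<psi>_def by linarith
      also have "\<dots> = (L\<phi> + k * (2 * diam)) * \<rho> y z" by (simp add: algebra_simps)
      also have "\<dots> \<le> K * \<rho> y z" by (intro mult_right_mono) (auto simp: K_def)
      finally show "\<bar>W n y - W n z\<bar> \<le> K * \<rho> y z" using 1 unfolding W_def by linarith
    qed
    have uK: "\<rho>_lipschitz K u"
      using u unfolding \<rho>_lipschitz_def K_def by (auto intro: order.trans[OF _ mult_right_mono[of L "max L (L\<phi> + k * (2 * diam))"]])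
    have Wu: "\<bar>W n z - u z\<bar> \<le> e n" if "z \<in> \<Gamma>" for n z
      using \<psi>le[OF that, of n] e0(1)[of n] unfolding W_def by linarith
    \<comment> \<open>The derivative of \<open>\<psi> n\<close> along an edge on which
      \<open>x\<close> has coordinate \<open>s\<close>, since there the distance to \<open>x\<close>
      is \<bar>\<open>t - s\<close>\<bar>. At \<open>t = s\<close> it equals the slope of
      \<open>\<phi>\<close>.\<close>
    define sl where "sl = (\<lambda>E s t. slope E \<phi> t - 2 * k * (t - s))"
    have star: "\<forall>\<^sub>F n in sequentially. \<forall>t. 0 \<le> t \<and> t \<le> len E \<and> u (\<gamma> E t) < \<psi> n (\<gamma> E t) \<longrightarrow> LG (W n) (\<gamma> E t) E (sl E s t) < 0"
      if E: "E \<in> edges N" and s: "0 \<le> s" "s \<le> len E" "x = \<gamma> E s" for E s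
    proof -
      define bad where "bad = (\<lambda>n t. (0 \<le> t \<and> t \<le> len E \<and> u (\<gamma> E t) < \<psi> n (\<gamma> E t)) \<and> \<not> LG (W n) (\<gamma> E t) E (sl E s t) < 0)"
      \<comment> \<open>A violating coordinate if there is one, otherwise \<open>s\<close>.
        Negativity for all \<open>t\<close> is thus reduced to one sequence, which tends to
        \<open>s\<close>.\<close>
      define y where "y = (\<lambda>n. if \<exists>t. bad n t then SOME t. bad n t else s)"
      have yb: "bad n (y n)" if "bad n t" for n t
        using someI[of "bad n" t] that unfolding y_def by auto
      have y: "0 \<le> y n \<and> y n \<le> len E" for n
      proof (cases "\<exists>t. bad n t")
        case True
        then have "bad n (y n)" using yb by blast
        then show ?thesis unfolding bad_def by blast
      next
        case False
        have "y n = s" unfolding y_def by (rule if_not_P[OF False])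
        then show ?thesis using s by simp
      qed
      have "k * (y n - s)\<^sup>2 \<le> e n" for n
      proof (cases "\<exists>t. bad n t")
        case True
        then have "bad n (y n)" using yb by blast
        then have "k * (\<rho> x (\<gamma> E (y n)))\<^sup>2 < e n" using above[OF \<gamma>_in_\<Gamma>[OF E]] unfolding bad_def by blast
        moreover have "\<rho> x (\<gamma> E (y n)) = \<bar>s - y n\<bar>" using \<rho>_edge[OF E s(1,2)] y s(3) by simp
        ultimately show ?thesis by (simp add: power2_commute)
      next
        case False
        have "y n = s" unfolding y_def by (rule if_not_P[OF False])
        then show ?thesis using e0(1)[of n] by simp
      qed
      then have "(y n - s)\<^sup>2 \<le> e n / k" for n using k(1) by (simp add: field_simps)
      moreover have "(\<lambda>n. e n / k) \<longlonglongrightarrow> 0 / k" by (intro tendsto_intros elim) (use k in auto)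
      ultimately have "(\<lambda>n. (y n - s)\<^sup>2) \<longlonglongrightarrow> 0"
        by (intro Lim_null_comparison[of "\<lambda>n. (y n - s)\<^sup>2" "\<lambda>n. e n / k"]) (auto intro!: always_eventually)
      then have "(\<lambda>n. sqrt ((y n - s)\<^sup>2)) \<longlonglongrightarrow> sqrt 0" by (rule tendsto_real_sqrt)
      then have ys: "y \<longlonglongrightarrow> s" by (simp add: tendsto_rabs_zero_iff LIM_zero_iff)
      have "(\<lambda>n. slope E \<phi> (y n)) \<longlonglongrightarrow> slope E \<phi> s"
        using y s by (intro continuous_on_tendsto_compose[OF C1_slope(2)[OF \<phi> E] ys]) auto
      then have "(\<lambda>n. sl E s (y n)) \<longlonglongrightarrow> slope E \<phi> s - 2 * k * (s - s)"
        unfolding sl_def by (intro tendsto_intros ys)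
      then have p: "(\<lambda>n. sl E s (y n)) \<longlonglongrightarrow> slope E \<phi> s" by simp
      have "(\<lambda>n. LG (W n) (\<gamma> E (y n)) E (sl E s (y n))) \<longlonglongrightarrow> LG u (\<gamma> E s) E (slope E \<phi> s)"
        by (rule LG_tendsto[OF E s(1,2) uK WL Wu elim y ys p])
      moreover have "LG u (\<gamma> E s) E (slope E \<phi> s) < 0" using F1[OF E s] s(3) by simp
      ultimately have "\<forall>\<^sub>F n in sequentially. LG (W n) (\<gamma> E (y n)) E (sl E s (y n)) < 0" by (rule order_tendstoD(2))
      then show ?thesis
      proof eventually_elim
        case (elim n)
        show ?case
        proof (rule ccontr)
          assume "\<not> ?thesis"
          then obtain t where "bad n t" unfolding bad_def by blast
          then have "bad n (y n)" by (rule yb)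
          then show False using elim unfolding bad_def by blast
        qed
      qed
    qed
    have all: "\<forall>\<^sub>F n in sequentially. \<forall>E \<in> edges N. \<forall>s. 0 \<le> s \<and> s \<le> len E \<and> x = \<gamma> E s \<longrightarrow>
      (\<forall>t. 0 \<le> t \<and> t \<le> len E \<and> u (\<gamma> E t) < \<psi> n (\<gamma> E t) \<longrightarrow> LG (W n) (\<gamma> E t) E (sl E s t) < 0)"
    proof (intro eventually_ball_finite ballI finite_edges)
      fix E assume E: "E \<in> edges N"
      show "\<forall>\<^sub>F n in sequentially. \<forall>s. 0 \<le> s \<and> s \<le> len E \<and> x = \<gamma> E s \<longrightarrow>
        (\<forall>t. 0 \<le> t \<and> t \<le> len E \<and> u (\<gamma> E t) < \<psi> n (\<gamma> E t) \<longrightarrow> LG (W n) (\<gamma> E t) E (sl E s t) < 0)"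
      proof (cases "\<exists>s. 0 \<le> s \<and> s \<le> len E \<and> x = \<gamma> E s")
        case True
        then obtain s where s: "0 \<le> s" "s \<le> len E" "x = \<gamma> E s" by blast
        have uniq: "s' = s" if "x = \<gamma> E s'" for s' using that s(3) \<gamma>_eq_iff[OF E] by simp
        from star[OF E s] show ?thesis by eventually_elim (use uniq in blast)
      next
        case False
        show ?thesis by (rule always_eventually) (use False in blast)
      qed
    qed
    obtain r1 where r1: "0 < r1" and near: "\<And>y. y \<in> \<Gamma> \<Longrightarrow> \<rho> x y < r1 \<Longrightarrow> (y \<in> verts N \<longrightarrow> y = x) \<and>
      (\<forall>E t. E \<in> edges N \<longrightarrow> 0 \<le> t \<longrightarrow> t \<le> len E \<longrightarrow> y = \<gamma> E t \<longrightarrow> (\<exists>s. 0 \<le> s \<and> s \<le> len E \<and> x = \<gamma> E s))"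
      using near_point[OF x] by blast
    have "\<forall>\<^sub>F n in sequentially. e n < k * r1\<^sup>2" using order_tendstoD(2)[OF elim] k r1 by simp
    moreover have "\<forall>\<^sub>F n in sequentially. x \<in> bdry_verts N \<longrightarrow> u x + e n < h x"
    proof (cases "x \<in> bdry_verts N")
      case True
      have "\<forall>\<^sub>F n in sequentially. e n < h x - u x" using order_tendstoD(2)[OF elim] F3[OF True] by simp
      then show ?thesis by eventually_elim simp
    qed simp
    ultimately have "\<forall>\<^sub>F n in sequentially. (e n < k * r1\<^sup>2) \<and> (x \<in> bdry_verts N \<longrightarrow> u x + e n < h x) \<and>
      (\<forall>E \<in> edges N. \<forall>s. 0 \<le> s \<and> s \<le> len E \<and> x = \<gamma> E s \<longrightarrow>
      (\<forall>t. 0 \<le> t \<and> t \<le> len E \<and> u (\<gamma> E t) < \<psi> n (\<gamma> E t) \<longrightarrow> LG (W n) (\<gamma> E t) E (sl E s t) < 0))"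
      using all by (intro eventually_conj)
    then obtain n where n: "e n < k * r1\<^sup>2" "x \<in> bdry_verts N \<Longrightarrow> u x + e n < h x"
      and neg: "\<And>E s t. E \<in> edges N \<Longrightarrow> 0 \<le> s \<Longrightarrow> s \<le> len E \<Longrightarrow> x = \<gamma> E s \<Longrightarrow> 0 \<le> t \<Longrightarrow> t \<le> len E \<Longrightarrow>
        u (\<gamma> E t) < \<psi> n (\<gamma> E t) \<Longrightarrow> LG (W n) (\<gamma> E t) E (sl E s t) < 0"
      unfolding eventually_sequentially by blast
    have \<psi>d: "((\<lambda>t. \<psi> n (\<gamma> E t)) has_real_derivative sl E s t) (at t within {0..len E})"
      if E: "E \<in> edges N" and s: "0 \<le> s" "s \<le> len E" "x = \<gamma> E s" and t: "0 \<le> t" "t \<le> len E" for E s t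
    proof -
      have "((\<lambda>t. \<phi> (\<gamma> E t) - \<phi> x + u x - k * (t - s)\<^sup>2 + e n) has_real_derivative slope E \<phi> t - 0 + 0 - k * (2 * (t - s)) + 0) (at t within {0..len E})"
        using C1_slope(1)[OF \<phi> E, of t] t by (auto intro!: derivative_eq_intros)
      then have d: "((\<lambda>t. \<phi> (\<gamma> E t) - \<phi> x + u x - k * (t - s)\<^sup>2 + e n) has_real_derivative sl E s t) (at t within {0..len E})"
        by (rule DERIV_cong) (simp add: sl_def)
      show ?thesis
      proof (rule has_field_derivative_transform_within[OF d zero_less_one])
        show "t \<in> {0..len E}" using t by simp
        fix r assume "r \<in> {0..len E}" "dist r t < 1"
        then have "\<rho> x (\<gamma> E r) = \<bar>s - r\<bar>" using \<rho>_edge[OF E s(1,2), of r] s(3) by simp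
        then show "\<phi> (\<gamma> E r) - \<phi> x + u x - k * (r - s)\<^sup>2 + e n = \<psi> n (\<gamma> E r)"
          by (simp add: \<psi>_def power2_commute)
      qed
    qed
    have "visc_lip 1 (W n)"
      unfolding visc_lip_def
    proof (intro ballI allI impI)
      fix y \<delta>' \<Phi> assume y: "y \<in> \<Gamma>" and \<Phi>: "\<Phi> \<in> C1 N" and tt: "touches 1 (W n) \<Phi> y \<delta>'"
      have \<delta>': "0 < \<delta>'" and tch: "\<And>z. z \<in> \<Gamma> \<Longrightarrow> \<rho> y z < \<delta>' \<Longrightarrow> W n z - \<Phi> z \<le> W n y - \<Phi> y"
        using tt by (auto simp: touches_def geo_ball_def)
      show "visc_cond 1 (LG (W n) y) (W n) y \<Phi>"
      \<comment> \<open>Where \<open>W n = u\<close>, a test function for \<open>W n\<close> also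
        tests \<open>u\<close>, and raising \<open>u\<close> elsewhere only increases the nonlocal
        term. Where \<open>W n = \<psi> n\<close>, the slopes of the test function are governed by
        those of \<open>\<psi> n\<close>.\<close>
      proof (cases "u y < \<psi> n y")
        case False
        then have Wy: "W n y = u y" by (simp add: W_def)
        have "touches 1 u \<Phi> y \<delta>'"
          unfolding touches_def
        proof (intro conjI ballI \<delta>')
          fix z assume "z \<in> geo_ball N y \<delta>'"
          then have "W n z - \<Phi> z \<le> W n y - \<Phi> y" using tch by (auto simp: geo_ball_def)
          moreover have "u z \<le> W n z" by (simp add: W_def)
          ultimately show "1 * (u z - \<Phi> z) \<le> 1 * (u y - \<Phi> y)" using Wy unfolding mult_1_left by linarith
        qed
        then have c: "visc_cond 1 (LG u y) u y \<Phi>" using sub y \<Phi> unfolding visc_lip_def by blast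
        have "visc_cond 1 (LG (W n) y) u y \<Phi>"
        proof (rule visc_cond_mono[OF c y])
          fix E t p assume E: "E \<in> edges N" "0 \<le> t" "t \<le> len E" "y = \<gamma> E t"
          have "nonloc N \<nu> E \<Gamma> u (\<gamma> E t) \<le> nonloc N \<nu> E \<Gamma> (W n) (\<gamma> E t)"
            using Wy E(4) by (intro nonloc_mono[OF E(1-3) \<rho>_lipschitz_at[OF u] \<rho>_lipschitz_at[OF WL]] \<gamma>_in_\<Gamma>[OF E(1-3)])
              (auto simp: W_def)
          moreover have "W n (\<gamma> E t) = u (\<gamma> E t)" using Wy E(4) by simp
          ultimately show "1 * LG (W n) y E p \<le> 1 * LG u y E p" unfolding LG_def E(4) by simp
        qed
        then show ?thesis unfolding visc_cond_def Wy by blast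
      next
        case True
        then have Wy: "W n y = \<psi> n y" by (simp add: W_def)
        have tch': "\<Phi> y - \<psi> n y \<le> \<Phi> z - \<psi> n z" if "z \<in> \<Gamma>" "\<rho> y z < \<delta>'" for z
          using tch[OF that] Wy unfolding W_def by linarith
        have yr: "\<rho> x y < r1"
        proof (rule ccontr)
          assume "\<not> ?thesis"
          then have "r1\<^sup>2 \<le> (\<rho> x y)\<^sup>2" using r1 by (intro power_mono) auto
          then have "k * r1\<^sup>2 \<le> k * (\<rho> x y)\<^sup>2" using k by (intro mult_left_mono) auto
          then show False using above[OF y True] n(1) by linarith
        qed
        have dist: "\<rho> y (\<gamma> E t) = \<bar>s - t\<bar>" if "E \<in> edges N" "0 \<le> s" "s \<le> len E" "y = \<gamma> E s" "0 \<le> t" "t \<le> len E" for E s t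
          using \<rho>_edge[OF that(1-3,5,6)] that(4) by simp
        show ?thesis
          unfolding visc_cond_def
        proof (intro conjI ballI allI impI)
          fix E t assume E: "E \<in> edges N" and t: "0 < t \<and> t < len E \<and> y = \<gamma> E t"
          then have tb: "0 \<le> t" "t \<le> len E" "y = \<gamma> E t" by auto
          obtain s where s: "0 \<le> s" "s \<le> len E" "x = \<gamma> E s" using near[OF y yr] E tb by blast
          have "slope E \<Phi> t = sl E s t"
          proof (rule interior_slope_eq[OF \<Phi> E _ _ \<delta>' \<psi>d[OF E s tb(1,2)]])
            show "0 < t" "t < len E" using t by auto
            fix r assume "0 \<le> r" "r \<le> len E" "\<bar>r - t\<bar> < \<delta>'"
            then show "\<Phi> (\<gamma> E t) - \<psi> n (\<gamma> E t) \<le> \<Phi> (\<gamma> E r) - \<psi> n (\<gamma> E r)"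
              using tch'[OF \<gamma>_in_\<Gamma>[OF E, of r]] dist[OF E tb, of r] tb(3) by (simp add: abs_minus_commute)
          qed
          moreover have "LG (W n) (\<gamma> E t) E (sl E s t) < 0"
            by (rule neg[OF E s tb(1,2)]) (use True tb(3) in simp)
          ultimately show "1 * LG (W n) y E (slope E \<Phi> t) \<le> 0" using tb(3) by simp
        next
          assume i: "y \<in> inner_verts N"
          then have yx: "y = x" using near[OF y yr] by (auto simp: verts_def)
          \<comment> \<open>At a vertex contact only bounds inward slopes from below, and this is
            the direction in which the strict Kirchhoff inequality of \<open>\<phi>\<close> is
            inherited.\<close>
          have "end_sign E x * slope E \<phi> (end_coord E x) \<le> end_sign E x * slope E \<Phi> (end_coord E x)" if E: "E \<in> Inc N x" for E
          proof -
            note E' = Inc_edges[OF E] and ec = end_coord_bounds[of E x] \<gamma>_end_coord[OF E, symmetric]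
            have "end_sign E x * sl E (end_coord E x) (end_coord E x) \<le> end_sign E x * slope E \<Phi> (end_coord E x)"
            proof (rule inward_slope_ge[OF \<Phi> E \<delta>' \<psi>d[OF E' ec ec(1,2)]])
              fix r assume "0 \<le> r" "r \<le> len E" "\<bar>r - end_coord E x\<bar> < \<delta>'"
              then show "\<Phi> x - \<psi> n (\<gamma> E (end_coord E x)) \<le> \<Phi> (\<gamma> E r) - \<psi> n (\<gamma> E r)"
                using tch'[OF \<gamma>_in_\<Gamma>[OF E', of r]] dist[OF E' ec(1,2) _, of r] ec(3) yx
                by (simp add: abs_minus_commute)
            qed
            then show ?thesis by (simp add: sl_def)
          qed
          then have "(\<Sum>E\<in>Inc N x. - (end_sign E x * slope E \<Phi> (end_coord E x))) \<le> (\<Sum>E\<in>Inc N x. - (end_sign E x * slope E \<phi> (end_coord E x)))"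
            by (intro sum_mono) simp
          moreover have "(\<Sum>E\<in>Inc N x. - (end_sign E x * slope E \<phi> (end_coord E x))) - B x < 0" using F2 i yx by simp
          ultimately have "(\<Sum>E\<in>Inc N x. - (end_sign E x * slope E \<Phi> (end_coord E x))) - B x \<le> 0" by linarith
          then show "(\<exists>E\<in>Inc N y. 1 * LG (W n) y E (slope E \<Phi> (end_coord E y)) \<le> 0) \<or>
            1 * ((\<Sum>E\<in>Inc N y. - (end_sign E y * slope E \<Phi> (end_coord E y))) - B y) \<le> 0" using yx by simp
        next
          assume i: "y \<in> bdry_verts N"
          then have yx: "y = x" using near[OF y yr] by (auto simp: verts_def)
          have "W n y - h y \<le> 0" using n(2) i \<psi>le[OF y, of n] Wy yx by simp
          then show "(\<exists>E\<in>Inc N y. 1 * LG (W n) y E (slope E \<Phi> (end_coord E y)) \<le> 0) \<or> 1 * (W n y - h y) \<le> 0" by simp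
        qed
      qed
    qed
    then have "visc_gen 1 (W n)" using visc_gen_iff_lip[OF WL, of 1 n] by simp
    then have "W n x \<le> u x" using maximal[OF \<rho>_lipschitz_C0[OF WL] _ _ x, of n] by (simp add: W_def)
    moreover have "\<psi> n x = u x + e n" using x by (simp add: \<psi>_def)
    ultimately show False using e0(1)[of n] unfolding W_def by linarith
  qed
qed

text \<open>Equi-Lipschitz members have a Lipschitz supremum \<open>u\<close>, so no semicontinuous
  envelopes occur. A subsolution above \<open>u\<close> is above \<open>- K\<close> and so belongs
  to the family, which is the maximality required.\<close>

lemma existence: "\<exists>u L. \<rho>_lipschitz L u \<and> visc_gen 1 u \<and> visc_gen (-1) u"
proof -
  obtain K where K: "visc_gen 1 (\<lambda>_. - K)" using constant_subsolution by blast
  obtain M where M: "\<And>w x. w \<in> C0 N \<Longrightarrow> visc_gen 1 w \<Longrightarrow> x \<in> \<Gamma> \<Longrightarrow> w x \<le> M" using subsolution_upper_bound by blast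
  define S where "S = perron_family K"
  have Sd: "w \<in> C0 N" "visc_gen 1 w" "\<And>x. x \<in> \<Gamma> \<Longrightarrow> - K \<le> w x" if "w \<in> S" for w
    using that by (auto simp: S_def perron_family_def)
  have cS: "csub (max \<bar>M\<bar> \<bar>K\<bar>) w" if "w \<in> S" for w
    using Sd[OF that] M[OF Sd(1,2)[OF that]] unfolding csub_def by (auto simp: abs_le_iff) (smt (verit))+
  have "\<exists>L. \<forall>w. csub (max \<bar>M\<bar> \<bar>K\<bar>) w \<longrightarrow> \<rho>_lipschitz L w" by (rule csub_lipschitz) simp
  then obtain L0 where L0: "\<And>w. w \<in> S \<Longrightarrow> \<rho>_lipschitz L0 w" using cS by blast
  have cK: "(\<lambda>_. - K) \<in> S" using K by (auto simp: S_def perron_family_def C0_const)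
  then have L0n: "0 \<le> L0" using L0 by (auto simp: \<rho>_lipschitz_def)
  define u where "u = (\<lambda>x. SUP w \<in> S. w x)"
  have bdd: "bdd_above ((\<lambda>w. w x) ` S)" if "x \<in> \<Gamma>" for x
    using M[OF Sd(1,2) that] by (intro bdd_aboveI[of _ M]) auto
  have up: "w x \<le> u x" if "x \<in> \<Gamma>" "w \<in> S" for w x
    unfolding u_def using that bdd[OF that(1)] by (intro cSUP_upper) auto
  have least: "u x \<le> c" if "\<And>w. w \<in> S \<Longrightarrow> w x \<le> c" for x c
    unfolding u_def using that cK by (intro cSUP_least) auto
  have uL: "\<rho>_lipschitz L0 u"
    unfolding \<rho>_lipschitz_def
  proof (intro conjI ballI L0n)
    have le: "u x \<le> u y + L0 * \<rho> x y" if xy: "x \<in> \<Gamma>" "y \<in> \<Gamma>" for x y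
    proof (rule least)
      fix w assume w: "w \<in> S"
      have "\<bar>w x - w y\<bar> \<le> L0 * \<rho> x y" using L0[OF w] xy unfolding \<rho>_lipschitz_def by blast
      then show "w x \<le> u y + L0 * \<rho> x y" using up[OF xy(2) w] by linarith
    qed
    fix x y assume xy: "x \<in> \<Gamma>" "y \<in> \<Gamma>"
    show "\<bar>u x - u y\<bar> \<le> L0 * \<rho> x y" using le[OF xy] le[OF xy(2,1)] \<rho>_commute[of x y] by simp
  qed
  have sub: "visc_lip 1 u"
  proof (rule sup_subsolution[OF uL])
    fix w assume w: "w \<in> S"
    show "\<rho>_lipschitz L0 w \<and> visc_lip 1 w \<and> (\<forall>z \<in> \<Gamma>. w z \<le> u z)"
      using L0[OF w] Sd(2)[OF w] visc_gen_iff_lip[OF L0[OF w], of 1] up w by simp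
  next
    fix x e :: real and y :: 'a assume "y \<in> \<Gamma>" "0 < e"
    show "\<exists>w \<in> S. u y - e < w y"
    proof (rule ccontr)
      assume "\<not> ?thesis"
      then have "u y \<le> u y - e" by (intro least) auto
      then show False using \<open>0 < e\<close> by simp
    qed
  qed
  have "visc_lip (-1) u"
  proof (rule maximal_subsolution_is_supersolution[OF uL sub])
    fix w z assume w: "w \<in> C0 N" "visc_gen 1 w" "\<And>z. z \<in> \<Gamma> \<Longrightarrow> u z \<le> w z" and z: "z \<in> \<Gamma>"
    have "- K \<le> w y" if "y \<in> \<Gamma>" for y using up[OF that cK] w(3)[OF that] by linarith
    then have "w \<in> S" using w(1,2) by (simp add: S_def perron_family_def)
    then show "w z \<le> u z" using up z by blast
  qed
  then show ?thesis using uL sub visc_gen_iff_lip[OF uL, of 1] visc_gen_iff_lip[OF uL, of "-1"] by auto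
qed

end

subsection \<open>Comparison\<close>

text \<open>\<open>upper_slope V\<close> is the upper right Dini derivative of \<open>V\<close> at \<open>0\<close>; the lower one is
  \<open>- upper_slope (\<lambda>t. - V t)\<close>.\<close>

definition slope_above :: "(real \<Rightarrow> real) \<Rightarrow> real set" where
  "slope_above V = {p. \<exists>\<eta>>0. \<forall>t. 0 < t \<and> t < \<eta> \<longrightarrow> V t - V 0 \<le> p * t}"

definition upper_slope :: "(real \<Rightarrow> real) \<Rightarrow> real" where
  "upper_slope V = Inf (slope_above V)"

definition right_lipschitz :: "real \<Rightarrow> real \<Rightarrow> (real \<Rightarrow> real) \<Rightarrow> bool" where
  "right_lipschitz L d V \<longleftrightarrow> 0 < d \<and> continuous_on {0..<d} V \<and> (\<forall>t. 0 < t \<and> t < d \<longrightarrow> \<bar>V t - V 0\<bar> \<le> L * t)"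

lemma right_lipschitz_uminus: "right_lipschitz L d V \<Longrightarrow> right_lipschitz L d (\<lambda>t. - V t)"
  unfolding right_lipschitz_def by (auto intro: continuous_on_minus simp: abs_minus_commute)

lemma slope_above_props:
  assumes "right_lipschitz L d V"
  shows "L \<in> slope_above V" "p \<in> slope_above V \<Longrightarrow> - L \<le> p"
proof -
  have d: "0 < d" "\<And>t. 0 < t \<Longrightarrow> t < d \<Longrightarrow> \<bar>V t - V 0\<bar> \<le> L * t" using assms by (auto simp: right_lipschitz_def)
  show "L \<in> slope_above V" unfolding slope_above_def using d by (auto intro!: exI[of _ d] simp: abs_le_iff)
  assume "p \<in> slope_above V"
  then obtain \<eta> where \<eta>: "0 < \<eta>" "\<And>t. 0 < t \<Longrightarrow> t < \<eta> \<Longrightarrow> V t - V 0 \<le> p * t" by (auto simp: slope_above_def)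
  define t where "t = min \<eta> d / 2"
  have t: "0 < t" "t < \<eta>" "t < d" using \<eta>(1) d(1) by (auto simp: t_def)
  have "- L * t \<le> p * t" using \<eta>(2)[OF t(1,2)] d(2)[OF t(1,3)] by (simp add: abs_le_iff)
  then show "- L \<le> p" by (rule mult_right_le_imp_le[OF _ t(1)])
qed

lemma upper_slope_le: "right_lipschitz L d V \<Longrightarrow> upper_slope V \<le> L"
  unfolding upper_slope_def using slope_above_props by (intro cInf_lower) (auto intro!: bdd_belowI[of _ "- L"])

lemma upper_slope_less:
  assumes V: "right_lipschitz L d V" and p: "upper_slope V < p"
  obtains \<eta> where "0 < \<eta>" "\<And>t. 0 < t \<Longrightarrow> t < \<eta> \<Longrightarrow> V t - V 0 \<le> p * t"
proof -
  obtain q where q: "q \<in> slope_above V" "q < p"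
    using p cInf_less_iff[of "slope_above V" p] slope_above_props[OF V] unfolding upper_slope_def
    by (metis bdd_belowI empty_iff)
  then obtain \<eta> where \<eta>: "0 < \<eta>" "\<And>t. 0 < t \<Longrightarrow> t < \<eta> \<Longrightarrow> V t - V 0 \<le> q * t" by (auto simp: slope_above_def)
  have "V t - V 0 \<le> p * t" if "0 < t" "t < \<eta>" for t
  proof -
    have "q * t \<le> p * t" using q(2) that by (intro mult_right_mono) auto
    then show ?thesis using \<eta>(2)[OF that] by linarith
  qed
  then show thesis using that \<eta>(1) by blast
qed

lemma upper_slope_greater:
  assumes V: "right_lipschitz L d V" and p: "p < upper_slope V" and \<eta>: "0 < \<eta>"
  obtains t where "0 < t" "t < \<eta>" "p * t < V t - V 0"
proof (rule ccontr)
  assume "\<not> thesis"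
  then have "p \<in> slope_above V" unfolding slope_above_def using that \<eta> by (auto simp: not_less[symmetric])
  then have "upper_slope V \<le> p"
    unfolding upper_slope_def using slope_above_props[OF V] by (intro cInf_lower) (auto intro!: bdd_belowI[of _ "- L"])
  then show False using p by simp
qed

lemma upper_slope_mono:
  assumes V: "right_lipschitz L d V" and W: "right_lipschitz K e W" and r: "0 < r"
    and le: "\<And>t. 0 < t \<Longrightarrow> t < r \<Longrightarrow> V t - V 0 \<le> W t - W 0"
  shows "upper_slope V \<le> upper_slope W"
proof (rule ccontr)
  assume neg: "\<not> ?thesis"
  define p where "p = (upper_slope V + upper_slope W) / 2"
  have p: "upper_slope W < p" "p < upper_slope V" using neg by (auto simp: p_def)
  obtain \<eta> where \<eta>: "0 < \<eta>" "\<And>t. 0 < t \<Longrightarrow> t < \<eta> \<Longrightarrow> W t - W 0 \<le> p * t" using upper_slope_less[OF W p(1)] by blast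
  obtain t where t: "0 < t" "t < min \<eta> r" "p * t < V t - V 0" using upper_slope_greater[OF V p(2), of "min \<eta> r"] \<eta>(1) r by auto
  then show False using \<eta>(2)[of t] le[of t] by auto
qed

lemma lower_slope_le_upper_slope:
  assumes V: "right_lipschitz L d V" shows "- upper_slope (\<lambda>t. - V t) \<le> upper_slope V"
proof (rule ccontr)
  assume neg: "\<not> ?thesis"
  define p where "p = (upper_slope V - upper_slope (\<lambda>t. - V t)) / 2"
  have p: "upper_slope V < p" "upper_slope (\<lambda>t. - V t) < - p" using neg by (auto simp: p_def field_simps)
  define q where "q = (upper_slope V + p) / 2"
  have q: "upper_slope V < q" "q < p" using p by (auto simp: q_def)
  obtain \<eta> where \<eta>: "0 < \<eta>" "\<And>t. 0 < t \<Longrightarrow> t < \<eta> \<Longrightarrow> V t - V 0 \<le> q * t" using upper_slope_less[OF V q(1)] by blast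
  obtain \<eta>' where \<eta>': "0 < \<eta>'" "\<And>t. 0 < t \<Longrightarrow> t < \<eta>' \<Longrightarrow> - V t - - V 0 \<le> - p * t"
    using upper_slope_less[OF right_lipschitz_uminus[OF V] p(2)] by blast
  define t where "t = min \<eta> \<eta>' / 2"
  have t: "0 < t" "t < \<eta>" "t < \<eta>'" using \<eta>(1) \<eta>'(1) by (auto simp: t_def)
  have "p * t \<le> q * t" using \<eta>(2)[OF t(1,2)] \<eta>'(2)[OF t(1,3)] by simp
  then show False using q(2) t(1) by simp
qed

lemma interior_max:
  fixes g :: "real \<Rightarrow> real"
  assumes "continuous_on {a..b} g" "a < m" "m < b" "g a < g m" "g b < g m"
  shows "\<exists>t. a < t \<and> t < b \<and> (\<forall>r. a \<le> r \<and> r \<le> b \<longrightarrow> g r \<le> g t)"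
proof -
  obtain t where t: "t \<in> {a..b}" "\<And>r. r \<in> {a..b} \<Longrightarrow> g r \<le> g t"
    using continuous_attains_sup[of "{a..b}" g] assms by auto
  have "g m \<le> g t" using t(2)[of m] assms by auto
  then have "t \<noteq> a" "t \<noteq> b" using assms by auto
  then show ?thesis using t by (intro exI[of _ t]) auto
qed

text \<open>Slopes between the two Dini derivatives are limits of slopes of parabolas touching from above
  at nearby points.\<close>

lemma critical_slope_contact:
  assumes V: "right_lipschitz L d V" and p: "- upper_slope (\<lambda>t. - V t) \<le> p" "p \<le> upper_slope V"
    and \<epsilon>: "0 < \<epsilon>" and \<eta>: "0 < \<eta>"
  shows "\<exists>t m q \<tau>. 0 < t \<and> t < \<eta> \<and> t < d \<and> \<bar>m - p\<bar> < \<epsilon> \<and> 0 < \<tau> \<and> \<tau> \<le> t \<and> t + \<tau> \<le> d \<and>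
    (\<forall>r. \<bar>r - t\<bar> < \<tau> \<longrightarrow> V r \<le> V t + m * (r - t) + q * (r - t)\<^sup>2)"
proof (rule ccontr)
  assume neg: "\<not> ?thesis"
  have contact: False if "0 < t" "t < \<eta>" "t < d" "\<bar>m - p\<bar> < \<epsilon>" "0 < \<tau>" "\<tau> \<le> t" "t + \<tau> \<le> d"
    "\<And>r. \<bar>r - t\<bar> < \<tau> \<Longrightarrow> V r \<le> V t + m * (r - t) + q * (r - t)\<^sup>2" for t m q \<tau>
    using neg that by blast
  \<comment> \<open>The slopes found below differ from \<open>p\<close> by at most
    \<open>8 * e\<close>.\<close>
  define e where "e = \<epsilon> / 9"
  define R0 where "R0 = min \<eta> d"
  have e: "0 < e" using \<epsilon> by (simp add: e_def)
  have R0: "0 < R0" using V \<eta> by (auto simp: R0_def right_lipschitz_def)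
  have cont: "continuous_on {a..b} V" if "0 \<le> a" "b < R0" for a b
    using V that by (auto simp: right_lipschitz_def R0_def intro: continuous_on_subset)
  define g where "g = (\<lambda>t. V t - V 0 - p * t)"
  have up: "\<exists>t. 0 < t \<and> t < r \<and> - (c * t) < g t" if "0 < r" "0 < c" for r c
  proof -
    have "p - c < upper_slope V" using p(2) that(2) by simp
    from upper_slope_greater[OF V this that(1)] show ?thesis by (auto simp: g_def algebra_simps)
  qed
  have dn: "\<exists>t. 0 < t \<and> t < r \<and> g t < c * t" if "0 < r" "0 < c" for r c
  proof -
    have "- p - c < upper_slope (\<lambda>t. - V t)" using p(1) that(2) by simp
    from upper_slope_greater[OF right_lipschitz_uminus[OF V] this that(1)] show ?thesis by (auto simp: g_def algebra_simps)
  qed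
  have finish: False if ab: "0 \<le> a" "b < R0" "a < t" "t < b"
    and m: "\<bar>m - p\<bar> < \<epsilon>" and mx: "\<And>r. a \<le> r \<Longrightarrow> r \<le> b \<Longrightarrow> V r \<le> V t + m * (r - t) + q * (r - t)\<^sup>2" for a b t m q
  proof (rule contact[of t m "min (t - a) (b - t)" q])
    fix r assume "\<bar>r - t\<bar> < min (t - a) (b - t)"
    then show "V r \<le> V t + m * (r - t) + q * (r - t)\<^sup>2" by (intro mx) auto
  qed (use ab m in \<open>auto simp: R0_def\<close>)
  \<comment> \<open>If \<open>g t - c * t\<close> takes both signs arbitrarily close to
    \<open>0\<close>, it has an interior maximum between two points where it is negative, and a line
    of slope \<open>p + c\<close> touches there.\<close>
  have osc: False if c: "\<bar>c\<bar> < \<epsilon>" and lo: "\<And>r. 0 < r \<Longrightarrow> \<exists>t. 0 < t \<and> t < r \<and> g t - c * t < 0"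
    and hi: "\<And>r. 0 < r \<Longrightarrow> \<exists>t. 0 < t \<and> t < r \<and> 0 < g t - c * t" for c
  proof -
    obtain t2 where t2: "0 < t2" "t2 < R0" "g t2 - c * t2 < 0" using lo[OF R0] by blast
    obtain t1 where t1: "0 < t1" "t1 < t2" "0 < g t1 - c * t1" using hi[OF t2(1)] by blast
    obtain t0 where t0: "0 < t0" "t0 < t1" "g t0 - c * t0 < 0" using lo[OF t1(1)] by blast
    have cc: "continuous_on {t0..t2} (\<lambda>t. g t - c * t)"
      unfolding g_def by (intro continuous_intros cont) (use t0 t2 in auto)
    have "\<exists>t. t0 < t \<and> t < t2 \<and> (\<forall>r. t0 \<le> r \<and> r \<le> t2 \<longrightarrow> g r - c * r \<le> g t - c * t)"
      by (rule interior_max[OF cc, of t1]) (use t0 t1 t2 in auto)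
    then obtain t where t: "t0 < t" "t < t2" "\<And>r. t0 \<le> r \<Longrightarrow> r \<le> t2 \<Longrightarrow> g r - c * r \<le> g t - c * t" by blast
    show False
    proof (rule finish[of t0 t2 t "p + c" 0])
      fix r assume "t0 \<le> r" "r \<le> t2"
      then show "V r \<le> V t + (p + c) * (r - t) + 0 * (r - t)\<^sup>2" using t(3)[of r] by (simp add: g_def algebra_simps)
    qed (use t t0 t2 c in auto)
  qed
  show False
  \<comment> \<open>If \<open>g\<close> falls below \<open>- (e * t)\<close> arbitrarily close to
    \<open>0\<close>, then by \<open>up\<close> it crosses the line of slope
    \<open>- (3/4 * e)\<close> again and again; reaching \<open>e * t\<close> is treated alike with
    \<open>dn\<close>. In the remaining case \<bar>\<open>g t\<close>\<bar> is less than
    \<open>e * t\<close> near \<open>0\<close>.\<close>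
  proof (cases "\<forall>r>0. \<exists>t. 0 < t \<and> t < r \<and> g t \<le> - (e * t)")
    case True
    show False
    proof (rule osc[of "- (3/4 * e)"])
      show "\<bar>- (3/4 * e)\<bar> < \<epsilon>" using e by (simp add: e_def)
      fix r :: real assume r: "0 < r"
      show "\<exists>t. 0 < t \<and> t < r \<and> g t - - (3/4 * e) * t < 0"
      proof -
        obtain t where t: "0 < t" "t < r" "g t \<le> - (e * t)" using True r by blast
        have "0 < e * t" using e t by simp
        then have "g t - - (3/4 * e) * t < 0" using t(3) by simp
        then show ?thesis using t by blast
      qed
      show "\<exists>t. 0 < t \<and> t < r \<and> 0 < g t - - (3/4 * e) * t"
      proof -
        obtain t where t: "0 < t" "t < r" "- (e / 2 * t) < g t" using up[OF r, of "e/2"] e by auto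
        have "0 < e * t" using e t by simp
        then have "0 < g t - - (3/4 * e) * t" using t(3) by simp
        then show ?thesis using t by blast
      qed
    qed
  next
    case nF1: False
    show False
    proof (cases "\<forall>r>0. \<exists>t. 0 < t \<and> t < r \<and> e * t \<le> g t")
      case True
      show False
      proof (rule osc[of "3/4 * e"])
        show "\<bar>3/4 * e\<bar> < \<epsilon>" using e by (simp add: e_def)
        fix r :: real assume r: "0 < r"
        show "\<exists>t. 0 < t \<and> t < r \<and> g t - 3/4 * e * t < 0"
        proof -
          obtain t where t: "0 < t" "t < r" "g t < e / 2 * t" using dn[OF r, of "e/2"] e by auto
          have "0 < e * t" using e t by simp
          then have "g t - 3/4 * e * t < 0" using t(3) by simp
          then show ?thesis using t by blast
        qed
        show "\<exists>t. 0 < t \<and> t < r \<and> 0 < g t - 3/4 * e * t"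
        proof -
          obtain t where t: "0 < t" "t < r" "e * t \<le> g t" using True r by blast
          have "0 < e * t" using e t by simp
          then have "0 < g t - 3/4 * e * t" using t(3) by simp
          then show ?thesis using t by blast
        qed
      qed
    next
      case False
      obtain ra where ra: "0 < ra" "\<And>t. 0 < t \<Longrightarrow> t < ra \<Longrightarrow> - (e * t) < g t" using nF1 by (meson not_le)
      obtain rb where rb: "0 < rb" "\<And>t. 0 < t \<Longrightarrow> t < rb \<Longrightarrow> g t < e * t" using False by (meson not_le)
      define R where "R = min R0 (min ra rb) / 2"
      have R: "0 < R" "R < R0" "R < ra" "R < rb" using R0 ra(1) rb(1) by (auto simp: R_def)
      \<comment> \<open>The parabola forces an interior maximum: the values are
        \<open>- (2 * (e * R))\<close> at \<open>0\<close>, less than \<open>- (e * R)\<close> at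
        \<open>R\<close>, and more than \<open>- (e * R) / 2\<close> in the middle.\<close>
      define G where "G = (\<lambda>t. g t - 8 * (e / R) * (t - R / 2)\<^sup>2)"
      have cG: "continuous_on {0..R} G"
        unfolding G_def g_def by (intro continuous_intros cont) (use R in auto)
      have G0: "G 0 = - (2 * (e * R))" using R by (simp add: G_def g_def power2_eq_square)
      have GR: "G R < - (e * R)"
      proof -
        have "8 * (e / R) * (R - R / 2)\<^sup>2 = 2 * (e * R)" using R by (simp add: power2_eq_square)
        then show ?thesis using rb(2)[OF R(1,4)] unfolding G_def by linarith
      qed
      have Gm: "- (e * R) / 2 < G (R / 2)" using ra(2)[of "R / 2"] R by (simp add: G_def)
      have eR: "0 < e * R" using e R by simp
      have "\<exists>t. 0 < t \<and> t < R \<and> (\<forall>r. 0 \<le> r \<and> r \<le> R \<longrightarrow> G r \<le> G t)"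
      proof (rule interior_max[OF cG, of "R / 2"])
        show "G 0 < G (R / 2)" "G R < G (R / 2)" using G0 GR Gm eR by linarith+
      qed (use R in auto)
      then obtain t where t: "0 < t" "t < R" "\<And>r. 0 \<le> r \<Longrightarrow> r \<le> R \<Longrightarrow> G r \<le> G t" by blast
      define m where "m = p + 16 * (e / R) * (t - R / 2)"
      show False
      proof (rule finish[of 0 R t m "8 * (e / R)"])
        have "\<bar>t - R / 2\<bar> \<le> R / 2" using t(1,2) by linarith
        then have "16 * (e / R) * \<bar>t - R / 2\<bar> \<le> 16 * (e / R) * (R / 2)" using e R by (intro mult_left_mono) auto
        also have "\<dots> = 8 * e" using R by simp
        finally show "\<bar>m - p\<bar> < \<epsilon>" using e R unfolding m_def e_def by (simp add: abs_mult)
        fix r assume r: "0 \<le> r" "r \<le> R"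
        have "(r - R / 2)\<^sup>2 - (t - R / 2)\<^sup>2 = 2 * (t - R / 2) * (r - t) + (r - t)\<^sup>2"
          by (simp add: power2_eq_square algebra_simps)
        then have "8 * (e / R) * (r - R / 2)\<^sup>2 - 8 * (e / R) * (t - R / 2)\<^sup>2 = 8 * (e / R) * (2 * (t - R / 2) * (r - t) + (r - t)\<^sup>2)"
          by (metis right_diff_distrib)
        then have "8 * (e / R) * (r - R / 2)\<^sup>2 - 8 * (e / R) * (t - R / 2)\<^sup>2 = 16 * (e / R) * (t - R / 2) * (r - t) + 8 * (e / R) * (r - t)\<^sup>2"
          by (simp add: distrib_left)
        moreover have "m * (r - t) = p * r - p * t + 16 * (e / R) * (t - R / 2) * (r - t)"
          unfolding m_def by (simp add: algebra_simps)
        ultimately show "V r \<le> V t + m * (r - t) + 8 * (e / R) * (r - t)\<^sup>2"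
          using t(3)[OF r] unfolding G_def g_def by linarith
      qed (use t R in auto)
    qed
  qed
qed

section \<open>Dini slopes along rays and the equations they satisfy\<close>

context hj_network
begin

text \<open>The function along the ray that leaves \<open>\<gamma> E s\<close> in direction
  \<open>\<epsilon>\<close>; with \<open>c = -1\<close> supersolutions and lower slopes are handled
  by the statements for subsolutions and upper slopes.\<close>

definition germ :: "real \<Rightarrow> ('a \<Rightarrow> real) \<Rightarrow> 'a set \<Rightarrow> real \<Rightarrow> real \<Rightarrow> real \<Rightarrow> real" where
  "germ c u E s \<epsilon> t = c * u (\<gamma> E (s + \<epsilon> * t))"

lemma germ_0 [simp]: "germ c u E s \<epsilon> 0 = c * u (\<gamma> E s)" by (simp add: germ_def)

lemma germ_uminus: "germ (- c) u E s \<epsilon> = (\<lambda>t. - germ c u E s \<epsilon> t)" by (auto simp: germ_def)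

lemma germ_lipschitz:
  assumes u: "\<rho>_lipschitz L u" and c: "c \<in> {1, -1}" and E: "E \<in> edges N" and s: "0 \<le> s" "s \<le> len E" and \<epsilon>: "\<epsilon> \<in> {1, -1}"
    and d: "0 < d" "\<And>t. 0 \<le> t \<Longrightarrow> t < d \<Longrightarrow> 0 \<le> s + \<epsilon> * t \<and> s + \<epsilon> * t \<le> len E"
  shows "right_lipschitz L d (germ c u E s \<epsilon>)"
  unfolding right_lipschitz_def
proof (intro conjI d(1) allI impI)
  have "continuous_on {0..<d} (\<lambda>t. u (\<gamma> E (s + \<epsilon> * t)))"
    by (rule continuous_on_compose2[OF C0_D[OF \<rho>_lipschitz_C0[OF u] E], of _ "\<lambda>t. s + \<epsilon> * t"])
       (use d in \<open>auto intro!: continuous_intros\<close>)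
  then show "continuous_on {0..<d} (germ c u E s \<epsilon>)" unfolding germ_def by (intro continuous_intros)
  fix t assume t: "0 < t \<and> t < d"
  then have b: "0 \<le> s + \<epsilon> * t" "s + \<epsilon> * t \<le> len E" using d(2)[of t] by auto
  have "\<bar>u (\<gamma> E (s + \<epsilon> * t)) - u (\<gamma> E s)\<bar> \<le> L * \<rho> (\<gamma> E (s + \<epsilon> * t)) (\<gamma> E s)"
    using u \<gamma>_in_\<Gamma>[OF E b] \<gamma>_in_\<Gamma>[OF E s] unfolding \<rho>_lipschitz_def by blast
  also have "\<rho> (\<gamma> E (s + \<epsilon> * t)) (\<gamma> E s) = t" using \<rho>_edge[OF E b s] \<epsilon> t by auto
  finally show "\<bar>germ c u E s \<epsilon> t - germ c u E s \<epsilon> 0\<bar> \<le> L * t"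
    using c by (auto simp: germ_def)
qed

lemma edge_touch:
  assumes vl: "visc_lip c u" and c: "c \<in> {1, -1}" and E: "E \<in> edges N" and y: "0 < y" "y < len E" and \<tau>: "0 < \<tau>"
    and le: "\<And>r. \<bar>r - y\<bar> < \<tau> \<Longrightarrow> c * u (\<gamma> E r) \<le> c * u (\<gamma> E y) + m * (r - y) + q * (r - y)\<^sup>2"
  shows "c * LG u (\<gamma> E y) E (c * m) \<le> 0"
proof -
  note y' = less_imp_le[OF y(1)] less_imp_le[OF y(2)]
  have cc: "c * (c * a) = a" for a using c by auto
  define f where "f = (\<lambda>r. c * (m * (r - y) + q * (r - y)\<^sup>2))"
  define f' where "f' = (\<lambda>r. c * (m + 2 * q * (r - y)))"
  have fd: "(f has_real_derivative f' r) (at r)" for r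
    unfolding f_def f'_def by (auto intro!: derivative_eq_intros simp: algebra_simps)
  have fc: "continuous_on UNIV f'" unfolding f'_def by (intro continuous_intros)
  obtain \<phi> where \<phi>: "\<phi> \<in> C1 N" "\<And>t. 0 \<le> t \<Longrightarrow> t \<le> len E \<Longrightarrow> \<phi> (\<gamma> E t) = f t"
    "\<And>t. 0 \<le> t \<Longrightarrow> t \<le> len E \<Longrightarrow> slope E \<phi> t = f' t" using edge_test[OF E fd fc] by blast
  define \<delta> where "\<delta> = min \<tau> (min y (len E - y))"
  have \<delta>: "0 < \<delta>" "\<delta> \<le> \<tau>" "\<delta> \<le> min y (len E - y)" using \<tau> y by (auto simp: \<delta>_def)
  have "touches c u \<phi> (\<gamma> E y) \<delta>"
    unfolding touches_def
  proof (intro conjI ballI \<delta>(1))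
    fix z assume "z \<in> geo_ball N (\<gamma> E y) \<delta>"
    then have z: "z \<in> \<Gamma>" "\<rho> (\<gamma> E y) z < \<delta>" by (auto simp: geo_ball_def)
    obtain r where r: "0 < r" "r < len E" "z = \<gamma> E r" "\<bar>r - y\<bar> < \<delta>" using edge_ball[OF E y' z \<delta>(3)] by blast
    have "c * \<phi> z = m * (r - y) + q * (r - y)\<^sup>2" using \<phi>(2)[of r] r cc by (simp add: f_def)
    moreover have "c * \<phi> (\<gamma> E y) = 0" using \<phi>(2)[OF y'] by (simp add: f_def)
    moreover have "c * u z \<le> c * u (\<gamma> E y) + m * (r - y) + q * (r - y)\<^sup>2" using le[of r] r \<delta>(2) by simp
    ultimately show "c * (u z - \<phi> z) \<le> c * (u (\<gamma> E y) - \<phi> (\<gamma> E y))" unfolding right_diff_distrib by linarith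
  qed
  then have "visc_cond c (LG u (\<gamma> E y)) u (\<gamma> E y) \<phi>"
    using vl \<gamma>_in_\<Gamma>[OF E y'] \<phi>(1) unfolding visc_lip_def by blast
  then have "c * LG u (\<gamma> E y) E (slope E \<phi> y) \<le> 0" using E y unfolding visc_cond_def by blast
  then show ?thesis unfolding \<phi>(3)[OF y'] by (simp add: f'_def)
qed

text \<open>The parabolas of \<open>critical_slope_contact\<close> touch inside the edge, where
  \<open>edge_touch\<close> applies; their contact points tend to \<open>\<gamma> E s\<close> and
  \<open>LG\<close> is continuous. For these slopes the edge equation thus holds at a vertex too,
  without the alternative offered by the vertex condition.\<close>

lemma critical_slope_LG:
  assumes vl: "visc_lip c u" and u: "\<rho>_lipschitz L u" and c: "c \<in> {1, -1}" and E: "E \<in> edges N" and s: "0 \<le> s" "s \<le> len E"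
    and \<epsilon>: "\<epsilon> \<in> {1, -1}" and d: "0 < d" "\<And>t. 0 \<le> t \<Longrightarrow> t < d \<Longrightarrow> 0 \<le> s + \<epsilon> * t \<and> s + \<epsilon> * t \<le> len E"
    and p: "- upper_slope (germ (- c) u E s \<epsilon>) \<le> p" "p \<le> upper_slope (germ c u E s \<epsilon>)"
  shows "c * LG u (\<gamma> E s) E (c * \<epsilon> * p) \<le> 0"
proof -
  note V = germ_lipschitz[OF u c E s \<epsilon> d]
  have ee: "\<epsilon> * \<epsilon> = 1" "\<bar>\<epsilon>\<bar> = 1" using \<epsilon> by auto
  have "\<exists>y m. 0 \<le> y \<and> y \<le> len E \<and> \<bar>y - s\<bar> < 1 / real (Suc n) \<and> \<bar>m - p\<bar> < 1 / real (Suc n) \<and> c * LG u (\<gamma> E y) E (c * (\<epsilon> * m)) \<le> 0" for n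
  proof -
    have n0: "0 < 1 / real (Suc n)" by simp
    obtain t m q \<tau> where t: "0 < t" "t < 1 / real (Suc n)" "t < d" "\<bar>m - p\<bar> < 1 / real (Suc n)" "0 < \<tau>" "\<tau> \<le> t" "t + \<tau> \<le> d"
      "\<And>r. \<bar>r - t\<bar> < \<tau> \<Longrightarrow> germ c u E s \<epsilon> r \<le> germ c u E s \<epsilon> t + m * (r - t) + q * (r - t)\<^sup>2"
      using critical_slope_contact[OF V p(1)[unfolded germ_uminus] p(2) n0 n0] by blast
    define y where "y = s + \<epsilon> * t"
    have y: "0 < y" "y < len E"
    proof -
      have "0 \<le> s + \<epsilon> * (t - \<tau> / 2) \<and> s + \<epsilon> * (t - \<tau> / 2) \<le> len E" "0 \<le> s + \<epsilon> * (t + \<tau> / 2) \<and> s + \<epsilon> * (t + \<tau> / 2) \<le> len E"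
        using d(2)[of "t - \<tau> / 2"] d(2)[of "t + \<tau> / 2"] t(1,3,5,6,7) by auto
      then show "0 < y" "y < len E" using \<epsilon> t(5) by (auto simp: y_def algebra_simps)
    qed
    have "c * LG u (\<gamma> E y) E (c * (\<epsilon> * m)) \<le> 0"
    proof (rule edge_touch[OF vl c E y t(5)])
      fix r assume r: "\<bar>r - y\<bar> < \<tau>"
      define r' where "r' = t + \<epsilon> * (r - y)"
      have rr: "r = s + \<epsilon> * r'" unfolding r'_def y_def using ee by (simp add: algebra_simps mult.assoc[symmetric])
      have "\<bar>r' - t\<bar> < \<tau>" using r ee by (simp add: r'_def abs_mult)
      from t(8)[OF this] have "c * u (\<gamma> E r) \<le> c * u (\<gamma> E y) + m * (r' - t) + q * (r' - t)\<^sup>2"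
        by (simp add: germ_def rr[symmetric] y_def[symmetric])
      moreover have "r' - t = \<epsilon> * (r - y)" by (simp add: r'_def)
      moreover have "(\<epsilon> * (r - y))\<^sup>2 = (r - y)\<^sup>2" by (simp add: power_mult_distrib power2_eq_square[of \<epsilon>] ee)
      ultimately show "c * u (\<gamma> E r) \<le> c * u (\<gamma> E y) + \<epsilon> * m * (r - y) + q * (r - y)\<^sup>2" by (simp add: mult_ac)
    qed
    then show ?thesis using y t ee by (intro exI[of _ y] exI[of _ m]) (auto simp: y_def abs_mult)
  qed
  then obtain y m where ym: "\<And>n. 0 \<le> y n \<and> y n \<le> len E" "\<And>n. \<bar>y n - s\<bar> < 1 / real (Suc n)" "\<And>n. \<bar>m n - p\<bar> < 1 / real (Suc n)"
    "\<And>n. c * LG u (\<gamma> E (y n)) E (c * (\<epsilon> * m n)) \<le> 0" by metis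
  have inv: "(\<lambda>n. 1 / real (Suc n)) \<longlonglongrightarrow> 0" using LIMSEQ_inverse_real_of_nat by (simp add: inverse_eq_divide)
  have ys: "y \<longlonglongrightarrow> s"
    by (rule LIM_zero_cancel, rule Lim_null_comparison[OF _ inv]) (use ym(2) in \<open>auto intro!: always_eventually less_imp_le\<close>)
  have mp: "m \<longlonglongrightarrow> p"
    by (rule LIM_zero_cancel, rule Lim_null_comparison[OF _ inv]) (use ym(3) in \<open>auto intro!: always_eventually less_imp_le\<close>)
  have "(\<lambda>n. LG u (\<gamma> E (y n)) E (c * (\<epsilon> * m n))) \<longlonglongrightarrow> LG u (\<gamma> E s) E (c * (\<epsilon> * p))"
    by (rule LG_tendsto[OF E s u u _ tendsto_const ym(1) ys]) (auto intro!: tendsto_intros mp)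
  then have "(\<lambda>n. c * LG u (\<gamma> E (y n)) E (c * (\<epsilon> * m n))) \<longlonglongrightarrow> c * LG u (\<gamma> E s) E (c * (\<epsilon> * p))" by (rule tendsto_mult_left)
  then have "c * LG u (\<gamma> E s) E (c * (\<epsilon> * p)) \<le> 0" by (rule LIMSEQ_le_const2) (use ym(4) in auto)
  then show ?thesis by (simp add: mult.assoc)
qed

text \<open>In both directions the upper slope lies strictly below that of the line of slope
  \<open>p\<close>, so this line itself touches at \<open>s\<close>.\<close>

lemma interior_test:
  assumes vl: "visc_lip c u" and u: "\<rho>_lipschitz L u" and c: "c \<in> {1, -1}" and E: "E \<in> edges N" and s: "0 < s" "s < len E"
    and p: "upper_slope (germ c u E s 1) < p" "upper_slope (germ c u E s (-1)) < - p"
  shows "c * LG u (\<gamma> E s) E (c * p) \<le> 0"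
proof -
  define d where "d = min s (len E - s)"
  have d: "0 < d" using s by (simp add: d_def)
  have V: "right_lipschitz L d (germ c u E s \<epsilon>)" if "\<epsilon> \<in> {1, -1}" for \<epsilon>
    using that by (intro germ_lipschitz[OF u c E _ _ that d]) (use s in \<open>auto simp: d_def\<close>)
  obtain \<eta>1 where \<eta>1: "0 < \<eta>1" "\<And>t. 0 < t \<Longrightarrow> t < \<eta>1 \<Longrightarrow> germ c u E s 1 t - germ c u E s 1 0 \<le> p * t"
    using upper_slope_less[OF V p(1)] by auto
  obtain \<eta>2 where \<eta>2: "0 < \<eta>2" "\<And>t. 0 < t \<Longrightarrow> t < \<eta>2 \<Longrightarrow> germ c u E s (-1) t - germ c u E s (-1) 0 \<le> - p * t"
    using upper_slope_less[OF V p(2)] by auto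
  show ?thesis
  proof (rule edge_touch[OF vl c E s, of "min \<eta>1 \<eta>2" p 0])
    fix r assume r: "\<bar>r - s\<bar> < min \<eta>1 \<eta>2"
    consider "s < r" | "r < s" | "r = s" by linarith
    then show "c * u (\<gamma> E r) \<le> c * u (\<gamma> E s) + p * (r - s) + 0 * (r - s)\<^sup>2"
    proof cases
      case 1
      then show ?thesis using \<eta>1(2)[of "r - s"] r by (simp add: germ_def)
    next
      case 2
      then show ?thesis using \<eta>2(2)[of "s - r"] r by (simp add: germ_def algebra_simps)
    qed simp
  qed (use \<eta>1 \<eta>2 in simp)
qed

text \<open>The test function vanishes at all vertices and has inward slopes \<open>c * p E\<close>
  at \<open>x\<close>. As the equation fails strictly on every incident edge, only the vertex
  condition is left of the alternative.\<close>

lemma vertex_test: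
  assumes vl: "visc_lip c u" and u: "\<rho>_lipschitz L u" and c: "c \<in> {1, -1}" and x: "x \<in> \<Gamma>" "x \<in> verts N"
    and p: "\<And>E. E \<in> Inc N x \<Longrightarrow> upper_slope (germ c u E (end_coord E x) (end_sign E x)) < p E"
    and G: "\<And>E. E \<in> Inc N x \<Longrightarrow> 0 < c * LG u x E (c * end_sign E x * p E)"
  shows "x \<in> inner_verts N \<Longrightarrow> c * ((\<Sum>E \<in> Inc N x. - (c * p E)) - B x) \<le> 0"
    and "x \<in> bdry_verts N \<Longrightarrow> c * (u x - h x) \<le> 0"
proof -
  have cc: "c * (c * a) = a" for a using c by auto
  define g where "g = (\<lambda>E t. c * p E * (t * (len E - t) / len E))"
  define g' where "g' = (\<lambda>E t. c * p E * ((len E - 2 * t) / len E))"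
  obtain \<phi> where \<phi>: "\<phi> \<in> C1 N" "\<And>E t. E \<in> edges N \<Longrightarrow> 0 \<le> t \<Longrightarrow> t \<le> len E \<Longrightarrow> \<phi> (\<gamma> E t) = g E t"
    "\<And>E t. E \<in> edges N \<Longrightarrow> 0 \<le> t \<Longrightarrow> t \<le> len E \<Longrightarrow> slope E \<phi> t = g' E t"
  proof (rule C1_exists[of g "\<lambda>_. 0" g'])
    fix E t assume E: "E \<in> edges N"
    show "(g E has_real_derivative g' E t) (at t within {0..len E})"
      unfolding g_def g'_def using len_pos[OF E] by (auto intro!: derivative_eq_intros simp: field_simps)
    show "continuous_on {0..len E} (g' E)" unfolding g'_def using len_pos[OF E] by (auto intro!: continuous_intros)
  qed (auto simp: g_def)
  have \<phi>x: "\<phi> x = 0"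
  proof -
    obtain E where E: "E \<in> Inc N x" using vertex_Inc[OF x(2,1)] by blast
    show ?thesis using \<phi>(2)[OF Inc_edges[OF E] end_coord_bounds, of x] \<gamma>_end_coord[OF E] by (auto simp: g_def end_coord_def)
  qed
  have sl: "slope E \<phi> (end_coord E x) = c * end_sign E x * p E" if "E \<in> Inc N x" for E
    using \<phi>(3)[OF Inc_edges[OF that] end_coord_bounds, of x] len_pos[OF Inc_edges[OF that]]
    by (auto simp: g'_def end_coord_def end_sign_def)
  have "\<exists>\<eta>>0. \<forall>t. 0 < t \<and> t < \<eta> \<longrightarrow> c * u (\<gamma> E (end_coord E x + end_sign E x * t)) - c * u x \<le> p E * (t * (len E - t) / len E)"
    if E: "E \<in> Inc N x" for E
  proof -
    note E' = Inc_edges[OF E]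
    have l: "0 < len E" by (rule len_pos[OF E'])
    have V: "right_lipschitz L (len E) (germ c u E (end_coord E x) (end_sign E x))"
      by (rule germ_lipschitz[OF u c E' end_coord_bounds _ l]) (use end_shift_bounds(1)[of _ E x] in \<open>auto simp: end_sign_def\<close>)
    define p' where "p' = (upper_slope (germ c u E (end_coord E x) (end_sign E x)) + p E) / 2"
    have p': "upper_slope (germ c u E (end_coord E x) (end_sign E x)) < p'" "p' < p E" using p[OF E] by (auto simp: p'_def)
    obtain \<eta> where \<eta>: "0 < \<eta>" "\<And>t. 0 < t \<Longrightarrow> t < \<eta> \<Longrightarrow> germ c u E (end_coord E x) (end_sign E x) t - germ c u E (end_coord E x) (end_sign E x) 0 \<le> p' * t"
      using upper_slope_less[OF V p'(1)] by blast
    \<comment> \<open>The gap between \<open>p'\<close> and \<open>p E\<close> pays for the bend of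
      \<open>t * (len E - t) / len E\<close> on this interval.\<close>
    define \<eta>' where "\<eta>' = min \<eta> ((p E - p') * len E / (1 + \<bar>p E\<bar>))"
    have \<eta>': "0 < \<eta>'" using \<eta>(1) p'(2) l by (auto simp: \<eta>'_def)
    have "c * u (\<gamma> E (end_coord E x + end_sign E x * t)) - c * u x \<le> p E * (t * (len E - t) / len E)" if t: "0 < t" "t < \<eta>'" for t
    proof -
      have "c * u (\<gamma> E (end_coord E x + end_sign E x * t)) - c * u x \<le> p' * t"
        using \<eta>(2)[of t] t \<gamma>_end_coord[OF E] by (simp add: germ_def \<eta>'_def)
      also have "\<dots> \<le> p E * (t * (len E - t) / len E)"
      proof -
        have "p E * t \<le> \<bar>p E\<bar> * t" using t by (intro mult_right_mono) auto
        also have "\<dots> \<le> (1 + \<bar>p E\<bar>) * t" using t by (intro mult_right_mono) auto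
        also have "\<dots> \<le> (1 + \<bar>p E\<bar>) * ((p E - p') * len E / (1 + \<bar>p E\<bar>))" using t by (intro mult_left_mono) (auto simp: \<eta>'_def)
        also have "\<dots> = (p E - p') * len E"
        proof -
          have "1 + \<bar>p E\<bar> \<noteq> 0" by linarith
          then show ?thesis by simp
        qed
        finally have "p E * t / len E \<le> p E - p'" using l by (simp add: divide_le_eq)
        then have "t * (p E * t / len E) \<le> t * (p E - p')" using t by (intro mult_left_mono) auto
        moreover have "p E * (t * (len E - t) / len E) = p E * t - t * (p E * t / len E)" using l by (simp add: field_simps)
        ultimately show ?thesis by (simp add: algebra_simps)
      qed
      finally show ?thesis .
    qed
    then show ?thesis using \<eta>' by blast
  qed
  then obtain \<eta> where \<eta>: "\<And>E. E \<in> Inc N x \<Longrightarrow> 0 < \<eta> E" "\<And>E t. E \<in> Inc N x \<Longrightarrow> 0 < t \<Longrightarrow> t < \<eta> E \<Longrightarrow>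
    c * u (\<gamma> E (end_coord E x + end_sign E x * t)) - c * u x \<le> p E * (t * (len E - t) / len E)" by metis
  define \<delta> where "\<delta> = Min (insert vsep (\<eta> ` Inc N x))"
  have \<delta>: "0 < \<delta>" "\<delta> \<le> vsep" "\<And>E. E \<in> Inc N x \<Longrightarrow> \<delta> \<le> \<eta> E"
    unfolding \<delta>_def using vsep_pos \<eta>(1) by (auto intro!: Min_le)
  have "touches c u \<phi> x \<delta>"
    unfolding touches_def
  proof (intro conjI ballI \<delta>(1))
    fix z assume "z \<in> geo_ball N x \<delta>"
    then have z: "z \<in> \<Gamma>" "\<rho> x z < \<delta>" by (auto simp: geo_ball_def)
    obtain E t where E: "E \<in> Inc N x" "0 \<le> t" "t < len E" "t = \<rho> x z" "z = \<gamma> E (end_coord E x + end_sign E x * t)"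
      using vertex_ball[OF x(2,1) z(1) z(2) \<delta>(2)] by blast
    note b = end_shift_bounds(1)[OF E(2) less_imp_le[OF E(3)], of x]
    have "\<phi> z = g E (end_coord E x + end_sign E x * t)"
      unfolding E(5) by (rule \<phi>(2)[OF Inc_edges[OF E(1)] conjunct1[OF b] conjunct2[OF b]])
    also have "\<dots> = c * (p E * (t * (len E - t) / len E))" by (auto simp: g_def end_coord_def end_sign_def algebra_simps)
    finally have \<phi>z: "\<phi> z = c * (p E * (t * (len E - t) / len E))" .
    have "c * \<phi> z = p E * (t * (len E - t) / len E)" unfolding \<phi>z by (rule cc)
    moreover have "c * u z - c * u x \<le> p E * (t * (len E - t) / len E)"
    proof (cases "t = 0")
      case True
      then show ?thesis using E(4) z(1) x \<rho>_eq_0_iff[OF x(1) z(1)] by simp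
    next
      case False
      then have t: "0 < t" "t < \<eta> E" using E(2,4) z(2) \<delta>(3)[OF E(1)] by linarith+
      show ?thesis using \<eta>(2)[OF E(1) t] unfolding E(5)[symmetric] .
    qed
    ultimately show "c * (u z - \<phi> z) \<le> c * (u x - \<phi> x)" using \<phi>x unfolding right_diff_distrib by simp
  qed
  then have cond: "visc_cond c (LG u x) u x \<phi>" using vl x \<phi>(1) unfolding visc_lip_def by blast
  have no: "\<not> (\<exists>E \<in> Inc N x. c * LG u x E (slope E \<phi> (end_coord E x)) \<le> 0)" using G sl by force
  show "c * (u x - h x) \<le> 0" if "x \<in> bdry_verts N" using cond no that unfolding visc_cond_def by blast
  have "(\<Sum>E \<in> Inc N x. - (end_sign E x * slope E \<phi> (end_coord E x))) = (\<Sum>E \<in> Inc N x. - (c * p E))"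
    using sl by (intro sum.cong) (auto simp: end_sign_def)
  then show "c * ((\<Sum>E \<in> Inc N x. - (c * p E)) - B x) \<le> 0" if "x \<in> inner_verts N"
    using cond no that unfolding visc_cond_def by metis
qed

lemma LG_lipschitz_p: "E \<in> edges N \<Longrightarrow> x \<in> closure E \<Longrightarrow> \<bar>LG u x E p - LG u x E q\<bar> \<le> C * \<bar>p - q\<bar>"
  using H_lipschitz_p[of E x p q] by (simp add: LG_def)

text \<open>By coercivity a steep enough inward slope violates the equation on every incident edge,
  so the relaxed boundary condition reduces to the Dirichlet inequality.\<close>

lemma subsolution_le_boundary_data:
  assumes vl: "visc_lip 1 u" and u: "\<rho>_lipschitz L u" and x: "x \<in> \<Gamma>" "x \<in> bdry_verts N"
  shows "u x \<le> h x"
proof -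
  have xv: "x \<in> verts N" using x(2) by (simp add: verts_def)
  define R where "R = (\<Sum>E \<in> Inc N x. \<bar>lam * u x - nonloc N \<nu> E \<Gamma> u x\<bar>)"
  \<comment> \<open>\<open>L < P\<close> keeps \<open>P\<close> above the slopes of
    \<open>u\<close>, and \<open>C * (R + C + 1) \<le> P\<close> makes the Hamiltonian exceed
    \<open>R\<close>.\<close>
  define P where "P = \<bar>L\<bar> + 1 + C * (R + C + 1)"
  have R: "0 \<le> R" unfolding R_def by (rule sum_nonneg) auto
  have CR: "0 \<le> C * (R + C + 1)" using R C_gt_1 by simp
  have P: "L < P" "C * (R + C + 1) \<le> P" "0 \<le> P" using CR by (auto simp: P_def)
  have "1 * (u x - h x) \<le> 0"
  proof (rule vertex_test(2)[OF vl u _ x(1) xv _ _ x(2), of "\<lambda>_. P"])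
    fix E assume E: "E \<in> Inc N x"
    note E' = Inc_edges[OF E]
    have "right_lipschitz L (len E) (germ 1 u E (end_coord E x) (end_sign E x))"
      by (rule germ_lipschitz[OF u _ E' end_coord_bounds _ len_pos[OF E']])
         (use end_shift_bounds(1)[of _ E x] in \<open>auto simp: end_sign_def\<close>)
    then show "upper_slope (germ 1 u E (end_coord E x) (end_sign E x)) < P"
      using upper_slope_le P(1) by (meson le_less_trans)
    have xc: "x \<in> closure E" using \<gamma>_in_closure[OF E' end_coord_bounds, of x] \<gamma>_end_coord[OF E] by simp
    have "R + C + 1 \<le> P / C" using P(2) C_gt_1 by (simp add: field_simps)
    moreover have "\<bar>end_sign E x * P\<bar> = P" using P(3) by (simp add: abs_mult)
    ultimately have "R + 1 \<le> H E x (end_sign E x * P)" using H_lower[OF E' xc, of "end_sign E x * P"] by simp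
    moreover have "\<bar>lam * u x - nonloc N \<nu> E \<Gamma> u x\<bar> \<le> R"
      unfolding R_def using E by (intro member_le_sum[of E _ "\<lambda>E. \<bar>lam * u x - nonloc N \<nu> E \<Gamma> u x\<bar>"]) auto
    ultimately show "0 < 1 * LG u x E (1 * end_sign E x * P)" unfolding LG_def mult_1_left by linarith
  qed auto
  then show ?thesis by simp
qed

text \<open>At a positive maximum of \<open>u - w\<close> the nonlocal terms are ordered, so the comparison is decided by
  the one-sided slopes of \<open>u\<close> and \<open>w\<close> along the edges meeting there.\<close>

lemma comparison:
  assumes vu: "visc_lip 1 u" and u: "\<rho>_lipschitz L u" and vw: "visc_lip (-1) w" and w: "\<rho>_lipschitz K w"
    and z: "z \<in> \<Gamma>"
  shows "u z \<le> w z"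
proof (rule ccontr)
  assume neg: "\<not> u z \<le> w z"
  obtain x where x: "x \<in> \<Gamma>" "\<And>y. y \<in> \<Gamma> \<Longrightarrow> u y - w y \<le> u x - w x"
    using C0_attains_sup[OF C0_diff[OF \<rho>_lipschitz_C0[OF u] \<rho>_lipschitz_C0[OF w]]] z by blast
  define \<kappa> where "\<kappa> = lam * (u x - w x)"
  have "w x < u x" using x(2)[OF z] neg by linarith
  then have \<kappa>: "0 < \<kappa>" using lam_pos by (simp add: \<kappa>_def)
  \<comment> \<open>The nonlocal terms are ordered at the maximum, so for a common slope the two
    operators are at least \<open>\<kappa>\<close> apart: no slope satisfies both
    inequalities.\<close>
  have gap: "LG w x E p \<le> LG u x E p - \<kappa>" if E: "E \<in> edges N" "0 \<le> s" "s \<le> len E" "x = \<gamma> E s" for E s p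
  proof -
    have "nonloc N \<nu> E \<Gamma> u (\<gamma> E s) \<le> nonloc N \<nu> E \<Gamma> w (\<gamma> E s)"
    proof (rule nonloc_mono[OF E(1-3) \<rho>_lipschitz_at[OF u] \<rho>_lipschitz_at[OF w]])
      fix y assume "y \<in> \<Gamma>"
      then show "u y - u (\<gamma> E s) \<le> w y - w (\<gamma> E s)" using x(2)[of y] E(4) by simp
    qed (use x(1) E(4) in auto)
    then show ?thesis unfolding LG_def \<kappa>_def E(4) by (simp add: right_diff_distrib)
  qed
  \<comment> \<open>\<open>a\<close> is the upper slope of \<open>u\<close> and \<open>b\<close> the
    lower slope of \<open>w\<close> along a ray leaving \<open>x\<close>.\<close>
  define a where "a = (\<lambda>E s \<epsilon>. upper_slope (germ 1 u E s \<epsilon>))"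
  define b where "b = (\<lambda>E s \<epsilon>. - upper_slope (germ (-1) w E s \<epsilon>))"
  have slopes: "a E s \<epsilon> < b E s \<epsilon> \<and> LG u x E (\<epsilon> * a E s \<epsilon>) \<le> 0 \<and> 0 \<le> LG w x E (\<epsilon> * b E s \<epsilon>)"
    if E: "E \<in> edges N" and s: "0 \<le> s" "s \<le> len E" "x = \<gamma> E s" and \<epsilon>: "\<epsilon> \<in> {1, -1}"
      and d: "0 < d" "\<And>t. 0 \<le> t \<Longrightarrow> t < d \<Longrightarrow> 0 \<le> s + \<epsilon> * t \<and> s + \<epsilon> * t \<le> len E" for E s \<epsilon> d
  proof -
    have c: "(1::real) \<in> {1, -1}" "(-1::real) \<in> {1, -1}" by auto
    note lu = germ_lipschitz[OF u c(1) E s(1,2) \<epsilon> d] and lw = germ_lipschitz[OF w c(1) E s(1,2) \<epsilon> d]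
    have lwm: "right_lipschitz K d (germ (-1) w E s \<epsilon>)" by (rule germ_lipschitz[OF w c(2) E s(1,2) \<epsilon> d])
    have gm: "germ (-1) v E s \<epsilon> = (\<lambda>t. - germ 1 v E s \<epsilon> t)" for v using germ_uminus[of 1 v E s \<epsilon>] by simp
    have cu: "LG u x E (\<epsilon> * p) \<le> 0" if "- upper_slope (germ (-1) u E s \<epsilon>) \<le> p" "p \<le> a E s \<epsilon>" for p
      using critical_slope_LG[OF vu u c(1) E s(1,2) \<epsilon> d, of p] that s(3) by (simp add: a_def)
    have cw: "0 \<le> LG w x E (\<epsilon> * p)" if "b E s \<epsilon> \<le> p" "p \<le> upper_slope (germ 1 w E s \<epsilon>)" for p
      using critical_slope_LG[OF vw w c(2) E s(1,2) \<epsilon> d, of "- p"] that s(3) by (simp add: b_def)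
    have lua: "- upper_slope (germ (-1) u E s \<epsilon>) \<le> a E s \<epsilon>" unfolding a_def gm by (rule lower_slope_le_upper_slope[OF lu])
    have bw: "b E s \<epsilon> \<le> upper_slope (germ 1 w E s \<epsilon>)" unfolding b_def gm by (rule lower_slope_le_upper_slope[OF lw])
    have "upper_slope (germ (-1) w E s \<epsilon>) \<le> upper_slope (germ (-1) u E s \<epsilon>)"
    proof (rule upper_slope_mono[OF lwm germ_lipschitz[OF u c(2) E s(1,2) \<epsilon> d] d(1)])
      fix t assume t: "0 < t" "t < d"
      then have "0 \<le> s + \<epsilon> * t" "s + \<epsilon> * t \<le> len E" using d(2)[of t] by auto
      from x(2)[OF \<gamma>_in_\<Gamma>[OF E this]]
      show "germ (-1) w E s \<epsilon> t - germ (-1) w E s \<epsilon> 0 \<le> germ (-1) u E s \<epsilon> t - germ (-1) u E s \<epsilon> 0"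
        using s(3) by (simp add: germ_def)
    qed
    then have lub: "- upper_slope (germ (-1) u E s \<epsilon>) \<le> b E s \<epsilon>" by (simp add: b_def)
    \<comment> \<open>Otherwise \<open>b\<close> would lie between the Dini slopes of
      \<open>u\<close>, as the maximum of \<open>u - w\<close> puts the lower slope of
      \<open>u\<close> below that of \<open>w\<close>; it would then satisfy both
      inequalities.\<close>
    have "a E s \<epsilon> < b E s \<epsilon>"
    proof (rule ccontr)
      assume "\<not> ?thesis"
      then have "LG u x E (\<epsilon> * b E s \<epsilon>) \<le> 0" using cu[OF lub] by simp
      moreover have "0 \<le> LG w x E (\<epsilon> * b E s \<epsilon>)" using cw[OF order_refl bw] .
      ultimately show False using gap[OF E s, of "\<epsilon> * b E s \<epsilon>"] \<kappa> by linarith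
    qed
    then show ?thesis using cu[OF lua order_refl] cw[OF order_refl bw] by blast
  qed
  show False
  proof (cases "x \<in> verts N")
    case True
    define \<alpha> where "\<alpha> = (\<lambda>E. a E (end_coord E x) (end_sign E x))"
    define \<beta> where "\<beta> = (\<lambda>E. b E (end_coord E x) (end_sign E x))"
    have gapI: "LG w x E p \<le> LG u x E p - \<kappa>" if "E \<in> Inc N x" for E p
      by (rule gap[OF Inc_edges[OF that] end_coord_bounds \<gamma>_end_coord[OF that, symmetric]])
    have S: "\<alpha> E < \<beta> E" "LG u x E (end_sign E x * \<alpha> E) \<le> 0" "0 \<le> LG w x E (end_sign E x * \<beta> E)" if E: "E \<in> Inc N x" for E
    proof -
      have "a E (end_coord E x) (end_sign E x) < b E (end_coord E x) (end_sign E x) \<and>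
        LG u x E (end_sign E x * a E (end_coord E x) (end_sign E x)) \<le> 0 \<and> 0 \<le> LG w x E (end_sign E x * b E (end_coord E x) (end_sign E x))"
        by (rule slopes[OF Inc_edges[OF E] end_coord_bounds \<gamma>_end_coord[OF E, symmetric] _ len_pos[OF Inc_edges[OF E]]])
           (use end_shift_bounds(1)[of _ E x] in \<open>auto simp: end_sign_def\<close>)
      then show "\<alpha> E < \<beta> E" "LG u x E (end_sign E x * \<alpha> E) \<le> 0" "0 \<le> LG w x E (end_sign E x * \<beta> E)"
        unfolding \<alpha>_def \<beta>_def by auto
    qed
    have cm: "(-1::real) \<in> {1, -1}" "(1::real) \<in> {1, -1}" by auto
    from True consider "x \<in> inner_verts N" | "x \<in> bdry_verts N" by (auto simp: verts_def)
    then show False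
    proof cases
      case 2
      \<comment> \<open>The slopes \<open>\<alpha>\<close> lie strictly below those of
        \<open>w\<close> and violate its equation, so the Dirichlet alternative gives
        \<open>h x \<le> w x\<close>, against the bound for \<open>u\<close>.\<close>
      have "- 1 * (w x - h x) \<le> 0"
      proof (rule vertex_test(2)[OF vw w cm(1) x(1) True _ _ 2, of "\<lambda>E. - \<alpha> E"])
        fix E assume E: "E \<in> Inc N x"
        show "upper_slope (germ (- 1) w E (end_coord E x) (end_sign E x)) < - \<alpha> E"
          using S(1)[OF E] by (simp add: \<beta>_def b_def)
        show "0 < - 1 * LG w x E (- 1 * end_sign E x * - \<alpha> E)"
          using S(2)[OF E] gapI[OF E, of "end_sign E x * \<alpha> E"] \<kappa> by simp
      qed
      then show False using subsolution_le_boundary_data[OF vu u x(1) 2] \<open>w x < u x\<close> by simp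
    next
      case 1
      \<comment> \<open>With \<open>r\<close> violating the equation for \<open>u\<close> and a
        strictly larger \<open>r'\<close> that for \<open>w\<close>, the Kirchhoff conditions put
        \<open>B x\<close> above minus the sum of \<open>r\<close> and below minus the sum of
        \<open>r'\<close>, which is impossible.\<close>
      have "\<exists>r r'. \<alpha> E < r \<and> r < r' \<and> r' < \<beta> E \<and> 0 < LG u x E (end_sign E x * r) \<and> LG w x E (end_sign E x * r') < 0"
        if E: "E \<in> Inc N x" for E
      proof -
        note E' = Inc_edges[OF E]
        have xc: "x \<in> closure E" using \<gamma>_in_closure[OF E' end_coord_bounds, of x] \<gamma>_end_coord[OF E] by simp
        have lip: "\<bar>LG v x E (end_sign E x * p) - LG v x E (end_sign E x * q)\<bar> \<le> C * \<bar>p - q\<bar>" for v p q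
          using LG_lipschitz_p[OF E' xc, of v "end_sign E x * p" "end_sign E x * q"]
          by (simp add: abs_mult right_diff_distrib[symmetric])
        have "C-lipschitz_on {\<alpha> E..\<beta> E} (\<lambda>p. LG u x E (end_sign E x * p))"
          using lip C_gt_1 by (intro lipschitz_onI) (auto simp: dist_real_def)
        then have "continuous_on {\<alpha> E..\<beta> E} (\<lambda>p. LG u x E (end_sign E x * p))" by (rule lipschitz_on_continuous_on)
        moreover have "LG u x E (end_sign E x * \<alpha> E) \<le> \<kappa> / 2" using S(2)[OF E] \<kappa> by simp
        moreover have "\<kappa> / 2 \<le> LG u x E (end_sign E x * \<beta> E)"
          using S(3)[OF E] gapI[OF E, of "end_sign E x * \<beta> E"] \<kappa> by simp
        ultimately obtain r where r: "\<alpha> E \<le> r" "r \<le> \<beta> E" "LG u x E (end_sign E x * r) = \<kappa> / 2"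
          using IVT'[of "\<lambda>p. LG u x E (end_sign E x * p)" "\<alpha> E" "\<kappa> / 2" "\<beta> E"] S(1)[OF E] by auto
        have wr: "LG w x E (end_sign E x * r) \<le> - \<kappa> / 2" using gapI[OF E, of "end_sign E x * r"] r(3) by simp
        have "r \<noteq> \<alpha> E" using r(3) S(2)[OF E] \<kappa> by auto
        moreover have "r \<noteq> \<beta> E" using wr S(3)[OF E] \<kappa> by auto
        ultimately have rr: "\<alpha> E < r" "r < \<beta> E" using r by auto
        \<comment> \<open>At \<open>r\<close> the operator for \<open>u\<close> equals
          \<open>\<kappa> / 2\<close>, so that for \<open>w\<close> is at most
          \<open>- \<kappa> / 2\<close>; a shift of the slope by \<open>e\<close> changes it by at
          most \<open>\<kappa> / 4\<close>.\<close>
        define e where "e = min ((\<beta> E - r) / 2) (\<kappa> / (4 * C))"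
        have e: "0 < e" "r + e < \<beta> E" "C * e \<le> \<kappa> / 4"
        proof -
          show "0 < e" using rr \<kappa> C_gt_1 by (simp add: e_def)
          have "e \<le> (\<beta> E - r) / 2" unfolding e_def by (rule min.cobounded1)
          then show "r + e < \<beta> E" using rr(2) by (auto simp: field_simps)
          have "C * e \<le> C * (\<kappa> / (4 * C))" using C_gt_1 unfolding e_def by (intro mult_left_mono min.cobounded2) auto
          then show "C * e \<le> \<kappa> / 4" using C_gt_1 by simp
        qed
        have "\<bar>LG w x E (end_sign E x * (r + e)) - LG w x E (end_sign E x * r)\<bar> \<le> C * \<bar>(r + e) - r\<bar>" by (rule lip)
        then have "LG w x E (end_sign E x * (r + e)) < 0" using e \<kappa> wr by simp
        then show ?thesis using rr e r(3) \<kappa> by (intro exI[of _ r] exI[of _ "r + e"]) auto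
      qed
      then obtain r r' where r: "\<And>E. E \<in> Inc N x \<Longrightarrow> \<alpha> E < r E \<and> r E < r' E \<and> r' E < \<beta> E \<and>
        0 < LG u x E (end_sign E x * r E) \<and> LG w x E (end_sign E x * r' E) < 0" by metis
      have "1 * ((\<Sum>E \<in> Inc N x. - (1 * r E)) - B x) \<le> 0"
      proof (rule vertex_test(1)[OF vu u cm(2) x(1) True _ _ 1])
        fix E assume E: "E \<in> Inc N x"
        show "upper_slope (germ 1 u E (end_coord E x) (end_sign E x)) < r E" using r[OF E] by (simp add: \<alpha>_def a_def)
        show "0 < 1 * LG u x E (1 * end_sign E x * r E)" using r[OF E] by simp
      qed
      moreover have "- 1 * ((\<Sum>E \<in> Inc N x. - (- 1 * - r' E)) - B x) \<le> 0"
      proof (rule vertex_test(1)[OF vw w cm(1) x(1) True _ _ 1])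
        fix E assume E: "E \<in> Inc N x"
        show "upper_slope (germ (- 1) w E (end_coord E x) (end_sign E x)) < - r' E" using r[OF E] by (simp add: \<beta>_def b_def)
        show "0 < - 1 * LG w x E (- 1 * end_sign E x * - r' E)" using r[OF E] by simp
      qed
      moreover have "(\<Sum>E \<in> Inc N x. r E) < (\<Sum>E \<in> Inc N x. r' E)"
        using r vertex_Inc[OF True x(1)] by (intro sum_strict_mono) auto
      ultimately show False by (simp add: sum_negf)
    qed
  next
    case False
    then obtain E s where E: "E \<in> edges N" "0 < s" "s < len E" "x = \<gamma> E s" using \<Gamma>_cases[OF x(1)] by metis
    note s = less_imp_le[OF E(2)] less_imp_le[OF E(3)] E(4)
    have d: "0 < min s (len E - s)" using E by simp
    have S1: "a E s 1 < b E s 1" "LG u x E (a E s 1) \<le> 0" "0 \<le> LG w x E (b E s 1)"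
      using slopes[OF E(1) s _ d, of 1] s by auto
    have S2: "a E s (-1) < b E s (-1)" "LG u x E (- a E s (-1)) \<le> 0" "0 \<le> LG w x E (- b E s (-1))"
      using slopes[OF E(1) s _ d, of "-1"] s by auto
    have tu: "LG u x E p \<le> 0" if "a E s 1 < p" "p < - a E s (-1)" for p
      using interior_test[OF vu u _ E(1-3), of p] that E(4) by (simp add: a_def)
    have tw: "0 \<le> LG w x E p" if "p < b E s 1" "- b E s (-1) < p" for p
      using interior_test[OF vw w _ E(1-3), of "- p"] that E(4) by (simp add: b_def)
    have no: False if "LG u x E p \<le> 0" "0 \<le> LG w x E p" for p
      using gap[OF E(1) s, of p] \<kappa> that by linarith
    show False
    \<comment> \<open>The slopes between \<open>a E s 1\<close> and \<open>- a E s (-1)\<close> are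
      tested by lines for \<open>u\<close>, those between \<open>- b E s (-1)\<close> and
      \<open>b E s 1\<close> for \<open>w\<close>. If these open windows are disjoint, one of them
      is empty, and \<open>a E s 1\<close> or \<open>b E s 1\<close>, which satisfies its own
      equation as a critical slope, lies in the other.\<close>
    proof (cases "max (a E s 1) (- b E s (-1)) < min (b E s 1) (- a E s (-1))")
      case True
      then obtain p where p: "max (a E s 1) (- b E s (-1)) < p" "p < min (b E s 1) (- a E s (-1))" using dense by blast
      show False using no[of p] tu[of p] tw[of p] p by auto
    next
      case False
      then consider "- a E s (-1) \<le> a E s 1" | "b E s 1 \<le> - b E s (-1)" using S1(1) S2(1) by linarith
      then show False
      proof cases
        case 1
        then show False using no[of "a E s 1"] tw[of "a E s 1"] S1 S2 by auto
      next
        case 2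
        then show False using no[of "b E s 1"] tu[of "b E s 1"] S1 S2 by auto
      qed
    qed
  qed
qed

text \<open>Any solution is continuous, hence bounded on the compact \<Gamma>, hence Lipschitz by
  the a priori bound; so comparison applies to every solution and not only to the constructed
  one.\<close>

lemma well_posedness:
  "\<exists>u L. visc_solution N lam H \<nu> B h u \<and> (\<forall>w. visc_solution N lam H \<nu> B h w \<longrightarrow> (\<forall>x \<in> \<Gamma>. w x = u x)) \<and> \<rho>_lipschitz L u"
proof -
  obtain u L where u: "\<rho>_lipschitz L u" "visc_gen 1 u" "visc_gen (-1) u" using existence by blast
  have ul: "visc_lip 1 u" "visc_lip (-1) u" using u visc_gen_iff_lip[OF u(1)] by auto
  have "w x = u x" if sol: "visc_solution N lam H \<nu> B h w" and x: "x \<in> \<Gamma>" for w x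
  proof -
    have w: "w \<in> C0 N" "visc_gen 1 w" "visc_gen (-1) w" using sol unfolding visc_solution_iff by auto
    obtain M where M: "0 < M" "\<And>y. y \<in> \<Gamma> \<Longrightarrow> \<bar>w y\<bar> \<le> M" using C0_bounded[OF w(1)] by blast
    have "csub M w" using w M by (simp add: csub_def)
    then obtain K where K: "\<rho>_lipschitz K w" using csub_lipschitz[of M] M(1) by auto
    have wl: "visc_lip 1 w" "visc_lip (-1) w" using w visc_gen_iff_lip[OF K] by auto
    show ?thesis using comparison[OF ul(1) u(1) wl(2) K x] comparison[OF wl(1) K ul(2) u(1) x] by simp
  qed
  moreover have "visc_solution N lam H \<nu> B h u"
    unfolding visc_solution_iff using u \<rho>_lipschitz_C0[OF u(1)] by blast
  ultimately show ?thesis using u(1) by blast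
qed

end

theorem theorem7p4:
  fixes N :: "'a::euclidean_space network"
    and lam :: real
    and H :: "'a set \<Rightarrow> 'a \<Rightarrow> real \<Rightarrow> real"
    and \<nu> :: "'a set \<Rightarrow> 'a set \<Rightarrow> 'a \<Rightarrow> real \<Rightarrow> real"
    and B h :: "'a \<Rightarrow> real"
  assumes "connected_network N"
    and "lam > 0"
    and "admissible_hamiltonians N H"
    and "admissible_kernels N \<nu>"
  shows "\<exists>u. visc_solution N lam H \<nu> B h u \<and>
           (\<forall>w. visc_solution N lam H \<nu> B h w \<longrightarrow> (\<forall>x \<in> Gam N. w x = u x)) \<and>
           (\<forall>\<delta> > 0. \<exists>L. \<forall>x \<in> Gam N - (\<Union>v \<in> bdry_verts N. geo_ball N v \<delta>).
              \<forall>y \<in> Gam N - (\<Union>v \<in> bdry_verts N. geo_ball N v \<delta>).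
                \<bar>u x - u y\<bar> \<le> L * geo_dist N x y)"
proof -
  obtain C where C: "1 < C" and Hb: "\<And>E x y p q. \<lbrakk>E \<in> edges N; x \<in> closure E; y \<in> closure E\<rbrakk> \<Longrightarrow>
      \<bar>p\<bar> / C - C \<le> H E x p \<and> H E x p \<le> C * (1 + \<bar>p\<bar>) \<and>
      \<bar>H E x p - H E y q\<bar> \<le> C * ((1 + min \<bar>p\<bar> \<bar>q\<bar>) * norm (x - y) + \<bar>p - q\<bar>)"
    using assms(3) unfolding admissible_hamiltonians_def by blast
  obtain \<Lambda> \<sigma> where k: "0 < \<Lambda>" "0 < \<sigma>" "\<sigma> < 1" and \<nu>b: "\<And>E F x y t. \<lbrakk>E \<in> edges N; F \<in> edges N; x \<in> closure E; y \<in> closure E; 0 < t\<rbrakk> \<Longrightarrow>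
      0 \<le> \<nu> E F x t \<and> \<nu> E F x t \<le> \<Lambda> * t powr (-(1 + \<sigma>)) \<and>
      \<bar>\<nu> E F x t - \<nu> E F y t\<bar> \<le> \<Lambda> * norm (x - y) * t powr (-(1 + \<sigma>))"
    using assms(4) unfolding admissible_kernels_def by blast
  interpret hj_network N \<nu> \<Lambda> \<sigma> lam H C B h
  proof
    fix E F assume "E \<in> edges N" "F \<in> edges N"
    then show "(\<lambda>(s, t). \<nu> E F (edge_param N E s) t) \<in> borel_measurable (lebesgue_on ({0..edge_len N E} \<times> {0<..}))"
      using assms(4) unfolding admissible_kernels_def by blast
  qed (use assms(1,2) C k Hb \<nu>b in blast)+
  obtain u L where u: "visc_solution N lam H \<nu> B h u"
    "\<forall>w. visc_solution N lam H \<nu> B h w \<longrightarrow> (\<forall>x \<in> Gam N. w x = u x)" "\<rho>_lipschitz L u"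
    using well_posedness by blast
  \<comment> \<open>One constant, from the a priori bound, serves every
    \<open>\<delta>\<close>.\<close>
  have "\<bar>u x - u y\<bar> \<le> L * geo_dist N x y" if "x \<in> Gam N" "y \<in> Gam N" for x y
    using u(3) that unfolding \<rho>_lipschitz_def by blast
  then show ?thesis using u(1,2) by (intro exI[of _ u]) blast
qed

end
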